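(* Let $a,b,c$ be the three elements of $\{0,1,t\}$ in some order ($a\ne b\ne c\ne a$), and let $D$ and $\tilde D$ be the pair of differential equations described in the context, where $\lambda,\tilde\lambda\notin\{0,1,t,\infty\}$ is assumed. (i) If $\theta_a\in\mathbb{Z}_{\le-1}$, $\kappa_2\notin\mathbb{Z}$ and the singularity $w=a$ of $D$ is apparent, then there exists a non-zero solution of $\tilde D$ of the form $(z-a)^{\tilde\theta_a}h(z)$ where $h(z)$ is a polynomial of degree no more than $-\theta_a-1$. Moreover, if $\kappa_1\notin\mathbb{Z}$, then $\deg h(z)=-\theta_a-1$. (ii) If $\theta_a\in\mathbb{Z}_{\ge0}$, $\kappa_1,\kappa_2,\tilde\theta_b,\tilde\theta_c\notin\mathbb{Z}$ and the singularity $w=a$ of $D$ is apparent, then there exists a non-zero solution of $\tilde D$ of the form $(z-b)^{\tilde\theta_b}(z-c)^{\tilde\theta_c}h(z)$ where $h(z)$ is a polynomial with $\deg h(z)=\theta_a$. (iii) If $\tilde\theta_a\in\mathbb{Z}_{\le0}$, $\kappa_2,\theta_\infty\notin\mathbb{Z}$ and there exists a non-zero solution of $D$ which is a product of $(w-a)^{\theta_a}$ and a polynomial, then the singularity $z=a$ of $\tilde D$ is apparent. (iv) If $\tilde\theta_a\in\mathbb{Z}_{\ge1}$, $\kappa_2,\theta_\infty,\theta_b,\theta_c\notin\mathbb{Z}$ and there exists a non-zero solution of $D$ of the form $(w-b)^{\theta_b}(w-c)^{\theta_c}h(w)$ where $h(w)$ is a polynomial, then the singularity $z=a$ of $\tilde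 D$ is apparent. (v) If $\theta_\infty\in\mathbb{Z}_{\le0}$, $\kappa_2\notin\mathbb{Z}$ and the singularity $w=\infty$ of $D$ is apparent, then there exists a non-zero solution of $\tilde D$ which is a polynomial of degree $-\theta_\infty$. (vi) If $\theta_\infty\in\mathbb{Z}_{\ge1}$, $\kappa_2,\tilde\theta_0,\tilde\theta_1,\tilde\theta_t\notin\mathbb{Z}$ and the singularity $w=\infty$ of $D$ is apparent, then there exists a non-zero solution of $\tilde D$ of the form $z^{\tilde\theta_0}(z-1)^{\tilde\theta_1}(z-t)^{\tilde\theta_t}h(z)$ where $h(z)$ is a polynomial of degree $\theta_\infty-1$. (vii) If $\kappa_1\in\mathbb{Z}_{\le0}$, $\kappa_2,\theta_0\notin\mathbb{Z}$ and there exists a non-zero solution of $D$ which is a polynomial in $w$, then the singularity $z=\infty$ of $\tilde D$ is apparent. (viii) If $\kappa_1\in\mathbb{Z}_{\ge1}$, $\kappa_2,\theta_0,\theta_1,\theta_t\notin\mathbb{Z}$ and there exists a non-zero solution of $D$ of the form $w^{\theta_0}(w-1)^{\theta_1}(w-t)^{\theta_t}h(w)$ where $h(w)$ is a polynomial, then the singularity $z=\infty$ of $\tilde D$ is apparent.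
   Context: Fix $t\in\mathbb{C}\setminus\{0,1\}$. For complex $\theta_0,\theta_1,\theta_t,\theta_\infty,\mu$ and $\lambda\notin\{0,1,t,\infty\}$ put $\kappa_1=(\theta_\infty-\theta_0-\theta_1-\theta_t)/2$, $\kappa_2=-(\theta_\infty+\theta_0+\theta_1+\theta_t)/2$, $$H=\tfrac{1}{t(t-1)}\big\{\lambda(\lambda-1)(\lambda-t)\mu^2-\{\theta_0(\lambda-1)(\lambda-t)+\theta_1\lambda(\lambda-t)+(\theta_t-1)\lambda(\lambda-1)\}\mu+\kappa_1(\kappa_2+1)(\lambda-t)\big\},$$ and let $D_{y_1}(\theta_0,\theta_1,\theta_t,\theta_\infty;\lambda,\mu)$ be the differential equation (in a variable $w$) $$y''+\Big(\tfrac{1-\theta_0}{w}+\tfrac{1-\theta_1}{w-1}+\tfrac{1-\theta_t}{w-t}-\tfrac{1}{w-\lambda}\Big)y'+\Big(\tfrac{\kappa_1(\kappa_2+1)}{w(w-1)}+\tfrac{\lambda(\lambda-1)\mu}{w(w-1)(w-\lambda)}-\tfrac{t(t-1)H}{w(w-1)(w-t)}\Big)y=0.$$ It is Fuchsian with singularities $0,1,t,\lambda,\infty$; the exponents at $p\in\{0,1,t\}$ are $0,\theta_p$, at $\lambda$ they are $0,2$ (and $\lambda$ is apparent), at $\infty$ they are $\kappa_1,\kappa_2+1$. Put $\tilde\theta_p=\kappa_2+\theta_p$ ($p=0,1,t,\infty$), $$\tilde\lambda=\lambda-\frac{\kappa_2}{\mu-\frac{\theta_0}{\lambda}-\frac{\theta_1}{\lambda-1}-\frac{\theta_t}{\lambda-t}},\qquad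 \tilde\mu=\frac{\kappa_2+\theta_0}{\tilde\lambda}+\frac{\kappa_2+\theta_1}{\tilde\lambda-1}+\frac{\kappa_2+\theta_t}{\tilde\lambda-t}+\frac{\kappa_2}{\lambda-\tilde\lambda}.$$ $D$ denotes $D_{y_1}(\theta_0,\theta_1,\theta_t,\theta_\infty;\lambda,\mu)$ in the variable $w$, and $\tilde D$ denotes $D_{y_1}(\tilde\theta_0,\tilde\theta_1,\tilde\theta_t,\tilde\theta_\infty;\tilde\lambda,\tilde\mu)$ in the variable $z$. A regular singularity of a second-order linear differential equation is called apparent if the monodromy matrix of the equation around it is a scalar matrix. $\mathbb{Z}_{\ge n}$ (resp. $\mathbb{Z}_{\le n}$) is the set of integers $\ge n$ (resp. $\le n$). *)

theory Defs
  imports "HOL-Complex_Analysis.Complex_Analysis" "HOL-Computational_Algebra.Polynomial"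
begin

text \<open>
  The equation \<open>y'' + p y' + q y = 0\<close> on the complement of a finite set of singular points
  in the plane. The values of \<open>p\<close> and \<open>q\<close> on \<open>ode_sing\<close> are irrelevant
  (there \<open>x / 0 = 0\<close> makes them meaningless): solutions are only considered on open sets
  avoiding \<open>ode_sing\<close>.
\<close>

record ode2 =
  ode_p :: "complex \<Rightarrow> complex"
  ode_q :: "complex \<Rightarrow> complex"
  ode_sing :: "complex set"

definition solves_on :: "ode2 \<Rightarrow> complex set \<Rightarrow> (complex \<Rightarrow> complex) \<Rightarrow> bool" where
  "solves_on E U y \<longleftrightarrow>
     open U \<and> U \<inter> ode_sing E = {} \<and> y holomorphic_on U \<and>
     (\<forall>w\<in>U. deriv (deriv y) w + ode_p E w * deriv y w + ode_q E w * y w = 0)"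


section \<open>Monodromy and apparent singularities\<close>

text \<open>
  \<open>F s\<close> represents a germ at \<open>\<gamma> s\<close>; only its values near \<open>\<gamma> s\<close> matter.
  This is analytic continuation of the germ \<open>F 0\<close> along the path \<open>\<gamma>\<close>.
\<close>

definition continuation_along ::
    "(real \<Rightarrow> complex) \<Rightarrow> (real \<Rightarrow> complex \<Rightarrow> complex) \<Rightarrow> bool" where
  "continuation_along \<gamma> F \<longleftrightarrow>
     (\<forall>s\<in>{0..1}. F s analytic_on {\<gamma> s} \<and>
        (\<forall>\<^sub>F u in at s within {0..1}. \<forall>\<^sub>F z in nhds (\<gamma> u). F u z = F s z))"

definition fundamental_system :: "ode2 \<Rightarrow> complex \<Rightarrow> (2 \<Rightarrow> complex \<Rightarrow> complex) \<Rightarrow> bool" where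
  "fundamental_system E b Y \<longleftrightarrow>
     (\<forall>j. \<exists>U. b \<in> U \<and> solves_on E U (Y j)) \<and>
     (\<forall>c :: 2 \<Rightarrow> complex. (\<forall>\<^sub>F z in nhds b. (\<Sum>j\<in>UNIV. c j * Y j z) = 0) \<longrightarrow> (\<forall>j. c j = 0))"

text \<open>
  \<open>M\<close> is the monodromy matrix along the loop \<open>\<gamma>\<close> with respect to some fundamental system
  \<open>(y\<^sub>1, y\<^sub>2)\<close> at the base point: continuation along \<open>\<gamma>\<close> turns \<open>(y\<^sub>1, y\<^sub>2)\<close>
  into \<open>(y\<^sub>1, y\<^sub>2) M\<close>. Another choice of fundamental system conjugates \<open>M\<close>.
\<close>

definition monodromy_matrix :: "ode2 \<Rightarrow> (real \<Rightarrow> complex) \<Rightarrow> complex^2^2 \<Rightarrow> bool" where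
  "monodromy_matrix E \<gamma> M \<longleftrightarrow>
     path \<gamma> \<and> pathfinish \<gamma> = pathstart \<gamma> \<and> path_image \<gamma> \<inter> ode_sing E = {} \<and>
     (\<exists>F :: 2 \<Rightarrow> real \<Rightarrow> complex \<Rightarrow> complex.
        (\<forall>j. continuation_along \<gamma> (F j)) \<and>
        fundamental_system E (pathstart \<gamma>) (\<lambda>j. F j 0) \<and>
        (\<forall>j. \<forall>\<^sub>F z in nhds (pathstart \<gamma>). F j 1 z = (\<Sum>i\<in>UNIV. F i 0 z * M $ i $ j)))"

text \<open>\<open>mat c\<close> is the scalar matrix with diagonal entries \<open>c\<close>.\<close>

definition apparent_at :: "ode2 \<Rightarrow> complex \<Rightarrow> bool" where
  "apparent_at E a \<longleftrightarrow>
     (\<exists>r>0. cball a r \<inter> ode_sing E \<subseteq> {a} \<and> (\<exists>c. monodromy_matrix E (circlepath a r) (mat c)))"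

text \<open>A positively oriented loop around \<open>\<infinity>\<close> runs clockwise around all finite singular points.\<close>

definition apparent_at_infinity :: "ode2 \<Rightarrow> bool" where
  "apparent_at_infinity E \<longleftrightarrow>
     (\<exists>r>0. ode_sing E \<subseteq> ball 0 r \<and>
        (\<exists>c. monodromy_matrix E (reversepath (circlepath 0 r)) (mat c)))"


section \<open>Solutions of the form \<open>\<Prod> (z - p)\<^sup>e h(z)\<close>\<close>

text \<open>
  The (in general multivalued) function \<open>(\<Prod>p\<in>B. (z - p) powr e p) * h z\<close> with \<open>h\<close> a non-zero
  polynomial solves \<open>E\<close>. It is represented by its principal determination on the plane slit along
  the rays \<open>p + {..0}\<close>, \<open>p \<in> B\<close>; any other determination is locally a non-zero constant multiple of
  it. For \<open>B = {}\<close> nothing is slit and the solution is the polynomial \<open>h\<close>.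
\<close>

definition has_power_poly_solution ::
    "ode2 \<Rightarrow> complex set \<Rightarrow> (complex \<Rightarrow> complex) \<Rightarrow> complex poly \<Rightarrow> bool" where
  "has_power_poly_solution E B e h \<longleftrightarrow>
     h \<noteq> 0 \<and>
     solves_on E {z. z \<notin> ode_sing E \<and> (\<forall>p\<in>B. z - p \<notin> \<real>\<^sub>\<le>\<^sub>0)}
       (\<lambda>z. (\<Prod>p\<in>B. (z - p) powr e p) * poly h z)"


section \<open>The equation and the transformed parameters\<close>

text \<open>
  The finite exponents are packed into a function \<open>\<theta>\<close> on the plane, of which only the values
  \<open>\<theta> 0\<close>, \<open>\<theta> 1\<close>, \<open>\<theta> t\<close> (that is, \<open>\<theta>\<^sub>0\<close>, \<open>\<theta>\<^sub>1\<close>, \<open>\<theta>\<^sub>t\<close>) are used; \<open>\<theta>i\<close> is the exponent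
  parameter at infinity. As \<open>0\<close>, \<open>1\<close>, \<open>t\<close> are distinct, the three values are independent.
\<close>

definition kappa1 :: "complex \<Rightarrow> (complex \<Rightarrow> complex) \<Rightarrow> complex \<Rightarrow> complex" where
  "kappa1 t \<theta> \<theta>i = (\<theta>i - \<theta> 0 - \<theta> 1 - \<theta> t) / 2"

definition kappa2 :: "complex \<Rightarrow> (complex \<Rightarrow> complex) \<Rightarrow> complex \<Rightarrow> complex" where
  "kappa2 t \<theta> \<theta>i = - (\<theta>i + \<theta> 0 + \<theta> 1 + \<theta> t) / 2"

definition Ham ::
    "complex \<Rightarrow> (complex \<Rightarrow> complex) \<Rightarrow> complex \<Rightarrow> complex \<Rightarrow> complex \<Rightarrow> complex" where
  "Ham t \<theta> \<theta>i l \<mu> =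
     1 / (t * (t - 1)) *
       (l * (l - 1) * (l - t) * \<mu>\<^sup>2
        - (\<theta> 0 * (l - 1) * (l - t) + \<theta> 1 * l * (l - t) + (\<theta> t - 1) * l * (l - 1)) * \<mu>
        + kappa1 t \<theta> \<theta>i * (kappa2 t \<theta> \<theta>i + 1) * (l - t))"

definition D_y1 ::
    "complex \<Rightarrow> (complex \<Rightarrow> complex) \<Rightarrow> complex \<Rightarrow> complex \<Rightarrow> complex \<Rightarrow> ode2" where
  "D_y1 t \<theta> \<theta>i l \<mu> =
     \<lparr> ode_p = (\<lambda>w. (1 - \<theta> 0) / w + (1 - \<theta> 1) / (w - 1) + (1 - \<theta> t) / (w - t) - 1 / (w - l)),
       ode_q = (\<lambda>w. kappa1 t \<theta> \<theta>i * (kappa2 t \<theta> \<theta>i + 1) / (w * (w - 1))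
                  + l * (l - 1) * \<mu> / (w * (w - 1) * (w - l))
                  - t * (t - 1) * Ham t \<theta> \<theta>i l \<mu> / (w * (w - 1) * (w - t))),
       ode_sing = {0, 1, t, l} \<rparr>"

definition theta_tilde ::
    "complex \<Rightarrow> (complex \<Rightarrow> complex) \<Rightarrow> complex \<Rightarrow> complex \<Rightarrow> complex" where
  "theta_tilde t \<theta> \<theta>i p = kappa2 t \<theta> \<theta>i + \<theta> p"

definition theta_tilde_inf :: "complex \<Rightarrow> (complex \<Rightarrow> complex) \<Rightarrow> complex \<Rightarrow> complex" where
  "theta_tilde_inf t \<theta> \<theta>i = kappa2 t \<theta> \<theta>i + \<theta>i"

text \<open>
  The transformed \<open>\<lambda>\<close> is finite iff the following denominator is non-zero (for \<open>\<kappa>\<^sub>2 \<noteq> 0\<close>).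
\<close>

definition lambda_tilde_denom ::
    "complex \<Rightarrow> (complex \<Rightarrow> complex) \<Rightarrow> complex \<Rightarrow> complex \<Rightarrow> complex" where
  "lambda_tilde_denom t \<theta> l \<mu> = \<mu> - \<theta> 0 / l - \<theta> 1 / (l - 1) - \<theta> t / (l - t)"

definition lambda_tilde ::
    "complex \<Rightarrow> (complex \<Rightarrow> complex) \<Rightarrow> complex \<Rightarrow> complex \<Rightarrow> complex \<Rightarrow> complex" where
  "lambda_tilde t \<theta> \<theta>i l \<mu> = l - kappa2 t \<theta> \<theta>i / lambda_tilde_denom t \<theta> l \<mu>"

definition mu_tilde ::
    "complex \<Rightarrow> (complex \<Rightarrow> complex) \<Rightarrow> complex \<Rightarrow> complex \<Rightarrow> complex \<Rightarrow> complex" where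
  "mu_tilde t \<theta> \<theta>i l \<mu> =
     (let k2 = kappa2 t \<theta> \<theta>i; lt = lambda_tilde t \<theta> \<theta>i l \<mu> in
        (k2 + \<theta> 0) / lt + (k2 + \<theta> 1) / (lt - 1) + (k2 + \<theta> t) / (lt - t) + k2 / (l - lt))"

definition D_y1_tilde ::
    "complex \<Rightarrow> (complex \<Rightarrow> complex) \<Rightarrow> complex \<Rightarrow> complex \<Rightarrow> complex \<Rightarrow> ode2" where
  "D_y1_tilde t \<theta> \<theta>i l \<mu> =
     D_y1 t (theta_tilde t \<theta> \<theta>i) (theta_tilde_inf t \<theta> \<theta>i)
       (lambda_tilde t \<theta> \<theta>i l \<mu>) (mu_tilde t \<theta> \<theta>i l \<mu>)"

end

theory Submission
  imports Defs
begin

text \<open>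
  Both equations are scalar forms of systems \<open>Y' = \<Sum> A\<^sub>p Y / (z - p)\<close>, \<open>p \<in> {0, 1, t}\<close>, whose residues
  \<open>A\<^sub>p = b\<^sub>p c\<^sub>p\<close> have rank one, and \<open>\<lambda>\<close>, \<open>\<mu>\<close> are transformed exactly in such a way that the matrix
  \<open>V\<^sub>p\<^sub>q = c\<^sub>p b\<^sub>q\<close> becomes \<open>V + \<kappa>\<^sub>2\<close> (middle convolution). Expanding \<open>U\<^sub>p = c\<^sub>p Y / (z - p)\<close> around \<open>a\<close>, the
  coefficients satisfy \<open>(k + 1 + \<tau>) (U\<^sub>k(p) + (a - p) U\<^sub>k\<^sub>+\<^sub>1(p)) = (V U\<^sub>k)(p)\<close>, so that a finite sequence of
  coefficients is carried from \<open>V\<close> to \<open>V + \<kappa>\<^sub>2\<close> by shifting \<open>\<tau>\<close> and rescaling \<open>U\<^sub>k\<close> by a quotient of Gamma values.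
  The principal part of a solution at an apparent singularity of \<open>D\<close> thus becomes a polynomial solution of the
  transformed equation, and a polynomial solution of \<open>D\<close> yields the non-logarithmic solution that makes the
  singularity of the transformed equation apparent. The even-numbered statements are the same ones for the dual
  system, with \<open>V\<close> replaced by \<open>- V\<^sup>T\<close>, which solves the equation twisted by \<open>\<Prod> (z - p) powr \<theta>\<^sub>p\<close>.
  Scalar monodromy is only used through Fourier expansions of continued solutions along the circle, so no local
  theory of Fuchsian equations is needed.
\<close>

section \<open>Fourier coefficients on a circle\<close>

text \<open>The shift by \<kappa>2 is the one that keeps the rank: V has the eigenvalues 0, -
  \<kappa>1, - \<kappa>2 (a zero and those of the sum of the residues), so V + \<kappa>2 is singular
  again and factors through a second system of size two. The obstacle is resonance. At each
  singularity in question the exponents of the apparent side differ by an integer, so series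
  solutions may need logarithms. Going forward, the Gamma quotient vanishes on one side of an index
  and cuts the sequence off. Going backward, a denominator would vanish at that index; the
  coefficients must be continued past it by hand, and the compatibility condition there is a
  consequence of the given solution being a polynomial. The hypothesis \<kappa>2 \<notin> \<int>
  keeps every other factor finite and nonzero. Scalar monodromy is exploited by linear algebra: two
  independent solutions with the same multiplier have a combination in which one chosen coefficient
  vanishes, and this forces a solution that realises the other exponent.\<close>

definition cis2 :: "real \<Rightarrow> real \<Rightarrow> complex" where
  "cis2 \<sigma> s = exp (2 * of_real pi * \<i> * of_real \<sigma> * of_real s)"

definition annihilated :: "(real \<Rightarrow> complex) \<Rightarrow> bool" where
  "annihilated f \<longleftrightarrow> continuous_on {0..1} f \<and>
     (\<forall>k::int. ((\<lambda>s. f s * exp (2 * of_real pi * \<i> * of_int k * of_real s)) has_integral 0) {0..1})"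

lemma annihilated_add:
  assumes "annihilated f" "annihilated g"
  shows "annihilated (\<lambda>s. f s + g s)"
proof -
  have "((\<lambda>s. (f s + g s) * exp (2 * of_real pi * \<i> * of_int k * of_real s)) has_integral 0) {0..1}" for k
    using has_integral_add[of "\<lambda>s. f s * exp (2 * of_real pi * \<i> * of_int k * of_real s)" 0 "{0..1}"
        "\<lambda>s. g s * exp (2 * of_real pi * \<i> * of_int k * of_real s)" 0] assms
    by (simp add: annihilated_def distrib_right)
  then show ?thesis
    using assms by (auto simp: annihilated_def intro: continuous_on_add)
qed

lemma annihilated_scale:
  assumes "annihilated f"
  shows "annihilated (\<lambda>s. c * f s)"
proof -
  have "((\<lambda>s. c * f s * exp (2 * of_real pi * \<i> * of_int k * of_real s)) has_integral 0) {0..1}" for k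
    using has_integral_mult_right[of "\<lambda>s. f s * exp (2 * of_real pi * \<i> * of_int k * of_real s)" 0 "{0..1}" c] assms
    by (simp add: annihilated_def mult.assoc)
  then show ?thesis
    using assms by (auto simp: annihilated_def intro: continuous_on_mult_left)
qed

lemma annihilated_exp:
  assumes "annihilated f"
  shows "annihilated (\<lambda>s. f s * exp (2 * of_real pi * \<i> * of_int m * of_real s))"
proof -
  have e: "f s * exp (2 * of_real pi * \<i> * of_int m * of_real s) * exp (2 * of_real pi * \<i> * of_int k * of_real s)
     = f s * exp (2 * of_real pi * \<i> * of_int (m+k) * of_real s)" for s k
    by (simp only: mult.assoc exp_add [symmetric]) (simp add: algebra_simps)
  have "continuous_on {0..1} (\<lambda>s. f s * exp (2 * of_real pi * \<i> * of_int m * of_real s))"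
    using assms by (intro continuous_intros) (simp add: annihilated_def)
  then show ?thesis
    using assms unfolding annihilated_def e by blast
qed

text \<open>On the unit circle an R-linear function is a combination of z and its conjugate, that is
  of the characters of index 1 and -1, and multiplication by a character only shifts the index of
  the Fourier coefficients. Sums and products follow by induction, with \<open>f\<close> general
  because a product is absorbed one factor at a time.\<close>

lemma annihilated_real_polynomial:
  fixes g :: "complex \<Rightarrow> real"
  assumes "real_polynomial_function g" "annihilated f"
  shows "annihilated (\<lambda>s. f s * of_real (g (cis2 1 s)))"
  using assms
proof (induction arbitrary: f rule: real_polynomial_function.induct)
  case (linear h)
  have h: "of_real (h z) = (of_real (h 1) - \<i> * of_real (h \<i>)) / 2 * z
      + (of_real (h 1) + \<i> * of_real (h \<i>)) / 2 * cnj z" for z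
  proof -
    interpret bounded_linear h by (rule linear)
    have "h z = h (Re z *\<^sub>R 1 + Im z *\<^sub>R \<i>)"
      by (intro arg_cong[of _ _ h]) (simp add: complex_eq_iff)
    also have "\<dots> = Re z * h 1 + Im z * h \<i>"
      by (simp only: add scaleR real_scaleR_def)
    finally have "h z = Re z * h 1 + Im z * h \<i>" .
    then show ?thesis by (simp add: complex_eq_iff field_simps)
  qed
  have c: "cnj (cis2 1 s) = exp (2 * of_real pi * \<i> * of_int (-1) * of_real s)"
    "cis2 1 s = exp (2 * of_real pi * \<i> * of_int 1 * of_real s)" for s
    by (simp_all add: cis2_def exp_cnj)
  have "f s * of_real (h (cis2 1 s)) =
      (of_real (h 1) - \<i> * of_real (h \<i>)) / 2 * (f s * cis2 1 s)
      + (of_real (h 1) + \<i> * of_real (h \<i>)) / 2 * (f s * cnj (cis2 1 s))" for s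
    by (subst h[of "cis2 1 s"]) (simp add: algebra_simps)
  then show ?case
    using annihilated_add[OF
        annihilated_scale[OF annihilated_exp[OF linear(2), of 1], of "(of_real (h 1) - \<i> * of_real (h \<i>)) / 2"]
        annihilated_scale[OF annihilated_exp[OF linear(2), of "-1"], of "(of_real (h 1) + \<i> * of_real (h \<i>)) / 2"]]
    unfolding c[symmetric] by simp
next
  case (const c)
  show ?case using annihilated_scale[OF const, of "of_real c"] by (simp add: mult.commute)
next
  case (add f1 f2)
  show ?case using annihilated_add[OF add.IH(1) add.IH(2), OF add.prems add.prems]
    by (simp add: algebra_simps)
next
  case (mult f1 f2)
  show ?case using mult.IH(2)[OF mult.IH(1)[OF mult.prems]] by (simp add: mult.assoc)
qed

lemma cis2_eq_iff:
  assumes "s \<in> {0..1}" "u \<in> {0..1}" "cis2 1 s = cis2 1 u"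
  shows "s = u \<or> {s, u} = {0, 1}"
proof -
  obtain n :: int where n: "2 * of_real pi * \<i> * of_real 1 * of_real s = 2 * of_real pi * \<i> * of_real 1 * of_real u + (of_int (2 * n) * pi) * \<i>"
    using assms(3) unfolding cis2_def exp_eq by blast
  have "2 * pi * s = 2 * pi * u + 2 * n * pi"
    using arg_cong[OF n, of Im] by simp
  then have "pi * s = pi * (u + n)"
    by (simp add: algebra_simps)
  then have "s = u + n" by simp
  moreover from this assms(1,2) have "n \<le> 1" "n \<ge> -1" by auto
  ultimately show ?thesis using assms(1,2) by (cases "n = 0"; cases "n = 1"; cases "n = -1") auto
qed

text \<open>The interval with its ends identified is the circle: \<open>f\<close> factors through
  \<open>cis2 1\<close> by a function \<open>F\<close>, which is continuous because
  \<open>cis2 1\<close> sends closed subsets of the compact interval to closed sets.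
  Stone-Weierstrass on the circle then supplies the polynomial.\<close>

lemma circle_function_real:
  fixes f :: "real \<Rightarrow> real"
  assumes "continuous_on {0..1} f" "f 0 = f 1" "0 < e"
  shows "\<exists>g. real_polynomial_function g \<and> (\<forall>s\<in>{0..1}. \<bar>f s - g (cis2 1 s)\<bar> < e)"
proof -
  let ?S = "cis2 1 ` {0..1}"
  have cc: "continuous_on {0..1} (cis2 1)"
    unfolding cis2_def by (intro continuous_intros)
  have cS: "compact ?S" by (rule compact_continuous_image[OF cc]) simp
  define F where "F z = f (SOME s. s \<in> {0..1} \<and> cis2 1 s = z)" for z
  have F: "F (cis2 1 s) = f s" if "s \<in> {0..1}" for s
  proof -
    let ?u = "SOME u. u \<in> {0..1} \<and> cis2 1 u = cis2 1 s"
    have "?u \<in> {0..1} \<and> cis2 1 ?u = cis2 1 s"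
      by (rule someI[of _ s]) (use that in simp)
    then have "?u = s \<or> {?u, s} = {0, 1}" using cis2_eq_iff that by blast
    then show ?thesis unfolding F_def using assms(2) by (auto simp: doubleton_eq_iff)
  qed
  have "continuous_on ?S F"
    unfolding continuous_closedin_preimage_eq
  proof (intro allI impI)
    fix T :: "real set" assume "closed T"
    have eq: "?S \<inter> F -` T = cis2 1 ` ({0..1} \<inter> f -` T)"
      using F by auto
    have "closedin (top_of_set {0..1}) ({0..1} \<inter> f -` T)"
      using continuous_closedin_preimage[OF assms(1) \<open>closed T\<close>] .
    then have "compact ({0..1} \<inter> f -` T)"
      by (rule closedin_compact[rotated]) simp
    then have "compact (cis2 1 ` ({0..1} \<inter> f -` T))"
      by (intro compact_continuous_image continuous_on_subset[OF cc]) auto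
    then show "closedin (top_of_set ?S) (?S \<inter> F -` T)"
      unfolding eq by (intro closed_subset compact_imp_closed) auto
  qed
  then obtain g where "real_polynomial_function g" "\<And>x. x \<in> ?S \<Longrightarrow> \<bar>F x - g x\<bar> < e"
    using Stone_Weierstrass_real_polynomial_function[OF cS _ assms(3), of F] by blast
  then show ?thesis using F by (metis image_eqI)
qed

lemma annihilated_times_real:
  fixes f :: "real \<Rightarrow> complex" and g :: "real \<Rightarrow> real"
  assumes f: "annihilated f" and g: "continuous_on {0..1} g" "g 0 = g 1"
  shows "integral {0..1} (\<lambda>s. f s * of_real (g s)) = 0"
proof -
  have cf: "continuous_on {0..1} f" using f by (simp add: annihilated_def)
  obtain B where B: "B > 0" "\<forall>s\<in>{0..1}. norm (f s) \<le> B"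
    using compact_imp_bounded[OF compact_continuous_image[OF cf]] unfolding bounded_pos by blast
  have "norm (integral {0..1} (\<lambda>s. f s * of_real (g s))) \<le> 0 + e" if "e > 0" for e
  proof -
    obtain h where h: "real_polynomial_function h" "\<forall>s\<in>{0..1}. \<bar>g s - h (cis2 1 s)\<bar> < e / B"
      using circle_function_real[OF g, of "e / B"] \<open>e > 0\<close> B(1) by auto
    have ann: "annihilated (\<lambda>s. f s * of_real (h (cis2 1 s)))"
      by (rule annihilated_real_polynomial[OF h(1) f])
    then have i0: "integral {0..1} (\<lambda>s. f s * of_real (h (cis2 1 s))) = 0"
      unfolding annihilated_def by (auto dest!: spec[of _ 0] integral_unique)
    have ch: "continuous_on {0..1} (\<lambda>s. f s * of_real (h (cis2 1 s)))"
      using ann by (simp add: annihilated_def)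
    have cg: "continuous_on {0..1} (\<lambda>s. f s * of_real (g s))"
      by (intro continuous_intros cf g)
    have "integral {0..1} (\<lambda>s. f s * of_real (g s))
      = integral {0..1} (\<lambda>s. f s * of_real (g s) - f s * of_real (h (cis2 1 s)))"
      using i0 by (subst integral_diff) (auto intro: integrable_continuous_real cg ch)
    also have "norm \<dots> \<le> e * (1 - 0)"
    proof (rule integral_bound)
      fix s :: real assume s: "s \<in> {0..1}"
      have "norm (f s * of_real (g s) - f s * of_real (h (cis2 1 s))) = norm (f s * of_real (g s - h (cis2 1 s)))"
        by (simp add: right_diff_distrib)
      also have "\<dots> = norm (f s) * \<bar>g s - h (cis2 1 s)\<bar>"
        unfolding norm_mult norm_of_real ..
      also have "\<dots> \<le> B * (e / B)"
        using h(2) s B by (intro mult_mono) (auto intro: less_imp_le)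
      finally show "norm (f s * of_real (g s) - f s * of_real (h (cis2 1 s))) \<le> e" using B by simp
    qed (auto intro!: continuous_intros cg ch)
    finally show ?thesis by simp
  qed
  then have "norm (integral {0..1} (\<lambda>s. f s * of_real (g s))) \<le> 0"
    by (rule field_le_epsilon)
  then show ?thesis by simp
qed

text \<open>Testing \<open>f\<close> against its own real and imaginary parts shows that the
  integral of f times its conjugate, that is of the squared norm, is zero.\<close>

lemma fourier_unique:
  fixes f :: "real \<Rightarrow> complex"
  assumes "annihilated f" "f 0 = f 1" "s \<in> {0..1}"
  shows "f s = 0"
proof -
  have cf: "continuous_on {0..1} f" using assms by (simp add: annihilated_def)
  have i: "integral {0..1} (\<lambda>s. f s * of_real (Re (f s))) = 0"
    "integral {0..1} (\<lambda>s. f s * of_real (Im (f s))) = 0"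
    using assms(2) by (intro annihilated_times_real[OF assms(1)] continuous_intros cf; simp)+
  have int: "(\<lambda>s. f s * of_real (Re (f s))) integrable_on {0..1}"
    "(\<lambda>s. f s * of_real (Im (f s))) integrable_on {0..1}"
    by (intro integrable_continuous_real continuous_intros cf)+
  have eq: "Re (f s * of_real (Re (f s)) - \<i> * (f s * of_real (Im (f s)))) = (norm (f s))\<^sup>2" for s
    by (simp add: cmod_power2) (simp add: power2_eq_square)
  have "((\<lambda>s. f s * of_real (Re (f s)) - \<i> * (f s * of_real (Im (f s)))) has_integral (0 - \<i> * 0)) {0..1}"
    using int i by (intro has_integral_diff has_integral_mult_right) (simp_all add: has_integral_iff)
  from has_integral_linear[OF this bounded_linear_Re]
  have "((\<lambda>s. (norm (f s))\<^sup>2) has_integral 0) {0..1}"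
    by (simp only: o_def eq) simp
  then have "integral {0..1} (\<lambda>s. (norm (f s))\<^sup>2) = 0"
    by (rule integral_unique)
  moreover have "continuous_on {0..1} (\<lambda>s. (norm (f s))\<^sup>2)"
    by (intro continuous_intros cf)
  ultimately have "\<forall>x\<in>{0..1}. (norm (f x))\<^sup>2 = 0"
    using integral_eq_0_iff[of 0 1 "\<lambda>s. (norm (f s))\<^sup>2"] by simp
  then show ?thesis using assms(3) by simp
qed

section \<open>Expansion along a circle in powers with exponents in \<nu> + \<int>\<close>

definition circ :: "real \<Rightarrow> real \<Rightarrow> real \<Rightarrow> complex" where
  "circ r \<sigma> s = of_real r * cis2 \<sigma> s"

definition coefker :: "real \<Rightarrow> complex \<Rightarrow> int \<Rightarrow> real \<Rightarrow> complex" where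
  "coefker \<sigma> \<nu> k s = exp (- (2 * of_real pi * \<i> * of_real \<sigma> * (of_int k + \<nu>) * of_real s))"

text \<open>Up to a constant power of \<open>r\<close>, the coefficient of x^(k + \<nu>) in the
  expansion of \<open>f\<close>, where x = \<open>circ r \<sigma> s\<close> and x^\<nu> is continued
  along the path. As the kernel contains \<open>\<sigma>\<close>, the index \<open>k\<close> counts
  powers of x for both orientations.\<close>

definition coef :: "real \<Rightarrow> real \<Rightarrow> complex \<Rightarrow> (real \<Rightarrow> complex) \<Rightarrow> int \<Rightarrow> complex" where
  "coef r \<sigma> \<nu> f k = integral {0..1} (\<lambda>s. f s * coefker \<sigma> \<nu> k s) * of_real r powi (- k)"

lemma continuous_on_coefker [continuous_intros]: "continuous_on A (coefker \<sigma> \<nu> k)"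
  unfolding coefker_def by (intro continuous_intros)

lemma continuous_on_circ [continuous_intros]: "continuous_on A (circ r \<sigma>)"
  unfolding circ_def cis2_def by (intro continuous_intros)

lemma coef_lincomb:
  assumes "continuous_on {0..1} f" "continuous_on {0..1} g"
  shows "coef r \<sigma> \<nu> (\<lambda>s. c * f s + d * g s) k = c * coef r \<sigma> \<nu> f k + d * coef r \<sigma> \<nu> g k"
proof -
  have i: "((\<lambda>s. h s * coefker \<sigma> \<nu> k s) has_integral integral {0..1} (\<lambda>s. h s * coefker \<sigma> \<nu> k s)) {0..1}"
    if "continuous_on {0..1} h" for h
    by (intro integrable_integral integrable_continuous_real continuous_intros that)
  have "((\<lambda>s. c * (f s * coefker \<sigma> \<nu> k s) + d * (g s * coefker \<sigma> \<nu> k s)) has_integral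
     (c * integral {0..1} (\<lambda>s. f s * coefker \<sigma> \<nu> k s) + d * integral {0..1} (\<lambda>s. g s * coefker \<sigma> \<nu> k s))) {0..1}"
    by (intro has_integral_add has_integral_mult_right i assms)
  then have "integral {0..1} (\<lambda>s. (c * f s + d * g s) * coefker \<sigma> \<nu> k s)
      = c * integral {0..1} (\<lambda>s. f s * coefker \<sigma> \<nu> k s) + d * integral {0..1} (\<lambda>s. g s * coefker \<sigma> \<nu> k s)"
    by (intro integral_unique) (simp add: algebra_simps)
  then show ?thesis by (simp add: coef_def algebra_simps)
qed

lemma coef_sum:
  assumes "finite P" "\<And>p. p \<in> P \<Longrightarrow> continuous_on {0..1} (f p)"
  shows "coef r \<sigma> \<nu> (\<lambda>s. \<Sum>p\<in>P. c p * f p s) k = (\<Sum>p\<in>P. c p * coef r \<sigma> \<nu> (f p) k)"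
  using assms
proof (induction P rule: finite_induct)
  case empty
  then show ?case by (simp add: coef_def)
next
  case (insert q P)
  have "continuous_on {0..1} (\<lambda>s. \<Sum>p\<in>P. c p * f p s)"
    using insert by (intro continuous_intros) auto
  then have "coef r \<sigma> \<nu> (\<lambda>s. c q * f q s + 1 * (\<Sum>p\<in>P. c p * f p s)) k
     = c q * coef r \<sigma> \<nu> (f q) k + 1 * coef r \<sigma> \<nu> (\<lambda>s. \<Sum>p\<in>P. c p * f p s) k"
    using insert by (intro coef_lincomb) auto
  then show ?case using insert by simp
qed

lemma coef_mult_circ:
  assumes "r > 0"
  shows "coef r \<sigma> \<nu> (\<lambda>s. circ r \<sigma> s * f s) k = coef r \<sigma> \<nu> f (k - 1)"
proof -
  have e: "cis2 \<sigma> s * coefker \<sigma> \<nu> k s = coefker \<sigma> \<nu> (k - 1) s" for s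
    by (simp add: cis2_def coefker_def exp_add [symmetric] algebra_simps)
  have "circ r \<sigma> s * f s * coefker \<sigma> \<nu> k s = of_real r * (f s * (cis2 \<sigma> s * coefker \<sigma> \<nu> k s))" for s
    by (simp only: circ_def mult_ac)
  then have "circ r \<sigma> s * f s * coefker \<sigma> \<nu> k s = of_real r * (f s * coefker \<sigma> \<nu> (k - 1) s)" for s
    by (simp only: e)
  then have "coef r \<sigma> \<nu> (\<lambda>s. circ r \<sigma> s * f s) k
     = of_real r * integral {0..1} (\<lambda>s. f s * coefker \<sigma> \<nu> (k - 1) s) * of_real r powi (- k)"
    unfolding coef_def by (simp only: integral_mult_right)
  also have "complex_of_real r powi (- (k - 1)) = of_real r * of_real r powi (- k)"
    using assms power_int_add_1'[of "complex_of_real r" "- k"] by (simp add: algebra_simps)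
  then have "of_real r * integral {0..1} (\<lambda>s. f s * coefker \<sigma> \<nu> (k - 1) s) * of_real r powi (- k)
     = coef r \<sigma> \<nu> f (k - 1)"
    by (simp add: coef_def)
  finally show ?thesis .
qed

text \<open>Integration by parts. \<open>G\<close> plays the part of x df/dx, and the multiplier of
  \<open>f\<close> makes the two boundary terms cancel.\<close>

lemma coef_deriv:
  assumes "\<And>s. s \<in> {0..1} \<Longrightarrow>
      (f has_vector_derivative (2 * of_real pi * \<i> * of_real \<sigma> * G s)) (at s within {0..1})"
    and "continuous_on {0..1} G" "\<sigma> = 1 \<or> \<sigma> = -1"
    and "f 1 = exp (2 * of_real pi * \<i> * of_real \<sigma> * \<nu>) * f 0"
  shows "coef r \<sigma> \<nu> G k = (of_int k + \<nu>) * coef r \<sigma> \<nu> f k"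
proof -
  let ?c = "2 * of_real pi * \<i> * of_real \<sigma> :: complex"
  have cf: "continuous_on {0..1} f"
    using assms(1) continuous_on_eq_continuous_within has_vector_derivative_continuous by blast
  have de: "(coefker \<sigma> \<nu> k has_vector_derivative (- (?c * (of_int k + \<nu>)) * coefker \<sigma> \<nu> k s)) (at s within {0..1})" for s
    unfolding coefker_def
    by (rule has_vector_derivative_real_field) (auto intro!: derivative_eq_intros)
  have "((\<lambda>s. f s * coefker \<sigma> \<nu> k s) has_vector_derivative
     (f s * (- (?c * (of_int k + \<nu>)) * coefker \<sigma> \<nu> k s) + (?c * G s) * coefker \<sigma> \<nu> k s)) (at s within {0..1})"
    if "s \<in> {0..1}" for s
    by (rule has_vector_derivative_mult[OF assms(1)[OF that] de])
  then have "((\<lambda>s. f s * (- (?c * (of_int k + \<nu>)) * coefker \<sigma> \<nu> k s) + (?c * G s) * coefker \<sigma> \<nu> k s)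
      has_integral (f 1 * coefker \<sigma> \<nu> k 1 - f 0 * coefker \<sigma> \<nu> k 0)) {0..1}"
    by (intro fundamental_theorem_of_calculus) auto
  moreover have "((\<lambda>s. f s * (- (?c * (of_int k + \<nu>)) * coefker \<sigma> \<nu> k s) + (?c * G s) * coefker \<sigma> \<nu> k s)
      has_integral (- (?c * (of_int k + \<nu>)) * integral {0..1} (\<lambda>s. f s * coefker \<sigma> \<nu> k s)
         + ?c * integral {0..1} (\<lambda>s. G s * coefker \<sigma> \<nu> k s))) {0..1}"
  proof -
    have i: "((\<lambda>s. h s * coefker \<sigma> \<nu> k s) has_integral integral {0..1} (\<lambda>s. h s * coefker \<sigma> \<nu> k s)) {0..1}"
      if "continuous_on {0..1} h" for h
      by (intro integrable_integral integrable_continuous_real continuous_intros that)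
    have "((\<lambda>s. - (?c * (of_int k + \<nu>)) * (f s * coefker \<sigma> \<nu> k s) + ?c * (G s * coefker \<sigma> \<nu> k s))
      has_integral (- (?c * (of_int k + \<nu>)) * integral {0..1} (\<lambda>s. f s * coefker \<sigma> \<nu> k s)
         + ?c * integral {0..1} (\<lambda>s. G s * coefker \<sigma> \<nu> k s))) {0..1}"
      by (intro has_integral_add has_integral_mult_right i cf assms(2))
    then show ?thesis by (simp add: algebra_simps)
  qed
  ultimately have "f 1 * coefker \<sigma> \<nu> k 1 - f 0 * coefker \<sigma> \<nu> k 0
     = - (?c * (of_int k + \<nu>)) * integral {0..1} (\<lambda>s. f s * coefker \<sigma> \<nu> k s)
         + ?c * integral {0..1} (\<lambda>s. G s * coefker \<sigma> \<nu> k s)"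
    using has_integral_unique by blast
  moreover have "coefker \<sigma> \<nu> k 1 = exp (- (?c * \<nu>))"
  proof -
    have "coefker \<sigma> \<nu> k 1 = exp (- (?c * \<nu>)) * exp (- (?c * of_int k))"
      by (simp add: coefker_def exp_add [symmetric] algebra_simps)
    also have "exp (- (?c * of_int k)) = 1"
    proof -
      obtain m :: int where m: "- (?c * of_int k) = (2 * of_int m * of_real pi) * \<i>"
        using assms(3)
      proof
        assume "\<sigma> = 1"
        then show ?thesis by (intro that[of "- k"]) (simp add: algebra_simps)
      next
        assume "\<sigma> = -1"
        then show ?thesis by (intro that[of k]) (simp add: algebra_simps)
      qed
      show ?thesis unfolding m using exp_integer_2pi[of "of_int m"] by simp
    qed
    finally show ?thesis by simp
  qed
  moreover have "exp (- (?c * \<nu>)) * exp (?c * \<nu>) = 1"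
    by (simp add: exp_minus_inverse mult.commute)
  ultimately have "?c * integral {0..1} (\<lambda>s. G s * coefker \<sigma> \<nu> k s)
     = ?c * ((of_int k + \<nu>) * integral {0..1} (\<lambda>s. f s * coefker \<sigma> \<nu> k s))"
    using assms(4) by (simp add: coefker_def algebra_simps)
  then have "integral {0..1} (\<lambda>s. G s * coefker \<sigma> \<nu> k s)
     = (of_int k + \<nu>) * integral {0..1} (\<lambda>s. f s * coefker \<sigma> \<nu> k s)"
    using assms(3) by auto
  then show ?thesis by (simp add: coef_def)
qed

text \<open>Cauchy estimate. The norm of the kernel is independent of \<open>k\<close>, so the bound
  has the exact radius \<open>r\<close> in both directions; it is compared later with the distances
  between the poles.\<close>

lemma coef_bound:
  assumes "continuous_on {0..1} f" "r > 0"
  shows "\<exists>M. \<forall>k. norm (coef r \<sigma> \<nu> f k) \<le> M * r powi (- k)"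
proof -
  have "continuous_on {0..1} (\<lambda>s. f s * coefker \<sigma> \<nu> 0 s)"
    by (intro continuous_intros assms)
  then have "bounded ((\<lambda>s. f s * coefker \<sigma> \<nu> 0 s) ` {0..1})"
    by (intro compact_imp_bounded compact_continuous_image) auto
  then obtain B where B: "\<forall>s\<in>{0..1}. norm (f s * coefker \<sigma> \<nu> 0 s) \<le> B"
    unfolding bounded_iff by auto
  have n: "norm (coefker \<sigma> \<nu> k s) = norm (coefker \<sigma> \<nu> 0 s)" for k s
    by (simp add: coefker_def)
  have "norm (integral {0..1} (\<lambda>s. f s * coefker \<sigma> \<nu> k s)) \<le> B * (1 - 0)" for k
  proof (rule integral_bound)
    show "continuous_on {0..1} (\<lambda>s. f s * coefker \<sigma> \<nu> k s)"
      by (intro continuous_intros assms)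
    show "norm (f s * coefker \<sigma> \<nu> k s) \<le> B" if "s \<in> {0..1}" for s
      using B that n[of k s] unfolding norm_mult by simp
  qed simp
  then have "norm (coef r \<sigma> \<nu> f k) \<le> B * r powi (- k)" for k
    unfolding coef_def norm_mult norm_power_int norm_of_real
    using assms(2) by (simp add: mult_right_mono)
  then show ?thesis by blast
qed

lemma coef_eq_0_imp:
  assumes "continuous_on {0..1} f" "\<sigma> = 1 \<or> \<sigma> = -1" "r > 0"
    and "f 1 = exp (2 * of_real pi * \<i> * of_real \<sigma> * \<nu>) * f 0"
    and "\<And>k. coef r \<sigma> \<nu> f k = 0" "s \<in> {0..1}"
  shows "f s = 0"
proof -
  let ?c = "2 * of_real pi * \<i> * of_real \<sigma> :: complex"
  define g where "g s = f s * exp (- (?c * \<nu> * of_real s))" for s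
  \<comment> \<open>For the reversed orientation the Fourier index is the negative of the power of
    x.\<close>
  have eq: "g s * exp (2 * of_real pi * \<i> * of_int k * of_real s) = f s * coefker \<sigma> \<nu> (if \<sigma> = 1 then - k else k) s" for s k
  proof -
    have "- (?c * \<nu> * of_real s) + 2 * of_real pi * \<i> * of_int k * of_real s
       = - (?c * (of_int (if \<sigma> = 1 then - k else k) + \<nu>) * of_real s)"
      using assms(2) by (auto simp: algebra_simps)
    then show ?thesis
      unfolding g_def coefker_def mult.assoc[of "f s"] exp_add[symmetric] by simp
  qed
  have cg: "continuous_on {0..1} g" unfolding g_def by (intro continuous_intros assms)
  have "((\<lambda>s. g s * exp (2 * of_real pi * \<i> * of_int k * of_real s)) has_integral 0) {0..1}" for k
  proof -
    have "integral {0..1} (\<lambda>s. f s * coefker \<sigma> \<nu> k s) = 0" for k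
      using assms(5)[of k] assms(3) by (simp add: coef_def power_int_eq_0_iff)
    moreover have "(\<lambda>s. f s * coefker \<sigma> \<nu> k s) integrable_on {0..1}" for k
      by (intro integrable_continuous_real continuous_intros assms)
    ultimately show ?thesis unfolding eq by (simp add: has_integral_iff)
  qed
  then have "annihilated g" by (simp add: annihilated_def cg)
  moreover have "g 0 = g 1"
    unfolding g_def assms(4) by (simp add: exp_minus_inverse mult.commute)
  ultimately have "g s = 0" using assms(6) by (rule fourier_unique)
  then show ?thesis by (simp add: g_def)
qed

section \<open>Twisted equations and scalar monodromy\<close>

text \<open>\<open>\<Phi> f\<close> solves \<open>D\<close> at \<open>z\<close> whenever \<open>\<Phi>' = E \<Phi>\<close>; this replaces the multivalued factors \<open>\<Phi>\<close> by rational data.\<close>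

definition twisted_ode :: "ode2 \<Rightarrow> (complex \<Rightarrow> complex) \<Rightarrow> (complex \<Rightarrow> complex) \<Rightarrow> complex \<Rightarrow> bool" where
  "twisted_ode D E f z \<longleftrightarrow> deriv (deriv f) z + (2 * E z + ode_p D z) * deriv f z
     + ((E z)\<^sup>2 + deriv E z + ode_p D z * E z + ode_q D z) * f z = 0"

lemma twist:
  assumes "open U" "\<Phi> holomorphic_on U" "f holomorphic_on U" "E holomorphic_on U"
    and d: "\<And>z. z \<in> U \<Longrightarrow> deriv \<Phi> z = E z * \<Phi> z" and z: "z \<in> U"
  shows "deriv (deriv (\<lambda>z. \<Phi> z * f z)) z + ode_p D z * deriv (\<lambda>z. \<Phi> z * f z) z + ode_q D z * (\<Phi> z * f z)
    = \<Phi> z * (deriv (deriv f) z + (2 * E z + ode_p D z) * deriv f z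
     + ((E z)\<^sup>2 + deriv E z + ode_p D z * E z + ode_q D z) * f z)"
proof -
  have D: "(h has_field_derivative deriv h w) (at w)" if "h holomorphic_on U" "w \<in> U" for h w
    using that assms(1) by (simp add: holomorphic_derivI)
  have f': "deriv f holomorphic_on U" using assms(1,3) holomorphic_deriv by blast
  have 1: "deriv (\<lambda>z. \<Phi> z * f z) w = \<Phi> w * (E w * f w + deriv f w)" if "w \<in> U" for w
    by (rule DERIV_imp_deriv) (use D[OF assms(2) that] D[OF assms(3) that] d[OF that] in
      \<open>auto intro!: derivative_eq_intros simp: algebra_simps\<close>)
  have "eventually (\<lambda>w. w \<in> U) (nhds z)"
    using assms(1) z eventually_nhds_in_open by blast
  then have "deriv (deriv (\<lambda>z. \<Phi> z * f z)) z = deriv (\<lambda>w. \<Phi> w * (E w * f w + deriv f w)) z"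
    by (intro deriv_cong_ev) (auto elim!: eventually_mono simp: 1)
  also have "\<dots> = \<Phi> z * (E z * (E z * f z + deriv f z) + (deriv E z * f z + E z * deriv f z + deriv (deriv f) z))"
    by (rule DERIV_imp_deriv)
      (use D[OF assms(2) z] D[OF assms(3) z] D[OF assms(4) z] D[OF f' z] d[OF z] in
      \<open>auto intro!: derivative_eq_intros simp: algebra_simps\<close>)
  finally show ?thesis using 1[OF z] by (simp add: algebra_simps power2_eq_square)
qed

section \<open>Analytic continuation along a path\<close>

lemma path_eventually:
  assumes "continuous_on {0..1} \<gamma>" "s \<in> {0..1::real}" "\<forall>\<^sub>F z in nhds (\<gamma> s :: complex). P z"
  shows "\<forall>\<^sub>F u in at s within {0..1}. P (\<gamma> u)"
proof -
  have "(\<gamma> \<longlongrightarrow> \<gamma> s) (at s within {0..1})"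
    using assms(1,2) by (simp add: continuous_on_def)
  then show ?thesis
    using assms(3) by (simp add: filterlim_iff)
qed

lemma eventually_nhds_eq_deriv:
  assumes "\<forall>\<^sub>F z in nhds x. f z = g z"
  shows "\<forall>\<^sub>F z in nhds x. deriv f z = deriv g z"
proof -
  have "\<forall>\<^sub>F y in nhds x. \<forall>\<^sub>F z in nhds y. f z = g z"
    using assms by (simp add: eventually_eventually)
  then show ?thesis by (rule eventually_mono) (auto intro: deriv_cong_ev)
qed

lemma continuation_deriv:
  assumes "continuation_along \<gamma> F"
  shows "continuation_along \<gamma> (\<lambda>s. deriv (F s))"
  unfolding continuation_along_def
proof (intro ballI conjI)
  fix s :: real assume s: "s \<in> {0..1}"
  show "deriv (F s) analytic_on {\<gamma> s}"
    using assms s by (auto simp: continuation_along_def intro: analytic_deriv)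
  have "\<forall>\<^sub>F u in at s within {0..1}. \<forall>\<^sub>F z in nhds (\<gamma> u). F u z = F s z"
    using assms s by (auto simp: continuation_along_def)
  then show "\<forall>\<^sub>F u in at s within {0..1}. \<forall>\<^sub>F z in nhds (\<gamma> u). deriv (F u) z = deriv (F s) z"
    by (rule eventually_mono) (rule eventually_nhds_eq_deriv)
qed

lemma continuation_add:
  assumes "continuation_along \<gamma> F" "continuation_along \<gamma> G"
  shows "continuation_along \<gamma> (\<lambda>s z. F s z + G s z)"
  unfolding continuation_along_def
proof (intro ballI conjI)
  fix s :: real assume s: "s \<in> {0..1}"
  show "(\<lambda>z. F s z + G s z) analytic_on {\<gamma> s}"
    using assms s by (auto simp: continuation_along_def intro: analytic_on_add)
  have "\<forall>\<^sub>F u in at s within {0..1}. \<forall>\<^sub>F z in nhds (\<gamma> u). F u z = F s z"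
    "\<forall>\<^sub>F u in at s within {0..1}. \<forall>\<^sub>F z in nhds (\<gamma> u). G u z = G s z"
    using assms s by (auto simp: continuation_along_def)
  then show "\<forall>\<^sub>F u in at s within {0..1}. \<forall>\<^sub>F z in nhds (\<gamma> u). F u z + G u z = F s z + G s z"
  proof eventually_elim
    case (elim u)
    from elim show ?case by eventually_elim simp
  qed
qed

lemma continuation_mult:
  assumes "continuation_along \<gamma> F" "\<And>s. s \<in> {0..1} \<Longrightarrow> h analytic_on {\<gamma> s}"
  shows "continuation_along \<gamma> (\<lambda>s z. h z * F s z)"
  unfolding continuation_along_def
proof (intro ballI conjI)
  fix s :: real assume s: "s \<in> {0..1}"
  show "(\<lambda>z. h z * F s z) analytic_on {\<gamma> s}"
    using assms s by (auto simp: continuation_along_def intro: analytic_on_mult)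
  have "\<forall>\<^sub>F u in at s within {0..1}. \<forall>\<^sub>F z in nhds (\<gamma> u). F u z = F s z"
    using assms s by (auto simp: continuation_along_def)
  then show "\<forall>\<^sub>F u in at s within {0..1}. \<forall>\<^sub>F z in nhds (\<gamma> u). h z * F u z = h z * F s z"
  proof eventually_elim
    case (elim u)
    from elim show ?case by eventually_elim simp
  qed
qed

lemma continuation_has_vector_derivative:
  assumes "continuation_along \<gamma> F" "continuous_on {0..1} \<gamma>" "s \<in> {0..1}"
    and "(\<gamma> has_vector_derivative \<gamma>') (at s within {0..1})"
  shows "((\<lambda>s. F s (\<gamma> s)) has_vector_derivative (\<gamma>' * deriv (F s) (\<gamma> s))) (at s within {0..1})"
proof -
  have an: "F s analytic_on {\<gamma> s}" and
    ev: "\<forall>\<^sub>F u in at s within {0..1}. \<forall>\<^sub>F z in nhds (\<gamma> u). F u z = F s z"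
    using assms by (auto simp: continuation_along_def)
  have "(F s has_field_derivative deriv (F s) (\<gamma> s)) (at (\<gamma> s))"
    using analytic_on_imp_differentiable_at[OF an, of "\<gamma> s"]
    by (simp add: DERIV_deriv_iff_field_differentiable)
  then have "(F s has_field_derivative deriv (F s) (\<gamma> s)) (at (\<gamma> s) within \<gamma> ` {0..1})"
    by (rule has_field_derivative_at_within)
  from field_vector_diff_chain_within[OF assms(4) this]
  have d: "((\<lambda>u. F s (\<gamma> u)) has_vector_derivative (\<gamma>' * deriv (F s) (\<gamma> s))) (at s within {0..1})"
    by (simp add: o_def)
  have "\<forall>\<^sub>F u in at s within {0..1}. F s (\<gamma> u) = F u (\<gamma> u)"
    using ev
  proof (rule eventually_mono)
    fix u assume "\<forall>\<^sub>F z in nhds (\<gamma> u). F u z = F s z"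
    from eventually_nhds_x_imp_x[OF this] show "F s (\<gamma> u) = F u (\<gamma> u)" by simp
  qed
  from has_derivative_transform_eventually[OF d[unfolded has_vector_derivative_def] this _ assms(3)]
  show ?thesis unfolding has_vector_derivative_def by simp
qed

text \<open>Whether the germ vanishes is locally constant in the parameter: nearby germs are
  restrictions of one holomorphic function on a ball, where the identity theorem applies. The
  interval is connected.\<close>

lemma continuation_zero:
  assumes "continuation_along \<gamma> F" "continuous_on {0..1} \<gamma>" "s \<in> {0..1}" "u \<in> {0..1}"
    and "\<forall>\<^sub>F z in nhds (\<gamma> s). F s z = 0"
  shows "\<forall>\<^sub>F z in nhds (\<gamma> u). F u z = 0"
proof -
  let ?P = "\<lambda>s. \<forall>\<^sub>F z in nhds (\<gamma> s). F s z = 0"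
  have loc: "\<forall>\<^sub>F u in at s within {0..1}. ?P u \<longleftrightarrow> ?P s" if s: "s \<in> {0..1}" for s
  proof -
    have "F s analytic_on {\<gamma> s}" and
      ev: "\<forall>\<^sub>F u in at s within {0..1}. \<forall>\<^sub>F z in nhds (\<gamma> u). F u z = F s z"
      using assms s by (auto simp: continuation_along_def)
    then obtain e where e: "e > 0" "F s holomorphic_on ball (\<gamma> s) e"
      by (auto simp: analytic_on_def)
    have "\<forall>\<^sub>F u in at s within {0..1}. \<gamma> u \<in> ball (\<gamma> s) e"
      by (rule path_eventually[OF assms(2) s], rule eventually_nhds_in_open) (use e in auto)
    with ev show ?thesis
    proof eventually_elim
      case (elim u)
      have all: "\<forall>z\<in>ball (\<gamma> s) e. F s z = 0" if v: "v \<in> ball (\<gamma> s) e" "\<forall>\<^sub>F z in nhds v. F s z = 0" for v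
      proof
        fix z assume z: "z \<in> ball (\<gamma> s) e"
        obtain T where T: "open T" "v \<in> T" "\<forall>z\<in>T. F s z = 0"
          using v(2) by (auto simp: eventually_nhds)
        show "F s z = 0"
        proof (rule analytic_continuation_open[of "T \<inter> ball (\<gamma> s) e" "ball (\<gamma> s) e" "F s" "\<lambda>_. 0" z])
          show "T \<inter> ball (\<gamma> s) e \<noteq> {}" using T(2) v(1) by blast
        qed (use T z e(2) in \<open>auto intro: open_Int\<close>)
      qed
      have u: "?P u \<longleftrightarrow> (\<forall>\<^sub>F z in nhds (\<gamma> u). F s z = 0)"
        by (rule eventually_cong[OF elim(1)]) simp
      show ?case
      proof
        assume "?P u"
        then have "\<forall>z\<in>ball (\<gamma> s) e. F s z = 0" using u all elim(2) by blast
        then show "?P s" using e(1) by (auto simp: eventually_nhds intro!: exI[of _ "ball (\<gamma> s) e"])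
      next
        assume "?P s"
        then have "\<forall>z\<in>ball (\<gamma> s) e. F s z = 0" using all[of "\<gamma> s"] e(1) by simp
        then show "?P u" unfolding u using elim(2)
          by (auto simp: eventually_nhds intro!: exI[of _ "ball (\<gamma> s) e"])
      qed
    qed
  qed
  have "?P u = ?P s"
  proof (rule connected_equivalence_relation[of "{0..1::real}" s u "\<lambda>s u. ?P u = ?P s"])
    fix s :: real assume s: "s \<in> {0..1}"
    obtain T where T: "open T" "s \<in> T" "\<forall>u\<in>T. u \<noteq> s \<longrightarrow> u \<in> {0..1} \<longrightarrow> ?P u = ?P s"
      using loc[OF s] unfolding eventually_at_topological by (elim exE conjE) (rule that)
    show "\<exists>T. openin (top_of_set {0..1}) T \<and> s \<in> T \<and> (\<forall>u\<in>T. ?P u = ?P s)"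
      using T s by (intro exI[of _ "{0..1} \<inter> T"]) (auto simp: openin_open_Int)
  qed (use assms in auto)
  then show ?thesis using assms by blast
qed

section \<open>Scalar monodromy in terms of continued and of single-valued functions\<close>

lemma cis2_simps [simp]: "cis2 \<sigma> 0 = 1" "cis2 \<sigma> s \<noteq> 0" "norm (cis2 \<sigma> s) = 1"
  by (simp_all add: cis2_def)

lemma cis2_1: "\<sigma> = 1 \<or> \<sigma> = -1 \<Longrightarrow> cis2 \<sigma> 1 = 1"
  by (auto simp: cis2_def exp_minus)

lemma circ_nz: "r > 0 \<Longrightarrow> circ r \<sigma> s \<noteq> 0"
  by (simp add: circ_def)

lemma circ_vector_derivative:
  "((\<lambda>s. a + circ r \<sigma> s) has_vector_derivative (2 * of_real pi * \<i> * of_real \<sigma> * circ r \<sigma> s)) (at s within S)"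
  unfolding circ_def cis2_def
  by (rule has_vector_derivative_real_field) (auto intro!: derivative_eq_intros)

lemma circlepath_eq_circ: "circlepath a r = (\<lambda>s. a + circ r 1 s)"
  by (simp add: circlepath circ_def cis2_def fun_eq_iff)

lemma reversepath_circlepath_eq_circ: "reversepath (circlepath a r) = (\<lambda>s. a + circ r (-1) s)"
proof
  fix s
  have "cis2 1 (1 - s) = cis2 1 1 * cis2 (-1) s"
    unfolding cis2_def exp_add [symmetric] by (simp add: algebra_simps)
  then show "reversepath (circlepath a r) s = a + circ r (-1) s"
    using cis2_1[of 1] by (simp add: reversepath_def circlepath_eq_circ circ_def)
qed

lemma sum_mat_2: "(\<Sum>i\<in>UNIV. F i * mat c $ i $ j) = c * F j" for F :: "2 \<Rightarrow> complex"
  by (cases j rule: exhaust_2[THEN disjE]) (simp_all add: sum_2 mat_def)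

text \<open>The left-hand side of the equation is itself continued along the path, so it stays zero
  by \<open>continuation_zero\<close>. The same lemma, applied backwards from the end point,
  excludes c = 0.\<close>

lemma monodromy_scalarE:
  assumes "monodromy_matrix D \<gamma> (mat c)" "finite (ode_sing D)"
    and hol: "ode_p D holomorphic_on - ode_sing D" "ode_q D holomorphic_on - ode_sing D"
  obtains F :: "2 \<Rightarrow> real \<Rightarrow> complex \<Rightarrow> complex" where
    "c \<noteq> 0" "\<And>j. continuation_along \<gamma> (F j)"
    "\<And>j s. s \<in> {0..1} \<Longrightarrow> \<forall>\<^sub>F z in nhds (\<gamma> s).
        deriv (deriv (F j s)) z + ode_p D z * deriv (F j s) z + ode_q D z * F j s z = 0"
    "\<And>j. \<forall>\<^sub>F z in nhds (\<gamma> 0). F j 1 z = c * F j 0 z"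
    "\<And>k j. \<forall>\<^sub>F z in nhds (\<gamma> 0). (\<Sum>j\<in>UNIV. k j * F j 0 z) = 0 \<Longrightarrow> k j = 0"
proof -
  from assms(1) obtain F :: "2 \<Rightarrow> real \<Rightarrow> complex \<Rightarrow> complex" where
    \<gamma>: "path \<gamma>" "pathfinish \<gamma> = pathstart \<gamma>" "path_image \<gamma> \<inter> ode_sing D = {}" and
    F: "\<And>j. continuation_along \<gamma> (F j)"
     "fundamental_system D (pathstart \<gamma>) (\<lambda>j. F j 0)" and
    e: "\<And>j. \<forall>\<^sub>F z in nhds (pathstart \<gamma>). F j 1 z = (\<Sum>i\<in>UNIV. F i 0 z * mat c $ i $ j)"
    unfolding monodromy_matrix_def by blast
  have cont: "continuous_on {0..1} \<gamma>" using \<gamma>(1) by (simp add: path_def)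
  have g01: "\<gamma> 1 = \<gamma> 0" using \<gamma>(2) by (simp add: pathstart_def pathfinish_def)
  have e: "\<forall>\<^sub>F z in nhds (\<gamma> 0). F j 1 z = c * F j 0 z" for j
    using e[of j] by (simp add: sum_mat_2 pathstart_def)
  have ind: "k j = 0" if "\<forall>\<^sub>F z in nhds (\<gamma> 0). (\<Sum>j\<in>UNIV. k j * F j 0 z) = 0" for k j
    using F(2) that unfolding fundamental_system_def pathstart_def by blast
  have an: "h analytic_on {\<gamma> s}" if "h holomorphic_on - ode_sing D" "s \<in> {0..1}" for h s
  proof -
    have "open (- ode_sing D)" using assms(2) by (simp add: finite_imp_closed open_Compl)
    moreover have "\<gamma> s \<in> - ode_sing D" using \<gamma>(3) that(2) unfolding path_image_def by blast
    ultimately show ?thesis using that(1) analytic_at by blast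
  qed
  have ode: "\<forall>\<^sub>F z in nhds (\<gamma> s).
        deriv (deriv (F j s)) z + ode_p D z * deriv (F j s) z + ode_q D z * F j s z = 0"
    if s: "s \<in> {0..1}" for j s
  proof -
    have c: "continuation_along \<gamma> (\<lambda>s z. deriv (deriv (F j s)) z + ode_p D z * deriv (F j s) z + ode_q D z * F j s z)"
      by (intro continuation_add continuation_mult continuation_deriv F an hol)
    obtain U where U: "\<gamma> 0 \<in> U" "solves_on D U (F j 0)"
      using F(2) unfolding fundamental_system_def pathstart_def by blast
    have "\<forall>\<^sub>F z in nhds (\<gamma> 0). z \<in> U"
      using U by (intro eventually_nhds_in_open) (auto simp: solves_on_def)
    then have "\<forall>\<^sub>F z in nhds (\<gamma> 0).
        deriv (deriv (F j 0)) z + ode_p D z * deriv (F j 0) z + ode_q D z * F j 0 z = 0"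
      by (rule eventually_mono) (use U in \<open>simp add: solves_on_def\<close>)
    from continuation_zero[OF c cont _ s this] show ?thesis by simp
  qed
  have "c \<noteq> 0"
  proof
    assume "c = 0"
    then have "\<forall>\<^sub>F z in nhds (\<gamma> 1). F 1 1 z = 0" using e[of 1] g01 by simp
    from continuation_zero[OF F(1) cont _ _ this, of 0]
    have "\<forall>\<^sub>F z in nhds (\<gamma> 0). F 1 0 z = 0" by simp
    then have "\<forall>\<^sub>F z in nhds (\<gamma> 0). (\<Sum>j\<in>UNIV. (if j = 1 then 1 else 0) * F j 0 z) = 0"
      by (rule eventually_mono) (simp add: sum_2)
    from ind[OF this, of 1] show False by simp
  qed
  then show ?thesis using that F(1) ode e ind by blast
qed

text \<open>The solutions are (z - a)^\<rho> W f_j. Their only multivalued factor is (z - a)^\<rho>,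
  which picks up the same scalar for both values of j.\<close>

lemma monodromy_scalarI:
  fixes f :: "2 \<Rightarrow> complex \<Rightarrow> complex"
  assumes r: "r > 0" and \<sigma>: "\<sigma> = 1 \<or> \<sigma> = -1"
    and \<Omega>: "open \<Omega>" "sphere a r \<subseteq> \<Omega>" "a \<notin> \<Omega>" "\<Omega> \<inter> ode_sing D = {}"
    and W: "W holomorphic_on \<Omega>" "\<And>z. z \<in> \<Omega> \<Longrightarrow> W z \<noteq> 0"
    and f: "\<And>j. f j holomorphic_on \<Omega>"
      "\<And>j z. z \<in> \<Omega> \<Longrightarrow> twisted_ode D (\<lambda>z. \<rho> / (z - a) + deriv W z / W z) (f j) z"
    and ind: "\<And>k j. \<forall>\<^sub>F z in nhds (a + of_real r). (\<Sum>j\<in>UNIV. k j * f j z) = 0 \<Longrightarrow> k j = 0"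
  shows "monodromy_matrix D (\<lambda>s. a + circ r \<sigma> s) (mat (exp (2 * of_real pi * \<i> * of_real \<sigma> * \<rho>)))"
proof -
  define \<gamma> where "\<gamma> = (\<lambda>s. a + circ r \<sigma> s)"
  \<comment> \<open>The branch of (z - a)^\<rho> W at the parameter \<open>s\<close>, up to the
    constant r^\<rho>: the logarithm is taken relative to the current point of the path, so that the
    principal branch is safe on the half plane in \<open>U s\<close>, and the angle turned so far is
    added.\<close>
  define \<Phi> where "\<Phi> = (\<lambda>s z. exp (\<rho> * (Ln ((z - a) / circ r \<sigma> s) + 2 * of_real pi * \<i> * of_real \<sigma> * of_real s)) * W z)"
  define F where "F = (\<lambda>j s z. \<Phi> s z * f j z)"
  define U where "U = (\<lambda>s. \<Omega> \<inter> {z. Re ((z - a) / circ r \<sigma> s) > 0})"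
  let ?E = "\<lambda>z. \<rho> / (z - a) + deriv W z / W z"
  have \<gamma>\<Omega>: "\<gamma> s \<in> \<Omega>" for s
    using \<Omega>(2) r by (auto simp: \<gamma>_def dist_norm circ_def norm_mult subset_iff)
  have oU: "open (U s)" for s
    unfolding U_def by (intro open_Int \<Omega> open_Collect_less continuous_intros)
      (auto simp: circ_nz[OF r])
  have \<gamma>U: "\<gamma> s \<in> U s" for s
    using \<gamma>\<Omega> r by (simp add: U_def) (simp add: \<gamma>_def circ_nz)
  have Re_Ln: "(z - a) / circ r \<sigma> s \<notin> \<real>\<^sub>\<le>\<^sub>0" if "z \<in> U s" for z s
    using that by (auto simp: U_def complex_nonpos_Reals_iff)
  have hol\<Phi>: "\<Phi> s holomorphic_on U s" for s
    unfolding \<Phi>_def using Re_Ln[of _ s]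
    by (intro holomorphic_intros holomorphic_on_subset[OF W(1)]) (auto simp: U_def circ_nz[OF r])
  have holE: "?E holomorphic_on \<Omega>"
    using \<Omega> W by (intro holomorphic_intros) auto
  have d\<Phi>: "deriv (\<Phi> s) z = ?E z * \<Phi> s z" if z: "z \<in> U s" for s z
  proof (rule DERIV_imp_deriv)
    have zO: "z \<in> \<Omega>" using z by (simp add: U_def)
    have W': "(W has_field_derivative deriv W z) (at z)"
      using W(1) \<Omega>(1) zO by (simp add: holomorphic_derivI)
    have za: "z \<noteq> a" using zO \<Omega>(3) by auto
    show "(\<Phi> s has_field_derivative ?E z * \<Phi> s z) (at z)"
      unfolding \<Phi>_def using W' Re_Ln[OF z] W(2)[OF zO] za circ_nz[OF r, of \<sigma> s]
      by (auto intro!: derivative_eq_intros simp: field_simps)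
  qed
  have holF: "F j s holomorphic_on U s" for j s
    unfolding F_def by (intro holomorphic_intros hol\<Phi> holomorphic_on_subset[OF f(1)]) (auto simp: U_def)
  have ode: "deriv (deriv (F j s)) z + ode_p D z * deriv (F j s) z + ode_q D z * F j s z = 0"
    if z: "z \<in> U s" for j s z
  proof -
    have "U s \<subseteq> \<Omega>" by (auto simp: U_def)
    then show ?thesis
      using twist[where D=D and f="f j", OF oU hol\<Phi> holomorphic_on_subset[OF f(1)] holomorphic_on_subset[OF holE] d\<Phi> z]
        f(2)[of z j] z
      unfolding F_def twisted_ode_def by auto
  qed
  have \<Phi>nz: "\<Phi> s z \<noteq> 0" if "z \<in> \<Omega>" for s z
    using W(2)[OF that] by (simp add: \<Phi>_def)
  have cont: "continuation_along \<gamma> (F j)" for j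
    unfolding continuation_along_def
  proof (intro ballI conjI)
    fix s :: real assume "s \<in> {0..1}"
    show "F j s analytic_on {\<gamma> s}"
      using holF oU \<gamma>U analytic_at by blast
    \<comment> \<open>A parameter step below 1/8 turns the circle by less than pi/4. Together with
      an argument below pi/2 this stays inside the principal strip of \<open>Ln\<close>.\<close>
    have "\<forall>\<^sub>F u in at s within {0..1}. dist u s < 1/8"
      by (auto simp: eventually_at intro!: exI[of _ "1/8"])
    then show "\<forall>\<^sub>F u in at s within {0..1}. \<forall>\<^sub>F z in nhds (\<gamma> u). F j u z = F j s z"
    proof eventually_elim
      case (elim u)
      have "\<forall>\<^sub>F z in nhds (\<gamma> u). z \<in> U u"
        by (rule eventually_nhds_in_open[OF oU \<gamma>U])
      then show ?case
      proof eventually_elim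
        case (elim z)
        define v where "v = (z - a) / circ r \<sigma> u"
        define \<phi> where "\<phi> = 2 * pi * \<sigma> * (u - s)"
        have "Re v > 0" using elim by (simp add: U_def v_def)
        then have v: "v \<noteq> 0" "\<bar>Im (Ln v)\<bar> < pi / 2"
          using Re_Ln_pos_lt[of v] by force+
        have "\<bar>u - s\<bar> < 1/8" using \<open>dist u s < 1/8\<close> by (simp add: dist_real_def)
        then have "2 * pi * \<bar>u - s\<bar> < 2 * pi * (1/8)" by (intro mult_strict_left_mono) auto
        then have \<phi>: "\<bar>\<phi>\<bar> < pi / 4" using \<sigma> by (auto simp: \<phi>_def abs_mult)
        have "circ r \<sigma> u = circ r \<sigma> s * exp (\<i> * of_real \<phi>)"
          by (simp add: circ_def cis2_def \<phi>_def exp_add [symmetric] algebra_simps)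
        then have "(z - a) / circ r \<sigma> s = v * exp (\<i> * of_real \<phi>)"
          by (simp add: v_def)
        also have "\<dots> = exp (Ln v + \<i> * of_real \<phi>)"
          using v by (simp add: exp_add)
        finally have "Ln ((z - a) / circ r \<sigma> s) = Ln v + \<i> * of_real \<phi>"
          using v \<phi> by (simp only:) (rule Ln_exp; simp)
        then have "Ln ((z - a) / circ r \<sigma> s) + 2 * of_real pi * \<i> * of_real \<sigma> * of_real s
           = Ln v + 2 * of_real pi * \<i> * of_real \<sigma> * of_real u"
          by (simp add: \<phi>_def algebra_simps)
        then show ?case by (simp add: F_def \<Phi>_def v_def)
      qed
    qed
  qed
  have \<gamma>0: "\<gamma> 0 = a + of_real r" "\<gamma> 1 = a + of_real r"
    using cis2_1[OF \<sigma>] by (simp_all add: \<gamma>_def circ_def)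
  have fs: "fundamental_system D (\<gamma> 0) (\<lambda>j. F j 0)"
    unfolding fundamental_system_def
  proof (intro conjI allI impI)
    fix j show "\<exists>V. \<gamma> 0 \<in> V \<and> solves_on D V (F j 0)"
      using oU[of 0] \<gamma>U[of 0] holF[of j 0] ode[of _ 0 j] \<Omega>(4)
      by (intro exI[of _ "U 0"]) (auto simp: solves_on_def U_def)
  next
    fix k :: "2 \<Rightarrow> complex" and j assume "\<forall>\<^sub>F z in nhds (\<gamma> 0). (\<Sum>j\<in>UNIV. k j * F j 0 z) = 0"
    moreover have "\<forall>\<^sub>F z in nhds (\<gamma> 0). z \<in> \<Omega>"
      by (rule eventually_nhds_in_open[OF \<Omega>(1) \<gamma>\<Omega>])
    ultimately have "\<forall>\<^sub>F z in nhds (\<gamma> 0). (\<Sum>j\<in>UNIV. k j * f j z) = 0"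
    proof eventually_elim
      case (elim z)
      then have "\<Phi> 0 z * (\<Sum>j\<in>UNIV. k j * f j z) = 0"
        by (simp add: F_def sum_distrib_left mult_ac)
      then show ?case using \<Phi>nz elim by simp
    qed
    then show "k j = 0" unfolding \<gamma>0 by (rule ind)
  qed
  have "F j 1 z = exp (2 * of_real pi * \<i> * of_real \<sigma> * \<rho>) * F j 0 z" for j z
    using cis2_1[OF \<sigma>] by (simp add: F_def \<Phi>_def circ_def exp_add [symmetric] algebra_simps)
  moreover have "path \<gamma>" unfolding path_def \<gamma>_def by (intro continuous_intros)
  moreover have "path_image \<gamma> \<inter> ode_sing D = {}"
    using \<gamma>\<Omega> \<Omega>(4) by (auto simp: path_image_def)
  ultimately show ?thesis
    unfolding monodromy_matrix_def \<gamma>_def [symmetric]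
    using \<gamma>0 cont fs by (intro conjI exI[of _ F]) (auto simp: pathstart_def pathfinish_def sum_mat_2)
qed

section \<open>Systems with residues of rank one\<close>

text \<open>The residue at \<open>p\<close> is the column \<open>(al p, be p)\<close> times the row \<open>(ga p, ep p)\<close>.\<close>

record rank_one_data =
  al :: "complex \<Rightarrow> complex"
  be :: "complex \<Rightarrow> complex"
  ga :: "complex \<Rightarrow> complex"
  ep :: "complex \<Rightarrow> complex"

definition dot :: "complex set \<Rightarrow> (complex \<Rightarrow> complex) \<Rightarrow> (complex \<Rightarrow> complex) \<Rightarrow> complex" where
  "dot P x u = (\<Sum>p\<in>P. x p * u p)"

definition pole_sum :: "complex set \<Rightarrow> (complex \<Rightarrow> complex) \<Rightarrow> (complex \<Rightarrow> complex) \<Rightarrow> complex \<Rightarrow> complex" where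
  "pole_sum P x y z = (\<Sum>p\<in>P. x p * y p / (z - p))"

definition pole_system :: "complex set \<Rightarrow> rank_one_data \<Rightarrow> (complex \<Rightarrow> complex) \<Rightarrow>
    (complex \<Rightarrow> complex) \<Rightarrow> (complex \<Rightarrow> complex) \<Rightarrow> complex \<Rightarrow> bool" where
  "pole_system P d E f g z \<longleftrightarrow>
     deriv f z + E z * f z = pole_sum P (al d) (ga d) z * f z + pole_sum P (al d) (ep d) z * g z \<and>
     deriv g z + E z * g z = pole_sum P (be d) (ga d) z * f z + pole_sum P (be d) (ep d) z * g z"

text \<open>
  Power series solutions \<open>(z - a)\<^sup>\<rho> \<Sum> Y\<^sub>i (z - a)\<^sup>i\<close>. Here \<open>U i p\<close> is the \<open>i\<close>-th coefficient of
  \<open>(z - a) (ga p Y1 + ep p Y2) / (z - p)\<close>, and of \<open>z (ga p Y1 + ep p Y2) / (z - p)\<close> in powers of \<open>1 / z\<close> below.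
\<close>

definition frobenius :: "complex set \<Rightarrow> rank_one_data \<Rightarrow> complex \<Rightarrow> complex \<Rightarrow>
    (nat \<Rightarrow> complex) \<Rightarrow> (nat \<Rightarrow> complex) \<Rightarrow> (nat \<Rightarrow> complex \<Rightarrow> complex) \<Rightarrow> bool" where
  "frobenius P d a \<rho> Y1 Y2 U \<longleftrightarrow>
     (\<forall>i. (of_nat i + \<rho>) * Y1 i = dot P (al d) (U i)) \<and>
     (\<forall>i. (of_nat i + \<rho>) * Y2 i = dot P (be d) (U i)) \<and>
     (\<forall>p\<in>P. (a - p) * U 0 p = 0) \<and>
     (\<forall>i. \<forall>p\<in>P. U i p + (a - p) * U (Suc i) p = ga d p * Y1 i + ep d p * Y2 i)"

definition frobenius_inf :: "complex set \<Rightarrow> rank_one_data \<Rightarrow> complex \<Rightarrow>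
    (nat \<Rightarrow> complex) \<Rightarrow> (nat \<Rightarrow> complex) \<Rightarrow> (nat \<Rightarrow> complex \<Rightarrow> complex) \<Rightarrow> bool" where
  "frobenius_inf P d \<rho> Y1 Y2 U \<longleftrightarrow>
     (\<forall>i. (\<rho> - of_nat i) * Y1 i = dot P (al d) (U i)) \<and>
     (\<forall>i. (\<rho> - of_nat i) * Y2 i = dot P (be d) (U i)) \<and>
     (\<forall>p\<in>P. U 0 p = ga d p * Y1 0 + ep d p * Y2 0) \<and>
     (\<forall>i. \<forall>p\<in>P. U (Suc i) p - p * U i p = ga d p * Y1 (Suc i) + ep d p * Y2 (Suc i))"

section \<open>Power series solutions of the system\<close>

definition psum :: "(nat \<Rightarrow> complex) \<Rightarrow> complex \<Rightarrow> complex" where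
  "psum Y = eval_fps (Abs_fps Y)"

definition psconv :: "real \<Rightarrow> (nat \<Rightarrow> complex) \<Rightarrow> bool" where
  "psconv R Y \<longleftrightarrow> ereal R \<le> fps_conv_radius (Abs_fps Y)"

lemma psconv_norm: "psconv R Y \<Longrightarrow> norm (x :: complex) < R \<Longrightarrow> ereal (norm x) < fps_conv_radius (Abs_fps Y)"
  unfolding psconv_def by (metis ereal_less_eq(3) linorder_not_le order.trans)

lemma psum_sums: "psconv R Y \<Longrightarrow> norm x < R \<Longrightarrow> (\<lambda>i. Y i * x ^ i) sums psum Y x"
  using sums_eval_fps[of x "Abs_fps Y"] psconv_norm by (simp add: psum_def)

lemma psum_holomorphic: "psconv R Y \<Longrightarrow> psum Y holomorphic_on ball 0 R"
  unfolding psum_def by (rule holomorphic_on_eval_fps) (auto intro: psconv_norm simp: in_eball_iff)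

lemma psum_deriv_sums:
  assumes "psconv R Y" "norm x < R"
  shows "(\<lambda>i. of_nat i * Y i * x ^ i) sums (x * deriv (psum Y) x)"
proof -
  let ?F = "Abs_fps Y"
  have 1: "ereal (norm x) < fps_conv_radius ?F" by (rule psconv_norm[OF assms])
  have "(eval_fps ?F has_field_derivative eval_fps (fps_deriv ?F) x) (at x)"
    by (rule has_field_derivative_eval_fps[OF 1])
  then have d: "deriv (psum Y) x = eval_fps (fps_deriv ?F) x"
    by (simp add: psum_def DERIV_imp_deriv)
  have "(\<lambda>i. fps_nth (fps_deriv ?F) i * x ^ i) sums eval_fps (fps_deriv ?F) x"
    by (rule sums_eval_fps) (use 1 fps_conv_radius_deriv[of ?F] in auto)
  from sums_mult[OF this, of x]
  have "(\<lambda>i. of_nat (Suc i) * Y (Suc i) * x ^ Suc i) sums (x * deriv (psum Y) x)"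
    by (simp add: d mult_ac)
  then show ?thesis
    using sums_Suc_iff[of "\<lambda>i. of_nat i * Y i * x ^ i" "x * deriv (psum Y) x"] by simp
qed

lemma psconv_geometric:
  assumes "Q > 0" "\<And>i. norm (Y i) \<le> K * Q ^ i"
  shows "psconv (1 / (2 * Q)) Y"
proof -
  have "summable (\<lambda>n. Y n * (of_real (1 / (2 * Q))) ^ n)"
  proof (rule summable_comparison_test)
    have "norm (Y n * of_real (1 / (2 * Q)) ^ n) \<le> K * (1/2) ^ n" for n
    proof -
      have "norm (Y n * of_real (1 / (2 * Q)) ^ n) = norm (Y n) * (1 / (2 * Q)) ^ n"
        using assms(1) by (simp add: norm_mult norm_power norm_divide power_divide)
      also have "\<dots> \<le> K * Q ^ n * (1 / (2 * Q)) ^ n"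
        using assms by (intro mult_right_mono) auto
      also have "\<dots> = K * (1/2) ^ n"
        using assms(1) by (simp add: power_mult_distrib power_divide)
      finally show ?thesis .
    qed
    then show "\<exists>N. \<forall>n\<ge>N. norm (Y n * of_real (1 / (2 * Q)) ^ n) \<le> K * (1/2) ^ n" by blast
    show "summable (\<lambda>n. K * (1/2) ^ n :: real)" by (intro summable_mult summable_geometric) simp
  qed
  from conv_radius_geI[OF this] show ?thesis
    using assms(1) unfolding psconv_def fps_conv_radius_def
    by (simp add: norm_divide)
qed

text \<open>The zeros are taken near an arbitrary point \<open>x\<close> of the disc, since
  independence of solutions is tested at the base point of a circle and not at its centre.\<close>

lemma psum_eq_0_imp:
  assumes "psconv R Y" "norm x < R" "\<forall>\<^sub>F w in nhds x. psum Y w = 0"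
  shows "Y i = 0"
proof -
  obtain T where T: "open T" "x \<in> T" "\<forall>w\<in>T. psum Y w = 0"
    using assms(3) by (auto simp: eventually_nhds)
  have R: "R > 0" using assms(2) norm_ge_zero[of x] by linarith
  have z: "psum Y w = 0" if "w \<in> ball 0 R" for w
  proof (rule analytic_continuation_open[of "T \<inter> ball 0 R" "ball 0 R" "psum Y" "\<lambda>_. 0" w])
    show "T \<inter> ball 0 R \<noteq> {}" using T(2) assms(2) by auto
  qed (use T that psum_holomorphic[OF assms(1)] in \<open>auto intro: open_Int\<close>)
  have "Abs_fps Y = 0"
  proof (rule eval_fps_eqD)
    show "fps_conv_radius (Abs_fps Y) > 0"
      using assms(1) R unfolding psconv_def by (metis ereal_less(2) less_le_trans)
    have "\<forall>\<^sub>F w in nhds 0. w \<in> ball (0::complex) R"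
      using R by (intro eventually_nhds_in_open) auto
    then show "\<forall>\<^sub>F w in nhds 0. eval_fps (Abs_fps Y) w = eval_fps 0 w"
      by (rule eventually_mono) (use z in \<open>simp add: psum_def\<close>)
  qed auto
  then show ?thesis by (metis fps_nth_Abs_fps fps_zero_nth)
qed

lemma dot_sums:
  assumes "\<And>p. p \<in> P \<Longrightarrow> (\<lambda>i. U i p * x ^ i) sums u p"
  shows "(\<lambda>i. dot P c (U i) * x ^ i) sums dot P c u"
proof -
  have "(\<lambda>i. \<Sum>p\<in>P. c p * (U i p * x ^ i)) sums (\<Sum>p\<in>P. c p * u p)"
    by (intro sums_sum sums_mult assms)
  then show ?thesis by (simp add: dot_def sum_distrib_right mult.assoc)
qed

lemma dot_pole_sum:
  assumes "\<And>p. p \<in> P \<Longrightarrow> (z - p) * u p = x * (ga d p * f + ep d p * g)" "z \<notin> P"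
  shows "dot P c u = x * (pole_sum P c (ga d) z * f + pole_sum P c (ep d) z * g)"
proof -
  have "c p * u p = x * (c p * ga d p / (z - p) * f + c p * ep d p / (z - p) * g)" if "p \<in> P" for p
  proof -
    have "u p = x * (ga d p * f + ep d p * g) / (z - p)"
      using assms(1)[OF that] assms(2) that by (subst eq_divide_eq) (auto simp: mult.commute)
    then show ?thesis by (simp add: add_divide_distrib ring_distribs mult_ac)
  qed
  then have "dot P c u = (\<Sum>p\<in>P. x * (c p * ga d p / (z - p) * f + c p * ep d p / (z - p) * g))"
    by (simp add: dot_def)
  then show ?thesis
    by (simp add: pole_sum_def sum_distrib_left sum_distrib_right sum.distrib ring_distribs)
qed

lemma tsysI:
  assumes "x \<noteq> 0" "z \<notin> P"
    and "x * (deriv f z + E z * f z) = dot P (al d) u"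
    and "x * (deriv g z + E z * g z) = dot P (be d) u"
    and "\<And>p. p \<in> P \<Longrightarrow> (z - p) * u p = x * (ga d p * f z + ep d p * g z)"
  shows "pole_system P d E f g z"
  using assms(1,3,4) dot_pole_sum[OF assms(5,2)] unfolding pole_system_def by simp

text \<open>Comparison of coefficients: with z - p = (z - a) + (a - p), the last two clauses of
  \<open>frobenius\<close> become one identity between (z - p) times the series of \<open>U\<close>
  and (z - a) times the row at \<open>p\<close>.\<close>

lemma frobenius_pole_system:
  assumes F: "frobenius P d a \<rho> Y1 Y2 U"
    and c: "psconv R Y1" "psconv R Y2" "\<And>p. p \<in> P \<Longrightarrow> psconv R (\<lambda>i. U i p)"
    and z: "norm (z - a) < R" "z \<noteq> a" "z \<notin> P"
  shows "pole_system P d (\<lambda>z. \<rho> / (z - a)) (\<lambda>z. psum Y1 (z - a)) (\<lambda>z. psum Y2 (z - a)) z"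
proof -
  let ?x = "z - a" and ?u = "\<lambda>p. psum (\<lambda>i. U i p) (z - a)"
  have sU: "(\<lambda>i. U i p * ?x ^ i) sums ?u p" if "p \<in> P" for p
    using psum_sums[OF c(3)[OF that] z(1)] .
  have der: "?x * (deriv (\<lambda>z. psum Y (z - a)) z + \<rho> / ?x * psum Y ?x) = dot P v ?u"
    if Y: "psconv R Y" "\<And>i. (of_nat i + \<rho>) * Y i = dot P v (U i)" for Y v
  proof -
    have "(psum Y has_field_derivative deriv (psum Y) ?x) (at ?x)"
      using psum_holomorphic[OF Y(1)] z(1) by (intro holomorphic_derivI[of _ "ball 0 R"]) auto
    then have "((\<lambda>z. psum Y (z - a)) has_field_derivative deriv (psum Y) ?x) (at z)"
      by (rule DERIV_chain2[where g="\<lambda>z. z - a", THEN DERIV_cong]) (auto intro!: derivative_eq_intros)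
    then have d: "deriv (\<lambda>z. psum Y (z - a)) z = deriv (psum Y) ?x" by (rule DERIV_imp_deriv)
    have "(\<lambda>i. of_nat i * Y i * ?x ^ i + \<rho> * (Y i * ?x ^ i)) sums (?x * deriv (psum Y) ?x + \<rho> * psum Y ?x)"
      by (intro sums_add sums_mult psum_deriv_sums[OF Y(1) z(1)] psum_sums[OF Y(1) z(1)])
    moreover have "of_nat i * Y i * ?x ^ i + \<rho> * (Y i * ?x ^ i) = dot P v (U i) * ?x ^ i" for i
      using Y(2)[of i] by (simp flip: Y(2) add: ring_distribs mult_ac)
    ultimately have "?x * deriv (psum Y) ?x + \<rho> * psum Y ?x = dot P v ?u"
      using dot_sums[where c=v, OF sU] by (simp add: sums_unique2)
    then show ?thesis using z(2) d by (simp add: field_simps)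
  qed
  have u: "(z - p) * ?u p = ?x * (ga d p * psum Y1 ?x + ep d p * psum Y2 ?x)" if p: "p \<in> P" for p
  proof -
    have "(\<lambda>i. U (Suc i) p * ?x ^ Suc i) sums (?u p - U 0 p)"
      using sU[OF p] sums_Suc_iff[of "\<lambda>i. U i p * ?x ^ i" "?u p - U 0 p"] by simp
    then have "(\<lambda>i. ?x * (U i p * ?x ^ i) + (a - p) * (U (Suc i) p * ?x ^ Suc i)) sums (?x * ?u p + (a - p) * (?u p - U 0 p))"
      by (intro sums_add sums_mult sU p)
    moreover have "?x * (U i p * ?x ^ i) + (a - p) * (U (Suc i) p * ?x ^ Suc i)
       = ?x * (ga d p * (Y1 i * ?x ^ i) + ep d p * (Y2 i * ?x ^ i))" for i
    proof -
      have "U i p + (a - p) * U (Suc i) p = ga d p * Y1 i + ep d p * Y2 i"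
        using F p by (simp add: frobenius_def)
      then have "?x * ?x ^ i * (U i p + (a - p) * U (Suc i) p) = ?x * ?x ^ i * (ga d p * Y1 i + ep d p * Y2 i)"
        by simp
      then show ?thesis by (simp add: ring_distribs mult_ac)
    qed
    moreover have "(\<lambda>i. ?x * (ga d p * (Y1 i * ?x ^ i) + ep d p * (Y2 i * ?x ^ i))) sums
       (?x * (ga d p * psum Y1 ?x + ep d p * psum Y2 ?x))"
      by (intro sums_add sums_mult psum_sums[OF c(1) z(1)] psum_sums[OF c(2) z(1)])
    ultimately have "?x * ?u p + (a - p) * (?u p - U 0 p) = ?x * (ga d p * psum Y1 ?x + ep d p * psum Y2 ?x)"
      using sums_unique2 by auto
    moreover have "(a - p) * U 0 p = 0" using F p unfolding frobenius_def by blast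
    moreover have "(z - p) * ?u p = ?x * ?u p + (a - p) * (?u p - U 0 p) + (a - p) * U 0 p"
      by (simp add: algebra_simps)
    ultimately show ?thesis by simp
  qed
  show ?thesis
    by (rule tsysI[of ?x z P _ _ _ ?u]) (use z u der[OF c(1)] der[OF c(2)] F in \<open>auto simp: frobenius_def\<close>)
qed

text \<open>In x = 1/z the operator z d/dz is - x d/dx, whence the factor \<rho> - i; and (z - p) /
  z = 1 - p x turns into the recursion between neighbouring \<open>U\<close>.\<close>

lemma frobenius_inf_pole_system:
  assumes F: "frobenius_inf P d \<rho> Y1 Y2 U"
    and c: "psconv R Y1" "psconv R Y2" "\<And>p. p \<in> P \<Longrightarrow> psconv R (\<lambda>i. U i p)"
    and z: "norm (1 / z) < R" "z \<noteq> 0" "z \<notin> P"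
  shows "pole_system P d (\<lambda>z. \<rho> / z) (\<lambda>z. psum Y1 (1 / z)) (\<lambda>z. psum Y2 (1 / z)) z"
proof -
  let ?x = "1 / z" and ?u = "\<lambda>p. psum (\<lambda>i. U i p) (1 / z)"
  have sU: "(\<lambda>i. U i p * ?x ^ i) sums ?u p" if "p \<in> P" for p
    using psum_sums[OF c(3)[OF that] z(1)] .
  have der: "z * (deriv (\<lambda>z. psum Y (1 / z)) z + \<rho> / z * psum Y ?x) = dot P v ?u"
    if Y: "psconv R Y" "\<And>i. (\<rho> - of_nat i) * Y i = dot P v (U i)" for Y v
  proof -
    have "(psum Y has_field_derivative deriv (psum Y) ?x) (at ?x)"
      using psum_holomorphic[OF Y(1)] z(1) by (intro holomorphic_derivI[of _ "ball 0 R"]) auto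
    then have "((\<lambda>z. psum Y (1 / z)) has_field_derivative (deriv (psum Y) ?x * (- (1 / z) * (1 / z)))) (at z)"
      by (rule DERIV_chain2[where g="\<lambda>z. 1 / z"])
        (use z(2) in \<open>auto intro!: derivative_eq_intros simp: power2_eq_square\<close>)
    then have d: "deriv (\<lambda>z. psum Y (1 / z)) z = deriv (psum Y) ?x * (- (1 / z) * (1 / z))"
      by (rule DERIV_imp_deriv)
    have "(\<lambda>i. \<rho> * (Y i * ?x ^ i) - of_nat i * Y i * ?x ^ i) sums (\<rho> * psum Y ?x - ?x * deriv (psum Y) ?x)"
      by (intro sums_diff sums_mult psum_deriv_sums[OF Y(1) z(1)] psum_sums[OF Y(1) z(1)])
    moreover have "\<rho> * (Y i * ?x ^ i) - of_nat i * Y i * ?x ^ i = dot P v (U i) * ?x ^ i" for i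
      by (simp only: Y(2)[symmetric] left_diff_distrib mult.assoc)
    ultimately have "\<rho> * psum Y ?x - ?x * deriv (psum Y) ?x = dot P v ?u"
      using dot_sums[where c=v, OF sU] by (simp add: sums_unique2)
    then show ?thesis using z(2) unfolding d by (simp add: field_simps)
  qed
  have u: "(z - p) * ?u p = z * (ga d p * psum Y1 ?x + ep d p * psum Y2 ?x)" if p: "p \<in> P" for p
  proof -
    define G where "G i = ga d p * (Y1 i * ?x ^ i) + ep d p * (Y2 i * ?x ^ i)" for i
    have "(\<lambda>i. U (Suc i) p * ?x ^ Suc i) sums (?u p - U 0 p)"
      using sU[OF p] sums_Suc_iff[of "\<lambda>i. U i p * ?x ^ i" "?u p - U 0 p"] by simp
    then have "(\<lambda>i. U (Suc i) p * ?x ^ Suc i - p * ?x * (U i p * ?x ^ i)) sums ((?u p - U 0 p) - p * ?x * ?u p)"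
      by (intro sums_diff sums_mult sU p)
    moreover have "U (Suc i) p * ?x ^ Suc i - p * ?x * (U i p * ?x ^ i) = G (Suc i)" for i
    proof -
      have "U (Suc i) p - p * U i p = ga d p * Y1 (Suc i) + ep d p * Y2 (Suc i)"
        using F p by (simp add: frobenius_inf_def)
      then have "?x ^ Suc i * (U (Suc i) p - p * U i p) = ?x ^ Suc i * (ga d p * Y1 (Suc i) + ep d p * Y2 (Suc i))"
        by simp
      then show ?thesis unfolding G_def by (simp add: ring_distribs mult_ac right_diff_distrib)
    qed
    moreover have "G sums (ga d p * psum Y1 ?x + ep d p * psum Y2 ?x)"
      unfolding G_def
      by (intro sums_add sums_mult psum_sums[OF c(1) z(1)] psum_sums[OF c(2) z(1)])
    then have "(\<lambda>i. G (Suc i)) sums (ga d p * psum Y1 ?x + ep d p * psum Y2 ?x - G 0)"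
      using sums_Suc_iff[of G] by simp
    ultimately have "(?u p - U 0 p) - p * ?x * ?u p = ga d p * psum Y1 ?x + ep d p * psum Y2 ?x - G 0"
      using sums_unique2 by auto
    moreover have "G 0 = U 0 p" using F p by (simp add: frobenius_inf_def G_def)
    ultimately have "?u p - p * ?x * ?u p = ga d p * psum Y1 ?x + ep d p * psum Y2 ?x" by simp
    then have "z * (?u p - p * ?x * ?u p) = z * (ga d p * psum Y1 ?x + ep d p * psum Y2 ?x)" by simp
    then show ?thesis using z(2) by (simp add: algebra_simps)
  qed
  show ?thesis
    by (rule tsysI[of z z P _ _ _ ?u]) (use z u der[OF c(1)] der[OF c(2)] F in \<open>auto simp: frobenius_inf_def\<close>)
qed

lemma frobenius_poly:
  assumes F: "frobenius P d a \<rho> (coeff h) (coeff g) (\<lambda>i p. coeff (u p) i)" and z: "z \<noteq> a" "z \<notin> P"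
  shows "pole_system P d (\<lambda>z. \<rho> / (z - a)) (poly (h \<circ>\<^sub>p [:- a, 1:])) (poly (g \<circ>\<^sub>p [:- a, 1:])) z"
proof -
  have p: "psum (coeff q) x = poly q x" for q x
    unfolding psum_def fps_of_poly_def[symmetric] by simp
  have c: "psconv R (coeff q)" for q R
    unfolding psconv_def fps_of_poly_def[symmetric] by simp
  have "pole_system P d (\<lambda>z. \<rho> / (z - a)) (\<lambda>z. psum (coeff h) (z - a)) (\<lambda>z. psum (coeff g) (z - a)) z"
    by (rule frobenius_pole_system[OF F, of "norm (z - a) + 1"]) (use c z in auto)
  moreover have "poly (q \<circ>\<^sub>p [:- a, 1:]) = (\<lambda>z. psum (coeff q) (z - a))" for q
    by (rule ext) (simp add: p poly_pcompose)
  ultimately show ?thesis by simp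
qed

lemma frobenius_of_poly:
  assumes h: "\<And>z. (z - a) * poly (pderiv h) z + \<rho> * poly h z = dot P (al d) (\<lambda>p. poly (u p) z)"
    and g: "\<And>z. (z - a) * poly (pderiv g) z + \<rho> * poly g z = dot P (be d) (\<lambda>p. poly (u p) z)"
    and u: "\<And>z p. p \<in> P \<Longrightarrow> (z - p) * poly (u p) z = (z - a) * (ga d p * poly h z + ep d p * poly g z)"
  shows "frobenius P d a \<rho> (coeff (h \<circ>\<^sub>p [:a, 1:])) (coeff (g \<circ>\<^sub>p [:a, 1:])) (\<lambda>i p. coeff (u p \<circ>\<^sub>p [:a, 1:]) i)"
proof -
  let ?s = "\<lambda>q. q \<circ>\<^sub>p [:a, 1:]"
  have sh: "poly (?s q) x = poly q (a + x)" for q x by (simp add: poly_pcompose)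
  have pd: "poly (pderiv (?s q)) x = poly (pderiv q) (a + x)" for q x
    by (simp add: pderiv_pcompose poly_pcompose pderiv_pCons)
  have 1: "(of_nat i + \<rho>) * coeff (?s q) i = dot P v (\<lambda>p. coeff (?s (u p)) i)"
    if q: "\<And>z. (z - a) * poly (pderiv q) z + \<rho> * poly q z = dot P v (\<lambda>p. poly (u p) z)" for q v i
  proof -
    have "poly (pCons 0 (pderiv (?s q)) + smult \<rho> (?s q)) x = poly (\<Sum>p\<in>P. smult (v p) (?s (u p))) x" for x
      using q[of "a + x"] by (simp add: sh pd dot_def poly_sum)
    then have "pCons 0 (pderiv (?s q)) + smult \<rho> (?s q) = (\<Sum>p\<in>P. smult (v p) (?s (u p)))"
      using poly_eq_poly_eq_iff by blast
    from arg_cong[OF this, of "\<lambda>q. coeff q i"] show ?thesis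
      by (simp add: coeff_sum dot_def coeff_pCons coeff_pderiv ring_distribs split: nat.splits)
  qed
  have 2: "(a - p) * coeff (?s (u p)) 0 = 0 \<and>
     (\<forall>i. coeff (?s (u p)) i + (a - p) * coeff (?s (u p)) (Suc i) = ga d p * coeff (?s h) i + ep d p * coeff (?s g) i)"
    if p: "p \<in> P" for p
  proof -
    have "poly (pCons 0 (?s (u p)) + smult (a - p) (?s (u p))) x
       = poly (pCons 0 (smult (ga d p) (?s h) + smult (ep d p) (?s g))) x" for x
      using u[OF p, of "a + x"] by (simp add: sh algebra_simps)
    then have e: "pCons 0 (?s (u p)) + smult (a - p) (?s (u p)) = pCons 0 (smult (ga d p) (?s h) + smult (ep d p) (?s g))"
      using poly_eq_poly_eq_iff by blast
    show ?thesis
      using arg_cong[OF e, of "\<lambda>q. coeff q 0"] arg_cong[OF e, of "\<lambda>q. coeff q (Suc i)" for i]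
      by simp
  qed
  show ?thesis unfolding frobenius_def using 1[OF h] 1[OF g] 2 by blast
qed

definition vmat :: "rank_one_data \<Rightarrow> complex \<Rightarrow> complex \<Rightarrow> complex" where
  "vmat d p q = ga d p * al d q + ep d p * be d q"

text \<open>The bilateral version; here the coefficients \<open>u k p\<close> are those of \<open>(ga p Y1 + ep p Y2) / (z - p)\<close>.\<close>

definition laurent_rel :: "complex set \<Rightarrow> rank_one_data \<Rightarrow> complex \<Rightarrow> complex \<Rightarrow>
    (int \<Rightarrow> complex) \<Rightarrow> (int \<Rightarrow> complex) \<Rightarrow> (int \<Rightarrow> complex \<Rightarrow> complex) \<Rightarrow> bool" where
  "laurent_rel P d a \<tau> Y1 Y2 u \<longleftrightarrow>
     (\<forall>k. (of_int k + \<tau>) * Y1 k = dot P (al d) (u (k - 1))) \<and>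
     (\<forall>k. (of_int k + \<tau>) * Y2 k = dot P (be d) (u (k - 1))) \<and>
     (\<forall>k. \<forall>p\<in>P. u (k - 1) p + (a - p) * u k p = ga d p * Y1 k + ep d p * Y2 k)"

lemma dot_vmat: "dot P (vmat d p) u = ga d p * dot P (al d) u + ep d p * dot P (be d) u"
  by (simp add: dot_def vmat_def sum.distrib sum_distrib_left ring_distribs mult.assoc)

lemma laurent_rel_rec:
  assumes "laurent_rel P d a \<tau> Y1 Y2 u" "p \<in> P"
  shows "(of_int k + 1 + \<tau>) * (u k p + (a - p) * u (k + 1) p) = dot P (vmat d p) (u k)"
proof -
  have 1: "u k p + (a - p) * u (k + 1) p = ga d p * Y1 (k + 1) + ep d p * Y2 (k + 1)"
    using assms unfolding laurent_rel_def by (metis add_diff_cancel_right')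
  have 2: "(of_int (k + 1) + \<tau>) * Y1 (k + 1) = dot P (al d) (u k)"
    "(of_int (k + 1) + \<tau>) * Y2 (k + 1) = dot P (be d) (u k)"
    using assms(1) unfolding laurent_rel_def by (metis add_diff_cancel_right')+
  show ?thesis unfolding 1 dot_vmat 2[symmetric] by (simp add: algebra_simps)
qed

section \<open>Laurent coefficients that vanish from some index on\<close>

lemma geom_decay_zero:
  fixes N :: "nat \<Rightarrow> real"
  assumes "\<And>j. 0 \<le> N j" "\<And>j. N j \<le> q * N (Suc j)" "\<And>j. N j \<le> M * s ^ j"
    and "0 \<le> q" "0 \<le> s" "q * s < 1"
  shows "N 0 = 0"
proof -
  have "N 0 \<le> q ^ j * N j" for j
  proof (induction j)
    case (Suc j)
    have "q ^ j * N j \<le> q ^ j * (q * N (Suc j))"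
      using assms by (intro mult_left_mono) auto
    then show ?case using Suc by (simp add: mult_ac)
  qed simp
  also have "q ^ j * N j \<le> M * (q * s) ^ j" for j
  proof -
    have "q ^ j * N j \<le> q ^ j * (M * s ^ j)" using assms by (intro mult_left_mono) auto
    then show ?thesis by (simp add: power_mult_distrib mult_ac)
  qed
  finally have "N 0 \<le> M * (q * s) ^ j" for j .
  moreover have "(\<lambda>j. M * (q * s) ^ j) \<longlonglongrightarrow> M * 0"
    using assms by (intro tendsto_mult tendsto_const LIMSEQ_realpow_zero) auto
  ultimately have "N 0 \<le> M * 0" by (intro LIMSEQ_le_const) auto
  then show ?thesis using assms(1)[of 0] by simp
qed

lemma vmat_bound:
  assumes "finite P"
  obtains C where "C \<ge> 0" "\<And>p u. p \<in> P \<Longrightarrow> norm (dot P (vmat d p) u) \<le> C * (\<Sum>q\<in>P. norm (u q))"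
    "\<And>p q. p \<in> P \<Longrightarrow> q \<in> P \<Longrightarrow> norm (vmat d p q) \<le> C"
proof
  let ?C = "\<Sum>p\<in>P. \<Sum>q\<in>P. norm (vmat d p q)"
  show "?C \<ge> 0" by (intro sum_nonneg) auto
  show le: "norm (vmat d p q) \<le> ?C" if "p \<in> P" "q \<in> P" for p q
  proof -
    have "norm (vmat d p q) \<le> (\<Sum>q\<in>P. norm (vmat d p q))"
      using that assms by (intro member_le_sum) auto
    also have "\<dots> \<le> ?C" using that assms by (intro member_le_sum[of p P "\<lambda>p. \<Sum>q\<in>P. norm (vmat d p q)"] sum_nonneg) auto
    finally show ?thesis .
  qed
  show "norm (dot P (vmat d p) u) \<le> ?C * (\<Sum>q\<in>P. norm (u q))" if "p \<in> P" for p u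
  proof -
    have "norm (dot P (vmat d p) u) \<le> (\<Sum>q\<in>P. norm (vmat d p q * u q))"
      unfolding dot_def by (rule norm_sum)
    also have "\<dots> \<le> (\<Sum>q\<in>P. ?C * norm (u q))"
      using le that by (intro sum_mono) (auto simp: norm_mult intro!: mult_right_mono)
    finally show ?thesis by (simp add: sum_distrib_left)
  qed
qed

lemma large_int_norm:
  fixes \<tau> :: complex
  obtains K :: int where "\<And>k. K \<le> \<bar>k\<bar> \<Longrightarrow> B \<le> norm (of_int k + \<tau>)"
proof
  fix k :: int assume "\<lceil>B + norm \<tau>\<rceil> \<le> \<bar>k\<bar>"
  then have "B + norm \<tau> \<le> \<bar>of_int k\<bar>" by linarith
  also have "\<bar>of_int k\<bar> = norm (of_int k :: complex)" by simp
  also have "\<dots> \<le> norm (of_int k + \<tau>) + norm \<tau>" using norm_triangle_ineq4[of "of_int k + \<tau>" \<tau>] by simp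
  finally show "B \<le> norm (of_int k + \<tau>)" by simp
qed

text \<open>Far to the left the factor k + 1 + \<tau> is large, so for p \<noteq> a the recursion is
  nearly \<open>u k p\<close> = - (a - p) \<open>u (k + 1) p\<close>. Hence nonzero coefficients
  would grow, as k decreases, at a rate close to the distance of the nearest other pole. The Cauchy
  bound permits only the smaller rate \<open>r\<close>. The component at \<open>a\<close> is
  dominated by the others.\<close>

lemma laurent_rel_vanish_local:
  assumes Z: "laurent_rel P d a \<tau> Y1 Y2 u" and P: "finite P" "a \<in> P"
    and r: "0 < r" "\<And>p. p \<in> P \<Longrightarrow> p \<noteq> a \<Longrightarrow> r < dist a p"
    and bd: "\<And>p. p \<in> P \<Longrightarrow> \<exists>M. \<forall>k. norm (u k p) \<le> M * r powi (- k)"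
  obtains K where "\<And>k p. k \<le> K \<Longrightarrow> p \<in> P \<Longrightarrow> u k p = 0"
proof -
  obtain C where C: "C \<ge> 0" "\<And>p u. p \<in> P \<Longrightarrow> norm (dot P (vmat d p) u) \<le> C * (\<Sum>q\<in>P. norm (u q))"
    "\<And>p q. p \<in> P \<Longrightarrow> q \<in> P \<Longrightarrow> norm (vmat d p q) \<le> C"
    using vmat_bound[OF P(1)] by blast
  let ?Q = "P - {a}"
  define n where "n = real (card P)"
  obtain m where m: "r < m" "\<And>p. p \<in> ?Q \<Longrightarrow> m \<le> dist a p"
  proof (cases "?Q = {}")
    case True then show ?thesis using that[of "r + 1"] by auto
  next
    case False
    then show ?thesis
      using P r(2) by (intro that[of "Min (dist a ` ?Q)"]) auto
  qed
  \<comment> \<open>Chosen so that (1 + \<delta>) r is the midpoint of r and m, hence below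
    m.\<close>
  define \<delta> where "\<delta> = (m / r - 1) / 2"
  have \<delta>: "\<delta> > 0" using m r by (simp add: \<delta>_def)
  have qr: "(1 + \<delta>) / m * r < 1"
  proof -
    have "(1 + \<delta>) * r = (m + r) / 2" using r by (simp add: \<delta>_def field_simps)
    also have "\<dots> < m" using m by simp
    finally show ?thesis using m r by (simp add: field_simps)
  qed
  define N where "N k = (\<Sum>p\<in>?Q. norm (u k p))" for k
  \<comment> \<open>Beyond \<open>K1\<close> the contribution of V costs at most the factor 1 +
    \<delta>; beyond \<open>K2\<close> the equation at \<open>a\<close> can be solved for the
    component at \<open>a\<close>.\<close>
  obtain K1 where K1: "\<And>k. K1 \<le> \<bar>k\<bar> \<Longrightarrow> max 1 (n * C * (1 + C) / \<delta>) \<le> norm (of_int k + (1 + \<tau>))"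
    using large_int_norm by blast
  obtain K2 where K2: "\<And>k. K2 \<le> \<bar>k\<bar> \<Longrightarrow> 1 \<le> norm (of_int k + (1 + \<tau> - vmat d a a))"
    using large_int_norm by blast
  define K where "K = - max 0 (max K1 K2)"
  have ua: "norm (u k a) \<le> C * N k" if k: "k \<le> K" for k
  proof -
    have "(of_int k + 1 + \<tau>) * u k a = dot P (vmat d a) (u k)"
      using laurent_rel_rec[OF Z P(2), of k] by simp
    also have "\<dots> = vmat d a a * u k a + dot ?Q (vmat d a) (u k)"
      using P by (simp add: dot_def sum.remove[of P a])
    finally have "(of_int k + (1 + \<tau> - vmat d a a)) * u k a = dot ?Q (vmat d a) (u k)"
      by (simp add: algebra_simps)
    then have "norm (of_int k + (1 + \<tau> - vmat d a a)) * norm (u k a) = norm (dot ?Q (vmat d a) (u k))"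
      by (metis norm_mult)
    also have "\<dots> \<le> (\<Sum>q\<in>?Q. norm (vmat d a q * u k q))" unfolding dot_def by (rule norm_sum)
    also have "\<dots> \<le> (\<Sum>q\<in>?Q. C * norm (u k q))"
      using C(3) P by (intro sum_mono) (auto simp: norm_mult intro!: mult_right_mono)
    finally have "norm (of_int k + (1 + \<tau> - vmat d a a)) * norm (u k a) \<le> C * N k"
      by (simp add: N_def sum_distrib_left)
    moreover have "1 * norm (u k a) \<le> norm (of_int k + (1 + \<tau> - vmat d a a)) * norm (u k a)"
      using k by (intro mult_right_mono K2) (auto simp: K_def)
    ultimately show ?thesis by simp
  qed
  have N0: "N k \<ge> 0" for k by (simp add: N_def sum_nonneg)
  have step: "N (k + 1) \<le> (1 + \<delta>) / m * N k" if k: "k \<le> K" for k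
  proof -
    have kn: "max 1 (n * C * (1 + C) / \<delta>) \<le> norm (of_int k + 1 + \<tau>)"
      using K1[of k] k by (simp add: K_def add.assoc)
    have tot: "(\<Sum>q\<in>P. norm (u k q)) \<le> (1 + C) * N k"
      using ua[OF k] P by (simp add: N_def sum.remove[of P a] algebra_simps)
    have 1: "m * norm (u (k+1) p) \<le> norm (u k p) + C * (1 + C) / norm (of_int k + 1 + \<tau>) * N k" if p: "p \<in> ?Q" for p
    proof -
      have nz: "of_int k + 1 + \<tau> \<noteq> 0" using kn by auto
      have "(a - p) * u (k + 1) p = dot P (vmat d p) (u k) / (of_int k + 1 + \<tau>) - u k p"
        using laurent_rel_rec[OF Z, of p k] p nz by (simp add: field_simps)
      then have "dist a p * norm (u (k+1) p) = norm (dot P (vmat d p) (u k) / (of_int k + 1 + \<tau>) - u k p)"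
        by (metis dist_norm norm_mult)
      also have "\<dots> \<le> norm (dot P (vmat d p) (u k)) / norm (of_int k + 1 + \<tau>) + norm (u k p)"
        using norm_triangle_ineq4 by (metis norm_divide)
      also have "norm (dot P (vmat d p) (u k)) / norm (of_int k + 1 + \<tau>) \<le> C * ((1 + C) * N k) / norm (of_int k + 1 + \<tau>)"
      proof (intro divide_right_mono)
        have "norm (dot P (vmat d p) (u k)) \<le> C * (\<Sum>q\<in>P. norm (u k q))" using C(2) p by blast
        also have "\<dots> \<le> C * ((1 + C) * N k)" using tot C by (intro mult_left_mono)
        finally show "norm (dot P (vmat d p) (u k)) \<le> C * ((1 + C) * N k)" .
      qed simp
      finally have "dist a p * norm (u (k+1) p) \<le> norm (u k p) + C * (1 + C) / norm (of_int k + 1 + \<tau>) * N k"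
        by (simp add: mult_ac)
      moreover have "m * norm (u (k+1) p) \<le> dist a p * norm (u (k+1) p)"
        using m p by (intro mult_right_mono) auto
      ultimately show ?thesis by linarith
    qed
    have "m * N (k + 1) = (\<Sum>p\<in>?Q. m * norm (u (k+1) p))" by (simp add: N_def sum_distrib_left)
    also have "\<dots> \<le> (\<Sum>p\<in>?Q. norm (u k p) + C * (1 + C) / norm (of_int k + 1 + \<tau>) * N k)"
      by (intro sum_mono 1)
    also have "\<dots> = N k + real (card ?Q) * (C * (1 + C) / norm (of_int k + 1 + \<tau>) * N k)"
      by (simp add: N_def sum.distrib)
    also have "\<dots> \<le> N k + n * (C * (1 + C) / norm (of_int k + 1 + \<tau>) * N k)"
      using N0[of k] C(1) P unfolding n_def
      by (intro add_left_mono mult_right_mono mult_nonneg_nonneg divide_nonneg_nonneg) (auto intro!: card_mono)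
    also have "\<dots> = N k + n * C * (1 + C) / norm (of_int k + 1 + \<tau>) * N k" by simp
    also have "\<dots> \<le> N k + \<delta> * N k"
    proof (intro add_left_mono mult_right_mono N0)
      have "n * C * (1 + C) / \<delta> \<le> norm (of_int k + 1 + \<tau>)" "0 < norm (of_int k + 1 + \<tau>)" using kn by auto
      then show "n * C * (1 + C) / norm (of_int k + 1 + \<tau>) \<le> \<delta>" using \<delta> by (simp add: field_simps)
    qed
    finally show ?thesis using m r by (simp add: field_simps)
  qed
  have "\<exists>M. \<forall>k. N k \<le> M * r powi (- k)"
  proof -
    obtain M where M: "\<And>p. p \<in> P \<Longrightarrow> \<forall>k. norm (u k p) \<le> M p * r powi (- k)"
      using bd by metis
    have "N k \<le> (\<Sum>p\<in>?Q. M p) * r powi (- k)" for k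
      unfolding N_def sum_distrib_right using M by (intro sum_mono) auto
    then show ?thesis by blast
  qed
  then obtain M where M: "\<And>k. N k \<le> M * r powi (- k)" by blast
  have NK: "N k = 0" if k: "k \<le> K" for k
  proof -
    have "N (k - int 0) = 0"
    proof (rule geom_decay_zero[of "\<lambda>j. N (k - int j)" "(1 + \<delta>) / m" "M * r powi (- k)" r])
      fix j
      have "N (k - int (Suc j) + 1) \<le> (1 + \<delta>) / m * N (k - int (Suc j))" using k by (intro step) auto
      then show "N (k - int j) \<le> (1 + \<delta>) / m * N (k - int (Suc j))" by simp
      have "r powi (- (k - int j)) = r powi (- k) * r ^ j"
        using r power_int_add[of r "- k" "int j"] by (simp add: algebra_simps)
      then show "N (k - int j) \<le> M * r powi (- k) * r ^ j" using M[of "k - int j"] by (simp add: mult.assoc)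
    qed (use N0 qr m r \<delta> in auto)
    then show ?thesis by simp
  qed
  show ?thesis
  proof (rule that[of K])
    fix k p assume k: "k \<le> K" and p: "p \<in> P"
    show "u k p = 0"
    proof (cases "p = a")
      case True then show ?thesis using ua[OF k] NK[OF k] by simp
    next
      case False
      have "\<forall>p\<in>?Q. norm (u k p) = 0"
        using NK[OF k] P unfolding N_def by (subst (asm) sum_nonneg_eq_0_iff) auto
      then show ?thesis using False p by auto
    qed
  qed
qed

text \<open>The mirror image: as k increases, nonzero coefficients cannot decay faster than the
  largest distance of a pole from \<open>a\<close> allows, while the Cauchy bound on a circle around
  all poles forces a faster decay.\<close>

lemma laurent_rel_vanish_inf:
  assumes Z: "laurent_rel P d a \<tau> Y1 Y2 u" and P: "finite P"
    and r: "0 < r" "\<And>p. p \<in> P \<Longrightarrow> dist a p < r"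
    and bd: "\<And>p. p \<in> P \<Longrightarrow> \<exists>M. \<forall>k. norm (u k p) \<le> M * r powi (- k)"
  obtains K where "\<And>k p. k \<ge> K \<Longrightarrow> p \<in> P \<Longrightarrow> u k p = 0"
proof -
  obtain C where C: "C \<ge> 0" "\<And>p u. p \<in> P \<Longrightarrow> norm (dot P (vmat d p) u) \<le> C * (\<Sum>q\<in>P. norm (u q))"
    "\<And>p q. p \<in> P \<Longrightarrow> q \<in> P \<Longrightarrow> norm (vmat d p q) \<le> C"
    using vmat_bound[OF P(1)] by blast
  define n where "n = real (card P)"
  obtain m where m: "0 < m" "m < r" "\<And>p. p \<in> P \<Longrightarrow> dist a p \<le> m"
  proof (cases "P = {}")
    case True then show ?thesis using that[of "r / 2"] r by auto
  next
    case False
    have "Max (dist a ` P) < r" using P False r by auto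
    then show ?thesis
      using P r(1) by (intro that[of "max (r / 2) (Max (dist a ` P))"]) (auto simp: le_max_iff_disj)
  qed
  \<comment> \<open>Here (1 - \<delta>) r is the midpoint of r and m, hence above m.\<close>
  define \<delta> where "\<delta> = (1 - m / r) / 2"
  have \<delta>: "\<delta> > 0" "\<delta> < 1" using m r by (auto simp: \<delta>_def field_simps)
  have qr: "m / (1 - \<delta>) * (1 / r) < 1"
  proof -
    have "(1 - \<delta>) * r = (r + m) / 2" using r by (simp add: \<delta>_def field_simps)
    then have "m < (1 - \<delta>) * r" using m by simp
    then show ?thesis using \<delta> r by (simp add: field_simps)
  qed
  define N where "N k = (\<Sum>p\<in>P. norm (u k p))" for k
  obtain K1 where K1: "\<And>k. K1 \<le> \<bar>k\<bar> \<Longrightarrow> max 1 (n * C / \<delta>) \<le> norm (of_int k + (1 + \<tau>))"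
    using large_int_norm by blast
  define K where "K = max 0 K1"
  have N0: "N k \<ge> 0" for k by (simp add: N_def sum_nonneg)
  have step: "N k \<le> m / (1 - \<delta>) * N (k + 1)" if k: "k \<ge> K" for k
  proof -
    have kn: "max 1 (n * C / \<delta>) \<le> norm (of_int k + 1 + \<tau>)"
      using K1[of k] k by (simp add: K_def add.assoc)
    have 1: "norm (u k p) \<le> m * norm (u (k+1) p) + C / norm (of_int k + 1 + \<tau>) * N k" if p: "p \<in> P" for p
    proof -
      have nz: "of_int k + 1 + \<tau> \<noteq> 0" using kn by auto
      have "u k p = dot P (vmat d p) (u k) / (of_int k + 1 + \<tau>) - (a - p) * u (k + 1) p"
        using laurent_rel_rec[OF Z p, of k] nz by (simp add: field_simps)
      then have "norm (u k p) = norm (dot P (vmat d p) (u k) / (of_int k + 1 + \<tau>) - (a - p) * u (k + 1) p)"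
        by simp
      also have "\<dots> \<le> norm (dot P (vmat d p) (u k)) / norm (of_int k + 1 + \<tau>) + dist a p * norm (u (k+1) p)"
        using norm_triangle_ineq4[of "dot P (vmat d p) (u k) / (of_int k + 1 + \<tau>)" "(a - p) * u (k + 1) p"]
        unfolding norm_divide norm_mult dist_norm .
      also have "norm (dot P (vmat d p) (u k)) / norm (of_int k + 1 + \<tau>) \<le> C * N k / norm (of_int k + 1 + \<tau>)"
        unfolding N_def using C(2) p by (intro divide_right_mono) auto
      also have "dist a p * norm (u (k+1) p) \<le> m * norm (u (k+1) p)"
        using m p by (intro mult_right_mono) auto
      finally show ?thesis by (simp add: mult_ac)
    qed
    have "N k \<le> (\<Sum>p\<in>P. m * norm (u (k+1) p) + C / norm (of_int k + 1 + \<tau>) * N k)"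
      using sum_mono[of P "\<lambda>p. norm (u k p)", OF 1] unfolding N_def[symmetric] .
    also have "\<dots> = m * N (k + 1) + n * C / norm (of_int k + 1 + \<tau>) * N k"
      unfolding sum.distrib sum_distrib_left [symmetric] N_def[of "k + 1"] by (simp add: n_def)
    also have "\<dots> \<le> m * N (k + 1) + \<delta> * N k"
    proof (intro add_left_mono mult_right_mono N0)
      have "n * C / \<delta> \<le> norm (of_int k + 1 + \<tau>)" "0 < norm (of_int k + 1 + \<tau>)" using kn by auto
      then show "n * C / norm (of_int k + 1 + \<tau>) \<le> \<delta>" using \<delta> by (simp add: field_simps)
    qed
    finally show ?thesis using \<delta> by (simp add: field_simps)
  qed
  have "\<exists>M. \<forall>k. N k \<le> M * r powi (- k)"
  proof -
    obtain M where M: "\<And>p. p \<in> P \<Longrightarrow> \<forall>k. norm (u k p) \<le> M p * r powi (- k)"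
      using bd by metis
    have "N k \<le> (\<Sum>p\<in>P. M p) * r powi (- k)" for k
      unfolding N_def sum_distrib_right using M by (intro sum_mono) auto
    then show ?thesis by blast
  qed
  then obtain M where M: "\<And>k. N k \<le> M * r powi (- k)" by blast
  have NK: "N k = 0" if k: "k \<ge> K" for k
  proof -
    have "N (k + int 0) = 0"
    proof (rule geom_decay_zero[of "\<lambda>j. N (k + int j)" "m / (1 - \<delta>)" "M * r powi (- k)" "1 / r"])
      fix j
      have "N (k + int j) \<le> m / (1 - \<delta>) * N (k + int j + 1)" using k by (intro step) auto
      then show "N (k + int j) \<le> m / (1 - \<delta>) * N (k + int (Suc j))" by (simp add: algebra_simps)
      have "r powi (- (k + int j)) = r powi (- k) * r powi (- int j)"
        using r power_int_add[of r "- k" "- int j"] by simp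
      also have "r powi (- int j) = (1 / r) ^ j"
        by (simp add: power_int_minus power_one_over inverse_eq_divide)
      finally have "r powi (- (k + int j)) = r powi (- k) * (1 / r) ^ j" .
      then show "N (k + int j) \<le> M * r powi (- k) * (1 / r) ^ j" using M[of "k + int j"] by (simp add: mult.assoc)
    qed (use N0 qr m r \<delta> in auto)
    then show ?thesis by simp
  qed
  show ?thesis
  proof (rule that[of K])
    fix k p assume k: "K \<le> k" and p: "p \<in> P"
    have "\<forall>p\<in>P. norm (u k p) = 0"
      using NK[OF k] P unfolding N_def by (subst (asm) sum_nonneg_eq_0_iff) auto
    then show "u k p = 0" using p by auto
  qed
qed

text \<open>A solution of the system, twisted by \<open>(z - a)\<^sup>e\<^sup>0\<close>, along a circle and with multiplier \<open>c\<close>.\<close>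

definition circle_solution :: "complex set \<Rightarrow> rank_one_data \<Rightarrow> complex \<Rightarrow> real \<Rightarrow> real \<Rightarrow> complex \<Rightarrow> complex \<Rightarrow>
    (real \<Rightarrow> complex) \<Rightarrow> (real \<Rightarrow> complex) \<Rightarrow> bool" where
  "circle_solution P d a r \<sigma> e0 c f g \<longleftrightarrow> continuous_on {0..1} f \<and> continuous_on {0..1} g \<and>
     (\<forall>s\<in>{0..1}. (f has_vector_derivative (2 * of_real pi * \<i> * of_real \<sigma> *
        (circ r \<sigma> s * (pole_sum P (al d) (ga d) (a + circ r \<sigma> s) * f s + pole_sum P (al d) (ep d) (a + circ r \<sigma> s) * g s) - e0 * f s)))
        (at s within {0..1})) \<and>
     (\<forall>s\<in>{0..1}. (g has_vector_derivative (2 * of_real pi * \<i> * of_real \<sigma> *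
        (circ r \<sigma> s * (pole_sum P (be d) (ga d) (a + circ r \<sigma> s) * f s + pole_sum P (be d) (ep d) (a + circ r \<sigma> s) * g s) - e0 * g s)))
        (at s within {0..1})) \<and>
     f 1 = c * f 0 \<and> g 1 = c * g 0"

definition residue_coef :: "rank_one_data \<Rightarrow> complex \<Rightarrow> real \<Rightarrow> real \<Rightarrow> complex \<Rightarrow>
    (real \<Rightarrow> complex) \<Rightarrow> (real \<Rightarrow> complex) \<Rightarrow> int \<Rightarrow> complex \<Rightarrow> complex" where
  "residue_coef d a r \<sigma> \<nu> f g k p = coef r \<sigma> \<nu> (\<lambda>s. (ga d p * f s + ep d p * g s) / (a + circ r \<sigma> s - p)) k"

text \<open>Solutions of \<open>D\<close> are thought of as W f with W' / W = \<Sum> \<tau> p / (z -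
  p), where f is the first component of the system. So \<tau> records the factor between the two; it
  is 0 for the primal data and \<theta> for the dual data. \<open>E\<close> is a further free twist.
  The second component is given by a formula so that it can be continued along a path together with
  the first.\<close>

definition ode_to_system :: "ode2 \<Rightarrow> complex set \<Rightarrow> rank_one_data \<Rightarrow> (complex \<Rightarrow> complex) \<Rightarrow> bool" where
  "ode_to_system D P d \<tau> \<longleftrightarrow> (\<forall>z. z \<notin> ode_sing D \<longrightarrow> pole_sum P (al d) (ep d) z \<noteq> 0) \<and>
     (\<forall>\<Omega> E f. open \<Omega> \<longrightarrow> \<Omega> \<inter> ode_sing D = {} \<longrightarrow> E holomorphic_on \<Omega> \<longrightarrow> f holomorphic_on \<Omega> \<longrightarrow>
        (\<forall>z\<in>\<Omega>. twisted_ode D (\<lambda>z. E z + (\<Sum>p\<in>P. \<tau> p / (z - p))) f z) \<longrightarrow>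
        (\<forall>z\<in>\<Omega>. pole_system P d E f (\<lambda>z. 1 / pole_sum P (al d) (ep d) z * (deriv f z + (E z - pole_sum P (al d) (ga d) z) * f z)) z))"

section \<open>From scalar monodromy to relations between Laurent coefficients\<close>

lemma circle_solution_lincomb:
  assumes "circle_solution P d a r \<sigma> e0 c f g" "circle_solution P d a r \<sigma> e0 c f' g'"
  shows "circle_solution P d a r \<sigma> e0 c (\<lambda>s. k * f s + k' * f' s) (\<lambda>s. k * g s + k' * g' s)"
proof -
  have *: "((\<lambda>s. k * h s + k' * h' s) has_vector_derivative (2 * of_real pi * \<i> * of_real \<sigma> *
        (x * (A * (k * f s + k' * f' s) + B * (k * g s + k' * g' s)) - e0 * (k * h s + k' * h' s)))) (at s within {0..1})"
    if "(h has_vector_derivative (2 * of_real pi * \<i> * of_real \<sigma> * (x * (A * f s + B * g s) - e0 * h s))) (at s within {0..1})"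
      "(h' has_vector_derivative (2 * of_real pi * \<i> * of_real \<sigma> * (x * (A * f' s + B * g' s) - e0 * h' s))) (at s within {0..1})"
    for h h' x A B s
    using has_vector_derivative_add[OF has_vector_derivative_mult_right[OF that(1), of k]
        has_vector_derivative_mult_right[OF that(2), of k']]
    by (rule back_subst) (simp add: algebra_simps)
  show ?thesis
    using assms unfolding circle_solution_def
    by (intro conjI ballI * continuous_intros) (auto simp: algebra_simps)
qed

text \<open>The Fourier transform of the system: \<open>coef_deriv\<close> turns x d/dx into k +
  \<nu>, the twist adds \<open>e0\<close>, and z - p = x + (a - p) turns division by z - p into the
  last clause of \<open>laurent_rel\<close>.\<close>

lemma circle_solution_laurent_rel:
  assumes C: "circle_solution P d a r \<sigma> e0 c f g" and P: "finite P" "\<And>p. p \<in> P \<Longrightarrow> dist a p \<noteq> r"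
    and r: "r > 0" "\<sigma> = 1 \<or> \<sigma> = -1" and \<nu>: "exp (2 * of_real pi * \<i> * of_real \<sigma> * \<nu>) = c"
  shows "laurent_rel P d a (\<nu> + e0) (coef r \<sigma> \<nu> f) (coef r \<sigma> \<nu> g) (residue_coef d a r \<sigma> \<nu> f g)"
    and "\<And>p. p \<in> P \<Longrightarrow> \<exists>M. \<forall>k. norm (residue_coef d a r \<sigma> \<nu> f g k p) \<le> M * r powi (- k)"
proof -
  have cf: "continuous_on {0..1} f" and cg: "continuous_on {0..1} g" using C by (auto simp: circle_solution_def)
  define u where "u p s = (ga d p * f s + ep d p * g s) / (a + circ r \<sigma> s - p)" for p s
  have nz: "a + circ r \<sigma> s - p \<noteq> 0" if "p \<in> P" for s p
  proof
    assume "a + circ r \<sigma> s - p = 0"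
    then have "p - a = circ r \<sigma> s" by (simp add: algebra_simps)
    then have "dist a p = norm (circ r \<sigma> s)" by (metis dist_commute dist_norm)
    then show False using P(2)[OF that] r by (simp add: circ_def norm_mult)
  qed
  have cu: "continuous_on {0..1} (u p)" if "p \<in> P" for p
    unfolding u_def using nz[OF that] by (intro continuous_intros cf cg) auto
  have uc: "residue_coef d a r \<sigma> \<nu> f g k p = coef r \<sigma> \<nu> (u p) k" for k p
  proof -
    have "u p = (\<lambda>s. (ga d p * f s + ep d p * g s) / (a + circ r \<sigma> s - p))" by (simp add: u_def fun_eq_iff)
    then show ?thesis by (simp add: residue_coef_def)
  qed
  show "\<exists>M. \<forall>k. norm (residue_coef d a r \<sigma> \<nu> f g k p) \<le> M * r powi (- k)" if "p \<in> P" for p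
    unfolding uc by (rule coef_bound[OF cu[OF that] r(1)])
  have A: "circ r \<sigma> s * (pole_sum P v (ga d) (a + circ r \<sigma> s) * f s + pole_sum P v (ep d) (a + circ r \<sigma> s) * g s)
     = dot P v (\<lambda>p. circ r \<sigma> s * u p s)" for v s
    by (rule dot_pole_sum[symmetric]) (use nz in \<open>auto simp: u_def\<close>)
  have R2: "(of_int k + (\<nu> + e0)) * coef r \<sigma> \<nu> h k = dot P v (residue_coef d a r \<sigma> \<nu> f g (k - 1))"
    if h: "continuous_on {0..1} h" "h 1 = c * h 0"
      "\<And>s. s\<in>{0..1} \<Longrightarrow> (h has_vector_derivative (2 * of_real pi * \<i> * of_real \<sigma> *
        (circ r \<sigma> s * (pole_sum P v (ga d) (a + circ r \<sigma> s) * f s + pole_sum P v (ep d) (a + circ r \<sigma> s) * g s) - e0 * h s)))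
        (at s within {0..1})" for h v k
  proof -
    let ?G = "\<lambda>s. 1 * (\<Sum>p\<in>P. v p * (circ r \<sigma> s * u p s)) + (- e0) * h s"
    have cx: "continuous_on {0..1} (\<lambda>s. \<Sum>p\<in>P. v p * (circ r \<sigma> s * u p s))"
      by (intro continuous_intros cu)
    have "coef r \<sigma> \<nu> ?G k = (of_int k + \<nu>) * coef r \<sigma> \<nu> h k"
    proof (rule coef_deriv)
      show "(h has_vector_derivative (2 * of_real pi * \<i> * of_real \<sigma> * ?G s)) (at s within {0..1})" if "s \<in> {0..1}" for s
        using h(3)[OF that] unfolding A by (simp add: dot_def)
      show "continuous_on {0..1} ?G" by (intro continuous_intros cx h(1))
    qed (use r h(2) \<nu> in auto)
    moreover have "coef r \<sigma> \<nu> ?G k = 1 * coef r \<sigma> \<nu> (\<lambda>s. \<Sum>p\<in>P. v p * (circ r \<sigma> s * u p s)) k + (- e0) * coef r \<sigma> \<nu> h k"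
      by (rule coef_lincomb[OF cx h(1)])
    moreover have "coef r \<sigma> \<nu> (\<lambda>s. \<Sum>p\<in>P. v p * (circ r \<sigma> s * u p s)) k = (\<Sum>p\<in>P. v p * coef r \<sigma> \<nu> (\<lambda>s. circ r \<sigma> s * u p s) k)"
      by (rule coef_sum[OF P(1)]) (intro continuous_intros cu)
    ultimately show ?thesis
      unfolding coef_mult_circ[OF r(1)] dot_def uc by (simp add: algebra_simps)
  qed
  have R1: "residue_coef d a r \<sigma> \<nu> f g (k - 1) p + (a - p) * residue_coef d a r \<sigma> \<nu> f g k p
      = ga d p * coef r \<sigma> \<nu> f k + ep d p * coef r \<sigma> \<nu> g k" if p: "p \<in> P" for k p
  proof -
    have "residue_coef d a r \<sigma> \<nu> f g (k - 1) p + (a - p) * residue_coef d a r \<sigma> \<nu> f g k p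
        = 1 * coef r \<sigma> \<nu> (\<lambda>s. circ r \<sigma> s * u p s) k + (a - p) * coef r \<sigma> \<nu> (u p) k"
      unfolding uc coef_mult_circ[OF r(1)] by simp
    also have "\<dots> = coef r \<sigma> \<nu> (\<lambda>s. 1 * (circ r \<sigma> s * u p s) + (a - p) * u p s) k"
      by (rule coef_lincomb[symmetric]) (intro continuous_intros cu p)+
    also have "(\<lambda>s. 1 * (circ r \<sigma> s * u p s) + (a - p) * u p s) = (\<lambda>s. ga d p * f s + ep d p * g s)"
    proof
      fix s
      have "1 * (circ r \<sigma> s * u p s) + (a - p) * u p s = (a + circ r \<sigma> s - p) * u p s" by (simp add: algebra_simps)
      then show "1 * (circ r \<sigma> s * u p s) + (a - p) * u p s = ga d p * f s + ep d p * g s"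
        using nz[OF p, of s] by (simp add: u_def)
    qed
    finally show ?thesis by (simp only: coef_lincomb[OF cf cg])
  qed
  show "laurent_rel P d a (\<nu> + e0) (coef r \<sigma> \<nu> f) (coef r \<sigma> \<nu> g) (residue_coef d a r \<sigma> \<nu> f g)"
    unfolding laurent_rel_def using C R1 by (intro conjI allI ballI R2) (auto simp: circle_solution_def)
qed

lemma pole_sum_holomorphic: "finite P \<Longrightarrow> P \<inter> \<Omega> = {} \<Longrightarrow> pole_sum P x y holomorphic_on \<Omega>"
  unfolding pole_sum_def by (intro holomorphic_intros) auto

lemma cis2_ne_1: "0 < s \<Longrightarrow> s < 1 \<Longrightarrow> \<sigma> = 1 \<or> \<sigma> = -1 \<Longrightarrow> cis2 \<sigma> s \<noteq> 1"
proof
  assume s: "0 < s" "s < 1" "\<sigma> = 1 \<or> \<sigma> = -1" "cis2 \<sigma> s = 1"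
  have "cis2 (-1) s = inverse (cis2 1 s)" by (simp add: cis2_def exp_minus)
  then have "cis2 1 s = cis2 1 0" using s by auto
  then show False using cis2_eq_iff[of s 0] s by (auto simp: doubleton_eq_iff)
qed

lemma analytic_at_imp_holomorphic_ball:
  assumes "f analytic_on {x}" "open S" "x \<in> S"
  obtains e where "e > 0" "ball x e \<subseteq> S" "f holomorphic_on ball x e"
proof -
  obtain d where d: "d > 0" "f holomorphic_on ball x d"
    using assms(1) by (auto simp: analytic_on_def)
  obtain e where e: "e > 0" "ball x e \<subseteq> S"
    using assms openE by blast
  show ?thesis
    by (rule that[of "min d e"]) (use d e in \<open>auto intro: holomorphic_on_subset\<close>)
qed

text \<open>Dividing the continued solutions by \<open>W\<close>, which is single-valued near the
  circle, keeps the multiplier \<open>c\<close> and leaves first components of solutions of the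
  system; their values along the path are \<open>f\<close>, \<open>g\<close>.\<close>

lemma monodromy_circle_solution:
  assumes mon: "monodromy_matrix D (\<lambda>s. a + circ r \<sigma> s) (mat c)"
    and r: "r > 0" "\<sigma> = 1 \<or> \<sigma> = -1"
    and D: "finite (ode_sing D)" "P \<subseteq> ode_sing D"
      "ode_p D holomorphic_on - ode_sing D" "ode_q D holomorphic_on - ode_sing D" "ode_to_system D P d \<tau>"
    and \<Omega>: "open \<Omega>" "sphere a r \<subseteq> \<Omega>" "a \<notin> \<Omega>" "\<Omega> \<inter> ode_sing D = {}"
    and W: "W holomorphic_on \<Omega>" "\<And>z. z \<in> \<Omega> \<Longrightarrow> W z \<noteq> 0"
      "\<And>z. z \<in> \<Omega> \<Longrightarrow> deriv W z = (e0 / (z - a) + (\<Sum>p\<in>P. \<tau> p / (z - p))) * W z"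
  obtains f g :: "2 \<Rightarrow> real \<Rightarrow> complex" where "c \<noteq> 0" "\<And>j. circle_solution P d a r \<sigma> e0 c (f j) (g j)"
    "\<And>k j. (\<And>s. s \<in> {0..1} \<Longrightarrow> (\<Sum>j\<in>UNIV. k j * f j s) = 0) \<Longrightarrow> k j = 0"
proof -
  define \<gamma> where "\<gamma> = (\<lambda>s. a + circ r \<sigma> s)"
  obtain F :: "2 \<Rightarrow> real \<Rightarrow> complex \<Rightarrow> complex" where F: "c \<noteq> 0" "\<And>j. continuation_along \<gamma> (F j)"
    "\<And>j s. s \<in> {0..1} \<Longrightarrow> \<forall>\<^sub>F z in nhds (\<gamma> s).
        deriv (deriv (F j s)) z + ode_p D z * deriv (F j s) z + ode_q D z * F j s z = 0"
    "\<And>j. \<forall>\<^sub>F z in nhds (\<gamma> 0). F j 1 z = c * F j 0 z"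
    "\<And>k j. \<forall>\<^sub>F z in nhds (\<gamma> 0). (\<Sum>j\<in>UNIV. k j * F j 0 z) = 0 \<Longrightarrow> k j = 0"
    using monodromy_scalarE[OF mon D(1,3,4)] unfolding \<gamma>_def by blast
  have finP: "finite P" using D finite_subset by blast
  have \<gamma>\<Omega>: "\<gamma> s \<in> \<Omega>" for s
    using \<Omega>(2) r by (auto simp: \<gamma>_def dist_norm circ_def norm_mult subset_iff)
  have cont\<gamma>: "continuous_on {0..1} \<gamma>" unfolding \<gamma>_def by (intro continuous_intros)
  have \<gamma>01: "\<gamma> 1 = \<gamma> 0" using cis2_1[OF r(2)] by (simp add: \<gamma>_def circ_def)
  let ?S = "\<lambda>z. \<Sum>p\<in>P. \<tau> p / (z - p)" and ?E = "\<lambda>z. e0 / (z - a)"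
  have P\<Omega>: "P \<inter> \<Omega> = {}" using \<Omega>(4) D(2) by auto
  have pole_sum_12: "pole_sum P (al d) (ep d) z \<noteq> 0" if "z \<in> \<Omega>" for z
    using D(5) \<Omega>(4) that unfolding ode_to_system_def by blast
  have an: "h analytic_on {\<gamma> s}" if "h holomorphic_on \<Omega>" for h s
    using that \<Omega>(1) \<gamma>\<Omega> analytic_at by blast
  define f0 where "f0 = (\<lambda>(j::2) s z. 1 / W z * F j s z)"
  define g0 where "g0 = (\<lambda>(j::2) s z. 1 / pole_sum P (al d) (ep d) z * (deriv (f0 j s) z + (?E z - pole_sum P (al d) (ga d) z) * f0 j s z))"
  have cf0: "continuation_along \<gamma> (f0 j)" for j
    unfolding f0_def by (intro continuation_mult F an holomorphic_intros W) (auto simp: W)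
  have cg0: "continuation_along \<gamma> (g0 j)" for j
    unfolding g0_def using pole_sum_12 P\<Omega> finP \<Omega>(3)
    by (intro continuation_mult continuation_add continuation_deriv cf0 an holomorphic_intros pole_sum_holomorphic) auto
  have sys: "pole_system P d ?E (f0 j s) (g0 j s) (\<gamma> s)" if s: "s \<in> {0..1}" for j s
  proof -
    obtain T where T: "open T" "\<gamma> s \<in> T" "\<And>z. z \<in> T \<Longrightarrow>
        deriv (deriv (F j s)) z + ode_p D z * deriv (F j s) z + ode_q D z * F j s z = 0"
      using F(3)[OF s, of j] by (auto simp: eventually_nhds)
    have "F j s analytic_on {\<gamma> s}" using F(2)[of j] s by (auto simp: continuation_along_def)
    then obtain e where e: "e > 0" "ball (\<gamma> s) e \<subseteq> T \<inter> \<Omega>" "F j s holomorphic_on ball (\<gamma> s) e"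
      using analytic_at_imp_holomorphic_ball[of "F j s" "\<gamma> s" "T \<inter> \<Omega>"] T \<Omega> \<gamma>\<Omega> by blast
    let ?B = "ball (\<gamma> s) e"
    have B\<Omega>: "z \<in> \<Omega>" if "z \<in> ?B" for z using e(2) that by blast
    have B\<Omega>': "?B \<subseteq> \<Omega>" using e(2) by blast
    have holf: "f0 j s holomorphic_on ?B"
      unfolding f0_def using B\<Omega> W(2)
      by (intro holomorphic_intros e holomorphic_on_subset[OF W(1)]) auto
    have holE: "?E holomorphic_on ?B" using B\<Omega> \<Omega>(3) by (intro holomorphic_intros) auto
    have holS: "(\<lambda>z. ?E z + ?S z) holomorphic_on ?B"
      using B\<Omega> P\<Omega> by (intro holomorphic_intros holE) auto
    have "twisted_ode D (\<lambda>z. ?E z + ?S z) (f0 j s) z" if z: "z \<in> ?B" for z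
    proof -
      have WF: "\<forall>\<^sub>F w in nhds z. W w * f0 j s w = F j s w"
        using eventually_nhds_in_open[OF open_ball z]
        by (rule eventually_mono) (use B\<Omega> W(2) in \<open>simp add: f0_def\<close>)
      have d1: "deriv (\<lambda>w. W w * f0 j s w) z = deriv (F j s) z"
        using eventually_nhds_x_imp_x[OF eventually_nhds_eq_deriv[OF WF]] .
      have d2: "deriv (deriv (\<lambda>w. W w * f0 j s w)) z = deriv (deriv (F j s)) z"
        using eventually_nhds_x_imp_x[OF eventually_nhds_eq_deriv[OF eventually_nhds_eq_deriv[OF WF]]] .
      have d0: "W z * f0 j s z = F j s z" using eventually_nhds_x_imp_x[OF WF] .
      have "deriv (deriv (F j s)) z + ode_p D z * deriv (F j s) z + ode_q D z * F j s z = 0"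
        using T(3) e(2) z by blast
      moreover have "W z \<noteq> 0" using W(2) B\<Omega> z by blast
      ultimately show ?thesis
        using twist[where D=D and \<Phi>=W and f="f0 j s", OF open_ball holomorphic_on_subset[OF W(1)] holf holS _ z]
          W(3) B\<Omega> B\<Omega>' unfolding d0 d1 d2 twisted_ode_def by auto
    qed
    then have "\<forall>z\<in>?B. twisted_ode D (\<lambda>z. ?E z + ?S z) (f0 j s) z" by blast
    moreover have "?B \<inter> ode_sing D = {}" using B\<Omega>' \<Omega>(4) by blast
    ultimately have "\<forall>z\<in>?B. pole_system P d ?E (f0 j s) (g0 j s) z"
      using D(5)[unfolded ode_to_system_def, THEN conjunct2, rule_format, OF open_ball _ holE holf] unfolding g0_def by blast
    then show ?thesis using e(1) by simp
  qed
  define f where "f = (\<lambda>(j::2) s. f0 j s (\<gamma> s))"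
  define g where "g = (\<lambda>(j::2) s. g0 j s (\<gamma> s))"
  let ?c = "2 * of_real pi * \<i> * of_real \<sigma> :: complex"
  have d\<gamma>: "(\<gamma> has_vector_derivative (?c * circ r \<sigma> s)) (at s within {0..1})" for s
    unfolding \<gamma>_def by (rule circ_vector_derivative)
  have vf: "(f j has_vector_derivative (?c * circ r \<sigma> s * deriv (f0 j s) (\<gamma> s))) (at s within {0..1})" if "s \<in> {0..1}" for j s
    unfolding f_def by (rule continuation_has_vector_derivative[OF cf0 cont\<gamma> that d\<gamma>])
  have vg: "(g j has_vector_derivative (?c * circ r \<sigma> s * deriv (g0 j s) (\<gamma> s))) (at s within {0..1})" if "s \<in> {0..1}" for j s
    unfolding g_def by (rule continuation_has_vector_derivative[OF cg0 cont\<gamma> that d\<gamma>])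
  have e0: "?E (\<gamma> s) = e0 / circ r \<sigma> s" for s by (simp add: \<gamma>_def)
  have x: "circ r \<sigma> s * (d' + e0 / circ r \<sigma> s * h) = circ r \<sigma> s * A \<Longrightarrow> ?c * circ r \<sigma> s * d' = ?c * (circ r \<sigma> s * A - e0 * h)" for s d' h A
  proof -
    assume h: "circ r \<sigma> s * (d' + e0 / circ r \<sigma> s * h) = circ r \<sigma> s * A"
    have "circ r \<sigma> s * d' = circ r \<sigma> s * (d' + e0 / circ r \<sigma> s * h) - e0 * h"
      using circ_nz[OF r(1), of \<sigma> s] by (simp add: algebra_simps)
    then show ?thesis unfolding h mult.assoc[of ?c] by simp
  qed
  have ev1: "\<forall>\<^sub>F z in nhds (\<gamma> 0). f0 j 1 z = c * f0 j 0 z" for j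
    using F(4)[of j] by (rule eventually_mono) (simp add: f0_def)
  have f1: "f0 j 1 (\<gamma> 0) = c * f0 j 0 (\<gamma> 0)" for j
    using eventually_nhds_x_imp_x[OF ev1] .
  have df1: "deriv (f0 j 1) (\<gamma> 0) = c * deriv (f0 j 0) (\<gamma> 0)" for j
  proof -
    have "f0 j 0 analytic_on {\<gamma> 0}" using cf0[of j] by (simp add: continuation_along_def)
    then have "f0 j 0 field_differentiable at (\<gamma> 0)" by (simp add: analytic_on_imp_differentiable_at)
    then have "deriv (\<lambda>z. c * f0 j 0 z) (\<gamma> 0) = c * deriv (f0 j 0) (\<gamma> 0)" by (rule deriv_cmult)
    then show ?thesis using eventually_nhds_x_imp_x[OF eventually_nhds_eq_deriv[OF ev1]] by simp
  qed
  have cs: "circle_solution P d a r \<sigma> e0 c (f j) (g j)" for j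
  proof -
    have "continuous_on {0..1} (f j)" "continuous_on {0..1} (g j)"
      using vf vg has_vector_derivative_continuous continuous_on_eq_continuous_within by blast+
    moreover have "f j 1 = c * f j 0" unfolding f_def \<gamma>01 by (rule f1)
    moreover have "g j 1 = c * g j 0" unfolding g_def \<gamma>01 g0_def f1 df1 by (simp add: algebra_simps)
    moreover have "(f j has_vector_derivative (?c *
        (circ r \<sigma> s * (pole_sum P (al d) (ga d) (a + circ r \<sigma> s) * f j s + pole_sum P (al d) (ep d) (a + circ r \<sigma> s) * g j s) - e0 * f j s)))
        (at s within {0..1})" if s: "s \<in> {0..1}" for s
    proof -
      have "?c * circ r \<sigma> s * deriv (f0 j s) (\<gamma> s) = ?c *
        (circ r \<sigma> s * (pole_sum P (al d) (ga d) (a + circ r \<sigma> s) * f j s + pole_sum P (al d) (ep d) (a + circ r \<sigma> s) * g j s) - e0 * f j s)"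
        by (rule x) (use sys[OF s, of j] in \<open>simp add: pole_system_def f_def g_def e0 \<gamma>_def\<close>)
      then show ?thesis using vf[OF s, of j] by (simp only:)
    qed
    moreover have "(g j has_vector_derivative (?c *
        (circ r \<sigma> s * (pole_sum P (be d) (ga d) (a + circ r \<sigma> s) * f j s + pole_sum P (be d) (ep d) (a + circ r \<sigma> s) * g j s) - e0 * g j s)))
        (at s within {0..1})" if s: "s \<in> {0..1}" for s
    proof -
      have "?c * circ r \<sigma> s * deriv (g0 j s) (\<gamma> s) = ?c *
        (circ r \<sigma> s * (pole_sum P (be d) (ga d) (a + circ r \<sigma> s) * f j s + pole_sum P (be d) (ep d) (a + circ r \<sigma> s) * g j s) - e0 * g j s)"
        by (rule x) (use sys[OF s, of j] in \<open>simp add: pole_system_def f_def g_def e0 \<gamma>_def\<close>)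
      then show ?thesis using vg[OF s, of j] by (simp only:)
    qed
    ultimately show ?thesis unfolding circle_solution_def by blast
  qed
  have ind: "k j = 0" if k: "\<And>s. s \<in> {0..1} \<Longrightarrow> (\<Sum>j\<in>UNIV. k j * f j s) = 0" for k :: "2 \<Rightarrow> complex" and j
  proof (rule F(5))
    have "\<forall>\<^sub>F s in at 0 within {0..1}. \<forall>\<^sub>F z in nhds (\<gamma> s). F j s z = F j 0 z" for j
      using F(2)[of j] by (simp add: continuation_along_def)
    then have "\<forall>\<^sub>F s in at 0 within {0..1}. F j 0 (\<gamma> s) = F j s (\<gamma> s)" for j
      by (rule eventually_mono[of _ _ "\<lambda>s. F j 0 (\<gamma> s) = F j s (\<gamma> s)"])
        (drule eventually_nhds_x_imp_x, rule sym)
    then have "\<forall>\<^sub>F s in at 0 within {0..1}. \<forall>j. F j 0 (\<gamma> s) = F j s (\<gamma> s)"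
      by (rule eventually_all_finite)
    then obtain \<delta> where \<delta>: "\<delta> > 0" "\<And>s j. s \<in> {0..1} \<Longrightarrow> s \<noteq> 0 \<Longrightarrow> dist s 0 < \<delta> \<Longrightarrow> F j 0 (\<gamma> s) = F j s (\<gamma> s)"
      unfolding eventually_at by blast
    let ?H = "\<lambda>z. \<Sum>j\<in>UNIV. k j * F j 0 z"
    let ?I = "{0<..<min \<delta> 1}"
    have H0: "?H (\<gamma> s) = 0" if "s \<in> ?I" for s
    proof -
      have "F j s (\<gamma> s) = W (\<gamma> s) * f j s" for j
        using W(2)[OF \<gamma>\<Omega>[of s]] by (simp add: f_def f0_def)
      then have "?H (\<gamma> s) = W (\<gamma> s) * (\<Sum>j\<in>UNIV. k j * f j s)"
        using that \<delta>(2)[of s] by (simp add: sum_distrib_left mult_ac dist_real_def)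
      then show ?thesis using k[of s] that by simp
    qed
    have "?H analytic_on {\<gamma> 0}"
      using F(2) by (intro analytic_intros) (auto simp: continuation_along_def)
    then obtain e where e: "e > 0" "?H holomorphic_on ball (\<gamma> 0) e"
      by (auto simp: analytic_on_def)
    \<comment> \<open>The points of the path for small parameters accumulate at the base point, so a
      combination that vanishes along the path also vanishes as a germ.\<close>
    have lim: "\<gamma> 0 islimpt (\<gamma> ` ?I \<inter> ball (\<gamma> 0) e)"
    proof (rule islimptI)
      fix T assume T: "\<gamma> 0 \<in> T" "open T"
      have "\<forall>\<^sub>F s in at 0 within {0..1}. \<gamma> s \<in> T \<inter> ball (\<gamma> 0) e"
        by (rule path_eventually[OF cont\<gamma>], simp, rule eventually_nhds_in_open) (use T e in auto)
      then obtain \<eta> where \<eta>: "\<eta> > 0" "\<And>s. s \<in> {0..1} \<Longrightarrow> s \<noteq> 0 \<Longrightarrow> dist s 0 < \<eta> \<Longrightarrow> \<gamma> s \<in> T \<inter> ball (\<gamma> 0) e"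
        unfolding eventually_at by blast
      define s where "s = min \<eta> (min \<delta> 1) / 2"
      have s: "s \<in> ?I" "0 < s" "s < 1" "s < \<eta>" using \<eta>(1) \<delta>(1) by (auto simp: s_def)
      moreover have "\<gamma> s \<noteq> \<gamma> 0" using cis2_ne_1[OF s(2,3) r(2)] r(1) by (simp add: \<gamma>_def circ_def)
      moreover have "\<gamma> s \<in> T \<inter> ball (\<gamma> 0) e" using \<eta>(2)[of s] s by (auto simp: dist_real_def)
      ultimately show "\<exists>y\<in>\<gamma> ` ?I \<inter> ball (\<gamma> 0) e. y \<in> T \<and> y \<noteq> \<gamma> 0" by blast
    qed
    have "?H z = 0" if "z \<in> ball (\<gamma> 0) e" for z
      by (rule analytic_continuation[OF e(2) open_ball _ _ _ lim _ that]) (use e(1) H0 in auto)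
    moreover have "\<forall>\<^sub>F z in nhds (\<gamma> 0). z \<in> ball (\<gamma> 0) e"
      using e(1) by (intro eventually_nhds_in_open) auto
    ultimately show "\<forall>\<^sub>F z in nhds (\<gamma> 0). ?H z = 0"
      by (auto elim: eventually_mono)
  qed
  show ?thesis using that[of f g] F(1) cs ind by blast
qed

section \<open>Elimination and recovery of the second component\<close>

definition system_to_ode :: "ode2 \<Rightarrow> complex set \<Rightarrow> rank_one_data \<Rightarrow> (complex \<Rightarrow> complex) \<Rightarrow> bool" where
  "system_to_ode D P d \<tau> \<longleftrightarrow> (\<forall>z. z \<notin> ode_sing D \<longrightarrow> pole_sum P (al d) (ep d) z \<noteq> 0) \<and>
     (\<forall>\<Omega> E f g. open \<Omega> \<longrightarrow> \<Omega> \<inter> ode_sing D = {} \<longrightarrow> E holomorphic_on \<Omega> \<longrightarrow> f holomorphic_on \<Omega> \<longrightarrow>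
        g holomorphic_on \<Omega> \<longrightarrow> (\<forall>z\<in>\<Omega>. pole_system P d E f g z) \<longrightarrow>
        (\<forall>z\<in>\<Omega>. twisted_ode D (\<lambda>z. E z + (\<Sum>p\<in>P. \<tau> p / (z - p))) f z))"

text \<open>The facts \<open>K\<close> are the classical coefficients of the equation for the first
  component of Y' = A Y, namely p = - tr A - A12' / A12 and q = det A - A11' + A11 A12' / A12,
  multiplied by A12.\<close>

lemma sys_twisted_ode_pointwise:
  fixes E f g pole_sum_11 pole_sum_12 A21 pole_sum_22 :: "complex \<Rightarrow> complex"
  assumes "open \<Omega>" "E holomorphic_on \<Omega>" "f holomorphic_on \<Omega>" "g holomorphic_on \<Omega>"
    "pole_sum_11 holomorphic_on \<Omega>" "pole_sum_12 holomorphic_on \<Omega>"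
    and sys: "\<And>z. z \<in> \<Omega> \<Longrightarrow> deriv f z + E z * f z = pole_sum_11 z * f z + pole_sum_12 z * g z"
      "\<And>z. z \<in> \<Omega> \<Longrightarrow> deriv g z + E z * g z = A21 z * f z + pole_sum_22 z * g z"
    and K: "\<And>z. z \<in> \<Omega> \<Longrightarrow> ode_p D z * pole_sum_12 z = - ((pole_sum_11 z + pole_sum_22 z) * pole_sum_12 z + deriv pole_sum_12 z)"
      "\<And>z. z \<in> \<Omega> \<Longrightarrow> ode_q D z * pole_sum_12 z = - (deriv pole_sum_11 z * pole_sum_12 z - pole_sum_11 z * deriv pole_sum_12 z + pole_sum_12 z * (pole_sum_12 z * A21 z - pole_sum_11 z * pole_sum_22 z))"
    and nz: "\<And>z. z \<in> \<Omega> \<Longrightarrow> pole_sum_12 z \<noteq> 0" and z: "z \<in> \<Omega>"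
  shows "twisted_ode D E f z"
proof -
  have D: "(h has_field_derivative deriv h w) (at w)" if "h holomorphic_on \<Omega>" "w \<in> \<Omega>" for h w
    using that assms(1) by (simp add: holomorphic_derivI)
  have ev: "\<forall>\<^sub>F w in nhds z. deriv f w = pole_sum_11 w * f w + pole_sum_12 w * g w - E w * f w"
    using eventually_nhds_in_open[OF assms(1) z] by (rule eventually_mono) (use sys(1) in \<open>force simp: algebra_simps\<close>)
  have f1: "deriv f z = pole_sum_11 z * f z + pole_sum_12 z * g z - E z * f z" using eventually_nhds_x_imp_x[OF ev] .
  have g1: "deriv g z = A21 z * f z + pole_sum_22 z * g z - E z * g z" using sys(2)[OF z] by (simp add: algebra_simps)
  have "deriv (deriv f) z = deriv (\<lambda>w. pole_sum_11 w * f w + pole_sum_12 w * g w - E w * f w) z"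
    by (rule deriv_cong_ev[OF ev]) simp
  also have "\<dots> = deriv pole_sum_11 z * f z + pole_sum_11 z * deriv f z + deriv pole_sum_12 z * g z + pole_sum_12 z * deriv g z - deriv E z * f z - E z * deriv f z"
    by (rule DERIV_imp_deriv)
      (use D[OF assms(2) z] D[OF assms(3) z] D[OF assms(4) z] D[OF assms(5) z] D[OF assms(6) z] in
      \<open>auto intro!: derivative_eq_intros simp: algebra_simps\<close>)
  finally have f2: "deriv (deriv f) z = deriv pole_sum_11 z * f z + pole_sum_11 z * deriv f z + deriv pole_sum_12 z * g z + pole_sum_12 z * deriv g z - deriv E z * f z - E z * deriv f z" .
  have p: "ode_p D z = - (pole_sum_11 z + pole_sum_22 z) - deriv pole_sum_12 z / pole_sum_12 z"
    using K(1)[OF z] nz[OF z] by (simp add: divide_simps ring_distribs)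
  have q: "ode_q D z = - deriv pole_sum_11 z + pole_sum_11 z * deriv pole_sum_12 z / pole_sum_12 z - (pole_sum_12 z * A21 z - pole_sum_11 z * pole_sum_22 z)"
    using K(2)[OF z] nz[OF z] by (simp add: divide_simps)
  show ?thesis unfolding twisted_ode_def f2 f1 g1 p q using nz[OF z]
    by (simp add: field_simps power2_eq_square)
qed

lemma twisted_ode_sys_pointwise:
  fixes E f pole_sum_11 pole_sum_12 A21 pole_sum_22 :: "complex \<Rightarrow> complex"
  assumes "open \<Omega>" "E holomorphic_on \<Omega>" "f holomorphic_on \<Omega>"
    "pole_sum_11 holomorphic_on \<Omega>" "pole_sum_12 holomorphic_on \<Omega>"
    and K: "\<And>z. z \<in> \<Omega> \<Longrightarrow> ode_p D z * pole_sum_12 z = - ((pole_sum_11 z + pole_sum_22 z) * pole_sum_12 z + deriv pole_sum_12 z)"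
      "\<And>z. z \<in> \<Omega> \<Longrightarrow> ode_q D z * pole_sum_12 z = - (deriv pole_sum_11 z * pole_sum_12 z - pole_sum_11 z * deriv pole_sum_12 z + pole_sum_12 z * (pole_sum_12 z * A21 z - pole_sum_11 z * pole_sum_22 z))"
    and nz: "\<And>z. z \<in> \<Omega> \<Longrightarrow> pole_sum_12 z \<noteq> 0" and z: "z \<in> \<Omega>"
    and ode: "twisted_ode D E f z"
  defines "g \<equiv> \<lambda>z. 1 / pole_sum_12 z * (deriv f z + (E z - pole_sum_11 z) * f z)"
  shows "deriv f z + E z * f z = pole_sum_11 z * f z + pole_sum_12 z * g z"
    "deriv g z + E z * g z = A21 z * f z + pole_sum_22 z * g z"
proof -
  have D: "(h has_field_derivative deriv h w) (at w)" if "h holomorphic_on \<Omega>" "w \<in> \<Omega>" for h w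
    using that assms(1) by (simp add: holomorphic_derivI)
  show "deriv f z + E z * f z = pole_sum_11 z * f z + pole_sum_12 z * g z"
    using nz[OF z] by (simp add: g_def field_simps)
  have f': "deriv f holomorphic_on \<Omega>" using assms(1,3) holomorphic_deriv by blast
  have dg: "deriv g z = - deriv pole_sum_12 z / (pole_sum_12 z)\<^sup>2 * (deriv f z + (E z - pole_sum_11 z) * f z)
      + 1 / pole_sum_12 z * (deriv (deriv f) z + (deriv E z - deriv pole_sum_11 z) * f z + (E z - pole_sum_11 z) * deriv f z)"
    unfolding g_def
    by (rule DERIV_imp_deriv)
      (use D[OF assms(2) z] D[OF assms(3) z] D[OF assms(4) z] D[OF assms(5) z] D[OF f' z] nz[OF z] in
      \<open>auto intro!: derivative_eq_intros simp: field_simps power2_eq_square\<close>)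
  have p: "ode_p D z = - (pole_sum_11 z + pole_sum_22 z) - deriv pole_sum_12 z / pole_sum_12 z"
    using K(1)[OF z] nz[OF z] by (simp add: divide_simps ring_distribs)
  have q: "ode_q D z = - deriv pole_sum_11 z + pole_sum_11 z * deriv pole_sum_12 z / pole_sum_12 z - (pole_sum_12 z * A21 z - pole_sum_11 z * pole_sum_22 z)"
    using K(2)[OF z] nz[OF z] by (simp add: divide_simps)
  have f2: "deriv (deriv f) z = - ((2 * E z + ode_p D z) * deriv f z
     + ((E z)\<^sup>2 + deriv E z + ode_p D z * E z + ode_q D z) * f z)"
    using ode unfolding twisted_ode_def by algebra
  show "deriv g z + E z * g z = A21 z * f z + pole_sum_22 z * g z"
    unfolding dg f2 p q unfolding g_def using nz[OF z]
    by (simp add: field_simps power2_eq_square)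
qed

section \<open>The equation as a system, and its dual\<close>

text \<open>The derivative of \<open>z (z - 1) (z - t)\<close>.\<close>

definition Lp :: "complex \<Rightarrow> complex \<Rightarrow> complex" where
  "Lp t p = 3 * p\<^sup>2 - 2 * (1 + t) * p + t"

text \<open>The residue of (z - \<lambda>) / (z (z - 1) (z - t)) at the pole
  \<open>p\<close>.\<close>

definition rr :: "complex \<Rightarrow> complex \<Rightarrow> complex \<Rightarrow> complex" where
  "rr t l p = (p - l) / Lp t p"

text \<open>With L(z) = z (z - 1) (z - t), the bracket is the divided difference (L(l) - L(p)) / (l
  - p), which is L(l) / (l - p) at a zero \<open>p\<close> of L. So the row entry is k1 (l - p) -
  \<mu> L(l) / (l - p), a choice for which the upper left entry of the system has the value \<mu> at
  \<lambda>.\<close>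

definition cc :: "complex \<Rightarrow> complex \<Rightarrow> complex \<Rightarrow> complex \<Rightarrow> complex \<Rightarrow> complex" where
  "cc t k1 l \<mu> p = k1 * (l - p) - \<mu> * (l\<^sup>2 + (p - 1 - t) * l + p\<^sup>2 - (1 + t) * p + t)"

text \<open>
  Chosen such that the upper right entry of the system is \<open>(z - \<lambda>) / (z (z - 1) (z - t))\<close>, the traces of the residues
  are \<open>\<theta>\<^sub>p\<close>, and their sum is lower triangular with diagonal \<open>- \<kappa>\<^sub>1, - \<kappa>\<^sub>2\<close>.
\<close>

definition primal :: "complex \<Rightarrow> (complex \<Rightarrow> complex) \<Rightarrow> complex \<Rightarrow> complex \<Rightarrow> complex \<Rightarrow> rank_one_data" where
  "primal t \<theta> k1 l \<mu> = \<lparr> al = rr t l, be = (\<lambda>p. \<theta> p - rr t l p * cc t k1 l \<mu> p), ga = cc t k1 l \<mu>, ep = (\<lambda>_. 1) \<rparr>"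

lemma Lp_simps: "Lp t 0 = t" "Lp t 1 = 1 - t" "Lp t t = t * (t - 1)"
  by (simp_all add: Lp_def power2_eq_square algebra_simps)

lemma sum_01t: "t \<notin> {0, 1} \<Longrightarrow> (\<Sum>p\<in>{0, 1, t}. f p) = f 0 + f 1 + f (t :: complex)" for f :: "complex \<Rightarrow> complex"
  by (simp add: add.assoc)

lemma cc_simps: "cc t k1 l \<mu> 0 = k1 * l - \<mu> * (l - 1) * (l - t)"
  "cc t k1 l \<mu> 1 = k1 * (l - 1) - \<mu> * l * (l - t)"
  "cc t k1 l \<mu> t = k1 * (l - t) - \<mu> * l * (l - 1)"
  by (simp_all add: cc_def power2_eq_square algebra_simps)

lemma kappa2_eq: "kappa2 t \<theta> \<theta>i = - kappa1 t \<theta> \<theta>i - \<theta> 0 - \<theta> 1 - \<theta> t"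
  by (simp add: kappa1_def kappa2_def field_simps)

locale painleve =
  fixes t l \<mu> \<theta>i :: complex and \<theta> :: "complex \<Rightarrow> complex"
  assumes t: "t \<notin> {0, 1}" and l: "l \<notin> {0, 1, t}"
begin

abbreviation (input) "P \<equiv> {0, 1, t}"
abbreviation (input) "k1 \<equiv> kappa1 t \<theta> \<theta>i"
abbreviation (input) "k2 \<equiv> kappa2 t \<theta> \<theta>i"
abbreviation (input) "pd \<equiv> primal t \<theta> (kappa1 t \<theta> \<theta>i) l \<mu>"
abbreviation (input) "D \<equiv> D_y1 t \<theta> \<theta>i l \<mu>"

lemma pole_sum_12: "w \<notin> P \<Longrightarrow> pole_sum P (al pd) (ep pd) w = (w - l) / (w * (w - 1) * (w - t))"
proof -
  assume "w \<notin> P"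
  then have nz: "w \<noteq> 0" "w - 1 \<noteq> 0" "w - t \<noteq> 0" "t \<noteq> 0" "t - 1 \<noteq> 0" "1 - t \<noteq> 0" using t by auto
  then show ?thesis unfolding pole_sum_def sum_01t[OF t]
    by (simp add: primal_def rr_def Lp_simps divide_simps) algebra
qed

lemma pole_sum_11: "w \<notin> P \<Longrightarrow> pole_sum P (al pd) (ga pd) w = (l * (l - 1) * (l - t) * \<mu> - k1 * (w - l)\<^sup>2) / (w * (w - 1) * (w - t))"
proof -
  assume "w \<notin> P"
  then have nz: "w \<noteq> 0" "w - 1 \<noteq> 0" "w - t \<noteq> 0" "t \<noteq> 0" "t - 1 \<noteq> 0" "1 - t \<noteq> 0" using t by auto
  then show ?thesis unfolding pole_sum_def sum_01t[OF t]
    by (simp add: primal_def rr_def Lp_simps cc_simps divide_simps) algebra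
qed

lemma pole_sum_22: "w \<notin> P \<Longrightarrow> pole_sum P (be pd) (ep pd) w = \<theta> 0 / w + \<theta> 1 / (w - 1) + \<theta> t / (w - t) - pole_sum P (al pd) (ga pd) w"
  using t unfolding pole_sum_def sum_01t[OF t]
  by (simp add: primal_def diff_divide_distrib)

text \<open>Residues of rank one have determinant 0, so only the cross terms of two different poles
  survive and there are no double poles. As \<open>ep\<close> is 1, the minors of the rows are the
  differences of the \<open>cc\<close>; \<open>d1\<close> and \<open>d2\<close> are those against
  the pole 0.\<close>

lemma det:
  assumes "w \<notin> P"
  shows "pole_sum P (al pd) (ep pd) w * pole_sum P (be pd) (ga pd) w - pole_sum P (al pd) (ga pd) w * pole_sum P (be pd) (ep pd) w
     = (- k1 * k2 * (w - l) + l * (l - 1) * (l - t) * \<mu>\<^sup>2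
         - \<mu> * (\<theta> 0 * (l - 1) * (l - t) + \<theta> 1 * l * (l - t) + \<theta> t * l * (l - 1))) / (w * (w - 1) * (w - t))"
proof -
  define r0 r1 rt c0 where "r0 = rr t l 0" "r1 = rr t l 1" "rt = rr t l t" "c0 = cc t k1 l \<mu> 0"
  define d1 d2 where "d1 = - (k1 + \<mu> * (l - t))" "d2 = - t * (k1 + \<mu> * (l - 1))"
  have c: "cc t k1 l \<mu> 1 = c0 + d1" "cc t k1 l \<mu> t = c0 + d2"
    by (simp_all add: r0_r1_rt_c0_def d1_d2_def cc_simps algebra_simps)
  have nz: "w \<noteq> 0" "w - 1 \<noteq> 0" "w - t \<noteq> 0" "t \<noteq> 0" "t - 1 \<noteq> 0" "1 - t \<noteq> 0" using assms t by auto
  have "pole_sum P (al pd) (ep pd) w * pole_sum P (be pd) (ga pd) w - pole_sum P (al pd) (ga pd) w * pole_sum P (be pd) (ep pd) w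
    = (d1 * (r0 * (\<theta> 1 - r1 * (c0 + d1)) - r1 * (\<theta> 0 - r0 * c0)) * (w - t)
      + d2 * (r0 * (\<theta> t - rt * (c0 + d2)) - rt * (\<theta> 0 - r0 * c0)) * (w - 1)
      + (d2 - d1) * (r1 * (\<theta> t - rt * (c0 + d2)) - rt * (\<theta> 1 - r1 * (c0 + d1))) * w) / (w * (w - 1) * (w - t))"
    using nz unfolding pole_sum_def sum_01t[OF t]
    by (simp add: primal_def c flip: r0_r1_rt_c0_def) (simp add: divide_simps, algebra)
  also have "d1 * (r0 * (\<theta> 1 - r1 * (c0 + d1)) - r1 * (\<theta> 0 - r0 * c0)) * (w - t)
      + d2 * (r0 * (\<theta> t - rt * (c0 + d2)) - rt * (\<theta> 0 - r0 * c0)) * (w - 1)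
      + (d2 - d1) * (r1 * (\<theta> t - rt * (c0 + d2)) - rt * (\<theta> 1 - r1 * (c0 + d1))) * w
     = \<theta> 0 * (- d1 * r1 * (w - t) - d2 * rt * (w - 1)) + \<theta> 1 * (d1 * r0 * (w - t) - (d2 - d1) * rt * w)
        + \<theta> t * (d2 * r0 * (w - 1) + (d2 - d1) * r1 * w)
        - (d1\<^sup>2 * r0 * r1 * (w - t) + d2\<^sup>2 * r0 * rt * (w - 1) + (d2 - d1)\<^sup>2 * r1 * rt * w)"
    by (simp add: algebra_simps power2_eq_square)
  also have "- d1 * r1 * (w - t) - d2 * rt * (w - 1) = k1 * (w - l) - \<mu> * (l - 1) * (l - t)"
    using nz by (simp add: r0_r1_rt_c0_def d1_d2_def rr_def Lp_simps divide_simps) algebra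
  also have "d1 * r0 * (w - t) - (d2 - d1) * rt * w = k1 * (w - l) - \<mu> * l * (l - t)"
    using nz by (simp add: r0_r1_rt_c0_def d1_d2_def rr_def Lp_simps divide_simps) algebra
  also have "d2 * r0 * (w - 1) + (d2 - d1) * r1 * w = k1 * (w - l) - \<mu> * l * (l - 1)"
    using nz by (simp add: r0_r1_rt_c0_def d1_d2_def rr_def Lp_simps divide_simps) algebra
  also have "d1\<^sup>2 * r0 * r1 * (w - t) + d2\<^sup>2 * r0 * rt * (w - 1) + (d2 - d1)\<^sup>2 * r1 * rt * w
     = - (k1\<^sup>2 * (w - l) + l * (l - 1) * (l - t) * \<mu>\<^sup>2)"
    using nz by (simp add: r0_r1_rt_c0_def d1_d2_def rr_def Lp_simps divide_simps) algebra
  also have "\<theta> 0 * (k1 * (w - l) - \<mu> * (l - 1) * (l - t)) + \<theta> 1 * (k1 * (w - l) - \<mu> * l * (l - t))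
      + \<theta> t * (k1 * (w - l) - \<mu> * l * (l - 1)) - - (k1\<^sup>2 * (w - l) + l * (l - 1) * (l - t) * \<mu>\<^sup>2)
     = - k1 * k2 * (w - l) + l * (l - 1) * (l - t) * \<mu>\<^sup>2
         - \<mu> * (\<theta> 0 * (l - 1) * (l - t) + \<theta> 1 * l * (l - t) + \<theta> t * l * (l - 1))"
    unfolding kappa2_eq by (simp add: algebra_simps power2_eq_square)
  finally show ?thesis .
qed

end

lemma poly_holomorphic: "poly h holomorphic_on S" for h :: "complex poly"
proof -
  have "poly h holomorphic_on UNIV"
    unfolding holomorphic_on_open[OF open_UNIV] using poly_DERIV by blast
  then show ?thesis by (rule holomorphic_on_subset) simp
qed

lemma D_y1_sel: "ode_sing (D_y1 t \<theta> \<theta>i l \<mu>) = {0, 1, t, l}"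
  "ode_p (D_y1 t \<theta> \<theta>i l \<mu>) = (\<lambda>w. (1 - \<theta> 0) / w + (1 - \<theta> 1) / (w - 1) + (1 - \<theta> t) / (w - t) - 1 / (w - l))"
  by (simp_all add: D_y1_def)

lemma D_y1_q:
  assumes "t \<notin> {0, 1}"
  shows "ode_q (D_y1 t \<theta> \<theta>i l \<mu>) w = kappa1 t \<theta> \<theta>i * (kappa2 t \<theta> \<theta>i + 1) / (w * (w - 1))
                  + l * (l - 1) * \<mu> / (w * (w - 1) * (w - l))
                  - (l * (l - 1) * (l - t) * \<mu>\<^sup>2
        - (\<theta> 0 * (l - 1) * (l - t) + \<theta> 1 * l * (l - t) + (\<theta> t - 1) * l * (l - 1)) * \<mu>
        + kappa1 t \<theta> \<theta>i * (kappa2 t \<theta> \<theta>i + 1) * (l - t)) / (w * (w - 1) * (w - t))"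
  using assms by (simp add: D_y1_def Ham_def)

context painleve
begin

lemma deriv_pole_sum_12:
  assumes "z \<notin> P"
  shows "deriv (pole_sum P (al pd) (ep pd)) z = (1 - (z - l) * (1 / z + 1 / (z - 1) + 1 / (z - t))) / (z * (z - 1) * (z - t))"
proof -
  have nz: "z \<noteq> 0" "z - 1 \<noteq> 0" "z - t \<noteq> 0" using assms by auto
  have "\<forall>\<^sub>F w in nhds z. w \<in> - P"
    using assms by (intro eventually_nhds_in_open) (auto intro: finite_imp_closed)
  then have "deriv (pole_sum P (al pd) (ep pd)) z = deriv (\<lambda>w. (w - l) / (w * (w - 1) * (w - t))) z"
    by (intro deriv_cong_ev) (auto elim!: eventually_mono simp: pole_sum_12)
  also have "\<dots> = (1 - (z - l) * (1 / z + 1 / (z - 1) + 1 / (z - t))) / (z * (z - 1) * (z - t))"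
  proof (rule DERIV_imp_deriv, (rule derivative_eq_intros refl)+, goal_cases)
    case 1 show ?case using nz by simp
  next
    case 2 show ?case using nz by (simp add: divide_simps)
  qed
  finally show ?thesis .
qed

lemma deriv_pole_sum_11:
  assumes "z \<notin> P"
  shows "deriv (pole_sum P (al pd) (ga pd)) z = (- 2 * k1 * (z - l) -
     (l * (l - 1) * (l - t) * \<mu> - k1 * (z - l)\<^sup>2) * (1 / z + 1 / (z - 1) + 1 / (z - t))) / (z * (z - 1) * (z - t))"
proof -
  have nz: "z \<noteq> 0" "z - 1 \<noteq> 0" "z - t \<noteq> 0" using assms by auto
  have "\<forall>\<^sub>F w in nhds z. w \<in> - P"
    using assms by (intro eventually_nhds_in_open) (auto intro: finite_imp_closed)
  then have "deriv (pole_sum P (al pd) (ga pd)) z = deriv (\<lambda>w. (l * (l - 1) * (l - t) * \<mu> - k1 * (w - l)\<^sup>2) / (w * (w - 1) * (w - t))) z"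
    by (intro deriv_cong_ev) (auto elim!: eventually_mono simp: pole_sum_11)
  also have "\<dots> = (- 2 * k1 * (z - l) -
     (l * (l - 1) * (l - t) * \<mu> - k1 * (z - l)\<^sup>2) * (1 / z + 1 / (z - 1) + 1 / (z - t))) / (z * (z - 1) * (z - t))"
  proof (rule DERIV_imp_deriv, (rule derivative_eq_intros refl)+, goal_cases)
    case 1 show ?case using nz by simp
  next
    case 2 show ?case using nz by (simp add: divide_simps)
  qed
  finally show ?thesis .
qed

lemma ode_p_pole_sum:
  assumes "z \<notin> {0, 1, t, l}"
  shows "ode_p D z * pole_sum P (al pd) (ep pd) z = - ((pole_sum P (al pd) (ga pd) z + pole_sum P (be pd) (ep pd) z) * pole_sum P (al pd) (ep pd) z
     + deriv (pole_sum P (al pd) (ep pd)) z)"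
proof -
  have z: "z \<notin> P" and nz: "z \<noteq> 0" "z - 1 \<noteq> 0" "z - t \<noteq> 0" "z - l \<noteq> 0" using assms by auto
  show ?thesis
    unfolding deriv_pole_sum_12[OF z] pole_sum_22[OF z] pole_sum_12[OF z] D_y1_sel using nz by (simp add: divide_simps) algebra
qed

lemma ode_q_pole_sum:
  assumes "z \<notin> {0, 1, t, l}"
  shows "ode_q D z * pole_sum P (al pd) (ep pd) z = - (deriv (pole_sum P (al pd) (ga pd)) z * pole_sum P (al pd) (ep pd) z
     - pole_sum P (al pd) (ga pd) z * deriv (pole_sum P (al pd) (ep pd)) z
     + pole_sum P (al pd) (ep pd) z * (pole_sum P (al pd) (ep pd) z * pole_sum P (be pd) (ga pd) z - pole_sum P (al pd) (ga pd) z * pole_sum P (be pd) (ep pd) z))"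
proof -
  have z: "z \<notin> P" and nz: "z \<noteq> 0" "z - 1 \<noteq> 0" "z - t \<noteq> 0" "z - l \<noteq> 0" using assms by auto
  show ?thesis
    unfolding deriv_pole_sum_12[OF z] deriv_pole_sum_11[OF z] det[OF z] D_y1_q[OF t] unfolding pole_sum_12[OF z] pole_sum_11[OF z]
    using nz by (simp add: divide_simps) algebra
qed

lemma pole_sum_12_nz: "z \<notin> {0, 1, t, l} \<Longrightarrow> pole_sum P (al pd) (ep pd) z \<noteq> 0"
  using pole_sum_12 by auto

lemma primal_system_to_ode: "system_to_ode D P pd (\<lambda>_. 0)"
  unfolding system_to_ode_def D_y1_sel
proof (intro conjI allI impI ballI)
  fix \<Omega> E f g z
  assume \<Omega>: "open \<Omega>" "\<Omega> \<inter> {0, 1, t, l} = {}" and hol: "E holomorphic_on \<Omega>" "f holomorphic_on \<Omega>" "g holomorphic_on \<Omega>"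
    and sys: "\<forall>z\<in>\<Omega>. pole_system P pd E f g z" and z: "z \<in> \<Omega>"
  have S: "w \<notin> {0, 1, t, l}" if "w \<in> \<Omega>" for w using that \<Omega>(2) by blast
  have "twisted_ode D E f z"
    by (rule sys_twisted_ode_pointwise[OF \<Omega>(1) hol pole_sum_holomorphic pole_sum_holomorphic _ _ ode_p_pole_sum[OF S] ode_q_pole_sum[OF S] pole_sum_12_nz[OF S] z])
      (use sys \<Omega>(2) in \<open>auto simp: pole_system_def\<close>)
  then show "twisted_ode D (\<lambda>z. E z + (\<Sum>p\<in>P. 0 / (z - p))) f z" by simp
qed (rule pole_sum_12_nz)

lemma primal_ode_to_system: "ode_to_system D P pd (\<lambda>_. 0)"
  unfolding ode_to_system_def D_y1_sel
proof (intro conjI allI impI ballI)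
  fix \<Omega> E f z
  assume \<Omega>: "open \<Omega>" "\<Omega> \<inter> {0, 1, t, l} = {}" and hol: "E holomorphic_on \<Omega>" "f holomorphic_on \<Omega>"
    and ode: "\<forall>z\<in>\<Omega>. twisted_ode D (\<lambda>z. E z + (\<Sum>p\<in>P. 0 / (z - p))) f z" and z: "z \<in> \<Omega>"
  have S: "w \<notin> {0, 1, t, l}" if "w \<in> \<Omega>" for w using that \<Omega>(2) by blast
  have ode': "twisted_ode D E f z" using ode z by simp
  have h1: "pole_sum P (al pd) (ga pd) holomorphic_on \<Omega>" "pole_sum P (al pd) (ep pd) holomorphic_on \<Omega>"
    using \<Omega>(2) by (intro pole_sum_holomorphic; auto)+
  show "pole_system P pd E f (\<lambda>z. 1 / pole_sum P (al pd) (ep pd) z * (deriv f z + (E z - pole_sum P (al pd) (ga pd) z) * f z)) z"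
    unfolding pole_system_def
    using twisted_ode_sys_pointwise[OF \<Omega>(1) hol h1 ode_p_pole_sum[OF S] ode_q_pole_sum[OF S] pole_sum_12_nz[OF S] z ode'] by blast
qed (rule pole_sum_12_nz)

text \<open>Along a polynomial \<open>h\<close> the second component is a polynomial
  \<open>N\<close> divided by z - \<lambda>, so \<open>N\<close> has to vanish at \<lambda>.
  Multiplying the equation by w - \<lambda> and letting w tend to \<lambda> leaves - (h' + E h) +
  \<mu> h = 0 there, and \<mu> is the value of the upper left entry of the system at
  \<lambda>.\<close>

lemma primal_poly:
  assumes ode: "\<And>z. z \<notin> {0, 1, t, l} \<Longrightarrow> twisted_ode D (\<lambda>z. \<Sum>p\<in>P. e p / (z - p)) (poly h) z"
  shows "\<exists>g. (\<forall>z. z \<notin> {0, 1, t, l} \<longrightarrow> pole_system P pd (\<lambda>z. \<Sum>p\<in>P. e p / (z - p)) (poly h) (poly g) z) \<and>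
    (\<forall>p\<in>P. rr t l p * poly g p = (e p - rr t l p * cc t k1 l \<mu> p) * poly h p)"
proof -
  let ?E = "\<lambda>z. \<Sum>p\<in>P. e p / (z - p)"
  let ?Om = "- {0, 1, t, l}"
  \<comment> \<open>The second component times z - \<lambda>: the denominators of the upper left
    entry and of the twist cancel against that of the upper right entry.\<close>
  define N where "N = [:0, 1:] * [:-1, 1:] * [:-t, 1:] * pderiv h
     + (smult (e 0) ([:-1, 1:] * [:-t, 1:]) + smult (e 1) ([:0, 1:] * [:-t, 1:]) + smult (e t) ([:0, 1:] * [:-1, 1:])) * h
     - ([:l * (l - 1) * (l - t) * \<mu>:] - smult k1 ([:-l, 1:] * [:-l, 1:])) * h"
  have N: "poly N z = z * (z - 1) * (z - t) * (poly (pderiv h) z + (?E z - pole_sum P (al pd) (ga pd) z) * poly h z)"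
    if z: "z \<notin> P" for z
  proof -
    have "z \<noteq> 0" "z - 1 \<noteq> 0" "z - t \<noteq> 0" using z by auto
    then show ?thesis
      unfolding N_def pole_sum_11[OF z] sum_01t[OF t] by (simp add: divide_simps) algebra
  qed
  have dh: "deriv (poly q) = poly (pderiv q)" for q :: "complex poly"
    by (rule ext) (rule DERIV_imp_deriv[OF poly_DERIV])
  have holE: "?E holomorphic_on ?Om" by (intro holomorphic_intros) auto
  have "poly (pderiv h) l + ?E l * poly h l = \<mu> * poly h l"
  proof -
    have oP: "open (- P)" by (intro open_Compl finite_imp_closed) auto
    have holE': "?E holomorphic_on - P" by (intro holomorphic_intros) auto
    have lP: "l \<in> - P" using l by auto
    define p0 where "p0 w = (1 - \<theta> 0) / w + (1 - \<theta> 1) / (w - 1) + (1 - \<theta> t) / (w - t)" for w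
    define q0 where "q0 w = k1 * (k2 + 1) / (w * (w - 1))
                  - (l * (l - 1) * (l - t) * \<mu>\<^sup>2
        - (\<theta> 0 * (l - 1) * (l - t) + \<theta> 1 * l * (l - t) + (\<theta> t - 1) * l * (l - 1)) * \<mu>
        + k1 * (k2 + 1) * (l - t)) / (w * (w - 1) * (w - t))" for w
    define R where "R w = (w - l) * (poly (pderiv (pderiv h)) w + (2 * ?E w + p0 w) * poly (pderiv h) w
       + ((?E w)\<^sup>2 + deriv ?E w + p0 w * ?E w + q0 w) * poly h w)
       - (poly (pderiv h) w + ?E w * poly h w) + l * (l - 1) * \<mu> / (w * (w - 1)) * poly h w" for w
    have "R holomorphic_on - P"
      unfolding R_def p0_def q0_def
      by (intro holomorphic_intros holE' holomorphic_deriv[OF holE' oP]) auto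
    then have "isCont R l"
      using oP lP holomorphic_on_imp_continuous_on continuous_on_eq_continuous_at by blast
    then have lim: "R \<midarrow>l\<rightarrow> R l" by (simp add: isCont_def)
    have "R w = 0" if w: "w \<notin> {0, 1, t, l}" for w
    proof -
      have nz: "w \<noteq> 0" "w - 1 \<noteq> 0" "w - t \<noteq> 0" "w - l \<noteq> 0" using w by auto
      define T1 T2 H0 H1 H2 where "T1 = ?E w" "T2 = deriv ?E w" "H0 = poly h w" "H1 = poly (pderiv h) w" "H2 = poly (pderiv (pderiv h)) w"
      have p: "ode_p D w = p0 w - 1 / (w - l)" by (simp add: D_y1_sel p0_def)
      have q: "ode_q D w = q0 w + l * (l - 1) * \<mu> / (w * (w - 1)) / (w - l)"
        unfolding D_y1_q[OF t] q0_def by simp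
      have "H2 + (2 * T1 + ode_p D w) * H1 + (T1\<^sup>2 + T2 + ode_p D w * T1 + ode_q D w) * H0 = 0"
        using ode[OF w] unfolding twisted_ode_def dh T1_T2_H0_H1_H2_def .
      then have "(w - l) * (H2 + (2 * T1 + ode_p D w) * H1 + (T1\<^sup>2 + T2 + ode_p D w * T1 + ode_q D w) * H0) = 0"
        by simp
      moreover have "(w - l) * ode_p D w = (w - l) * p0 w - 1" unfolding p using nz by (simp add: field_simps)
      moreover have "(w - l) * ode_q D w = (w - l) * q0 w + l * (l - 1) * \<mu> / (w * (w - 1))" unfolding q using nz by (simp add: distrib_left)
      ultimately have "(w - l) * (H2 + (2 * T1 + p0 w) * H1 + (T1\<^sup>2 + T2 + p0 w * T1 + q0 w) * H0)
          - (H1 + T1 * H0) + l * (l - 1) * \<mu> / (w * (w - 1)) * H0 = 0"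
        by algebra
      then show ?thesis unfolding R_def T1_T2_H0_H1_H2_def .
    qed
    moreover have "\<forall>\<^sub>F w in at l. w \<notin> {0, 1, t, l}"
      using eventually_nhds_in_open[OF oP lP] unfolding eventually_at_filter
      by (rule eventually_mono) auto
    ultimately have "\<forall>\<^sub>F w in at l. R w = 0" by (auto elim: eventually_mono)
    then have "R \<midarrow>l\<rightarrow> 0" using tendsto_cong[of R "\<lambda>_. 0"] by auto
    then have "R l = 0" using lim LIM_unique by blast
    then have "- (poly (pderiv h) l + ?E l * poly h l) + \<mu> * poly h l = 0"
      using l unfolding R_def by simp
    then show ?thesis by algebra
  qed
  moreover have "pole_sum P (al pd) (ga pd) l = \<mu>" using pole_sum_11[of l] l by simp
  ultimately have "poly (pderiv h) l + (?E l - pole_sum P (al pd) (ga pd) l) * poly h l = 0"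
    by algebra
  then have "poly N l = 0" using N[of l] l by simp
  then obtain g where g: "N = [:-l, 1:] * g" by (auto simp: poly_eq_0_iff_dvd elim: dvdE)
  have gz: "poly g z = 1 / pole_sum P (al pd) (ep pd) z * (deriv (poly h) z + (?E z - pole_sum P (al pd) (ga pd) z) * poly h z)"
    if z: "z \<notin> {0, 1, t, l}" for z
  proof -
    have nz: "z \<noteq> 0" "z - 1 \<noteq> 0" "z - t \<noteq> 0" "z - l \<noteq> 0" using z by auto
    have "(z - l) * poly g z = z * (z - 1) * (z - t) * (poly (pderiv h) z + (?E z - pole_sum P (al pd) (ga pd) z) * poly h z)"
    proof -
      have "poly N z = (z - l) * poly g z" unfolding g by (simp add: algebra_simps)
      then show ?thesis using N[of z] z by simp
    qed
    then show ?thesis using pole_sum_12[of z] nz z unfolding dh by (simp add: field_simps)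
  qed
  show ?thesis
  proof (intro exI[of _ g] conjI allI impI ballI)
    fix z assume z: "z \<notin> {0, 1, t, l}"
    let ?g = "\<lambda>z. 1 / pole_sum P (al pd) (ep pd) z * (deriv (poly h) z + (?E z - pole_sum P (al pd) (ga pd) z) * poly h z)"
    have oO: "open ?Om" by (intro open_Compl finite_imp_closed) auto
    have "pole_system P pd ?E (poly h) ?g z"
    proof (rule primal_ode_to_system[unfolded ode_to_system_def D_y1_sel, THEN conjunct2, rule_format, OF oO _ holE])
      show "poly h holomorphic_on ?Om" by (rule poly_holomorphic)
      show "twisted_ode D (\<lambda>z. ?E z + (\<Sum>p\<in>P. 0 / (z - p))) (poly h) w" if "w \<in> ?Om" for w using ode[of w] that by simp
    qed (use z in auto)
    moreover have ev: "\<forall>\<^sub>F w in nhds z. poly g w = ?g w"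
    proof (rule eventually_mono)
      show "\<forall>\<^sub>F w in nhds z. w \<in> ?Om" using z by (intro eventually_nhds_in_open oO) auto
    qed (rule gz, simp)
    then have "deriv (poly g) z = deriv ?g z" by (intro deriv_cong_ev) auto
    ultimately show "pole_system P pd ?E (poly h) (poly g) z"
      unfolding pole_system_def using gz[OF z] by simp
  next
    fix p assume p: "p \<in> P"
    have Ln: "Lp t p \<noteq> 0" using p t by (auto simp: Lp_simps)
    have pl: "p - l \<noteq> 0" using p l by auto
    have "poly N p = (Lp t p * e p - (p - l) * cc t k1 l \<mu> p) * poly h p"
      using p unfolding N_def by (elim insertE) (auto simp: Lp_simps cc_simps algebra_simps)
    then have "(p - l) * poly g p = (Lp t p * e p - (p - l) * cc t k1 l \<mu> p) * poly h p" unfolding g by (simp add: algebra_simps)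
    then show "rr t l p * poly g p = (e p - rr t l p * cc t k1 l \<mu> p) * poly h p"
      using Ln unfolding rr_def by (simp add: divide_simps)
  qed
qed

end

text \<open>The adjoint system with its two components exchanged. In size two this equals diag(1,
  -1) (A - tr A) diag(1, -1), so its first component is one of the original system times a scalar
  factor with logarithmic derivative - tr A.\<close>

definition dual :: "rank_one_data \<Rightarrow> rank_one_data" where
  "dual d = \<lparr> al = ep d, be = ga d, ga = (\<lambda>p. - be d p), ep = (\<lambda>p. - al d p) \<rparr>"

lemma pole_sum_minus: "pole_sum P x (\<lambda>p. - y p) z = - pole_sum P x y z"
  by (simp add: pole_sum_def sum_negf)

lemma pole_sum_commute: "pole_sum P x y z = pole_sum P y x z"
  by (simp add: pole_sum_def mult.commute)

lemma trace_pole_sum: "(\<Sum>p\<in>P. vmat d p p / (z - p)) = pole_sum P (al d) (ga d) z + pole_sum P (be d) (ep d) z"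
  by (simp add: pole_sum_def vmat_def add_divide_distrib sum.distrib mult.commute)

lemma vmat_dual: "vmat (dual d) p q = - vmat d q p"
  by (simp add: vmat_def dual_def algebra_simps)

lemma dual_pole_system:
  assumes "deriv (\<lambda>z. - g z) z = - deriv g z"
  shows "pole_system P (dual d) E f g z \<longleftrightarrow> pole_system P d (\<lambda>z. E z + (\<Sum>p\<in>P. vmat d p p / (z - p))) f (\<lambda>z. - g z) z"
  unfolding pole_system_def trace_pole_sum assms
  by (auto simp: dual_def pole_sum_minus pole_sum_commute[of P "ep d"] pole_sum_commute[of P "ga d"] ring_distribs; algebra)

lemma deriv_minus_holomorphic:
  assumes "open \<Omega>" "g holomorphic_on \<Omega>" "z \<in> \<Omega>"
  shows "deriv (\<lambda>z. - g z) z = - deriv g z"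
  using assms holomorphic_on_imp_differentiable_at deriv_minus by blast

lemma dual_system_to_ode:
  assumes "system_to_ode D P d (\<lambda>_. 0)" "finite P" "P \<subseteq> ode_sing D"
  shows "system_to_ode D P (dual d) (\<lambda>p. vmat d p p)"
  unfolding system_to_ode_def
proof (intro conjI allI impI ballI)
  fix z assume "z \<notin> ode_sing D"
  then show "pole_sum P (al (dual d)) (ep (dual d)) z \<noteq> 0"
    using assms(1) by (simp add: system_to_ode_def dual_def pole_sum_minus pole_sum_commute[of P "ep d"])
next
  fix \<Omega> E f g z
  assume \<Omega>: "open \<Omega>" "\<Omega> \<inter> ode_sing D = {}" and hol: "E holomorphic_on \<Omega>" "f holomorphic_on \<Omega>" "g holomorphic_on \<Omega>"
    and sys: "\<forall>z\<in>\<Omega>. pole_system P (dual d) E f g z" and z: "z \<in> \<Omega>"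
  let ?E = "\<lambda>z. E z + (\<Sum>p\<in>P. vmat d p p / (z - p))"
  have h: "?E holomorphic_on \<Omega>" "(\<lambda>z. - g z) holomorphic_on \<Omega>"
    using assms(3) \<Omega>(2) by (intro holomorphic_intros hol; auto)+
  have "\<forall>z\<in>\<Omega>. pole_system P d ?E f (\<lambda>z. - g z) z"
    using sys dual_pole_system deriv_minus_holomorphic[OF \<Omega>(1) hol(3)] by blast
  then show "twisted_ode D ?E f z"
    using assms(1)[unfolded system_to_ode_def, THEN conjunct2, rule_format, OF \<Omega> h(1) hol(2) h(2) _ z] by simp
qed

lemma dual_ode_to_system:
  assumes "ode_to_system D P d (\<lambda>_. 0)" "finite P" "P \<subseteq> ode_sing D"
  shows "ode_to_system D P (dual d) (\<lambda>p. vmat d p p)"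
  unfolding ode_to_system_def
proof (intro conjI allI impI ballI)
  fix z assume "z \<notin> ode_sing D"
  then show "pole_sum P (al (dual d)) (ep (dual d)) z \<noteq> 0"
    using assms(1) by (simp add: ode_to_system_def dual_def pole_sum_minus pole_sum_commute[of P "ep d"])
next
  fix \<Omega> E f z
  assume \<Omega>: "open \<Omega>" "\<Omega> \<inter> ode_sing D = {}" and hol: "E holomorphic_on \<Omega>" "f holomorphic_on \<Omega>"
    and ode: "\<forall>z\<in>\<Omega>. twisted_ode D (\<lambda>z. E z + (\<Sum>p\<in>P. vmat d p p / (z - p))) f z" and z: "z \<in> \<Omega>"
  let ?E = "\<lambda>z. E z + (\<Sum>p\<in>P. vmat d p p / (z - p))"
  let ?g = "\<lambda>z. 1 / pole_sum P (al (dual d)) (ep (dual d)) z * (deriv f z + (E z - pole_sum P (al (dual d)) (ga (dual d)) z) * f z)"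
  have hE: "?E holomorphic_on \<Omega>"
    using assms(3) \<Omega>(2) by (intro holomorphic_intros hol; auto)
  have nz: "pole_sum P (al d) (ep d) z \<noteq> 0" if "z \<in> \<Omega>" for z
    using assms(1) that \<Omega>(2) unfolding ode_to_system_def by blast
  have eq: "- ?g w = 1 / pole_sum P (al d) (ep d) w * (deriv f w + (?E w - pole_sum P (al d) (ga d) w) * f w)" for w
    unfolding trace_pole_sum by (simp add: dual_def pole_sum_minus pole_sum_commute[of P "ep d"])
  have "pole_system P d ?E f (\<lambda>w. - ?g w) z"
    unfolding eq
    by (rule assms(1)[unfolded ode_to_system_def, THEN conjunct2, rule_format, OF \<Omega> hE hol(2) _ z]) (use ode in simp)
  moreover have "?g holomorphic_on \<Omega>"
    using assms(2,3) \<Omega> nz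
    by (intro holomorphic_intros hol holomorphic_deriv[OF hol(2)] pole_sum_holomorphic)
      (auto simp: dual_def pole_sum_minus pole_sum_commute[of P "ep d"])
  ultimately show "pole_system P (dual d) E f ?g z"
    by (intro dual_pole_system[THEN iffD2] deriv_minus_holomorphic[OF \<Omega>(1) _ z])
qed

lemma poly_eq_off_finite:
  fixes p q :: "complex poly"
  assumes "finite S" "\<And>z. z \<notin> S \<Longrightarrow> poly p z = poly q z"
  shows "poly p z = poly q z"
proof -
  have "infinite (- S)" using assms(1) infinite_UNIV_char_0 finite_compl by blast
  moreover have "- S \<subseteq> {z. poly (p - q) z = 0}" using assms(2) by auto
  ultimately have "p - q = 0" using poly_roots_finite finite_subset by blast
  then show ?thesis by simp
qed

text \<open>For p \<noteq> a the row at \<open>p\<close> applied to (h, g) vanishes at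
  \<open>p\<close>, so z - p can be divided out and every \<open>U\<close> is the coefficient
  sequence of a polynomial. This is why the \<open>U\<close> are eventually zero.\<close>

lemma poly_pole_system_frobenius:
  assumes sys: "\<And>z. z \<notin> S \<Longrightarrow> pole_system P d (\<lambda>z. e0 / (z - a)) (poly h) (poly g) z"
    and S: "finite S" "P \<subseteq> S"
    and v: "\<And>p. p \<in> P \<Longrightarrow> p \<noteq> a \<Longrightarrow> ga d p * poly h p + ep d p * poly g p = 0"
  shows "\<exists>U. frobenius P d a e0 (coeff (h \<circ>\<^sub>p [:a, 1:])) (coeff (g \<circ>\<^sub>p [:a, 1:])) U \<and>
    ((\<forall>p\<in>P. ga d p * poly h p + ep d p * poly g p = 0) \<longrightarrow> (\<forall>p\<in>P. U 0 p = 0)) \<and>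
    (\<exists>N. \<forall>i>N. \<forall>p\<in>P. U i p = 0)"
proof -
  define w where "w p = smult (ga d p) h + smult (ep d p) g" for p
  have "\<exists>u. \<forall>z. (z - p) * poly u z = (z - a) * poly (w p) z" if p: "p \<in> P" for p
  proof (cases "p = a")
    case True then show ?thesis by blast
  next
    case False
    then have "poly (w p) p = 0" using v[OF p] by (simp add: w_def)
    then obtain q where q: "w p = [:-p, 1:] * q" by (auto simp: poly_eq_0_iff_dvd elim: dvdE)
    have "(z - p) * poly ([:-a, 1:] * q) z = (z - a) * poly (w p) z" for z
      unfolding q by (simp add: algebra_simps)
    then show ?thesis by blast
  qed
  then obtain u where u: "\<And>p z. p \<in> P \<Longrightarrow> (z - p) * poly (u p) z = (z - a) * poly (w p) z" by metis
  have finP: "finite P" using S finite_subset by blast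
  have dh: "deriv (poly q) = poly (pderiv q)" for q :: "complex poly"
    by (rule ext) (rule DERIV_imp_deriv[OF poly_DERIV])
  have *: "(z - a) * poly (pderiv q) z + e0 * poly q z = dot P x (\<lambda>p. poly (u p) z)"
    if q: "\<And>z. z \<notin> S \<Longrightarrow> deriv (poly q) z + e0 / (z - a) * poly q z = pole_sum P x (ga d) z * poly h z + pole_sum P x (ep d) z * poly g z"
    for q x z
  proof -
    have "poly ([:-a, 1:] * pderiv q + smult e0 q) z = poly (\<Sum>p\<in>P. smult (x p) (u p)) z"
    proof (rule poly_eq_off_finite[of "insert a S"])
      fix z assume z: "z \<notin> insert a S"
      have "dot P x (\<lambda>p. poly (u p) z) = (z - a) * (pole_sum P x (ga d) z * poly h z + pole_sum P x (ep d) z * poly g z)"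
        by (rule dot_pole_sum) (use z S u in \<open>auto simp: w_def\<close>)
      also have "\<dots> = (z - a) * (poly (pderiv q) z + e0 / (z - a) * poly q z)" using q[of z] z by (simp add: dh)
      also have "\<dots> = (z - a) * poly (pderiv q) z + e0 * poly q z" using z by (simp add: distrib_left)
      finally show "poly ([:-a, 1:] * pderiv q + smult e0 q) z = poly (\<Sum>p\<in>P. smult (x p) (u p)) z"
        by (simp add: dot_def poly_sum algebra_simps)
    qed (use S in auto)
    then show ?thesis by (simp add: dot_def poly_sum algebra_simps)
  qed
  show ?thesis
  proof (rule exI[of _ "\<lambda>i p. coeff (u p \<circ>\<^sub>p [:a, 1:]) i"], intro conjI impI ballI)
    show "frobenius P d a e0 (coeff (h \<circ>\<^sub>p [:a, 1:])) (coeff (g \<circ>\<^sub>p [:a, 1:])) (\<lambda>i p. coeff (u p \<circ>\<^sub>p [:a, 1:]) i)"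
      by (rule frobenius_of_poly) (use sys u in \<open>auto simp: pole_system_def w_def intro!: *\<close>)
    have "coeff (u p \<circ>\<^sub>p [:a, 1:]) i = 0" if i: "i > (\<Sum>p\<in>P. degree (u p \<circ>\<^sub>p [:a, 1:]))" and p: "p \<in> P" for i p
    proof -
      have "degree (u p \<circ>\<^sub>p [:a, 1:]) \<le> (\<Sum>p\<in>P. degree (u p \<circ>\<^sub>p [:a, 1:]))"
        using finP p by (intro member_le_sum) auto
      then show ?thesis using i by (intro coeff_eq_0) simp
    qed
    then show "\<exists>N. \<forall>i>N. \<forall>p\<in>P. coeff (u p \<circ>\<^sub>p [:a, 1:]) i = 0" by blast
  next
    fix p assume z: "\<forall>p\<in>P. ga d p * poly h p + ep d p * poly g p = 0" and p: "p \<in> P"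
    have "poly (u p) a = 0"
    proof (cases "p = a")
      case False then show ?thesis using u[OF p, of a] by simp
    next
      case True
      have "poly (u p) z = poly (w p) z" for z
        by (rule poly_eq_off_finite[of "{a}"]) (use u[OF p] True in auto)
      then show ?thesis using z p True by (simp add: w_def)
    qed
    moreover have "coeff (u p \<circ>\<^sub>p [:a, 1:]) 0 = poly (u p \<circ>\<^sub>p [:a, 1:]) 0" by (simp add: poly_0_coeff_0)
    ultimately show "coeff (u p \<circ>\<^sub>p [:a, 1:]) 0 = 0" by (simp add: poly_pcompose)
  qed
qed

context painleve
begin

lemma vmat_primal: "vmat pd p p = \<theta> p"
  by (simp add: vmat_def primal_def)

lemma rr_nz: "p \<in> P \<Longrightarrow> rr t l p \<noteq> 0"
  using t l by (auto simp: rr_def Lp_simps)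

lemma sum_e0:
  assumes "e0 = 0 \<or> a \<in> P"
  shows "(\<Sum>p\<in>P. (f p + (if p = a then e0 else 0)) / (z - p)) = e0 / (z - a) + (\<Sum>p\<in>P. f p / (z - p))"
proof -
  have "(\<Sum>p\<in>P. (f p + (if p = a then e0 else 0)) / (z - p)) = (\<Sum>p\<in>P. f p / (z - p)) + (\<Sum>p\<in>P. if p = a then e0 / (z - a) else 0)"
    unfolding sum.distrib[symmetric] by (intro sum.cong) (auto simp: add_divide_distrib)
  also have "(\<Sum>p\<in>P. if p = a then e0 / (z - a) else 0) = e0 / (z - a)"
    using assms by (subst sum.delta) auto
  finally show ?thesis by simp
qed

text \<open>By \<open>primal_poly\<close> the row at \<open>p\<close> applied to (h, g) is
  proportional at \<open>p\<close> to the exponent of the twist there, so it vanishes at every pole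
  without a twist.\<close>

lemma primal_poly_frobenius:
  assumes e0: "e0 = 0 \<or> a \<in> P \<and> e0 = \<theta> a"
    and ode: "\<forall>z. z \<notin> {0, 1, t, l} \<longrightarrow> twisted_ode D (\<lambda>z. e0 / (z - a)) (poly h) z"
  shows "\<exists>g U. frobenius P pd a e0 (coeff (h \<circ>\<^sub>p [:a, 1:])) (coeff (g \<circ>\<^sub>p [:a, 1:])) U \<and>
    (e0 = 0 \<longrightarrow> (\<forall>p\<in>P. U 0 p = 0)) \<and> (\<exists>N. \<forall>i>N. \<forall>p\<in>P. U i p = 0)"
proof -
  define e where "e = (\<lambda>p. 0 + (if p = a then e0 else 0))"
  have E: "(\<lambda>z. \<Sum>p\<in>P. e p / (z - p)) = (\<lambda>z. e0 / (z - a))"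
    unfolding e_def using e0 by (subst sum_e0) auto
  obtain g where g: "\<And>z. z \<notin> {0, 1, t, l} \<Longrightarrow> pole_system P pd (\<lambda>z. e0 / (z - a)) (poly h) (poly g) z"
    "\<And>p. p \<in> P \<Longrightarrow> rr t l p * poly g p = (e p - rr t l p * cc t k1 l \<mu> p) * poly h p"
    using primal_poly[of e h] ode unfolding E by blast
  have v: "ga pd p * poly h p + ep pd p * poly g p = 0" if "p \<in> P" "p \<noteq> a \<or> e0 = 0" for p
  proof -
    have "rr t l p * (ga pd p * poly h p + ep pd p * poly g p) = e p * poly h p"
      using g(2)[OF that(1)] by (simp add: primal_def algebra_simps)
    moreover have "e p = 0" using that(2) by (auto simp: e_def)
    ultimately show ?thesis using rr_nz[OF that(1)] by simp
  qed
  have f: "finite {0, 1, t, l}" "P \<subseteq> {0, 1, t, l}" by auto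
  from poly_pole_system_frobenius[OF g(1) f] v show ?thesis by blast
qed

text \<open>In the dual system the row at \<open>p\<close> gives (e_p - \<theta> p) h(p), where e_p
  is the total exponent of the twist; this vanishes where the twist is exactly \<theta> p.\<close>

lemma dual_poly_frobenius:
  assumes e0: "e0 = 0 \<or> a \<in> P \<and> e0 = - \<theta> a"
    and ode: "\<forall>z. z \<notin> {0, 1, t, l} \<longrightarrow> twisted_ode D (\<lambda>z. e0 / (z - a) + (\<Sum>p\<in>P. \<theta> p / (z - p))) (poly h) z"
  shows "\<exists>g U. frobenius P (dual pd) a e0 (coeff (h \<circ>\<^sub>p [:a, 1:])) (coeff (g \<circ>\<^sub>p [:a, 1:])) U \<and>
    (e0 = 0 \<longrightarrow> (\<forall>p\<in>P. U 0 p = 0)) \<and> (\<exists>N. \<forall>i>N. \<forall>p\<in>P. U i p = 0)"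
proof -
  define e where "e = (\<lambda>p. \<theta> p + (if p = a then e0 else 0))"
  have E: "(\<lambda>z. \<Sum>p\<in>P. e p / (z - p)) = (\<lambda>z. e0 / (z - a) + (\<Sum>p\<in>P. \<theta> p / (z - p)))"
    unfolding e_def using e0 by (subst sum_e0) auto
  obtain g where g: "\<And>z. z \<notin> {0, 1, t, l} \<Longrightarrow> pole_system P pd (\<lambda>z. e0 / (z - a) + (\<Sum>p\<in>P. \<theta> p / (z - p))) (poly h) (poly g) z"
    "\<And>p. p \<in> P \<Longrightarrow> rr t l p * poly g p = (e p - rr t l p * cc t k1 l \<mu> p) * poly h p"
    using primal_poly[of e h] ode unfolding E by blast
  have dm: "deriv (\<lambda>z. - poly (- g) z) z = - deriv (poly (- g)) z" for z
    by (rule deriv_minus_holomorphic[OF open_UNIV poly_holomorphic]) simp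
  have sys: "pole_system P (dual pd) (\<lambda>z. e0 / (z - a)) (poly h) (poly (- g)) z" if "z \<notin> {0, 1, t, l}" for z
    unfolding dual_pole_system[OF dm] vmat_primal using g(1)[OF that] by simp
  have v: "ga (dual pd) p * poly h p + ep (dual pd) p * poly (- g) p = 0" if "p \<in> P" "p \<noteq> a \<or> e0 = 0" for p
  proof -
    have "ga (dual pd) p * poly h p + ep (dual pd) p * poly (- g) p = (e p - \<theta> p) * poly h p"
      using g(2)[OF that(1)] by (simp add: primal_def dual_def algebra_simps)
    moreover have "e p = \<theta> p" using that(2) by (auto simp: e_def)
    ultimately show ?thesis by simp
  qed
  have f: "finite {0, 1, t, l}" "P \<subseteq> {0, 1, t, l}" by auto
  from poly_pole_system_frobenius[OF sys f] v show ?thesis by blast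
qed

end

section \<open>The transformed system\<close>

text \<open>Here p, q, s are the three poles, and l and m the old and the new \<lambda>. Once \<mu>,
  \<mu>' and k1 are eliminated, \<theta>q and \<theta>s drop out of both sides (facts
  \<open>1\<close> and \<open>2\<close>), and what remains is an elementary identity in k2 and
  \<theta>p.\<close>

lemma offdiag_transform:
  fixes p q s l m \<delta> \<mu> k1 k2 \<theta>p \<theta>q \<theta>s :: complex
  assumes d: "p - q \<noteq> 0" "q - s \<noteq> 0" "l - p \<noteq> 0" "l - q \<noteq> 0" "l - s \<noteq> 0" "m - p \<noteq> 0" "m - q \<noteq> 0" "m - s \<noteq> 0"
    and \<delta>: "l - m = \<delta>" "\<delta> \<noteq> 0"
    and \<mu>: "\<mu> = k2 / \<delta> + \<theta>p / (l - p) + \<theta>q / (l - q) + \<theta>s / (l - s)"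
    and \<mu>': "\<mu>' = (k2 + \<theta>p) / (m - p) + (k2 + \<theta>q) / (m - q) + (k2 + \<theta>s) / (m - s) + k2 / \<delta>"
    and k1: "k1 = - k2 - \<theta>p - \<theta>q - \<theta>s"
  shows "\<theta>q + (k1 + \<mu> * (l - s)) * (q - l) / (q - s) =
     (p - m) / (p - l) * ((q - l) / (q - m)) * (k2 + \<theta>q + (k1 - k2 + \<mu>' * (m - s)) * (q - m) / (q - s))"
proof -
  define A B C where "A = l - p" "B = l - q" "C = l - s"
  have nz: "A \<noteq> 0" "B \<noteq> 0" "C \<noteq> 0" "A - \<delta> \<noteq> 0" "B - \<delta> \<noteq> 0" "C - \<delta> \<noteq> 0" "C - B \<noteq> 0"
    using d \<delta> by (auto simp: A_B_C_def)
  have e: "p - l = - A" "q - l = - B" "l - p = A" "l - q = B" "l - s = C" "m - p = A - \<delta>" "m - q = B - \<delta>" "m - s = C - \<delta>"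
    "p - m = - (A - \<delta>)" "q - m = - (B - \<delta>)" "q - s = C - B"
    using \<delta> by (auto simp: A_B_C_def)
  have 1: "\<theta>q + (k1 + \<mu> * C) * (- B) / (C - B) = - (B / (C - B)) * (k2 * (C - \<delta>) / \<delta> + \<theta>p * (C - A) / A)"
    unfolding \<mu> k1 e using nz \<delta>(2) by (simp add: divide_simps) algebra
  have 2: "k2 + \<theta>q + (k1 - k2 + \<mu>' * (C - \<delta>)) * (- (B - \<delta>)) / (C - B)
     = - ((B - \<delta>) / (C - B)) * (k2 * C / \<delta> + (\<theta>p + k2) * (C - A) / (A - \<delta>))"
    unfolding \<mu>' k1 e using nz \<delta>(2) by (simp add: divide_simps) algebra
  show ?thesis unfolding e 1 2 using nz \<delta>(2) by (simp add: divide_simps) algebra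
qed

context painleve
begin

lemma dot_pd: "dot P (al pd) (ep pd) = 0" "dot P (al pd) (ga pd) = - k1" "dot P (be pd) (ep pd) = - k2"
proof -
  have nz: "t \<noteq> 0" "t - 1 \<noteq> 0" "1 - t \<noteq> 0" using t by auto
  show "dot P (al pd) (ep pd) = 0" unfolding dot_def sum_01t[OF t]
    using nz by (simp add: primal_def rr_def Lp_simps divide_simps) algebra
  show 2: "dot P (al pd) (ga pd) = - k1" unfolding dot_def sum_01t[OF t]
    using nz by (simp add: primal_def rr_def Lp_simps cc_simps divide_simps) algebra
  have "dot P (be pd) (ep pd) = \<theta> 0 + \<theta> 1 + \<theta> t - dot P (al pd) (ga pd)"
    unfolding dot_def sum_01t[OF t] by (simp add: primal_def)
  then show "dot P (be pd) (ep pd) = - k2" unfolding 2 kappa2_eq by simp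
qed

end

locale painleve_pair = painleve +
  assumes den: "lambda_tilde_denom t \<theta> l \<mu> \<noteq> 0"
    and lt: "lambda_tilde t \<theta> \<theta>i l \<mu> \<notin> {0, 1, t}"
    and k2_nz: "kappa2 t \<theta> \<theta>i \<noteq> 0"
begin

abbreviation (input) "lt \<equiv> lambda_tilde t \<theta> \<theta>i l \<mu>"
abbreviation (input) "mt \<equiv> mu_tilde t \<theta> \<theta>i l \<mu>"
abbreviation (input) "th \<equiv> theta_tilde t \<theta> \<theta>i"
abbreviation (input) "thi \<equiv> theta_tilde_inf t \<theta> \<theta>i"
abbreviation (input) "D' \<equiv> D_y1_tilde t \<theta> \<theta>i l \<mu>"

sublocale tl: painleve t lt mt thi th
  by unfold_locales (use t lt in auto)

lemma kappa_tilde: "kappa1 t th thi = k1 - k2" "kappa2 t th thi = - k2"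
  by (simp_all add: kappa1_def kappa2_def theta_tilde_def theta_tilde_inf_def field_simps)

definition sf :: "complex \<Rightarrow> complex" where "sf p = (p - lt) / (p - l)"

definition ct :: "complex \<Rightarrow> complex" where "ct = cc t (k1 - k2) lt mt"

text \<open>
  The data of the transformed equation, except that the row at \<open>p\<close> is multiplied and the column divided by \<open>sf p\<close>.
  This changes no residue, but makes \<open>V\<close> differ from that of \<open>D\<close> by the scalar \<open>\<kappa>\<^sub>2\<close> only.
\<close>

definition td :: rank_one_data where
  "td = \<lparr> al = rr t l, be = (\<lambda>p. (th p - rr t lt p * ct p) / sf p), ga = (\<lambda>p. sf p * ct p), ep = sf \<rparr>"

lemma sf_nz: "p \<in> P \<Longrightarrow> sf p \<noteq> 0"
  using l lt by (auto simp: sf_def)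

lemma rr_sf: "p \<in> P \<Longrightarrow> rr t l p * sf p = rr t lt p"
  using l by (auto simp: rr_def sf_def)

lemma pole_sum_td:
  "pole_sum P (al td) (ga td) = pole_sum P (al (primal t th (kappa1 t th thi) lt mt)) (ga (primal t th (kappa1 t th thi) lt mt))"
  "pole_sum P (al td) (ep td) = pole_sum P (al (primal t th (kappa1 t th thi) lt mt)) (ep (primal t th (kappa1 t th thi) lt mt))"
  "pole_sum P (be td) (ga td) = pole_sum P (be (primal t th (kappa1 t th thi) lt mt)) (ga (primal t th (kappa1 t th thi) lt mt))"
  "pole_sum P (be td) (ep td) = pole_sum P (be (primal t th (kappa1 t th thi) lt mt)) (ep (primal t th (kappa1 t th thi) lt mt))"
  unfolding pole_sum_def kappa_tilde td_def primal_def ct_def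
  using sf_nz rr_sf by (auto simp del: sum.insert intro!: ext sum.cong simp: mult.assoc[symmetric])

lemma td_system_to_ode: "system_to_ode D' P td (\<lambda>_. 0)"
  using tl.primal_system_to_ode unfolding system_to_ode_def pole_system_def pole_sum_td D_y1_tilde_def .

lemma mu_eq: "\<mu> = k2 / (l - lt) + \<theta> 0 / l + \<theta> 1 / (l - 1) + \<theta> t / (l - t)" "l - lt \<noteq> 0"
proof -
  have e: "l - lt = k2 / lambda_tilde_denom t \<theta> l \<mu>" by (simp add: lambda_tilde_def)
  then show "l - lt \<noteq> 0" using k2_nz den by simp
  then have "lambda_tilde_denom t \<theta> l \<mu> = k2 / (l - lt)"
    unfolding e using k2_nz den by simp
  then show "\<mu> = k2 / (l - lt) + \<theta> 0 / l + \<theta> 1 / (l - 1) + \<theta> t / (l - t)"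
    by (simp add: lambda_tilde_denom_def algebra_simps)
qed

lemma mt_eq: "mt = (k2 + \<theta> 0) / lt + (k2 + \<theta> 1) / (lt - 1) + (k2 + \<theta> t) / (lt - t) + k2 / (l - lt)"
  by (simp add: mu_tilde_def Let_def)

text \<open>This is where the formulas for the new \<lambda> and \<mu> enter. The diagonal entries
  are the \<theta> p and their shifts. Off the diagonal the third pole \<open>s\<close> is named
  along with the pair, which gives \<open>rq\<close> and \<open>cd\<close> one form for all six
  ordered pairs.\<close>

lemma vmat_td:
  assumes "p \<in> P" "q \<in> P"
  shows "vmat td p q = vmat pd p q + (if p = q then k2 else 0)"
proof -
  have V1: "vmat pd p q = \<theta> q + (cc t k1 l \<mu> p - cc t k1 l \<mu> q) * rr t l q"
    by (simp add: vmat_def primal_def algebra_simps)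
  have "vmat td p q = sf p * ct p * rr t l q + sf p * ((th q - rr t lt q * ct q) / sf q)"
    by (simp add: vmat_def td_def)
  also have "rr t l q = rr t lt q / sf q" using rr_sf[OF assms(2)] sf_nz[OF assms(2)] by (simp add: field_simps)
  also have "sf p * ct p * (rr t lt q / sf q) + sf p * ((th q - rr t lt q * ct q) / sf q)
     = sf p / sf q * (k2 + \<theta> q + (ct p - ct q) * rr t lt q)"
    using sf_nz[OF assms(2)] by (simp add: theta_tilde_def field_simps)
  finally have V2: "vmat td p q = sf p / sf q * (k2 + \<theta> q + (ct p - ct q) * rr t lt q)" .
  have off: "vmat td p q = vmat pd p q" if s: "(p, q, s) \<in> {(0,1,t), (0,t,1), (1,0,t), (1,t,0), (t,0,1), (t,1,0)}" for s
  proof -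
    have nz: "t \<noteq> 0" "t \<noteq> 1" "l \<noteq> 0" "l \<noteq> 1" "l \<noteq> t" "lt \<noteq> 0" "lt \<noteq> 1" "lt \<noteq> t" using t l lt by auto
    have ne: "p - q \<noteq> 0" "q - s \<noteq> 0" "q - p \<noteq> 0" "l - p \<noteq> 0" "l - q \<noteq> 0" "l - s \<noteq> 0" "lt - p \<noteq> 0" "lt - q \<noteq> 0" "lt - s \<noteq> 0"
      using s nz by auto
    have rq: "rr t x q = (q - x) / ((q - p) * (q - s))" for x
      using s by (auto simp: rr_def Lp_simps)
    have cd: "cc t k x m p - cc t k x m q = (q - p) * (k + m * (x - s))" for k x m
      using s by (auto simp: cc_simps algebra_simps)
    have "\<theta> p / (l - p) + \<theta> q / (l - q) + \<theta> s / (l - s) = \<theta> 0 / l + \<theta> 1 / (l - 1) + \<theta> t / (l - t)"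
      using s by (auto simp: add_ac)
    then have m: "\<mu> = k2 / (l - lt) + \<theta> p / (l - p) + \<theta> q / (l - q) + \<theta> s / (l - s)"
      using mu_eq(1) by (simp only: add.assoc)
    have "(k2 + \<theta> p) / (lt - p) + (k2 + \<theta> q) / (lt - q) + (k2 + \<theta> s) / (lt - s)
       = (k2 + \<theta> 0) / lt + (k2 + \<theta> 1) / (lt - 1) + (k2 + \<theta> t) / (lt - t)"
      using s by (auto simp: add_ac)
    then have m': "mt = (k2 + \<theta> p) / (lt - p) + (k2 + \<theta> q) / (lt - q) + (k2 + \<theta> s) / (lt - s) + k2 / (l - lt)"
      using mt_eq by (simp only:)
    have kk: "k1 = - k2 - \<theta> p - \<theta> q - \<theta> s"
      using s kappa2_eq[of t \<theta> \<theta>i] by auto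
    have "\<theta> q + (k1 + \<mu> * (l - s)) * (q - l) / (q - s) =
     (p - lt) / (p - l) * ((q - l) / (q - lt)) * (k2 + \<theta> q + (k1 - k2 + mt * (lt - s)) * (q - lt) / (q - s))"
      by (rule offdiag_transform[OF ne(1,2,4-9) refl mu_eq(2) m m' kk])
    moreover have "(cc t k x m p - cc t k x m q) * rr t x q = (k + m * (x - s)) * (q - x) / (q - s)" for k x m
      unfolding cd rq using ne(3) by simp
    ultimately show ?thesis unfolding V1 V2 ct_def by (simp add: sf_def)
  qed
  show ?thesis
  proof (cases "p = q")
    case True
    then show ?thesis using sf_nz[OF assms(1)] unfolding V1 V2 by simp
  next
    case False
    then have "(p, q, t) \<in> {(0,1,t), (0,t,1), (1,0,t), (1,t,0), (t,0,1), (t,1,0)} \<or>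
       (p, q, 1) \<in> {(0,1,t), (0,t,1), (1,0,t), (1,t,0), (t,0,1), (t,1,0)} \<or>
       (p, q, 0) \<in> {(0,1,t), (0,t,1), (1,0,t), (1,t,0), (t,0,1), (t,1,0)}"
      using assms by auto
    then have "vmat td p q = vmat pd p q" by (elim disjE) (erule off)+
    then show ?thesis using False by simp
  qed
qed

lemma dot_td: "dot P (al td) (ep td) = 0" "dot P (al td) (ga td) = k2 - k1" "dot P (be td) (ep td) = k2"
proof -
  let ?p = "primal t th (kappa1 t th thi) lt mt"
  have e: "dot P (al td) (ep td) = dot P (al ?p) (ep ?p)" "dot P (al td) (ga td) = dot P (al ?p) (ga ?p)"
    "dot P (be td) (ep td) = dot P (be ?p) (ep ?p)"
    unfolding dot_def kappa_tilde td_def primal_def ct_def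
    using sf_nz rr_sf by (auto simp del: sum.insert intro!: sum.cong simp: mult.assoc[symmetric])
  show "dot P (al td) (ep td) = 0" by (rule trans[OF e(1) tl.dot_pd(1)])
  show "dot P (al td) (ga td) = k2 - k1" by (rule trans[OF e(2) trans[OF tl.dot_pd(2)]]) (simp add: kappa_tilde)
  show "dot P (be td) (ep td) = k2" by (rule trans[OF e(3) trans[OF tl.dot_pd(3)]]) (simp add: kappa_tilde)
qed

end

section \<open>Middle convolution of local solutions\<close>

lemma exists_log: "c \<noteq> 0 \<Longrightarrow> \<sigma> = 1 \<or> \<sigma> = -1 \<Longrightarrow> \<exists>\<nu>. exp (2 * of_real pi * \<i> * of_real \<sigma> * \<nu>) = (c :: complex)"
proof -
  assume c: "c \<noteq> 0" "\<sigma> = 1 \<or> \<sigma> = -1"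
  have "exp (2 * of_real pi * \<i> * of_real \<sigma> * (Ln c / (2 * of_real pi * \<i> * of_real \<sigma>))) = c"
    using c by auto
  then show ?thesis by blast
qed

lemma exp_int_period:
  assumes "\<sigma> = 1 \<or> \<sigma> = -1" "\<mu> - \<nu> \<in> \<int>"
  shows "exp (2 * of_real pi * \<i> * of_real \<sigma> * \<mu>) = exp (2 * of_real pi * \<i> * of_real \<sigma> * \<nu>)"
proof -
  obtain m :: int where m: "\<mu> = \<nu> + of_int m" using assms(2) by (metis Ints_cases add.commute diff_add_cancel)
  define m' where "m' = (if \<sigma> = 1 then m else - m)"
  have "2 * of_real pi * \<i> * of_real \<sigma> * \<mu> = 2 * of_real pi * \<i> * of_real \<sigma> * \<nu> + (of_int (2 * m') * of_real pi) * \<i>"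
    using assms(1) unfolding m m'_def by (auto simp: algebra_simps)
  then show ?thesis unfolding exp_eq by (intro exI[of _ m']) simp
qed

text \<open>The exponents at \<open>a\<close> are 0 and \<open>vmat d a a\<close>. Coefficients that
  vanish up to some index can become nonzero again only where an exponent is met, the first one
  concerning the components off \<open>a\<close> and the second one the component at
  \<open>a\<close>.\<close>

lemma laurent_rel_zero_up:
  assumes Z: "laurent_rel P d a \<tau> Y1 Y2 u" and P: "finite P" "a \<in> P"
    and K: "\<And>k p. k \<le> K \<Longrightarrow> p \<in> P \<Longrightarrow> u k p = 0"
    and nz: "\<And>k. k > K \<Longrightarrow> of_int k + \<tau> \<noteq> 0" "\<And>k. k > K \<Longrightarrow> of_int k + 1 + \<tau> \<noteq> vmat d a a"
  shows "p \<in> P \<Longrightarrow> u k p = 0"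
proof (cases "k \<le> K")
  case True then show "p \<in> P \<Longrightarrow> ?thesis" using K by blast
next
  case False
  have "\<forall>p\<in>P. u k p = 0" if "k \<ge> K" for k
    using that
  proof (induction k rule: int_ge_induct)
    case base then show ?case using K by blast
  next
    case (step k)
    have off: "u (k + 1) p = 0" if p: "p \<in> P" "p \<noteq> a" for p
    proof -
      have "dot P (vmat d p) (u k) = 0" using step.IH by (simp add: dot_def)
      then have "(of_int (k + 1) + \<tau>) * ((a - p) * u (k + 1) p) = 0"
        using laurent_rel_rec[OF Z p(1), of k] step.IH p(1) by simp
      then show ?thesis using nz(1)[of "k + 1"] step.hyps p(2) by simp
    qed
    have "dot P (vmat d a) (u (k + 1)) = vmat d a a * u (k + 1) a"
      using off P unfolding dot_def by (subst sum.remove[OF P]) auto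
    then have "(of_int (k + 1) + 1 + \<tau>) * u (k + 1) a = vmat d a a * u (k + 1) a"
      using laurent_rel_rec[OF Z P(2), of "k + 1"] by simp
    then have "(of_int (k + 1) + 1 + \<tau> - vmat d a a) * u (k + 1) a = 0"
      unfolding left_diff_distrib by simp
    moreover have "of_int (k + 1) + 1 + \<tau> - vmat d a a \<noteq> 0" using nz(2)[of "k + 1"] step.hyps by simp
    ultimately have "u (k + 1) a = 0" by simp
    then show ?case using off by blast
  qed
  then show "p \<in> P \<Longrightarrow> ?thesis" using False by auto
qed

lemma poly_of_seq:
  fixes Y :: "nat \<Rightarrow> complex"
  assumes "\<And>i. i > m \<Longrightarrow> Y i = 0"
  obtains q where "coeff q = Y" "degree q \<le> m"
proof -
  have "coeff (Abs_poly Y) = Y"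
    by (rule coeff_Abs_poly[of m]) (use assms in auto)
  moreover from this have "degree (Abs_poly Y) \<le> m" using assms by (intro degree_le) auto
  ultimately show ?thesis by (rule that)
qed

lemma frobenius_of_rec:
  assumes "\<And>i. of_nat i + \<rho> \<noteq> 0" "\<And>p. p \<in> P \<Longrightarrow> (a - p) * U 0 p = 0"
    and "\<And>i p. p \<in> P \<Longrightarrow> (of_nat i + \<rho>) * (U i p + (a - p) * U (Suc i) p) = dot P (vmat d p) (U i)"
  shows "frobenius P d a \<rho> (\<lambda>i. dot P (al d) (U i) / (of_nat i + \<rho>)) (\<lambda>i. dot P (be d) (U i) / (of_nat i + \<rho>)) U"
proof -
  have "U i p + (a - p) * U (Suc i) p = ga d p * (dot P (al d) (U i) / (of_nat i + \<rho>)) + ep d p * (dot P (be d) (U i) / (of_nat i + \<rho>))"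
    if "p \<in> P" for i p
  proof -
    have "U i p + (a - p) * U (Suc i) p = dot P (vmat d p) (U i) / (of_nat i + \<rho>)"
      using assms(3)[OF that, of i] assms(1)[of i] by (subst eq_divide_eq) (simp add: mult.commute)
    then show ?thesis unfolding dot_vmat by (simp add: add_divide_distrib)
  qed
  then show ?thesis unfolding frobenius_def using assms(1,2) by simp
qed

text \<open>\<open>W\<close> is the product of ((z - p) / (a - p))^\<tau>_p over the other poles. On
  the disc that reaches to the nearest of them these quotients have positive real part, so the
  principal powers are single-valued. The factor left out at \<open>a\<close> accounts for - \<tau>
  a / (z - a).\<close>

lemma local_gauge:
  assumes P: "finite P" "a \<in> P" and r: "r > 0" "\<And>p. p \<in> P \<Longrightarrow> p \<noteq> a \<Longrightarrow> r < dist a p"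
    and S: "finite S" "P \<subseteq> S" "sphere a r \<inter> S = {}"
  obtains \<Omega> W where "open \<Omega>" "sphere a r \<subseteq> \<Omega>" "a \<notin> \<Omega>" "\<Omega> \<inter> S = {}"
    "W holomorphic_on \<Omega>" "\<And>z. z \<in> \<Omega> \<Longrightarrow> W z \<noteq> (0 :: complex)"
    "\<And>z. z \<in> \<Omega> \<Longrightarrow> deriv W z = (- \<tau> a / (z - a) + (\<Sum>p\<in>P. \<tau> p / (z - p))) * W z"
proof -
  let ?Q = "P - {a}"
  define \<Omega> where "\<Omega> = (\<Inter>p\<in>?Q. ball a (dist a p)) - S"
  define W where "W z = exp (\<Sum>p\<in>?Q. \<tau> p * Ln ((z - p) / (a - p)))" for z
  have o: "open \<Omega>"
    unfolding \<Omega>_def using P(1) S(1) by (intro open_Diff open_INT finite_imp_closed) auto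
  have nR: "(z - p) / (a - p) \<notin> \<real>\<^sub>\<le>\<^sub>0" if z: "z \<in> \<Omega>" and p: "p \<in> ?Q" for z p
  proof
    assume "(z - p) / (a - p) \<in> \<real>\<^sub>\<le>\<^sub>0"
    then have "Re ((z - p) / (a - p)) \<le> 0" by (simp add: complex_nonpos_Reals_iff)
    moreover have "(z - p) / (a - p) = 1 + (z - a) / (a - p)" using p by (auto simp: divide_simps)
    ultimately have "1 \<le> - Re ((z - a) / (a - p))" by simp
    also have "\<dots> \<le> norm ((z - a) / (a - p))" by (metis abs_Re_le_cmod abs_ge_minus_self order_trans)
    also have "\<dots> < 1" using z p unfolding \<Omega>_def by (auto simp: norm_divide dist_norm norm_minus_commute)
    finally show False by simp
  qed
  have d: "(W has_field_derivative (\<Sum>p\<in>?Q. \<tau> p / (z - p)) * W z) (at z)" if z: "z \<in> \<Omega>" for z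
  proof -
    have "((\<lambda>z. \<tau> p * Ln ((z - p) / (a - p))) has_field_derivative \<tau> p / (z - p)) (at z)" if p: "p \<in> ?Q" for p
    proof -
      have "z - p \<noteq> 0" "a - p \<noteq> 0" using p z S(2) unfolding \<Omega>_def by auto
      then show ?thesis using nR[OF z p] by (auto intro!: derivative_eq_intros)
    qed
    then have "((\<lambda>z. \<Sum>p\<in>?Q. \<tau> p * Ln ((z - p) / (a - p))) has_field_derivative (\<Sum>p\<in>?Q. \<tau> p / (z - p))) (at z)"
      by (rule DERIV_sum)
    from DERIV_fun_exp[OF this] show ?thesis unfolding W_def by (simp add: mult.commute)
  qed
  show ?thesis
  proof (rule that[of \<Omega> W])
    show "sphere a r \<subseteq> \<Omega>" using r(2) S(3) unfolding \<Omega>_def by auto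
    show "a \<notin> \<Omega>" "\<Omega> \<inter> S = {}" using S(2) P(2) by (auto simp: \<Omega>_def)
    show "W holomorphic_on \<Omega>" unfolding holomorphic_on_open[OF o] using d by blast
    show "deriv W z = (- \<tau> a / (z - a) + (\<Sum>p\<in>P. \<tau> p / (z - p))) * W z" if "z \<in> \<Omega>" for z
      using DERIV_imp_deriv[OF d[OF that]] by (simp add: sum.remove[OF P])
  qed (auto simp: o W_def)
qed

text \<open>One step of middle convolution for abstract data, so that it serves the primal pair with
  \<kappa> = \<kappa>2 as well as the dual pair with \<kappa> = - \<kappa>2.\<close>

locale mc_pair =
  fixes P :: "complex set" and d td :: rank_one_data and \<kappa> :: complex and D D' :: ode2 and \<tau> \<tau>' :: "complex \<Rightarrow> complex"
  assumes finP: "finite P"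
    and Vt: "\<And>p q. p \<in> P \<Longrightarrow> q \<in> P \<Longrightarrow> vmat td p q = vmat d p q + (if p = q then \<kappa> else 0)"
    and \<kappa>: "\<kappa> \<notin> \<int>"
    and D: "finite (ode_sing D)" "P \<subseteq> ode_sing D" "ode_p D holomorphic_on - ode_sing D"
      "ode_q D holomorphic_on - ode_sing D" "ode_to_system D P d \<tau>"
    and D': "finite (ode_sing D')" "P \<subseteq> ode_sing D'" "system_to_ode D' P td \<tau>'"
    and ep_nz: "\<And>p. p \<in> P \<Longrightarrow> ep d p \<noteq> 0" and alt_nz: "\<And>p. p \<in> P \<Longrightarrow> al td p \<noteq> 0"
    and ale: "dot P (al d) (ep d) = 0" "dot P (al td) (ep td) = 0"
begin

lemma dot_Vt: "p \<in> P \<Longrightarrow> dot P (vmat td p) u = dot P (vmat d p) u + \<kappa> * u p"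
proof -
  assume p: "p \<in> P"
  have "dot P (vmat td p) u = (\<Sum>q\<in>P. vmat d p q * u q + (if p = q then \<kappa> * u q else 0))"
    unfolding dot_def using Vt[OF p] by (intro sum.cong) (auto simp: algebra_simps)
  also have "\<dots> = dot P (vmat d p) u + \<kappa> * u p"
    unfolding sum.distrib dot_def using p finP by (subst sum.delta') auto
  finally show ?thesis .
qed

lemma of_int_kappa_nz: "of_int k + \<kappa> \<noteq> 0" "of_int k - \<kappa> \<noteq> 0"
proof -
  show "of_int k + \<kappa> \<noteq> 0"
  proof
    assume "of_int k + \<kappa> = 0"
    then have "\<kappa> = of_int (- k)" by (simp add: eq_neg_iff_add_eq_0 add.commute)
    then show False using \<kappa> by (metis Ints_of_int)
  qed
  show "of_int k - \<kappa> \<noteq> 0" using \<kappa> by (metis Ints_of_int eq_iff_diff_eq_0)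
qed

lemma pole_system_td_twisted_ode:
  assumes "\<And>z. z \<notin> ode_sing D' \<Longrightarrow> pole_system P td (\<lambda>z. \<rho> / (z - a)) (poly h) (poly g) z"
    and "a \<in> ode_sing D' \<or> \<rho> = 0" "z \<notin> ode_sing D'"
  shows "twisted_ode D' (\<lambda>z. \<rho> / (z - a) + (\<Sum>p\<in>P. \<tau>' p / (z - p))) (poly h) z"
proof (rule D'(3)[unfolded system_to_ode_def, THEN conjunct2, rule_format, of "- ode_sing D'" _ _ "poly g"])
  show "open (- ode_sing D')" using D'(1) by (simp add: finite_imp_closed open_Compl)
  show "(\<lambda>z. \<rho> / (z - a)) holomorphic_on - ode_sing D'"
    using assms(2) by (cases "\<rho> = 0") (auto intro!: holomorphic_intros)
qed (use assms poly_holomorphic in auto)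

text \<open>The exponents of the system at \<open>a\<close> are 0 and n. Scalar monodromy yields a
  solution with a nonzero \<open>u k\<close> for some k \<le> -1, and its lowest coefficient must
  sit at the exponent n. Rescaled from there on, the sequence stops at the index where the exponent
  0 would be reached.\<close>

theorem local_forward:
  assumes a: "a \<in> P" and n: "vmat d a a = of_int n" "n \<le> 0" and \<tau>a: "\<tau> a \<in> \<int>"
    and app: "apparent_at D a"
  shows "\<exists>h. h \<noteq> 0 \<and>
    (\<forall>z. z \<notin> ode_sing D' \<longrightarrow> twisted_ode D' (\<lambda>z. (of_int n + \<kappa>) / (z - a) + (\<Sum>p\<in>P. \<tau>' p / (z - p))) (poly h) z) \<and>
    (al td = al d \<longrightarrow> degree h \<le> nat (- n - 1))"
proof -
  obtain r c where r: "r > 0" "cball a r \<inter> ode_sing D \<subseteq> {a}" "monodromy_matrix D (circlepath a r) (mat c)"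
    using app by (auto simp: apparent_at_def)
  have rp: "r < dist a p" if "p \<in> P" "p \<noteq> a" for p
  proof (rule ccontr)
    assume "\<not> r < dist a p"
    then have "p \<in> cball a r \<inter> ode_sing D" using that D(2) by auto
    then show False using r(2) that by auto
  qed
  have sph: "sphere a r \<inter> ode_sing D = {}"
    using r(1,2) by auto
  obtain \<Omega> W where W: "open \<Omega>" "sphere a r \<subseteq> \<Omega>" "a \<notin> \<Omega>" "\<Omega> \<inter> ode_sing D = {}"
    "W holomorphic_on \<Omega>" "\<And>z. z \<in> \<Omega> \<Longrightarrow> W z \<noteq> 0"
    "\<And>z. z \<in> \<Omega> \<Longrightarrow> deriv W z = (- \<tau> a / (z - a) + (\<Sum>p\<in>P. \<tau> p / (z - p))) * W z"
    using local_gauge[OF finP a r(1) rp D(1,2) sph, of \<tau>] by blast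
  define e0 where "e0 = - \<tau> a"
  have e0: "e0 \<in> \<int>" using \<tau>a by (simp add: e0_def)
  obtain f g :: "2 \<Rightarrow> real \<Rightarrow> complex" where fg: "c \<noteq> 0" "\<And>j. circle_solution P d a r 1 e0 c (f j) (g j)"
    "\<And>k j. (\<And>s. s \<in> {0..1} \<Longrightarrow> (\<Sum>j\<in>UNIV. k j * f j s) = 0) \<Longrightarrow> k j = 0"
    using monodromy_circle_solution[OF r(3)[unfolded circlepath_eq_circ] r(1) disjI1[OF refl] D W(1-6), of e0] W(7)
    unfolding e0_def by blast
  have f0: "\<exists>s\<in>{0..1}. f j s \<noteq> 0" for j
  proof (rule ccontr)
    assume "\<not> ?thesis"
    then have "(\<Sum>i\<in>UNIV. (if i = j then 1 else 0) * f i s) = 0" if "s \<in> {0..1}" for s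
      using that exhaust_2[of j] by (auto simp: sum_2)
    from fg(3)[OF this, of j] show False by simp
  qed
  have dist: "dist a p \<noteq> r" if "p \<in> P" for p using rp[OF that] r(1) by (cases "p = a") auto
  have laurent_rel: "laurent_rel P d a (\<nu> + e0) (coef r 1 \<nu> F) (coef r 1 \<nu> G) (residue_coef d a r 1 \<nu> F G)"
    "\<exists>K. \<forall>k p. k \<le> K \<longrightarrow> p \<in> P \<longrightarrow> residue_coef d a r 1 \<nu> F G k p = 0"
    if "circle_solution P d a r 1 e0 c F G" "exp (2 * of_real pi * \<i> * of_real 1 * \<nu>) = c" for \<nu> F G
  proof -
    note Z = circle_solution_laurent_rel[OF that(1) finP dist r(1) _ that(2)]
    show "laurent_rel P d a (\<nu> + e0) (coef r 1 \<nu> F) (coef r 1 \<nu> G) (residue_coef d a r 1 \<nu> F G)" using Z(1) by simp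
    show "\<exists>K. \<forall>k p. k \<le> K \<longrightarrow> p \<in> P \<longrightarrow> residue_coef d a r 1 \<nu> F G k p = 0"
      using laurent_rel_vanish_local[OF Z(1) finP a r(1) rp Z(2)] by (metis (no_types, lifting))
  qed
  have cz: "\<exists>k. coef r 1 \<nu> F k \<noteq> 0"
    if "circle_solution P d a r 1 e0 c F G" "exp (2 * of_real pi * \<i> * of_real 1 * \<nu>) = c" "\<exists>s\<in>{0..1}. F s \<noteq> 0" for \<nu> F G
    using coef_eq_0_imp[of F 1 r \<nu>] that r(1) unfolding circle_solution_def by (metis (no_types, lifting))
  \<comment> \<open>Both exponents and \<open>e0\<close> are integers, so with any other multiplier
    there would be no index at which a solution could start.\<close>
  have "c = 1"
  proof -
    obtain \<nu> where \<nu>: "exp (2 * of_real pi * \<i> * of_real 1 * \<nu>) = c" using exists_log[OF fg(1), of 1] by auto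
    have "\<nu> + e0 \<in> \<int>"
    proof (rule ccontr)
      assume nI: "\<nu> + e0 \<notin> \<int>"
      then have nz: "of_int k + (\<nu> + e0) \<noteq> 0" "of_int k + 1 + (\<nu> + e0) \<noteq> of_int n" for k :: int
        by (metis Ints_of_int add.commute add_diff_cancel_left' diff_0 of_int_minus Ints_minus minus_minus,
            metis Ints_of_int add.commute add_diff_cancel_left' of_int_add of_int_1 Ints_diff)
      obtain K where K: "\<And>k p. k \<le> K \<Longrightarrow> p \<in> P \<Longrightarrow> residue_coef d a r 1 \<nu> (f 1) (g 1) k p = 0"
        using laurent_rel(2)[OF fg(2) \<nu>] by blast
      have "residue_coef d a r 1 \<nu> (f 1) (g 1) k p = 0" if "p \<in> P" for k p
        by (rule laurent_rel_zero_up[OF laurent_rel(1)[OF fg(2) \<nu>] finP a K _ _ that]) (use nz n(1) in auto)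
      then have "(of_int k + (\<nu> + e0)) * coef r 1 \<nu> (f 1) k = 0" for k
        using laurent_rel(1)[OF fg(2)[of 1] \<nu>] by (simp add: laurent_rel_def dot_def)
      then show False using cz[OF fg(2) \<nu> f0] nz(1) by auto
    qed
    then have "\<nu> - 0 \<in> \<int>" using e0 by (metis Ints_diff add_diff_cancel_right' diff_zero)
    from exp_int_period[OF disjI1[OF refl] this] show "c = 1" unfolding \<nu> by simp
  qed
  define \<nu> where "\<nu> = - e0"
  have \<nu>: "exp (2 * of_real pi * \<i> * of_real 1 * \<nu>) = c"
    using exp_int_period[OF disjI1[OF refl], of \<nu> 0] e0 \<open>c = 1\<close> by (simp add: \<nu>_def)
  have ZS0: "laurent_rel P d a 0 (coef r 1 \<nu> F) (coef r 1 \<nu> G) (residue_coef d a r 1 \<nu> F G)" if "circle_solution P d a r 1 e0 c F G" for F G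
    using laurent_rel(1)[OF that \<nu>] by (simp add: \<nu>_def)
  \<comment> \<open>Otherwise take the combination with coefficients \<open>m\<close>, chosen so
    that its first component has coefficient 0 at index 0. The row at \<open>a\<close> then kills
    the second component there, no exponent is left at which the solution could start, and it
    vanishes identically.\<close>
  have "\<exists>j k. k \<le> -1 \<and> (\<exists>p\<in>P. residue_coef d a r 1 \<nu> (f j) (g j) k p \<noteq> 0)"
  proof (rule ccontr)
    assume neg: "\<not> ?thesis"
    define m :: "2 \<Rightarrow> complex" where "m j = (if coef r 1 \<nu> (f 1) 0 = 0 then (if j = 1 then 1 else 0)
       else (if j = 1 then coef r 1 \<nu> (f 2) 0 else - coef r 1 \<nu> (f 1) 0))" for j
    define F where "F s = m 1 * f 1 s + m 2 * f 2 s" for s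
    define G where "G s = m 1 * g 1 s + m 2 * g 2 s" for s
    have cs: "circle_solution P d a r 1 e0 c F G"
      using circle_solution_lincomb[OF fg(2)[of 1] fg(2)[of 2], of "m 1" "m 2"] by (simp add: F_def[abs_def] G_def[abs_def])
    note Z = ZS0[OF cs]
    let ?u = "residue_coef d a r 1 \<nu> F G" and ?Y1 = "coef r 1 \<nu> F" and ?Y2 = "coef r 1 \<nu> G"
    have cont: "continuous_on {0..1} (f j)" "continuous_on {0..1} (g j)" for j
      using fg(2)[of j] by (auto simp: circle_solution_def)
    have Y10: "?Y1 0 = 0"
      unfolding F_def coef_lincomb[OF cont(1) cont(1)] by (simp add: m_def)
    have neg': "?u k p = 0" if k: "k \<le> -1" and p: "p \<in> P" for k p
    proof -
      have nz: "a + circ r 1 s - p \<noteq> 0" for s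
      proof
        assume "a + circ r 1 s - p = 0"
        then have "p - a = circ r 1 s" by (simp add: algebra_simps)
        then have "dist a p = r" using r(1) by (metis abs_of_pos circ_def cis2_simps(3) dist_commute dist_norm mult.right_neutral norm_mult norm_of_real)
        then show False using dist[OF p] by simp
      qed
      have c: "continuous_on {0..1} (\<lambda>s. (ga d p * f j s + ep d p * g j s) / (a + circ r 1 s - p))" for j
        by (intro continuous_intros cont) (use nz in auto)
      have "?u k p = m 1 * residue_coef d a r 1 \<nu> (f 1) (g 1) k p + m 2 * residue_coef d a r 1 \<nu> (f 2) (g 2) k p"
        unfolding residue_coef_def coef_lincomb[OF c c, symmetric]
        by (simp add: F_def G_def add_divide_distrib algebra_simps)
      then show ?thesis using neg k p by auto
    qed
    have "?u (0 - 1) a + (a - a) * ?u 0 a = ga d a * ?Y1 0 + ep d a * ?Y2 0"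
      using Z a unfolding laurent_rel_def by blast
    then have Y20: "?Y2 0 = 0" using neg'[of "-1" a] a Y10 ep_nz[OF a] by simp
    have u0: "?u 0 p = 0" if p: "p \<in> P" "p \<noteq> a" for p
    proof -
      have "?u (0 - 1) p + (a - p) * ?u 0 p = ga d p * ?Y1 0 + ep d p * ?Y2 0"
        using Z p unfolding laurent_rel_def by blast
      then show ?thesis using neg'[of "-1" p] p Y10 Y20 by simp
    qed
    have "dot P (vmat d a) (?u 0) = vmat d a a * ?u 0 a"
      unfolding dot_def using u0 finP a by (subst sum.remove[OF finP a]) auto
    then have "(1 - of_int n) * ?u 0 a = 0"
      using laurent_rel_rec[OF Z a, of 0] n(1) by (simp add: algebra_simps)
    moreover have "(1 - of_int n :: complex) \<noteq> 0"
    proof -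
      have "complex_of_int (1 - n) \<noteq> 0" using n(2) by (subst of_int_eq_0_iff) simp
      then show ?thesis by simp
    qed
    ultimately have u0a: "?u 0 a = 0" by simp
    have K: "?u k p = 0" if "k \<le> 0" "p \<in> P" for k p
      using that neg'[of k p] u0[of p] u0a by (cases "k = 0"; cases "p = a") auto
    have uz: "?u k p = 0" if "p \<in> P" for k p
    proof (rule laurent_rel_zero_up[OF Z finP a K _ _ that])
      show "of_int k + 0 \<noteq> (0 :: complex)" if "0 < k" for k :: int using that by simp
      show "of_int k + 1 + 0 \<noteq> vmat d a a" if "0 < k" for k :: int
      proof -
        have "k + 1 \<noteq> n" using that n(2) by simp
        then show ?thesis unfolding n(1) by (metis add.right_neutral of_int_1 of_int_add of_int_eq_iff)
      qed
    qed
    have "?Y1 k = 0" for k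
    proof (cases "k = 0")
      case False
      have "(of_int k + 0) * ?Y1 k = dot P (al d) (?u (k - 1))" using Z unfolding laurent_rel_def by blast
      then show ?thesis using uz False by (simp add: dot_def)
    qed (use Y10 in simp)
    then have "\<forall>s\<in>{0..1}. F s = 0" using cz[OF cs \<nu>] by blast
    then have "(\<Sum>j\<in>UNIV. m j * f j s) = 0" if "s \<in> {0..1}" for s using that by (simp add: sum_2 F_def)
    from fg(3)[OF this] have "m 1 = 0" "m 2 = 0" by blast+
    then show False by (simp add: m_def split: if_splits)
  qed
  then obtain j k1 p1 where k1: "k1 \<le> -1" "p1 \<in> P" "residue_coef d a r 1 \<nu> (f j) (g j) k1 p1 \<noteq> 0" by blast
  define u where "u = residue_coef d a r 1 \<nu> (f j) (g j)"
  note Z = ZS0[OF fg(2)[of j], folded u_def]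
  obtain K where K: "\<And>k p. k \<le> K \<Longrightarrow> p \<in> P \<Longrightarrow> u k p = 0" using laurent_rel(2)[OF fg(2) \<nu>] unfolding u_def by blast
  \<comment> \<open>The lowest nonzero coefficient. The recursion leaves only its component at
    \<open>a\<close>, and the equation there reads k0 + 1 = n.\<close>
  obtain k0 where k0: "\<exists>p\<in>P. u k0 p \<noteq> 0" "\<And>k p. k < k0 \<Longrightarrow> p \<in> P \<Longrightarrow> u k p = 0" "k0 \<le> -1"
  proof -
    let ?A = "{k \<in> {K..k1}. \<exists>p\<in>P. u k p \<noteq> 0}"
    have "K \<le> k1" using k1(2,3) K[of k1 p1] unfolding u_def by (cases "K \<le> k1") auto
    then have k1A: "k1 \<in> ?A" using k1(2,3) unfolding u_def by auto
    have fin: "finite ?A" by (rule finite_subset[of _ "{K..k1}"]) auto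
    show ?thesis
    proof (rule that[of "Min ?A"])
      show "\<exists>p\<in>P. u (Min ?A) p \<noteq> 0" using Min_in[OF fin] k1A by blast
      show "u k p = 0" if "k < Min ?A" "p \<in> P" for k p
      proof (rule ccontr)
        assume "u k p \<noteq> 0"
        moreover have "k \<le> k1" using that(1) Min_le[OF fin k1A] by simp
        ultimately have "k \<in> ?A" using K[of k p] that(2) by (cases "k \<le> K") auto
        then show False using Min_le[OF fin] that(1) by fastforce
      qed
      show "Min ?A \<le> -1" using Min_le[OF fin k1A] k1(1) by simp
    qed
  qed
  have sup: "u k0 p = 0" if p: "p \<in> P" "p \<noteq> a" for p
  proof -
    have "dot P (vmat d p) (u (k0 - 1)) = 0" using k0(2) by (simp add: dot_def)
    then have "of_int k0 * ((a - p) * u k0 p) = 0"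
      using laurent_rel_rec[OF Z p(1), of "k0 - 1"] k0(2)[of "k0 - 1" p] p(1) by simp
    then show ?thesis using k0(3) p by simp
  qed
  then have ua: "u k0 a \<noteq> 0" using k0(1) by auto
  have "dot P (vmat d a) (u k0) = vmat d a a * u k0 a"
    unfolding dot_def using sup finP a by (subst sum.remove[OF finP a]) auto
  then have "(of_int k0 + 1) * u k0 a = of_int n * u k0 a" using laurent_rel_rec[OF Z a, of k0] n(1) by simp
  then have "of_int (k0 + 1) = (of_int n :: complex)" using ua by simp
  then have k0n: "k0 = n - 1" unfolding of_int_eq_iff by simp
  define m where "m = nat (- n)"
  have mn: "int m = - n" using n(2) by (simp add: m_def)
  \<comment> \<open>The quotient of rising factorials (n)_i / (n + \<kappa>)_i. The factor with l =
    - n is 0, so the quotient vanishes for i > m, and \<kappa> \<notin> \<int> keeps the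
    denominators away from 0. The index n - 1 + i in \<open>U\<close> appears because
    \<open>frobenius\<close> counts with an extra factor z - a.\<close>
  define Gf where "Gf i = (\<Prod>l<i. (of_int (n + int l) :: complex) / (of_int (n + int l) + \<kappa>))" for i :: nat
  define U where "U i p = Gf i * u (n - 1 + int i) p" for i p
  define \<rho> where "\<rho> = of_int n + \<kappa>"
  have \<rho>i: "of_nat i + \<rho> = of_int (n + int i) + \<kappa>" for i by (simp add: \<rho>_def)
  have \<rho>nz: "of_nat i + \<rho> \<noteq> 0" for i unfolding \<rho>i by (rule of_int_kappa_nz)
  have Gz: "Gf i = 0" if "i > m" for i
  proof -
    have "n + int m = 0" using mn by simp
    then have "\<exists>l\<in>{..<i}. complex_of_int (n + int l) / (of_int (n + int l) + \<kappa>) = 0"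
      using that by (intro bexI[of _ m]) (simp_all del: of_int_add)
    then show ?thesis unfolding Gf_def by (intro prod_zero) auto
  qed
  have GS: "Gf (Suc i) * (of_nat i + \<rho>) = Gf i * of_int (n + int i)" for i
    using \<rho>nz[of i] unfolding \<rho>i by (simp add: Gf_def)
  have rec: "(of_nat i + \<rho>) * (U i p + (a - p) * U (Suc i) p) = dot P (vmat td p) (U i)" if p: "p \<in> P" for i p
  proof -
    have R: "of_int (n + int i) * (u (n - 1 + int i) p + (a - p) * u (n + int i) p) = dot P (vmat d p) (u (n - 1 + int i))"
      using laurent_rel_rec[OF Z p, of "n - 1 + int i"] by (simp add: add_ac)
    have "dot P (vmat td p) (U i) = Gf i * dot P (vmat d p) (u (n - 1 + int i)) + \<kappa> * U i p"
      unfolding dot_Vt[OF p] by (simp add: U_def dot_def sum_distrib_left mult_ac)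
    also have "\<dots> = of_int (n + int i) * U i p + Gf i * of_int (n + int i) * ((a - p) * u (n + int i) p) + \<kappa> * U i p"
      unfolding R[symmetric] U_def by (simp add: algebra_simps)
    also have "\<dots> = (of_nat i + \<rho>) * U i p + Gf (Suc i) * (of_nat i + \<rho>) * ((a - p) * u (n + int i) p)"
      unfolding GS unfolding \<rho>i by (simp add: algebra_simps)
    also have "\<dots> = (of_nat i + \<rho>) * (U i p + (a - p) * U (Suc i) p)"
      by (simp add: U_def algebra_simps)
    finally show ?thesis by simp
  qed
  define Y1 where "Y1 i = dot P (al td) (U i) / (of_nat i + \<rho>)" for i
  define Y2 where "Y2 i = dot P (be td) (U i) / (of_nat i + \<rho>)" for i
  have frobenius: "frobenius P td a \<rho> Y1 Y2 U"
    unfolding Y1_def[abs_def] Y2_def[abs_def]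
  proof (rule frobenius_of_rec[OF \<rho>nz _ rec])
    show "(a - p) * U 0 p = 0" if "p \<in> P" for p
      using sup[OF that] by (cases "p = a") (auto simp: U_def k0n)
  qed
  have Uz: "U i p = 0" if "i > m" for i p using Gz[OF that] by (simp add: U_def)
  obtain q1 where q1: "coeff q1 = Y1" "degree q1 \<le> m"
    by (rule poly_of_seq[of m Y1]) (auto simp: Y1_def dot_def Uz)
  obtain q2 where q2: "coeff q2 = Y2" "degree q2 \<le> m"
    by (rule poly_of_seq[of m Y2]) (auto simp: Y2_def dot_def Uz)
  have "\<exists>q. coeff q = (\<lambda>i. U i p)" for p
    by (rule poly_of_seq[of m "\<lambda>i. U i p"]) (auto simp: Uz)
  then obtain uq where uq: "\<And>p. coeff (uq p) = (\<lambda>i. U i p)" by metis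
  have FS': "frobenius P td a \<rho> (coeff q1) (coeff q2) (\<lambda>i p. coeff (uq p) i)"
    using frobenius by (simp add: q1 q2 uq)
  let ?h = "q1 \<circ>\<^sub>p [:- a, 1:]"
  show ?thesis
  proof (intro exI[of _ ?h] conjI allI impI)
    have "dot P (al td) (U 0) = al td a * U 0 a"
      unfolding dot_def using sup finP a by (subst sum.remove[OF finP a]) (auto simp: U_def k0n)
    moreover have "U 0 a = u k0 a" by (simp add: U_def Gf_def k0n)
    ultimately have "Y1 0 \<noteq> 0" using ua alt_nz[OF a] \<rho>nz[of 0] by (simp add: Y1_def)
    then have "q1 \<noteq> 0" using q1(1) by auto
    then show "?h \<noteq> 0" by (simp add: pcompose_eq_0_iff)
    have sysq: "pole_system P td (\<lambda>z. \<rho> / (z - a)) (poly ?h) (poly (q2 \<circ>\<^sub>p [:- a, 1:])) z" if "z \<notin> ode_sing D'" for z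
      by (rule frobenius_poly[OF FS']) (use that D'(2) a in auto)
    show "twisted_ode D' (\<lambda>z. (of_int n + \<kappa>) / (z - a) + (\<Sum>p\<in>P. \<tau>' p / (z - p))) (poly ?h) z" if "z \<notin> ode_sing D'" for z
      unfolding \<rho>_def[symmetric] by (rule pole_system_td_twisted_ode[OF sysq]) (use D'(2) a that in auto)
    assume al: "al td = al d"
    \<comment> \<open>The coefficient at index m is a multiple of
      \<open>dot P (al d) (u (-1))\<close>, which by \<open>laurent_rel\<close> at k = 0 is 0 times
      a coefficient of the first component. This lowers the degree by one.\<close>
    have "coeff q1 i = 0" if "i > m - 1" for i
    proof (cases "i = m")
      case True
      have "dot P (al d) (u (-1)) = (of_int 0 + 0) * coef r 1 \<nu> (f j) 0"
        using Z unfolding laurent_rel_def by (metis diff_0)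
      then have "dot P (al d) (u (-1)) = 0" by simp
      moreover have "dot P (al td) (U m) = Gf m * dot P (al d) (u (-1))"
        using mn by (simp add: al U_def dot_def sum_distrib_left mult_ac)
      ultimately show ?thesis using True by (simp add: q1 Y1_def)
    next
      case False
      then have "i > m" using that mn by simp
      then show ?thesis using q1(2) by (simp add: coeff_eq_0)
    qed
    then have "degree q1 \<le> m - 1" by (intro degree_le) auto
    then show "degree ?h \<le> nat (- n - 1)" using mn by (simp add: degree_pcompose)
  qed
qed

end

section \<open>Middle convolution of solutions at infinity\<close>

text \<open>The analogue at \<infinity>: the factors (1 - p / z)^\<tau>_p are single-valued where z
  is larger in norm than all poles, and the division of z - p by z accounts for the term with the
  sum of the \<tau> p.\<close>

lemma infinity_gauge:
  assumes P: "finite P" and r: "r > 0" and S: "finite S" "P \<subseteq> S" "S \<subseteq> ball 0 r"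
  obtains \<Omega> W where "open \<Omega>" "\<And>z. norm z \<ge> r \<Longrightarrow> z \<in> \<Omega>" "(0::complex) \<notin> \<Omega>" "\<Omega> \<inter> S = {}"
    "W holomorphic_on \<Omega>" "\<And>z. z \<in> \<Omega> \<Longrightarrow> W z \<noteq> (0 :: complex)"
    "\<And>z. z \<in> \<Omega> \<Longrightarrow> deriv W z = (- (\<Sum>p\<in>P. \<tau> p) / z + (\<Sum>p\<in>P. \<tau> p / (z - p))) * W z"
proof -
  define \<Omega> where "\<Omega> = (\<Inter>p\<in>P. - cball 0 (norm p)) - insert 0 S"
  define W where "W z = exp (\<Sum>p\<in>P. \<tau> p * Ln (1 - p / z))" for z
  have o: "open \<Omega>"
    unfolding \<Omega>_def using P(1) S(1) by (intro open_Diff open_INT open_Compl finite_imp_closed) auto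
  have nR: "1 - p / z \<notin> \<real>\<^sub>\<le>\<^sub>0" if z: "z \<in> \<Omega>" and p: "p \<in> P" for z p
  proof
    assume "1 - p / z \<in> \<real>\<^sub>\<le>\<^sub>0"
    then have "1 \<le> Re (p / z)" by (simp add: complex_nonpos_Reals_iff)
    also have "\<dots> \<le> norm (p / z)" by (rule complex_Re_le_cmod)
    also have "\<dots> < 1" using z p unfolding \<Omega>_def by (auto simp: norm_divide not_le divide_less_eq)
    finally show False by simp
  qed
  have d: "(W has_field_derivative (\<Sum>p\<in>P. \<tau> p / (z - p) - \<tau> p / z) * W z) (at z)" if z: "z \<in> \<Omega>" for z
  proof -
    have "((\<lambda>z. \<tau> p * Ln (1 - p / z)) has_field_derivative (\<tau> p / (z - p) - \<tau> p / z)) (at z)" if p: "p \<in> P" for p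
    proof -
      have nz: "z - p \<noteq> 0" "z \<noteq> 0" using p z S(2) unfolding \<Omega>_def by auto
      have "((\<lambda>z. \<tau> p * Ln (1 - p / z)) has_field_derivative (\<tau> p * ((p / (z * z)) / (1 - p / z)))) (at z)"
        using nR[OF z p] nz by (auto intro!: derivative_eq_intros simp: divide_inverse mult_ac)
      moreover have "\<tau> p * ((p / (z * z)) / (1 - p / z)) = \<tau> p / (z - p) - \<tau> p / z"
        using nz by (auto simp: divide_simps) (simp_all add: algebra_simps)
      ultimately show ?thesis by simp
    qed
    then have "((\<lambda>z. \<Sum>p\<in>P. \<tau> p * Ln (1 - p / z)) has_field_derivative (\<Sum>p\<in>P. \<tau> p / (z - p) - \<tau> p / z)) (at z)"
      by (rule DERIV_sum)
    from DERIV_fun_exp[OF this] show ?thesis unfolding W_def by (simp add: mult.commute)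
  qed
  show ?thesis
  proof (rule that[of \<Omega> W])
    show "z \<in> \<Omega>" if "norm z \<ge> r" for z using S that r unfolding \<Omega>_def by auto
    show "0 \<notin> \<Omega>" "\<Omega> \<inter> S = {}" by (auto simp: \<Omega>_def)
    show "W holomorphic_on \<Omega>" unfolding holomorphic_on_open[OF o] using d by blast
    show "deriv W z = (- (\<Sum>p\<in>P. \<tau> p) / z + (\<Sum>p\<in>P. \<tau> p / (z - p))) * W z" if "z \<in> \<Omega>" for z
      using DERIV_imp_deriv[OF d[OF that]] by (simp add: sum_subtractf sum_divide_distrib)
  qed (auto simp: o W_def)
qed

lemma dot_lincomb: "dot P x (\<lambda>p. y p * A + w p * B) = dot P x y * A + dot P x w * B"
  by (simp add: dot_def sum_distrib_left sum_distrib_right sum.distrib ring_distribs mult_ac)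

lemma dot_cong: "(\<And>p. p \<in> P \<Longrightarrow> u p = v p) \<Longrightarrow> dot P x u = dot P x v"
  by (simp add: dot_def)

text \<open>The highest coefficient vector is an eigenvector of the sum of the residues. By
  \<open>ale\<close> this sum is lower triangular, so the eigenvalue is the diagonal entry that
  belongs to the first nonzero component.\<close>

lemma laurent_rel_top:
  assumes Z: "laurent_rel P d a \<tau> Y1 Y2 u" and K: "\<And>k p. k \<ge> K \<Longrightarrow> p \<in> P \<Longrightarrow> u k p = 0"
    and ale: "dot P (al d) (ep d) = 0" and nz: "\<exists>k. Y1 k \<noteq> 0 \<or> Y2 k \<noteq> 0"
  shows "\<exists>k. (Y1 k \<noteq> 0 \<or> Y2 k \<noteq> 0) \<and> (\<forall>j>k. Y1 j = 0 \<and> Y2 j = 0) \<and>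
    (\<forall>j\<ge>k. \<forall>p\<in>P. u j p = 0) \<and> (\<forall>p\<in>P. u (k - 1) p = ga d p * Y1 k + ep d p * Y2 k) \<and>
    (Y1 k \<noteq> 0 \<longrightarrow> of_int k + \<tau> = dot P (al d) (ga d)) \<and> (Y1 k = 0 \<longrightarrow> of_int k + \<tau> = dot P (be d) (ep d))"
proof -
  obtain N where N: "\<And>k. N \<le> \<bar>k\<bar> \<Longrightarrow> 1 \<le> norm (of_int k + \<tau>)"
    using large_int_norm by blast
  define M where "M = max (K + 1) (max N 0)"
  have big: "Y1 k = 0 \<and> Y2 k = 0" if "k \<ge> M" for k
  proof -
    have "of_int k + \<tau> \<noteq> 0" using N[of k] that by (auto simp: M_def)
    moreover have "dot P x (u (k - 1)) = 0" for x using K[of "k - 1"] that by (auto simp: dot_def M_def)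
    ultimately show ?thesis using Z unfolding laurent_rel_def by (metis mult_eq_0_iff)
  qed
  obtain k1 where k1: "Y1 k1 \<noteq> 0 \<or> Y2 k1 \<noteq> 0" using nz by blast
  let ?A = "{k \<in> {k1..M}. Y1 k \<noteq> 0 \<or> Y2 k \<noteq> 0}"
  have fin: "finite ?A" by (rule finite_subset[of _ "{k1..M}"]) auto
  have k1A: "k1 \<in> ?A" using k1 big[of k1] by (cases "k1 \<le> M") auto
  define k where "k = Max ?A"
  have kA: "k \<in> ?A" using Max_in[OF fin] k1A unfolding k_def by blast
  have above: "Y1 j = 0 \<and> Y2 j = 0" if "j > k" for j
  proof (rule ccontr)
    assume c: "\<not> ?thesis"
    then have "j < M" using big[of j] by (cases "j < M") auto
    then have "j \<in> ?A" using c that kA by auto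
    then show False using Max_ge[OF fin] that unfolding k_def by fastforce
  qed
  have uz: "u j p = 0" if j: "j \<ge> k" and p: "p \<in> P" for j p
  proof -
    \<comment> \<open>Descent from an index where everything vanishes: as long as the components are
      zero, \<open>u\<close> at one index determines \<open>u\<close> at the next lower one.\<close>
    have "u (max K k - int i) p = 0 \<or> max K k - int i < k" for i
    proof (induction i)
      case 0 then show ?case using K p by simp
    next
      case (Suc i)
      show ?case
      proof (cases "max K k - int (Suc i) < k")
        case False
        then have *: "u (max K k - int i) p = 0" using Suc by auto
        have "u (max K k - int i - 1) p + (a - p) * u (max K k - int i) p = ga d p * Y1 (max K k - int i) + ep d p * Y2 (max K k - int i)"
          using Z p unfolding laurent_rel_def by blast
        moreover have "max K k - int i > k" using False by simp
        ultimately have "u (max K k - int i - 1) p = 0" using * above by simp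
        then show ?thesis by (simp add: algebra_simps)
      qed simp
    qed
    from this[of "nat (max K k - j)"] show ?thesis using j K[OF _ p, of j] by (cases "j \<le> max K k") auto
  qed
  have uk: "u (k - 1) p = ga d p * Y1 k + ep d p * Y2 k" if p: "p \<in> P" for p
  proof -
    have "u (k - 1) p + (a - p) * u k p = ga d p * Y1 k + ep d p * Y2 k"
      using Z p unfolding laurent_rel_def by blast
    then show ?thesis using uz[of k p] p by simp
  qed
  have e: "(of_int k + \<tau>) * Y1 k = dot P (al d) (ga d) * Y1 k"
    "(of_int k + \<tau>) * Y2 k = dot P (be d) (ga d) * Y1 k + dot P (be d) (ep d) * Y2 k"
  proof -
    have "(of_int k + \<tau>) * Y1 k = dot P (al d) (u (k - 1))" "(of_int k + \<tau>) * Y2 k = dot P (be d) (u (k - 1))"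
      using Z unfolding laurent_rel_def by blast+
    moreover have "dot P x (u (k - 1)) = dot P x (ga d) * Y1 k + dot P x (ep d) * Y2 k" for x
      unfolding dot_lincomb[symmetric] by (rule dot_cong) (rule uk)
    ultimately show "(of_int k + \<tau>) * Y1 k = dot P (al d) (ga d) * Y1 k"
      "(of_int k + \<tau>) * Y2 k = dot P (be d) (ga d) * Y1 k + dot P (be d) (ep d) * Y2 k"
      by (simp_all add: ale)
  qed
  show ?thesis
    by (intro exI[of _ k]) (use kA above uz uk e in auto)
qed

context mc_pair
begin

text \<open>The residue sum has the eigenvalues m - \<kappa> and - \<kappa>. Two independent
  solutions cannot both stop at the lower one, so some solution reaches index m, and its
  coefficients \<open>u\<close> of nonnegative index, rescaled, give the polynomial. In the second
  alternative of \<open>e\<close> the eigenvalue m - \<kappa> belongs to the second component, so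
  the top coefficient does not fix the degree of the first one.\<close>

theorem infinity_forward:
  assumes app: "apparent_at_infinity D"
    and e: "(dot P (al d) (ga d) = of_nat m - \<kappa> \<and> dot P (be d) (ep d) = - \<kappa> \<and> al td = al d) \<or>
       (dot P (al d) (ga d) = - \<kappa> \<and> dot P (be d) (ep d) = of_nat m - \<kappa> \<and> m \<ge> 1)"
  shows "\<exists>h. h \<noteq> 0 \<and> (\<forall>z. z \<notin> ode_sing D' \<longrightarrow> twisted_ode D' (\<lambda>z. \<Sum>p\<in>P. \<tau>' p / (z - p)) (poly h) z) \<and>
    (dot P (al d) (ga d) = of_nat m - \<kappa> \<longrightarrow> degree h = m)"
proof -
  obtain r c where r: "r > 0" "ode_sing D \<subseteq> ball 0 r" "monodromy_matrix D (reversepath (circlepath 0 r)) (mat c)"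
    using app by (auto simp: apparent_at_infinity_def)
  obtain \<Omega> W where W: "open \<Omega>" "\<And>z. norm z \<ge> r \<Longrightarrow> z \<in> \<Omega>" "0 \<notin> \<Omega>" "\<Omega> \<inter> ode_sing D = {}"
    "W holomorphic_on \<Omega>" "\<And>z. z \<in> \<Omega> \<Longrightarrow> W z \<noteq> 0"
    "\<And>z. z \<in> \<Omega> \<Longrightarrow> deriv W z = (- (\<Sum>p\<in>P. \<tau> p) / z + (\<Sum>p\<in>P. \<tau> p / (z - p))) * W z"
    using infinity_gauge[OF finP r(1) D(1,2) r(2), of \<tau>] by blast
  have sph: "sphere 0 r \<subseteq> \<Omega>" using W(2) by auto
  define e0 where "e0 = - (\<Sum>p\<in>P. \<tau> p)"
  have W7: "deriv W z = (e0 / (z - 0) + (\<Sum>p\<in>P. \<tau> p / (z - p))) * W z" if "z \<in> \<Omega>" for z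
    using W(7)[OF that] by (simp add: e0_def)
  obtain f g :: "2 \<Rightarrow> real \<Rightarrow> complex" where fg: "c \<noteq> 0" "\<And>j. circle_solution P d 0 r (-1) e0 c (f j) (g j)"
    "\<And>k j. (\<And>s. s \<in> {0..1} \<Longrightarrow> (\<Sum>j\<in>UNIV. k j * f j s) = 0) \<Longrightarrow> k j = 0"
    using monodromy_circle_solution[OF r(3)[unfolded reversepath_circlepath_eq_circ] r(1) disjI2[OF refl] D W(1) sph W(3-6) W7] by blast
  have f0: "\<exists>s\<in>{0..1}. f j s \<noteq> 0" for j
  proof (rule ccontr)
    assume "\<not> ?thesis"
    then have "(\<Sum>i\<in>UNIV. (if i = j then 1 else 0) * f i s) = 0" if "s \<in> {0..1}" for s
      using that exhaust_2[of j] by (auto simp: sum_2)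
    from fg(3)[OF this, of j] show False by simp
  qed
  have rp: "dist 0 p < r" if "p \<in> P" for p using D(2) r(2) that by auto
  have dist: "dist 0 p \<noteq> r" if "p \<in> P" for p using rp[OF that] by simp
  have laurent_rel: "laurent_rel P d 0 (\<nu> + e0) (coef r (-1) \<nu> F) (coef r (-1) \<nu> G) (residue_coef d 0 r (-1) \<nu> F G)"
    "\<exists>K. \<forall>k p. k \<ge> K \<longrightarrow> p \<in> P \<longrightarrow> residue_coef d 0 r (-1) \<nu> F G k p = 0"
    if "circle_solution P d 0 r (-1) e0 c F G" "exp (2 * of_real pi * \<i> * of_real (-1) * \<nu>) = c" for \<nu> F G
  proof -
    note Z = circle_solution_laurent_rel[OF that(1) finP dist r(1) _ that(2)]
    show "laurent_rel P d 0 (\<nu> + e0) (coef r (-1) \<nu> F) (coef r (-1) \<nu> G) (residue_coef d 0 r (-1) \<nu> F G)" using Z(1) by simp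
    show "\<exists>K. \<forall>k p. k \<ge> K \<longrightarrow> p \<in> P \<longrightarrow> residue_coef d 0 r (-1) \<nu> F G k p = 0"
      using laurent_rel_vanish_inf[OF Z(1) finP r(1) rp Z(2)] by (metis (no_types, lifting))
  qed
  have cz: "\<exists>k. coef r (-1) \<nu> F k \<noteq> 0"
    if "circle_solution P d 0 r (-1) e0 c F G" "exp (2 * of_real pi * \<i> * of_real (-1) * \<nu>) = c" "\<exists>s\<in>{0..1}. F s \<noteq> 0" for \<nu> F G
    using coef_eq_0_imp[of F "-1" r \<nu>] that r(1) unfolding circle_solution_def by (metis (no_types, lifting))
  \<comment> \<open>Any admissible \<nu> differs from this one by an integer, since both eigenvalues
    lie in - \<kappa> + \<int>. With this choice top coefficients can sit only at the indices 0 and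
    m.\<close>
  define \<nu> where "\<nu> = - \<kappa> - e0"
  have \<nu>: "exp (2 * of_real pi * \<i> * of_real (-1) * \<nu>) = c"
  proof -
    obtain \<nu>' where \<nu>': "exp (2 * of_real pi * \<i> * of_real (-1) * \<nu>') = c" using exists_log[OF fg(1), of "-1"] by auto
    obtain K where K: "\<And>k p. k \<ge> K \<Longrightarrow> p \<in> P \<Longrightarrow> residue_coef d 0 r (-1) \<nu>' (f 1) (g 1) k p = 0"
      using laurent_rel(2)[OF fg(2) \<nu>'] by blast
    obtain k where "coef r (-1) \<nu>' (f 1) k \<noteq> 0 \<Longrightarrow> of_int k + (\<nu>' + e0) = dot P (al d) (ga d)"
      "coef r (-1) \<nu>' (f 1) k = 0 \<Longrightarrow> of_int k + (\<nu>' + e0) = dot P (be d) (ep d)"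
    proof -
      have "\<exists>k. coef r (-1) \<nu>' (f 1) k \<noteq> 0 \<or> coef r (-1) \<nu>' (g 1) k \<noteq> 0"
        using cz[OF fg(2) \<nu>' f0, of 1] by blast
      from laurent_rel_top[OF laurent_rel(1)[OF fg(2) \<nu>'] K ale(1) this] show ?thesis using that by blast
    qed
    then have "of_int k + (\<nu>' + e0) = of_nat m - \<kappa> \<or> of_int k + (\<nu>' + e0) = - \<kappa>"
      using e by (cases "coef r (-1) \<nu>' (f 1) k = 0") auto
    then have "\<nu> - \<nu>' = of_int (k - int m) \<or> \<nu> - \<nu>' = of_int k"
      unfolding \<nu>_def by (auto simp: algebra_simps)
    then have "\<nu> - \<nu>' \<in> \<int>" by (metis Ints_of_int)
    from exp_int_period[OF disjI2[OF refl] this] show ?thesis unfolding \<nu>' .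
  qed
  define Z1 where "Z1 F = coef r (-1) \<nu> F" for F
  define uu where "uu F G = residue_coef d 0 r (-1) \<nu> F G" for F G
  have ZS0: "laurent_rel P d 0 (- \<kappa>) (Z1 F) (Z1 G) (uu F G)" if "circle_solution P d 0 r (-1) e0 c F G" for F G
    using laurent_rel(1)[OF that \<nu>] by (simp add: \<nu>_def Z1_def uu_def)
  have cont: "continuous_on {0..1} (f j)" "continuous_on {0..1} (g j)" for j
    using fg(2)[of j] by (auto simp: circle_solution_def)
  have top: "\<exists>k. (Z1 F k \<noteq> 0 \<or> Z1 G k \<noteq> 0) \<and> (\<forall>j>k. Z1 F j = 0 \<and> Z1 G j = 0) \<and>
      (\<forall>j\<ge>k. \<forall>p\<in>P. uu F G j p = 0) \<and> (\<forall>p\<in>P. uu F G (k - 1) p = ga d p * Z1 F k + ep d p * Z1 G k) \<and>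
      (Z1 F k \<noteq> 0 \<longrightarrow> of_int k - \<kappa> = dot P (al d) (ga d)) \<and> (Z1 F k = 0 \<longrightarrow> of_int k - \<kappa> = dot P (be d) (ep d))"
    if cs: "circle_solution P d 0 r (-1) e0 c F G" and nz: "\<exists>s\<in>{0..1}. F s \<noteq> 0" for F G
  proof -
    obtain K where K: "\<And>k p. k \<ge> K \<Longrightarrow> p \<in> P \<Longrightarrow> uu F G k p = 0"
      using laurent_rel(2)[OF cs \<nu>] unfolding uu_def by blast
    have "\<exists>k. Z1 F k \<noteq> 0 \<or> Z1 G k \<noteq> 0" using cz[OF cs \<nu> nz] unfolding Z1_def by blast
    from laurent_rel_top[OF ZS0[OF cs] K ale(1) this] show ?thesis unfolding diff_conv_add_uminus .
  qed
  have comb: "\<exists>F G n1 n2. circle_solution P d 0 r (-1) e0 c F G \<and> (\<exists>s\<in>{0..1}. F s \<noteq> 0) \<and>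
      (\<forall>k. Z1 F k = n1 * Z1 (f 1) k + n2 * Z1 (f 2) k) \<and> (\<forall>k. Z1 G k = n1 * Z1 (g 1) k + n2 * Z1 (g 2) k) \<and>
      n1 * x1 + n2 * x2 = 0" for x1 x2 :: complex
  proof -
    define n :: "2 \<Rightarrow> complex" where "n j = (if x1 = 0 then (if j = 1 then 1 else 0) else (if j = 1 then x2 else - x1))" for j
    define F where "F s = n 1 * f 1 s + n 2 * f 2 s" for s
    define G where "G s = n 1 * g 1 s + n 2 * g 2 s" for s
    have "circle_solution P d 0 r (-1) e0 c F G"
      using circle_solution_lincomb[OF fg(2)[of 1] fg(2)[of 2], of "n 1" "n 2"] by (simp add: F_def[abs_def] G_def[abs_def])
    moreover have "\<exists>s\<in>{0..1}. F s \<noteq> 0"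
    proof (rule ccontr)
      assume "\<not> ?thesis"
      then have "(\<Sum>j\<in>UNIV. n j * f j s) = 0" if "s \<in> {0..1}" for s using that by (simp add: sum_2 F_def)
      from fg(3)[OF this] have "n 1 = 0" "n 2 = 0" by blast+
      then show False by (simp add: n_def split: if_splits)
    qed
    moreover have "\<forall>k. Z1 F k = n 1 * Z1 (f 1) k + n 2 * Z1 (f 2) k" "\<forall>k. Z1 G k = n 1 * Z1 (g 1) k + n 2 * Z1 (g 2) k"
      unfolding Z1_def F_def G_def coef_lincomb[OF cont(1) cont(1)] coef_lincomb[OF cont(2) cont(2)] by auto
    moreover have "n 1 * x1 + n 2 * x2 = 0" by (simp add: n_def)
    ultimately show ?thesis by blast
  qed
  \<comment> \<open>If neither solution reached index m in the component demanded, the combination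
    that removes the leading coefficient at index 0 would have no admissible top index left.\<close>
  have "\<exists>j. (Z1 (f j) (int m) \<noteq> 0 \<or> (Z1 (g j) (int m) \<noteq> 0 \<and> dot P (al d) (ga d) = - \<kappa> \<and> m \<ge> 1)) \<and>
      (\<forall>i>int m. Z1 (f j) i = 0 \<and> Z1 (g j) i = 0) \<and> (\<forall>i\<ge>int m. \<forall>p\<in>P. uu (f j) (g j) i p = 0) \<and>
      (\<forall>p\<in>P. uu (f j) (g j) (int m - 1) p = ga d p * Z1 (f j) (int m) + ep d p * Z1 (g j) (int m))"
  proof (rule ccontr)
    assume neg: "\<not> ?thesis"
    have ne: "of_int k - \<kappa> = of_int k' - \<kappa> \<longleftrightarrow> k = k'" for k k' by simp
    have low: "(\<forall>i>0. Z1 (f j) i = 0 \<and> Z1 (g j) i = 0) \<and> (dot P (al d) (ga d) = of_nat m - \<kappa> \<longrightarrow> Z1 (f j) 0 = 0)" for j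
    proof -
      obtain k where k: "Z1 (f j) k \<noteq> 0 \<or> Z1 (g j) k \<noteq> 0" "\<forall>i>k. Z1 (f j) i = 0 \<and> Z1 (g j) i = 0"
        "\<forall>i\<ge>k. \<forall>p\<in>P. uu (f j) (g j) i p = 0" "\<forall>p\<in>P. uu (f j) (g j) (k - 1) p = ga d p * Z1 (f j) k + ep d p * Z1 (g j) k"
        "Z1 (f j) k \<noteq> 0 \<longrightarrow> of_int k - \<kappa> = dot P (al d) (ga d)" "Z1 (f j) k = 0 \<longrightarrow> of_int k - \<kappa> = dot P (be d) (ep d)"
        using top[OF fg(2) f0, of j] by blast
      from e show ?thesis
      proof
        assume e: "dot P (al d) (ga d) = of_nat m - \<kappa> \<and> dot P (be d) (ep d) = - \<kappa> \<and> al td = al d"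
        have "Z1 (f j) k = 0"
        proof (rule ccontr)
          assume n: "Z1 (f j) k \<noteq> 0"
          then have "of_int k = (of_int (int m) :: complex)" using k(5) e by simp
          then have "k = int m" unfolding of_int_eq_iff .
          then show False using neg k(2-4) n by blast
        qed
        moreover from this have "of_int k = (of_int 0 :: complex)" using k(6) e by simp
        then have "k = 0" unfolding of_int_eq_iff .
        ultimately show ?thesis using k(2) by auto
      next
        assume e: "dot P (al d) (ga d) = - \<kappa> \<and> dot P (be d) (ep d) = of_nat m - \<kappa> \<and> m \<ge> 1"
        have "Z1 (f j) k \<noteq> 0"
        proof
          assume n: "Z1 (f j) k = 0"
          then have "of_int k = (of_int (int m) :: complex)" using k(6) e by simp
          then have "k = int m" unfolding of_int_eq_iff .
          then show False using neg k(1-4) n e by blast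
        qed
        then have "of_int k = (of_int 0 :: complex)" using k(5) e by simp
        then have "k = 0" unfolding of_int_eq_iff .
        then show ?thesis using k(2) e by auto
      qed
    qed
    define x where "x j = (if dot P (al d) (ga d) = of_nat m - \<kappa> then Z1 (g j) 0 else Z1 (f j) 0)" for j
    obtain F G n1 n2 where F: "circle_solution P d 0 r (-1) e0 c F G" "\<exists>s\<in>{0..1}. F s \<noteq> 0"
      "\<And>k. Z1 F k = n1 * Z1 (f 1) k + n2 * Z1 (f 2) k" "\<And>k. Z1 G k = n1 * Z1 (g 1) k + n2 * Z1 (g 2) k"
      "n1 * x 1 + n2 * x 2 = 0"
      using comb[of "x 1" "x 2"] by blast
    obtain k where k: "Z1 F k \<noteq> 0 \<or> Z1 G k \<noteq> 0"
        "Z1 F k \<noteq> 0 \<longrightarrow> of_int k - \<kappa> = dot P (al d) (ga d)" "Z1 F k = 0 \<longrightarrow> of_int k - \<kappa> = dot P (be d) (ep d)"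
      using top[OF F(1,2)] by blast
    have z: "Z1 F i = 0 \<and> Z1 G i = 0" if "i > 0" for i using low that unfolding F(3,4) by simp
    then have k0: "k \<le> 0" using k(1) by (meson not_le)
    show False
    proof (cases "dot P (al d) (ga d) = of_nat m - \<kappa>")
      case True
      then have e': "dot P (be d) (ep d) = - \<kappa>" using e by auto
      have F00: "Z1 F 0 = 0" "Z1 G 0 = 0" using low True F(5) unfolding F(3,4) x_def by auto
      show False
      proof (cases "Z1 F k = 0")
        case False
        then have "of_int k = (of_int (int m) :: complex)" using k(2) True by simp
        then have "k = int m" unfolding of_int_eq_iff .
        then show False using k0 False F00 by simp
      next
        case True
        then have "of_int k = (of_int 0 :: complex)" using k(3) e' by simp
        then have "k = 0" unfolding of_int_eq_iff .
        then show False using k(1) F00 by simp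
      qed
    next
      case False
      then have e': "dot P (al d) (ga d) = - \<kappa>" "dot P (be d) (ep d) = of_nat m - \<kappa>" "m \<ge> 1" using e by auto
      have F00: "Z1 F 0 = 0" using False F(5) unfolding F(3) x_def by auto
      show False
      proof (cases "Z1 F k = 0")
        case n: False
        then have "of_int k = (of_int 0 :: complex)" using k(2) e' by simp
        then have "k = 0" unfolding of_int_eq_iff .
        then show False using n F00 by simp
      next
        case True
        then have "of_int k = (of_int (int m) :: complex)" using k(3) e' by simp
        then have "k = int m" unfolding of_int_eq_iff .
        then show False using k0 e'(3) by simp
      qed
    qed
  qed
  then obtain j where j: "Z1 (f j) (int m) \<noteq> 0 \<or> (Z1 (g j) (int m) \<noteq> 0 \<and> dot P (al d) (ga d) = - \<kappa> \<and> m \<ge> 1)"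
    "\<And>i p. i \<ge> int m \<Longrightarrow> p \<in> P \<Longrightarrow> uu (f j) (g j) i p = 0" by blast
  define u where "u = uu (f j) (g j)"
  note Z = ZS0[OF fg(2)[of j], folded u_def]
  have \<kappa>0: "\<kappa> \<noteq> 0" using of_int_kappa_nz(1)[of 0] by simp
  \<comment> \<open>The quotient (1 - \<kappa>)_i / i! of rising factorials. Setting
    \<open>U 0\<close> to 0 cuts off all negative powers, and \<open>U\<close> ends at m because
    \<open>u\<close> vanishes from index m on.\<close>
  define Gf where "Gf i = (\<Prod>l<i. (of_nat (Suc l) - \<kappa>) / of_nat (Suc l) :: complex)" for i :: nat
  have Gnz: "Gf i \<noteq> 0" for i
  proof -
    have "of_nat (Suc l) - \<kappa> \<noteq> 0" for l using of_int_kappa_nz(2)[of "int (Suc l)"] by simp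
    then show ?thesis unfolding Gf_def by (auto simp del: of_nat_Suc)
  qed
  define U where "U i p = (case i of 0 \<Rightarrow> 0 | Suc i \<Rightarrow> Gf i * u (int i) p)" for i p
  \<comment> \<open>At index 0 the derivative clause has the factor 0 and leaves \<open>Y\<close>
    free. Its value is read off from the recursion for \<open>u\<close> at k = -1, where the factor
    k + 1 - \<kappa> is - \<kappa>.\<close>
  define Y where "Y x i = (if i = 0 then - (1 / \<kappa>) * dot P x (u (-1)) else dot P x (U i) / of_nat i)" for x i
  have GS: "Gf (Suc i) * of_nat (Suc i) = Gf i * (of_nat (Suc i) - \<kappa>)" for i
    by (simp add: Gf_def del: of_nat_Suc)
  have frobenius: "frobenius P td 0 0 (Y (al td)) (Y (be td)) U"
    unfolding frobenius_def
  proof (intro conjI allI ballI)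
    show "(of_nat i + 0) * Y x i = dot P x (U i)" for x i by (cases i) (simp_all add: Y_def U_def dot_def del: of_nat_Suc)
    then show "(of_nat i + 0) * Y (be td) i = dot P (be td) (U i)" for i .
    show "(0 - p) * U 0 p = 0" for p by (simp add: U_def)
    fix i p assume p: "p \<in> P"
    show "U i p + (0 - p) * U (Suc i) p = ga td p * Y (al td) i + ep td p * Y (be td) i"
    proof (cases i)
      case 0
      have "(- \<kappa>) * (u (-1) p - p * u 0 p) = dot P (vmat d p) (u (-1))"
        using laurent_rel_rec[OF Z p, of "-1"] by simp
      then have "\<kappa> * (p * u 0 p) = dot P (vmat td p) (u (-1))"
        unfolding dot_Vt[OF p] by (simp add: algebra_simps)
      then have "p * u 0 p = dot P (vmat td p) (u (-1)) / \<kappa>" using \<kappa>0 by (simp add: field_simps)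
      then show ?thesis unfolding 0 dot_vmat by (simp add: U_def Y_def Gf_def add_divide_distrib)
    next
      case (Suc l)
      have R: "(of_nat (Suc l) - \<kappa>) * (u (int l) p - p * u (int (Suc l)) p) = dot P (vmat d p) (u (int l))"
        using laurent_rel_rec[OF Z p, of "int l"] by (simp add: algebra_simps)
      have "dot P (vmat td p) (U (Suc l)) = Gf l * dot P (vmat d p) (u (int l)) + \<kappa> * U (Suc l) p"
        unfolding dot_Vt[OF p] by (simp add: U_def dot_def sum_distrib_left mult_ac)
      also have "\<dots> = of_nat (Suc l) * U (Suc l) p - Gf l * (of_nat (Suc l) - \<kappa>) * (p * u (int (Suc l)) p)"
        unfolding R[symmetric] U_def by (simp add: algebra_simps del: of_nat_Suc)
      also have "\<dots> = of_nat (Suc l) * (U (Suc l) p - p * U (Suc (Suc l)) p)"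
        unfolding GS[symmetric] by (simp add: U_def algebra_simps del: of_nat_Suc)
      finally have "U (Suc l) p - p * U (Suc (Suc l)) p = dot P (vmat td p) (U (Suc l)) / of_nat (Suc l)"
        by (simp add: field_simps del: of_nat_Suc)
      then show ?thesis unfolding Suc dot_vmat by (simp add: Y_def add_divide_distrib del: of_nat_Suc)
    qed
  qed
  have Uz: "U i p = 0" if "i > m" "p \<in> P" for i p
    using that j(2)[of "int (i - 1)" p] by (cases i) (auto simp: U_def u_def)
  \<comment> \<open>Values outside \<open>P\<close> are set to 0 so that for every \<open>p\<close>
    the sequence is that of a polynomial.\<close>
  define U' where "U' i p = (if p \<in> P then U i p else 0)" for i p
  have dotU': "dot P x (U' i) = dot P x (U i)" for x i by (rule dot_cong) (simp add: U'_def)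
  have U'z: "U' i p = 0" if "i > m" for i p using Uz[OF that] by (simp add: U'_def)
  have FS1: "frobenius P td 0 0 (Y (al td)) (Y (be td)) U'"
    using frobenius unfolding frobenius_def dotU' by (simp add: U'_def)
  have Yz: "Y x i = 0" if "i > m" for x i
    using that Uz[OF that] by (simp add: Y_def dot_def)
  obtain q1 where q1: "coeff q1 = Y (al td)" "degree q1 \<le> m"
    by (rule poly_of_seq[of m "Y (al td)"]) (auto simp: Yz)
  obtain q2 where q2: "coeff q2 = Y (be td)" "degree q2 \<le> m"
    by (rule poly_of_seq[of m "Y (be td)"]) (auto simp: Yz)
  have "\<exists>q. coeff q = (\<lambda>i. U' i p)" for p
    by (rule poly_of_seq[of m "\<lambda>i. U' i p"]) (auto simp: U'z)
  then obtain uq where uq: "\<And>p. coeff (uq p) = (\<lambda>i. U' i p)" by metis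
  have FS': "frobenius P td 0 0 (coeff q1) (coeff q2) (\<lambda>i p. coeff (uq p) i)"
    using FS1 by (simp add: q1 q2 uq)
  have pc: "q \<circ>\<^sub>p [:- 0, 1:] = q" for q :: "complex poly" by (simp add: pcompose_idR)
  have sysq: "pole_system P td (\<lambda>z. 0 / (z - 0)) (poly q1) (poly q2) z" if "z \<notin> insert 0 P" for z
    using frobenius_poly[OF FS', of z] that unfolding pc by simp
  \<comment> \<open>\<open>frobenius_poly\<close> excludes the centre of expansion 0, which may be a
    regular point; the identity extends to it by continuity.\<close>
  have cont0: "pole_system P td (\<lambda>z. 0 / (z - 0)) (poly q1) (poly q2) z" if z: "z \<notin> P" for z
  proof (cases "z = 0")
    case False then show ?thesis using sysq z by simp
  next
    case True
    have dp: "deriv (poly q) = poly (pderiv q)" for q :: "complex poly"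
      by (rule ext) (rule DERIV_imp_deriv[OF poly_DERIV])
    have "poly (pderiv q) 0 = pole_sum P x (ga td) 0 * poly q1 0 + pole_sum P x (ep td) 0 * poly q2 0"
      if q: "\<And>z. z \<notin> insert 0 P \<Longrightarrow> poly (pderiv q) z = pole_sum P x (ga td) z * poly q1 z + pole_sum P x (ep td) z * poly q2 z" for q x
    proof -
      let ?R = "\<lambda>z. poly (pderiv q) z - (pole_sum P x (ga td) z * poly q1 z + pole_sum P x (ep td) z * poly q2 z)"
      have o: "open (- P)" "0 \<in> - P" using finP z True by (auto intro: finite_imp_closed)
      have "?R holomorphic_on - P"
        by (intro holomorphic_intros pole_sum_holomorphic poly_holomorphic finP) auto
      then have "isCont ?R 0" using o holomorphic_on_imp_continuous_on continuous_on_eq_continuous_at by blast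
      moreover have "\<forall>\<^sub>F z in at 0. ?R z = 0"
        using eventually_nhds_in_open[OF o] unfolding eventually_at_filter
        by (rule eventually_mono) (use q in auto)
      then have "?R \<midarrow>0\<rightarrow> 0" using tendsto_cong[of ?R "\<lambda>_. 0"] by auto
      ultimately have "?R 0 = 0" using LIM_unique isCont_def by blast
      then show ?thesis by simp
    qed
    from this[of q1 "al td"] this[of q2 "be td"] sysq show ?thesis unfolding True pole_system_def dp by simp
  qed
  show ?thesis
  proof (intro exI[of _ q1] conjI allI impI)
    show "twisted_ode D' (\<lambda>z. \<Sum>p\<in>P. \<tau>' p / (z - p)) (poly q1) z" if "z \<notin> ode_sing D'" for z
      using pole_system_td_twisted_ode[of 0 0 q1 q2 z] cont0 that D'(2) by auto
    have c_m: "coeff q1 m \<noteq> 0" if e1: "dot P (al d) (ga d) = of_nat m - \<kappa>"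
    proof -
      have al: "al td = al d" and Ym: "Z1 (f j) (int m) \<noteq> 0"
        using e j(1) e1 by auto
      have "(of_int (int m) + - \<kappa>) * Z1 (f j) (int m) = dot P (al d) (u (int m - 1))"
        using Z unfolding laurent_rel_def by blast
      moreover have "of_int (int m) + - \<kappa> \<noteq> 0" using of_int_kappa_nz(2)[of "int m"] by simp
      ultimately have nz: "dot P (al d) (u (int m - 1)) \<noteq> 0" using Ym by (metis mult_eq_0_iff)
      show ?thesis
      proof (cases m)
        case 0 then show ?thesis using nz \<kappa>0 unfolding q1 al by (simp add: Y_def)
      next
        case (Suc l)
        have "dot P (al td) (U m) = Gf l * dot P (al d) (u (int m - 1))"
          unfolding al Suc by (simp add: U_def dot_def sum_distrib_left mult_ac)
        then show ?thesis using nz Gnz[of l] Suc unfolding q1 by (simp add: Y_def del: of_nat_Suc)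
      qed
    qed
    show "degree q1 = m" if "dot P (al d) (ga d) = of_nat m - \<kappa>"
      by (intro antisym q1(2) le_degree c_m that)
    \<comment> \<open>If q1 = 0, then q2 = 0 as the upper right entry of the system does not vanish,
      hence \<open>U m = 0\<close>; since m - \<kappa> \<noteq> 0, the top coefficients of the
      solution at index m would vanish too.\<close>
    show "q1 \<noteq> 0"
    proof
      assume q0: "q1 = 0"
      then have "dot P (al d) (ga d) \<noteq> of_nat m - \<kappa>" using c_m by auto
      then have e2: "dot P (al d) (ga d) = - \<kappa>" "dot P (be d) (ep d) = of_nat m - \<kappa>" "m \<ge> 1" using e by auto
      have "poly q2 z = poly 0 z" for z
      proof (rule poly_eq_off_finite[OF D'(1)])
        fix z assume z: "z \<notin> ode_sing D'"
        then have "pole_sum P (al td) (ep td) z \<noteq> 0" using D'(3) unfolding system_to_ode_def by blast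
        moreover have "poly q1 = (\<lambda>_. 0)" using q0 by auto
        moreover have "pole_system P td (\<lambda>z. 0 / (z - 0)) (poly q1) (poly q2) z" using cont0 z D'(2) by blast
        ultimately show "poly q2 z = poly 0 z" by (simp add: pole_system_def)
      qed
      then have "q2 = 0" by (intro poly_eq_poly_eq_iff[THEN iffD1] ext)
      have "U m p - p * U (Suc m) p = 0" if "p \<in> P" for p
      proof -
        have "U m p + (0 - p) * U (Suc m) p = ga td p * Y (al td) m + ep td p * Y (be td) m"
          using frobenius that unfolding frobenius_def by blast
        then show ?thesis unfolding q1(1)[symmetric] q2(1)[symmetric] q0 \<open>q2 = 0\<close> by simp
      qed
      then have "U m p = 0" if "p \<in> P" for p using Uz[of "Suc m" p] that by simp
      then have u0: "u (int m - 1) p = 0" if "p \<in> P" for p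
        using that e2(3) Gnz by (cases m) (auto simp: U_def)
      have "(of_int (int m) + - \<kappa>) * Z1 (f j) (int m) = dot P (al d) (u (int m - 1))"
        "(of_int (int m) + - \<kappa>) * Z1 (g j) (int m) = dot P (be d) (u (int m - 1))"
        using Z unfolding laurent_rel_def by blast+
      moreover have "of_int (int m) + - \<kappa> \<noteq> 0" using of_int_kappa_nz(2)[of "int m"] by simp
      moreover have "dot P x (u (int m - 1)) = 0" for x using u0 by (simp add: dot_def)
      ultimately show False using j(1) by auto
    qed
  qed
qed

end

section \<open>From polynomial solutions to apparent singularities\<close>

lemma psum_lincomb:
  assumes "psconv R Y" "psconv R Y'"
  shows "psconv R (\<lambda>i. k * Y i + k' * Y' i)"
    and "norm x < R \<Longrightarrow> psum (\<lambda>i. k * Y i + k' * Y' i) x = k * psum Y x + k' * psum Y' x"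
proof -
  have e: "Abs_fps (\<lambda>i. k * Y i + k' * Y' i) = fps_const k * Abs_fps Y + fps_const k' * Abs_fps Y'"
    by (rule fps_ext) simp
  have "ereal R \<le> min (fps_conv_radius (Abs_fps Y)) (fps_conv_radius (Abs_fps Y'))"
    using assms by (simp add: psconv_def)
  also have "\<dots> \<le> min (fps_conv_radius (fps_const k * Abs_fps Y)) (fps_conv_radius (fps_const k' * Abs_fps Y'))"
    using fps_conv_radius_mult[of "fps_const k" "Abs_fps Y"] fps_conv_radius_mult[of "fps_const k'" "Abs_fps Y'"]
    by (intro min.mono) auto
  also have "\<dots> \<le> fps_conv_radius (Abs_fps (\<lambda>i. k * Y i + k' * Y' i))"
    unfolding e by (rule fps_conv_radius_add)
  finally show c: "psconv R (\<lambda>i. k * Y i + k' * Y' i)" by (simp add: psconv_def)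
  assume x: "norm x < R"
  have "(\<lambda>i. k * (Y i * x ^ i) + k' * (Y' i * x ^ i)) sums (k * psum Y x + k' * psum Y' x)"
    by (intro sums_add sums_mult psum_sums[OF _ x] assms)
  moreover have "(\<lambda>i. (k * Y i + k' * Y' i) * x ^ i) sums psum (\<lambda>i. k * Y i + k' * Y' i) x"
    by (rule psum_sums[OF c x])
  ultimately show "psum (\<lambda>i. k * Y i + k' * Y' i) x = k * psum Y x + k' * psum Y' x"
    using sums_unique2 by (simp add: ring_distribs mult.assoc) blast
qed

section \<open>Continuing initial coefficients to convergent solutions\<close>

lemma geometric_bound:
  fixes N :: "nat \<Rightarrow> real"
  assumes "\<And>i. i \<ge> m \<Longrightarrow> N (Suc i) \<le> Q * N i" "Q \<ge> 1" "\<And>i. N i \<ge> 0"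
  shows "N i \<le> (\<Sum>l\<le>m. N l) * Q ^ i"
proof (cases "i \<le> m")
  case True
  then have "N i \<le> (\<Sum>l\<le>m. N l)" using assms(3) by (intro member_le_sum) auto
  also have "\<dots> * 1 \<le> (\<Sum>l\<le>m. N l) * Q ^ i"
    using assms by (intro mult_left_mono sum_nonneg one_le_power) auto
  finally show ?thesis by simp
next
  case False
  then have "m \<le> i" by simp
  then show ?thesis
  proof (induction i rule: dec_induct)
    case base
    have "N m \<le> (\<Sum>l\<le>m. N l)" using assms(3) by (intro member_le_sum) auto
    also have "\<dots> * 1 \<le> (\<Sum>l\<le>m. N l) * Q ^ m"
      using assms by (intro mult_left_mono sum_nonneg one_le_power) auto
    finally show ?case by simp
  next
    case (step i)
    have "N (Suc i) \<le> Q * N i" using step assms(1) by simp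
    also have "\<dots> \<le> Q * ((\<Sum>l\<le>m. N l) * Q ^ i)" using step assms(2) by (intro mult_left_mono) auto
    finally show ?case by (simp add: mult_ac)
  qed
qed

lemma dot_norm_bound:
  assumes "finite P"
  shows "norm (dot P x u) \<le> (\<Sum>p\<in>P. norm (x p)) * (\<Sum>p\<in>P. norm (u p))"
proof -
  have "norm (dot P x u) \<le> (\<Sum>p\<in>P. norm (x p) * norm (u p))"
    unfolding dot_def by (rule sum_norm_le) (simp add: norm_mult)
  also have "\<dots> \<le> (\<Sum>p\<in>P. norm (x p) * (\<Sum>p\<in>P. norm (u p)))"
    using assms by (intro sum_mono mult_left_mono member_le_sum) auto
  finally show ?thesis by (simp add: sum_distrib_right)
qed

lemma bounded_triple_psconv:
  fixes Y1 Y2 :: "nat \<Rightarrow> complex" and U :: "nat \<Rightarrow> complex \<Rightarrow> complex"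
  assumes "finite P" "Q \<ge> 1"
    and "\<And>i. i \<ge> m \<Longrightarrow> norm (Y1 (Suc i)) + norm (Y2 (Suc i)) + (\<Sum>p\<in>P. norm (U (Suc i) p))
      \<le> Q * (norm (Y1 i) + norm (Y2 i) + (\<Sum>p\<in>P. norm (U i p)))"
  shows "\<exists>R>0. psconv R Y1 \<and> psconv R Y2 \<and> (\<forall>p\<in>P. psconv R (\<lambda>i. U i p))"
proof -
  define N where "N i = norm (Y1 i) + norm (Y2 i) + (\<Sum>p\<in>P. norm (U i p))" for i
  have N: "N i \<le> (\<Sum>l\<le>m. N l) * Q ^ i" for i
    by (rule geometric_bound) (use assms(2,3) in \<open>auto simp: N_def intro!: add_nonneg_nonneg sum_nonneg\<close>)
  have s: "(\<Sum>p\<in>P. norm (U i p)) \<ge> 0" for i by (rule sum_nonneg) simp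
  have Y: "norm (Y1 i) \<le> N i" "norm (Y2 i) \<le> N i" for i using s[of i] by (auto simp: N_def)
  have U: "norm (U i p) \<le> N i" if "p \<in> P" for i p
  proof -
    have "norm (U i p) \<le> (\<Sum>p\<in>P. norm (U i p))" using assms(1) that by (intro member_le_sum) auto
    then show ?thesis unfolding N_def using norm_ge_zero[of "Y1 i"] norm_ge_zero[of "Y2 i"] by linarith
  qed
  have "Q > 0" using assms(2) by simp
  have "psconv (1 / (2 * Q)) X" if "\<And>i. norm (X i) \<le> N i" for X
    by (rule psconv_geometric[OF \<open>Q > 0\<close>, of _ "\<Sum>l\<le>m. N l"]) (use that N order_trans in blast)
  then show ?thesis using \<open>Q > 0\<close> Y U by (intro exI[of _ "1 / (2 * Q)"]) auto
qed

text \<open>Index m = - n is the resonant one; the coefficients up to it are given, together with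
  the relation at \<open>a\<close> there. Beyond it i + n is positive, and in the equation at
  \<open>a\<close> the component at \<open>a\<close> has the factor i + n -
  \<open>vmat d a a\<close> = i. So the recursion is solvable, and since all these divisors have
  norm at least 1 the growth is geometric.\<close>

lemma frobenius_extend:
  fixes n :: int
  assumes P: "finite P" "a \<in> P" and V: "vmat d a a = of_int n" and n: "int m = - n"
    and pre: "\<And>i. i \<le> m \<Longrightarrow> (of_nat i + of_int n) * Y1 i = dot P (al d) (U i)"
      "\<And>i. i \<le> m \<Longrightarrow> (of_nat i + of_int n) * Y2 i = dot P (be d) (U i)"
      "\<And>p. p \<in> P \<Longrightarrow> (a - p) * U 0 p = 0"
      "\<And>i p. i < m \<Longrightarrow> p \<in> P \<Longrightarrow> U i p + (a - p) * U (Suc i) p = ga d p * Y1 i + ep d p * Y2 i"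
      "U m a = ga d a * Y1 m + ep d a * Y2 m"
  shows "\<exists>Z1 Z2 T R. frobenius P d a (of_int n) Z1 Z2 T \<and> R > 0 \<and> psconv R Z1 \<and> psconv R Z2 \<and>
    (\<forall>p\<in>P. psconv R (\<lambda>i. T i p)) \<and> (\<forall>i\<le>m. Z1 i = Y1 i \<and> Z2 i = Y2 i)"
proof -
  let ?Q = "P - {a}"
  define off where "off y p = (ga d p * fst y + ep d p * fst (snd y) - snd (snd y) p) / (a - p)" for y p
  define un where "un j y p = (if p = a then dot ?Q (vmat d a) (off y) / of_nat (m + Suc j) else off y p)" for j :: nat and y p
  define step where "step j y = (dot P (al d) (un j y) / of_nat (Suc j), dot P (be d) (un j y) / of_nat (Suc j), un j y)" for j :: nat and y
  define st where "st = rec_nat (Y1 m, Y2 m, U m) step"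
  have st: "st 0 = (Y1 m, Y2 m, U m)" "st (Suc j) = step j (st j)" for j by (simp_all add: st_def)
  define Z1 where "Z1 i = (if i \<le> m then Y1 i else fst (st (i - m)))" for i
  define Z2 where "Z2 i = (if i \<le> m then Y2 i else fst (snd (st (i - m))))" for i
  define T where "T i = (if i \<le> m then U i else snd (snd (st (i - m))))" for i
  have stm: "st j = (Z1 (m + j), Z2 (m + j), T (m + j))" for j
    by (cases j) (simp_all add: Z1_def Z2_def T_def st)
  have stepst: "st (Suc j) = (dot P (al d) (un j (st j)) / of_nat (Suc j), dot P (be d) (un j (st j)) / of_nat (Suc j), un j (st j))" for j
    unfolding st step_def ..
  have TS: "T (m + Suc j) p = (if p = a then dot ?Q (vmat d a) (off (st j)) / of_nat (m + Suc j) else off (st j) p)" for j p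
  proof -
    have "T (m + Suc j) = un j (st j)" using stm[of "Suc j"] stepst[of j] by simp
    then show ?thesis by (simp only: un_def)
  qed
  have offT: "off (st j) p = (ga d p * Z1 (m + j) + ep d p * Z2 (m + j) - T (m + j) p) / (a - p)" for j p
    by (simp add: off_def stm)
  have laurent_rel: "of_nat (Suc j) * Z1 (m + Suc j) = dot P (al d) (T (m + Suc j))"
    "of_nat (Suc j) * Z2 (m + Suc j) = dot P (be d) (T (m + Suc j))" for j
  proof -
    have "Z1 (m + Suc j) = dot P (al d) (un j (st j)) / of_nat (Suc j)"
      "Z2 (m + Suc j) = dot P (be d) (un j (st j)) / of_nat (Suc j)" "T (m + Suc j) = un j (st j)"
      using trans[OF stm[of "Suc j", symmetric] stepst[of j]] by (simp_all only: prod.inject)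
    then show "of_nat (Suc j) * Z1 (m + Suc j) = dot P (al d) (T (m + Suc j))"
      "of_nat (Suc j) * Z2 (m + Suc j) = dot P (be d) (T (m + Suc j))" by (simp_all del: of_nat_Suc)
  qed
  have mn: "of_int n = - (of_nat m :: complex)" using n by (metis add.inverse_inverse of_int_minus of_int_of_nat_eq)
  have Y: "(of_nat i + of_int n) * Z1 i = dot P (al d) (T i)" "(of_nat i + of_int n) * Z2 i = dot P (be d) (T i)" for i
  proof -
    have "(of_nat i + of_int n) * Z1 i = dot P (al d) (T i) \<and> (of_nat i + of_int n) * Z2 i = dot P (be d) (T i)"
    proof (cases "i \<le> m")
      case True then show ?thesis using pre(1,2)[of i] by (simp add: Z1_def Z2_def T_def)
    next
      case False
      then obtain j where j: "i = m + Suc j" using less_iff_Suc_add[of m i] by auto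
      have "of_nat i + of_int n = (of_nat (Suc j) :: complex)" by (simp add: j mn)
      then show ?thesis using laurent_rel[of j] by (simp only: j)
    qed
    then show "(of_nat i + of_int n) * Z1 i = dot P (al d) (T i)" "(of_nat i + of_int n) * Z2 i = dot P (be d) (T i)" by auto
  qed
  have Ta: "T i a = ga d a * Z1 i + ep d a * Z2 i" if "i \<ge> m" for i
  proof (cases "i = m")
    case True then show ?thesis using pre(5) by (simp add: T_def Z1_def Z2_def)
  next
    case False
    then obtain j where j: "i = m + Suc j" using \<open>i \<ge> m\<close> False less_iff_Suc_add[of m i] by auto
    have "of_nat (m + Suc j) * T i a = dot ?Q (vmat d a) (off (st j))"
      unfolding j TS by (simp del: of_nat_add of_nat_Suc)
    also have "\<dots> = dot ?Q (vmat d a) (T i)" unfolding j dot_def TS by (intro sum.cong) auto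
    also have "\<dots> = dot P (vmat d a) (T i) - vmat d a a * T i a"
      using P by (simp add: dot_def sum.remove[OF P])
    also have "dot P (vmat d a) (T i) = of_nat (Suc j) * (ga d a * Z1 i + ep d a * Z2 i)"
      unfolding dot_vmat j laurent_rel[symmetric] by (simp add: algebra_simps)
    finally have "of_nat (Suc j) * T i a = of_nat (Suc j) * (ga d a * Z1 i + ep d a * Z2 i)"
      unfolding V mn by (simp add: algebra_simps)
    then show ?thesis by (simp del: of_nat_Suc)
  qed
  have R1: "T i p + (a - p) * T (Suc i) p = ga d p * Z1 i + ep d p * Z2 i" if p: "p \<in> P" for i p
  proof (cases "i < m")
    case True then show ?thesis using pre(4)[OF True p] by (simp add: T_def Z1_def Z2_def)
  next
    case False
    show ?thesis
    proof (cases "p = a")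
      case True then show ?thesis using Ta[of i] False by simp
    next
      case pa: False
      obtain j where j: "i = m + j" using False using le_Suc_ex[of m i] by auto
      have "T (Suc i) p = off (st j) p" using TS[of j p] pa by (simp add: j)
      then show ?thesis using pa by (simp add: offT j)
    qed
  qed
  have frobenius: "frobenius P d a (of_int n) Z1 Z2 T"
    unfolding frobenius_def using Y R1 pre(3) by (auto simp: T_def)
  obtain C where C: "C \<ge> 0" "\<And>p u. p \<in> P \<Longrightarrow> norm (dot P (vmat d p) u) \<le> C * (\<Sum>q\<in>P. norm (u q))"
    "\<And>p q. p \<in> P \<Longrightarrow> q \<in> P \<Longrightarrow> norm (vmat d p q) \<le> C"
    using vmat_bound[OF P(1)] by blast
  define c0 where "c0 = (\<Sum>p\<in>?Q. (norm (ga d p) + norm (ep d p) + 1) / dist a p)"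
  define A where "A = (\<Sum>p\<in>P. norm (al d p)) + (\<Sum>p\<in>P. norm (be d p))"
  define N where "N i = norm (Z1 i) + norm (Z2 i) + (\<Sum>p\<in>P. norm (T i p))" for i
  define Q where "Q = 1 + (1 + A) * ((1 + C) * c0)"
  have c0: "c0 \<ge> 0" unfolding c0_def by (intro sum_nonneg) auto
  have A0: "A \<ge> 0" unfolding A_def by (intro add_nonneg_nonneg sum_nonneg) auto
  have N0: "N i \<ge> 0" for i unfolding N_def by (intro add_nonneg_nonneg sum_nonneg) auto
  have bound: "N (Suc i) \<le> Q * N i" if "i \<ge> m" for i
  proof -
    obtain j where j: "i = m + j" using le_Suc_ex[OF \<open>i \<ge> m\<close>] by auto
    have offb: "(\<Sum>p\<in>?Q. norm (off (st j) p)) \<le> c0 * N i"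
    proof -
      have "norm (off (st j) p) \<le> (norm (ga d p) + norm (ep d p) + 1) / dist a p * N i" if p: "p \<in> ?Q" for p
      proof -
        have t: "norm (T i p) \<le> (\<Sum>p\<in>P. norm (T i p))" using P p by (intro member_le_sum) auto
        have s0: "0 \<le> (\<Sum>p\<in>P. norm (T i p))" by (intro sum_nonneg) auto
        have "norm (ga d p * Z1 i + ep d p * Z2 i - T i p) \<le> norm (ga d p * Z1 i) + norm (ep d p * Z2 i) + norm (T i p)"
          by (meson add_mono norm_triangle_ineq norm_triangle_ineq4 order_refl order_trans)
        also have "\<dots> \<le> norm (ga d p) * N i + norm (ep d p) * N i + N i"
        proof -
          have "norm (T i p) \<le> N i" "norm (Z1 i) \<le> N i" "norm (Z2 i) \<le> N i"
            unfolding N_def using t s0 norm_ge_zero[of "Z1 i"] norm_ge_zero[of "Z2 i"] by linarith+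
          then show ?thesis unfolding norm_mult by (intro add_mono mult_left_mono norm_ge_zero)
        qed
        finally have "norm (ga d p * Z1 i + ep d p * Z2 i - T i p) \<le> (norm (ga d p) + norm (ep d p) + 1) * N i"
          by (simp add: algebra_simps)
        then have "norm (ga d p * Z1 i + ep d p * Z2 i - T i p) / dist a p \<le> (norm (ga d p) + norm (ep d p) + 1) * N i / dist a p"
          by (rule divide_right_mono) simp
        then show ?thesis unfolding offT j by (simp add: norm_divide dist_norm)
      qed
      then have "(\<Sum>p\<in>?Q. norm (off (st j) p)) \<le> (\<Sum>p\<in>?Q. (norm (ga d p) + norm (ep d p) + 1) / dist a p * N i)"
        by (rule sum_mono)
      then show ?thesis unfolding c0_def sum_distrib_right .
    qed
    have Toff: "(\<Sum>p\<in>?Q. norm (T (Suc i) p)) \<le> c0 * N i"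
    proof -
      have "(\<Sum>p\<in>?Q. norm (T (Suc i) p)) = (\<Sum>p\<in>?Q. norm (off (st j) p))"
        using TS[of j] by (intro sum.cong) (auto simp: j)
      then show ?thesis using offb by simp
    qed
    have "norm (dot ?Q (vmat d a) (off (st j))) \<le> (\<Sum>q\<in>?Q. C * norm (off (st j) q))"
      unfolding dot_def using C(3) P by (intro sum_norm_le) (auto simp: norm_mult intro!: mult_right_mono)
    also have "\<dots> \<le> C * (c0 * N i)" unfolding sum_distrib_left[symmetric] by (intro mult_left_mono offb C)
    finally have "norm (dot ?Q (vmat d a) (off (st j))) \<le> C * (c0 * N i)" .
    moreover have "norm (T (Suc i) a) \<le> norm (dot ?Q (vmat d a) (off (st j)))"
    proof -
      have "norm (T (Suc i) a) = norm (dot ?Q (vmat d a) (off (st j))) / real (m + Suc j)"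
        using TS[of j a] norm_of_nat[of "m + Suc j", where 'a = complex]
        by (simp add: j norm_divide del: of_nat_Suc of_nat_add norm_of_nat)
      also have "\<dots> \<le> norm (dot ?Q (vmat d a) (off (st j))) / 1"
        by (intro divide_left_mono) auto
      finally show ?thesis by simp
    qed
    ultimately have tot: "(\<Sum>p\<in>P. norm (T (Suc i) p)) \<le> (1 + C) * c0 * N i"
      using Toff P by (simp add: sum.remove[OF P] algebra_simps)
    have z: "norm X \<le> (\<Sum>p\<in>P. norm (x p)) * (\<Sum>p\<in>P. norm (T (Suc i) p))"
      if "of_nat (Suc j) * X = dot P x (T (Suc i))" for X x
    proof -
      have "1 * norm X \<le> norm (of_nat (Suc j) :: complex) * norm X"
        by (intro mult_right_mono) (simp_all del: of_nat_Suc)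
      also have "\<dots> = norm (dot P x (T (Suc i)))" by (simp only: norm_mult[symmetric] that)
      also have "\<dots> \<le> (\<Sum>p\<in>P. norm (x p)) * (\<Sum>p\<in>P. norm (T (Suc i) p))" by (rule dot_norm_bound[OF P(1)])
      finally show ?thesis by simp
    qed
    have "norm (Z1 (Suc i)) + norm (Z2 (Suc i)) \<le> A * (\<Sum>p\<in>P. norm (T (Suc i) p))"
      using z[of "Z1 (Suc i)" "al d"] z[of "Z2 (Suc i)" "be d"] laurent_rel[of j] by (simp add: j A_def algebra_simps)
    then have "N (Suc i) \<le> (1 + A) * (\<Sum>p\<in>P. norm (T (Suc i) p))" by (simp add: N_def algebra_simps)
    also have "\<dots> \<le> (1 + A) * ((1 + C) * c0 * N i)" using tot A0 by (intro mult_left_mono) auto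
    also have "\<dots> \<le> Q * N i"
    proof -
      have "Q * N i = N i + (1 + A) * ((1 + C) * c0 * N i)" unfolding Q_def by (simp only: distrib_right mult_1 mult.assoc)
      then show ?thesis using N0[of i] by linarith
    qed
    finally show ?thesis .
  qed
  have "Q \<ge> 1" using A0 C(1) c0 by (simp add: Q_def)
  have "\<exists>R>0. psconv R Z1 \<and> psconv R Z2 \<and> (\<forall>p\<in>P. psconv R (\<lambda>i. T i p))"
    by (rule bounded_triple_psconv[OF P(1) \<open>Q \<ge> 1\<close>, of m]) (rule bound[unfolded N_def])
  then obtain R where R: "R > 0" "psconv R Z1" "psconv R Z2" "\<forall>p\<in>P. psconv R (\<lambda>i. T i p)" by (elim exE conjE) (rule that)
  have U: "\<forall>i\<le>m. Z1 i = Y1 i \<and> Z2 i = Y2 i" by (simp add: Z1_def Z2_def)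
  have "frobenius P d a (of_int n) Z1 Z2 T \<and> R > 0 \<and> psconv R Z1 \<and> psconv R Z2 \<and>
    (\<forall>p\<in>P. psconv R (\<lambda>i. T i p)) \<and> (\<forall>i\<le>m. Z1 i = Y1 i \<and> Z2 i = Y2 i)"
    by (rule conjI[OF frobenius conjI[OF R(1) conjI[OF R(2) conjI[OF R(3) conjI[OF R(4) U]]]]])
  then show ?thesis by - (rule exI[where x = Z1], rule exI[where x = Z2], rule exI[where x = T], rule exI[where x = R], assumption)
qed

text \<open>The new \<open>Y\<close> occurs in the new \<open>U\<close> as well. Inserting the
  recursion gives an equation for \<open>Y\<close> whose matrix is \<rho> - i minus the residue sum;
  it is triangular by \<open>ale\<close>, so \<open>Y1\<close> and then \<open>Y2\<close> come by
  division. The bounds \<open>nz\<close> give solvability and convergence at once.\<close>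

lemma frobenius_inf_extend:
  assumes P: "finite P" and ale: "dot P (al d) (ep d) = 0"
    and nz: "\<And>i. i \<ge> m \<Longrightarrow> 1 \<le> norm (\<rho> - of_nat (Suc i) - dot P (al d) (ga d))"
      "\<And>i. i \<ge> m \<Longrightarrow> 1 \<le> norm (\<rho> - of_nat (Suc i) - dot P (be d) (ep d))"
    and pre: "\<And>i. i \<le> m \<Longrightarrow> (\<rho> - of_nat i) * Y1 i = dot P (al d) (U i)"
      "\<And>i. i \<le> m \<Longrightarrow> (\<rho> - of_nat i) * Y2 i = dot P (be d) (U i)"
      "\<And>p. p \<in> P \<Longrightarrow> U 0 p = ga d p * Y1 0 + ep d p * Y2 0"
      "\<And>i p. i < m \<Longrightarrow> p \<in> P \<Longrightarrow> U (Suc i) p - p * U i p = ga d p * Y1 (Suc i) + ep d p * Y2 (Suc i)"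
  shows "\<exists>Z1 Z2 T R. frobenius_inf P d \<rho> Z1 Z2 T \<and> R > 0 \<and> psconv R Z1 \<and> psconv R Z2 \<and>
    (\<forall>p\<in>P. psconv R (\<lambda>i. T i p)) \<and> (\<forall>i\<le>m. T i = U i)"
proof -
  let ?e1 = "dot P (al d) (ga d)" and ?e2 = "dot P (be d) (ep d)" and ?e21 = "dot P (be d) (ga d)"
  define w where "w u p = p * u p" for u :: "complex \<Rightarrow> complex" and p
  define y1 where "y1 j u = dot P (al d) (w u) / (\<rho> - of_nat (Suc (m + j)) - ?e1)" for j :: nat and u
  define y2 where "y2 j u = (dot P (be d) (w u) + ?e21 * y1 j u) / (\<rho> - of_nat (Suc (m + j)) - ?e2)" for j :: nat and u
  define step where "step j y = (y1 j (snd (snd y)), y2 j (snd (snd y)),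
     (\<lambda>p. w (snd (snd y)) p + ga d p * y1 j (snd (snd y)) + ep d p * y2 j (snd (snd y))))" for j :: nat and y :: "complex \<times> complex \<times> (complex \<Rightarrow> complex)"
  define st where "st = rec_nat (Y1 m, Y2 m, U m) step"
  have st: "st 0 = (Y1 m, Y2 m, U m)" "st (Suc j) = step j (st j)" for j by (simp_all add: st_def)
  define Z1 where "Z1 i = (if i \<le> m then Y1 i else fst (st (i - m)))" for i
  define Z2 where "Z2 i = (if i \<le> m then Y2 i else fst (snd (st (i - m))))" for i
  define T where "T i = (if i \<le> m then U i else snd (snd (st (i - m))))" for i
  have stm: "st j = (Z1 (m + j), Z2 (m + j), T (m + j))" for j
    by (cases j) (simp_all add: Z1_def Z2_def T_def st)
  have S: "Z1 (Suc (m + j)) = y1 j (T (m + j))" "Z2 (Suc (m + j)) = y2 j (T (m + j))"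
    "T (Suc (m + j)) p = w (T (m + j)) p + ga d p * y1 j (T (m + j)) + ep d p * y2 j (T (m + j))" for j p
  proof -
    have "(Z1 (m + Suc j), Z2 (m + Suc j), T (m + Suc j)) = (y1 j (T (m + j)), y2 j (T (m + j)),
      (\<lambda>p. w (T (m + j)) p + ga d p * y1 j (T (m + j)) + ep d p * y2 j (T (m + j))))"
      unfolding stm[of "Suc j", symmetric] st(2) step_def stm[of j] by simp
    then show "Z1 (Suc (m + j)) = y1 j (T (m + j))" "Z2 (Suc (m + j)) = y2 j (T (m + j))"
      "T (Suc (m + j)) p = w (T (m + j)) p + ga d p * y1 j (T (m + j)) + ep d p * y2 j (T (m + j))"
      by (simp_all only: prod.inject add_Suc_right)
  qed
  have dT: "dot P x (T (Suc (m + j))) = dot P x (w (T (m + j))) + dot P x (ga d) * y1 j (T (m + j)) + dot P x (ep d) * y2 j (T (m + j))" for x j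
    unfolding dot_def S(3) by (simp add: ring_distribs sum.distrib sum_distrib_right mult.assoc)
  have Ynew: "(\<rho> - of_nat (Suc (m + j))) * Z1 (Suc (m + j)) = dot P (al d) (T (Suc (m + j)))"
    "(\<rho> - of_nat (Suc (m + j))) * Z2 (Suc (m + j)) = dot P (be d) (T (Suc (m + j)))" for j
  proof -
    have n1: "\<rho> - of_nat (Suc (m + j)) - ?e1 \<noteq> 0" and n2: "\<rho> - of_nat (Suc (m + j)) - ?e2 \<noteq> 0"
      using nz[of "m + j"] by auto
    have "(\<rho> - of_nat (Suc (m + j)) - ?e1) * y1 j (T (m + j)) = dot P (al d) (w (T (m + j)))"
      using n1 unfolding y1_def by simp
    then show "(\<rho> - of_nat (Suc (m + j))) * Z1 (Suc (m + j)) = dot P (al d) (T (Suc (m + j)))"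
      unfolding S dT ale by (simp only: left_diff_distrib diff_eq_eq mult_zero_left add_0_right)
    have "(\<rho> - of_nat (Suc (m + j)) - ?e2) * y2 j (T (m + j)) = dot P (be d) (w (T (m + j))) + ?e21 * y1 j (T (m + j))"
      using n2 unfolding y2_def by simp
    then show "(\<rho> - of_nat (Suc (m + j))) * Z2 (Suc (m + j)) = dot P (be d) (T (Suc (m + j)))"
      unfolding S dT by (simp only: left_diff_distrib diff_eq_eq mult_zero_left add_0_right)
  qed
  have Y: "(\<rho> - of_nat i) * Z1 i = dot P (al d) (T i) \<and> (\<rho> - of_nat i) * Z2 i = dot P (be d) (T i)" for i
  proof (cases "i \<le> m")
    case True then show ?thesis using pre(1,2)[of i] by (simp add: Z1_def Z2_def T_def)
  next
    case False
    then obtain j where j: "i = Suc (m + j)" using less_iff_Suc_add[of m i] by auto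
    show ?thesis using Ynew[of j] unfolding j by blast
  qed
  have R1: "T (Suc i) p - p * T i p = ga d p * Z1 (Suc i) + ep d p * Z2 (Suc i)" if p: "p \<in> P" for i p
  proof (cases "i < m")
    case True then show ?thesis using pre(4)[OF True p] by (simp add: T_def Z1_def Z2_def)
  next
    case False
    then obtain j where j: "i = m + j" using le_Suc_ex[of m i] by auto
    show ?thesis unfolding j S by (simp add: w_def)
  qed
  have frobenius: "frobenius_inf P d \<rho> Z1 Z2 T"
    unfolding frobenius_inf_def using Y R1 pre(3) by (auto simp: T_def Z1_def Z2_def)
  define B where "B = (\<Sum>p\<in>P. norm p)"
  define A1 where "A1 = (\<Sum>p\<in>P. norm (al d p)) * B"
  define A2 where "A2 = (\<Sum>p\<in>P. norm (be d p)) * B + norm ?e21 * A1"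
  define G where "G = (\<Sum>p\<in>P. norm (ga d p))"
  define E where "E = (\<Sum>p\<in>P. norm (ep d p))"
  define Q where "Q = 1 + (A1 + A2 + B + G * A1 + E * A2)"
  define N where "N i = norm (Z1 i) + norm (Z2 i) + (\<Sum>p\<in>P. norm (T i p))" for i
  have nn: "B \<ge> 0" "A1 \<ge> 0" "A2 \<ge> 0" "G \<ge> 0" "E \<ge> 0"
    unfolding B_def A1_def A2_def G_def E_def by (intro add_nonneg_nonneg mult_nonneg_nonneg sum_nonneg norm_ge_zero)+
  have N0: "N i \<ge> 0" for i unfolding N_def by (intro add_nonneg_nonneg sum_nonneg) auto
  have bound: "N (Suc i) \<le> Q * N i" if "i \<ge> m" for i
  proof -
    obtain j where j: "i = m + j" using le_Suc_ex[OF \<open>i \<ge> m\<close>] by auto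
    have wb: "(\<Sum>p\<in>P. norm (w (T i) p)) \<le> B * N i"
    proof -
      have t: "norm (T i p) \<le> N i" if "p \<in> P" for p
      proof -
        have "norm (T i p) \<le> (\<Sum>p\<in>P. norm (T i p))" using P that by (intro member_le_sum) auto
        then show ?thesis unfolding N_def using norm_ge_zero[of "Z1 i"] norm_ge_zero[of "Z2 i"] by linarith
      qed
      have "(\<Sum>p\<in>P. norm (w (T i) p)) \<le> (\<Sum>p\<in>P. norm p * N i)"
        unfolding w_def norm_mult using t by (intro sum_mono mult_left_mono) auto
      then show ?thesis by (simp add: B_def sum_distrib_right)
    qed
    have dw: "norm (dot P x (w (T i))) \<le> (\<Sum>p\<in>P. norm (x p)) * B * N i" for x
    proof -
      have "norm (dot P x (w (T i))) \<le> (\<Sum>p\<in>P. norm (x p)) * (\<Sum>p\<in>P. norm (w (T i) p))"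
        by (rule dot_norm_bound[OF P])
      also have "\<dots> \<le> (\<Sum>p\<in>P. norm (x p)) * (B * N i)" by (intro mult_left_mono wb sum_nonneg) auto
      finally show ?thesis by (simp add: mult.assoc)
    qed
    have dv: "norm (x / y) \<le> norm x" if "1 \<le> norm y" for x y :: complex
    proof -
      have "norm x / norm y \<le> norm x / 1" using that by (intro divide_left_mono) auto
      then show ?thesis by (simp add: norm_divide)
    qed
    have n1: "1 \<le> norm (\<rho> - of_nat (Suc (m + j)) - ?e1)" and n2: "1 \<le> norm (\<rho> - of_nat (Suc (m + j)) - ?e2)"
      using nz[of "m + j"] by auto
    have b1: "norm (y1 j (T i)) \<le> A1 * N i"
      unfolding y1_def A1_def by (rule order_trans[OF dv[OF n1] dw])
    have b2: "norm (y2 j (T i)) \<le> A2 * N i"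
    proof -
      have "norm (y2 j (T i)) \<le> norm (dot P (be d) (w (T i)) + ?e21 * y1 j (T i))"
        unfolding y2_def by (rule dv[OF n2])
      also have "\<dots> \<le> norm (dot P (be d) (w (T i))) + norm ?e21 * norm (y1 j (T i))"
        using norm_triangle_ineq by (metis norm_mult)
      also have "\<dots> \<le> (\<Sum>p\<in>P. norm (be d p)) * B * N i + norm ?e21 * (A1 * N i)"
        by (intro add_mono dw mult_left_mono b1) auto
      finally show ?thesis by (simp add: A2_def algebra_simps)
    qed
    have "(\<Sum>p\<in>P. norm (T (Suc i) p)) \<le> (\<Sum>p\<in>P. norm (w (T i) p) + norm (ga d p) * norm (y1 j (T i)) + norm (ep d p) * norm (y2 j (T i)))"
    proof (rule sum_mono)
      fix p
      have "norm (w (T i) p + ga d p * y1 j (T i) + ep d p * y2 j (T i)) \<le> norm (w (T i) p + ga d p * y1 j (T i)) + norm (ep d p * y2 j (T i))"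
        by (rule norm_triangle_ineq)
      also have "\<dots> \<le> norm (w (T i) p) + norm (ga d p * y1 j (T i)) + norm (ep d p * y2 j (T i))"
        by (intro add_right_mono norm_triangle_ineq)
      finally show "norm (T (Suc i) p) \<le> norm (w (T i) p) + norm (ga d p) * norm (y1 j (T i)) + norm (ep d p) * norm (y2 j (T i))"
        unfolding j S norm_mult .
    qed
    also have "\<dots> = (\<Sum>p\<in>P. norm (w (T i) p)) + G * norm (y1 j (T i)) + E * norm (y2 j (T i))"
      by (simp add: sum.distrib G_def E_def sum_distrib_right)
    also have "\<dots> \<le> B * N i + G * (A1 * N i) + E * (A2 * N i)"
      using nn by (intro add_mono mult_left_mono wb b1 b2) auto
    finally have "(\<Sum>p\<in>P. norm (T (Suc i) p)) \<le> B * N i + G * (A1 * N i) + E * (A2 * N i)" .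
    moreover have "norm (Z1 (Suc i)) \<le> A1 * N i" "norm (Z2 (Suc i)) \<le> A2 * N i" using b1 b2 unfolding j S by auto
    moreover have "Q * N i = N i + (A1 * N i + A2 * N i + B * N i + G * (A1 * N i) + E * (A2 * N i))"
      unfolding Q_def by (simp only: distrib_right mult_1 mult.assoc)
    ultimately show ?thesis using N0[of i] unfolding N_def[of "Suc i"] by linarith
  qed
  have "Q \<ge> 1" unfolding Q_def using nn by simp
  have "\<exists>R>0. psconv R Z1 \<and> psconv R Z2 \<and> (\<forall>p\<in>P. psconv R (\<lambda>i. T i p))"
    by (rule bounded_triple_psconv[OF P \<open>Q \<ge> 1\<close>, of m]) (rule bound[unfolded N_def])
  then obtain R where R: "R > 0" "psconv R Z1" "psconv R Z2" "\<forall>p\<in>P. psconv R (\<lambda>i. T i p)" by (elim exE conjE) (rule that)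
  have U: "\<forall>i\<le>m. T i = U i" by (simp add: T_def)
  have "frobenius_inf P d \<rho> Z1 Z2 T \<and> R > 0 \<and> psconv R Z1 \<and> psconv R Z2 \<and>
    (\<forall>p\<in>P. psconv R (\<lambda>i. T i p)) \<and> (\<forall>i\<le>m. T i = U i)"
    by (rule conjI[OF frobenius conjI[OF R(1) conjI[OF R(2) conjI[OF R(3) conjI[OF R(4) U]]]]])
  then show ?thesis by - (rule exI[where x = Z1], rule exI[where x = Z2], rule exI[where x = T], rule exI[where x = R], assumption)
qed

lemma psconv_mono: "psconv R Y \<Longrightarrow> R' \<le> R \<Longrightarrow> psconv R' Y"
  unfolding psconv_def by (meson ereal_less_eq(3) order_trans)

lemma twisted_ode_cong:
  assumes "open \<Omega>" "z \<in> \<Omega>" "\<And>w. w \<in> \<Omega> \<Longrightarrow> E w = E' w"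
  shows "twisted_ode D E f z \<longleftrightarrow> twisted_ode D E' f z"
proof -
  have "\<forall>\<^sub>F w in nhds z. E w = E' w"
    using eventually_nhds_in_open[OF assms(1,2)] by (rule eventually_mono) (rule assms(3))
  then have "deriv E z = deriv E' z" by (rule deriv_cong_ev) simp
  then show ?thesis using assms(2,3) by (simp add: twisted_ode_def)
qed

lemma small_radius:
  fixes a :: complex
  assumes "finite S" "R > 0"
  shows "\<exists>r. 0 < r \<and> r < R \<and> cball a r \<inter> S \<subseteq> {a}"
proof -
  obtain d where d: "d > 0" "\<forall>x\<in>S. x \<noteq> a \<longrightarrow> d \<le> dist a x" using finite_set_avoid[OF assms(1)] by blast
  have "cball a (min d R / 2) \<inter> S \<subseteq> {a}" using d by fastforce
  then show ?thesis using d assms(2) by (intro exI[of _ "min d R / 2"]) auto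
qed

text \<open>\<open>U\<close> counts with one more factor z - a than \<open>u\<close>, whence the
  shift of the index; the clause on \<open>U 0\<close> becomes the relation at k = -1.\<close>

lemma frobenius_laurent_rel:
  assumes "frobenius P d a \<rho> Y1 Y2 U"
  shows "laurent_rel P d a \<rho> (\<lambda>k. if k < 0 then 0 else Y1 (nat k)) (\<lambda>k. if k < 0 then 0 else Y2 (nat k))
    (\<lambda>k p. if k < -1 then 0 else U (nat (k + 1)) p)"
proof -
  have F: "(of_nat i + \<rho>) * Y1 i = dot P (al d) (U i)" "(of_nat i + \<rho>) * Y2 i = dot P (be d) (U i)"
    "p \<in> P \<Longrightarrow> (a - p) * U 0 p = 0" "p \<in> P \<Longrightarrow> U i p + (a - p) * U (Suc i) p = ga d p * Y1 i + ep d p * Y2 i" for i p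
    using assms unfolding frobenius_def by blast+
  have 1: "(of_int k + \<rho>) * (if k < 0 then 0 else Y1 (nat k)) = dot P (al d) (\<lambda>p. if k - 1 < -1 then 0 else U (nat (k - 1 + 1)) p) \<and>
    (of_int k + \<rho>) * (if k < 0 then 0 else Y2 (nat k)) = dot P (be d) (\<lambda>p. if k - 1 < -1 then 0 else U (nat (k - 1 + 1)) p)" for k :: int
  proof (cases "k < 0")
    case True then show ?thesis by (simp add: dot_def)
  next
    case False
    then obtain i where "k = int i" using nonneg_int_cases[of k] by auto
    then show ?thesis using F(1,2)[of i] by simp
  qed
  have 2: "(if k - 1 < -1 then 0 else U (nat (k - 1 + 1)) p) + (a - p) * (if k < -1 then 0 else U (nat (k + 1)) p)
    = ga d p * (if k < 0 then 0 else Y1 (nat k)) + ep d p * (if k < 0 then 0 else Y2 (nat k))" if p: "p \<in> P" for k :: int and p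
  proof (cases "k < 0")
    case True
    show ?thesis
    proof (cases "k = -1")
      case True then show ?thesis using F(3)[OF p] by simp
    next
      case False then show ?thesis using \<open>k < 0\<close> by simp
    qed
  next
    case False
    then obtain i where i: "k = int i" using nonneg_int_cases[of k] by auto
    have "nat (k + 1) = Suc i" by (simp add: i nat_add_distrib)
    then show ?thesis using F(4)[OF p, of i] by (simp add: i)
  qed
  show ?thesis unfolding laurent_rel_def using 1 2 by blast
qed

lemma frobenius_top:
  assumes F: "frobenius P d a \<rho> Y1 Y2 U" and N: "\<forall>i>N. \<forall>p\<in>P. U i p = 0"
    and ale: "dot P (al d) (ep d) = 0" and nz: "\<exists>i. Y1 i \<noteq> 0 \<or> Y2 i \<noteq> 0"
  shows "\<exists>m. (Y1 m \<noteq> 0 \<or> Y2 m \<noteq> 0) \<and> (\<forall>i>m. \<forall>p\<in>P. U i p = 0) \<and>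
    (of_nat m + \<rho> = dot P (al d) (ga d) \<or> of_nat m + \<rho> = dot P (be d) (ep d))"
proof -
  let ?Y = "\<lambda>Y k. if k < 0 then 0 else Y (nat k)" and ?u = "\<lambda>k p. if k < -1 then 0 else U (nat (k + 1)) p"
  have K: "?u k p = 0" if "k \<ge> int N" "p \<in> P" for k p using that N by auto
  have n: "\<exists>k::int. ?Y Y1 k \<noteq> 0 \<or> ?Y Y2 k \<noteq> 0"
  proof -
    obtain i where "Y1 i \<noteq> 0 \<or> Y2 i \<noteq> 0" using nz by blast
    then show ?thesis by (intro exI[of _ "int i"]) simp
  qed
  obtain k where k: "?Y Y1 k \<noteq> 0 \<or> ?Y Y2 k \<noteq> 0" "\<forall>j\<ge>k. \<forall>p\<in>P. ?u j p = 0"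
    "of_int k + \<rho> = dot P (al d) (ga d) \<or> of_int k + \<rho> = dot P (be d) (ep d)"
    using laurent_rel_top[OF frobenius_laurent_rel[OF F] K ale n] by metis
  have k0: "k \<ge> 0" using k(1) by (cases "k < 0") auto
  have "U i p = 0" if "i > nat k" "p \<in> P" for i p
  proof -
    have "k \<le> int i - 1" using that k0 by linarith
    then have "?u (int i - 1) p = 0" using k(2) that by blast
    then show ?thesis using that k0 by simp
  qed
  then show ?thesis using k(1,3) k0 by (intro exI[of _ "nat k"]) auto
qed

section \<open>Apparent singularities of the transformed equation\<close>

context mc_pair
begin

text \<open>The single-valued \<open>W\<close> supplies the twist by the \<tau>' p at the price of
  an extra \<open>e0 / (z - a)\<close>, which is subtracted from the exponent \<rho>.\<close>

lemma scalar_monodromy: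
  fixes f g :: "2 \<Rightarrow> complex \<Rightarrow> complex"
  assumes r: "r > 0" and \<sigma>: "\<sigma> = 1 \<or> \<sigma> = -1"
    and \<Omega>: "open \<Omega>" "sphere a r \<subseteq> \<Omega>" "a \<notin> \<Omega>" "\<Omega> \<inter> ode_sing D' = {}"
    and W: "W holomorphic_on \<Omega>" "\<And>z. z \<in> \<Omega> \<Longrightarrow> W z \<noteq> 0"
      "\<And>z. z \<in> \<Omega> \<Longrightarrow> deriv W z = (e0 / (z - a) + (\<Sum>p\<in>P. \<tau>' p / (z - p))) * W z"
    and fg: "\<And>j. f j holomorphic_on \<Omega>" "\<And>j. g j holomorphic_on \<Omega>"
      "\<And>j z. z \<in> \<Omega> \<Longrightarrow> pole_system P td (\<lambda>z. \<rho> / (z - a)) (f j) (g j) z"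
    and ind: "\<And>k j. \<forall>\<^sub>F z in nhds (a + of_real r). (\<Sum>j\<in>UNIV. k j * f j z) = 0 \<Longrightarrow> k j = 0"
  shows "monodromy_matrix D' (\<lambda>s. a + circ r \<sigma> s) (mat (exp (2 * of_real pi * \<i> * of_real \<sigma> * (\<rho> - e0))))"
proof (rule monodromy_scalarI[where f = f and \<Omega> = \<Omega> and W = W])
  fix j z assume z: "z \<in> \<Omega>"
  have hE: "(\<lambda>z. \<rho> / (z - a)) holomorphic_on \<Omega>" using \<Omega>(3) by (intro holomorphic_intros) auto
  have "twisted_ode D' (\<lambda>z. \<rho> / (z - a) + (\<Sum>p\<in>P. \<tau>' p / (z - p))) (f j) z"
    by (rule D'(3)[unfolded system_to_ode_def, THEN conjunct2, rule_format, OF \<Omega>(1,4) hE fg(1,2) _ z]) (use fg(3) in blast)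
  moreover have "\<rho> / (w - a) + (\<Sum>p\<in>P. \<tau>' p / (w - p)) = (\<rho> - e0) / (w - a) + deriv W w / W w" if "w \<in> \<Omega>" for w
    using W(2)[OF that] unfolding W(3)[OF that] by (simp add: diff_divide_distrib)
  ultimately show "twisted_ode D' (\<lambda>z. (\<rho> - e0) / (z - a) + deriv W z / W z) (f j) z"
    using twisted_ode_cong[OF \<Omega>(1) z, of "\<lambda>z. \<rho> / (z - a) + (\<Sum>p\<in>P. \<tau>' p / (z - p))" "\<lambda>z. (\<rho> - e0) / (z - a) + deriv W z / W z"]
    by simp
next
  show "k j = 0" if "\<forall>\<^sub>F z in nhds (a + of_real r). (\<Sum>j\<in>UNIV. k j * f j z) = 0" for k j
    by (rule ind[OF that])
qed (use r \<sigma> \<Omega> W fg in auto)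

text \<open>The transformed system has the integral exponents n and 0 at \<open>a\<close>. The given
  solution, rescaled, is a start at n, and it can be continued past the resonant index without a
  logarithm because the given sequence stops exactly there. Together with a solution that starts at
  the exponent 0 it forms a basis with one common multiplier.\<close>

theorem local_backward:
  assumes a: "a \<in> P" and V: "vmat d a a = of_int n - \<kappa>"
    and F: "frobenius P d a (of_int n - \<kappa>) Y1 Y2 U" "\<forall>i>N. \<forall>p\<in>P. U i p = 0" "\<exists>i. Y1 i \<noteq> 0 \<or> Y2 i \<noteq> 0"
    and e: "(dot P (al d) (ga d) = - \<kappa> \<and> dot P (be d) (ep d) + \<kappa> \<notin> \<int>) \<or>
      (dot P (be d) (ep d) = - \<kappa> \<and> dot P (al d) (ga d) + \<kappa> \<notin> \<int>)"
    and inj: "\<And>A B. (\<And>p. p \<in> P \<Longrightarrow> ga td p * A + ep td p * B = 0) \<Longrightarrow> A = 0 \<and> B = 0"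
    and ept: "ep td a \<noteq> 0"
  shows "apparent_at D' a"
proof -
  define \<rho> where "\<rho> = of_int n - \<kappa>"
  note F1 = F(1)[folded \<rho>_def]
  have \<rho>i: "of_nat i + \<rho> = of_int (int i + n) - \<kappa>" for i by (simp add: \<rho>_def)
  have \<rho>nz: "of_nat i + \<rho> \<noteq> 0" for i unfolding \<rho>i by (rule of_int_kappa_nz)
  have frobenius: "(of_nat i + \<rho>) * Y1 i = dot P (al d) (U i)" "(of_nat i + \<rho>) * Y2 i = dot P (be d) (U i)"
    "p \<in> P \<Longrightarrow> (a - p) * U 0 p = 0" "p \<in> P \<Longrightarrow> U i p + (a - p) * U (Suc i) p = ga d p * Y1 i + ep d p * Y2 i" for i p
    using F1 unfolding frobenius_def by blast+
  obtain m where m': "\<forall>i>m. \<forall>p\<in>P. U i p = 0"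
    "of_nat m + \<rho> = dot P (al d) (ga d) \<or> of_nat m + \<rho> = dot P (be d) (ep d)"
    using frobenius_top[OF F1 F(2) ale(1) F(3)] by (elim exE conjE) (rule that)
  then have m: "\<And>i p. i > m \<Longrightarrow> p \<in> P \<Longrightarrow> U i p = 0" by blast
  have i: "of_nat m + of_int n \<in> (\<int> :: complex set)" by simp
  \<comment> \<open>The given solution stops at an eigenvalue of the residue sum that lies in -
    \<kappa> + \<int>. By \<open>e\<close> this can only be - \<kappa> itself, so m + n = 0.\<close>
  have mn: "int m = - n"
  proof -
    have "dot P (al d) (ga d) + \<kappa> = of_nat m + of_int n \<or> dot P (be d) (ep d) + \<kappa> = of_nat m + of_int n"
      using m'(2) unfolding \<rho>_def by (auto simp: algebra_simps)
    then have "of_nat m + of_int n = (0 :: complex)" using e i by auto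
    then have "complex_of_int (int m) = of_int (- n)" by (simp add: eq_neg_iff_add_eq_0)
    then show ?thesis by (simp only: of_int_eq_iff)
  qed
  have nm: "of_nat m + of_int n = (0 :: complex)" using arg_cong[OF mn, of complex_of_int] by simp
  have R: "(of_nat i + \<rho>) * (U i p + (a - p) * U (Suc i) p) = dot P (vmat d p) (U i)" if "p \<in> P" for i p
    unfolding frobenius(4)[OF that] dot_vmat frobenius(1,2)[symmetric] by algebra
  have U0: "U 0 p = 0" if "p \<in> P" "p \<noteq> a" for p using frobenius(3)[OF that(1)] that(2) by simp
  \<comment> \<open>Without this lowest coefficient no later index meets an exponent, and the whole
    solution would vanish.\<close>
  have U0a: "U 0 a \<noteq> 0"
  proof
    assume z: "U 0 a = 0"
    have 0: "(if k < -1 then 0 else U (nat (k + 1)) p) = 0" if "k \<le> -1" "p \<in> P" for k p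
      using that z U0 by (cases "p = a") auto
    have uz: "(if k < -1 then 0 else U (nat (k + 1)) p) = 0" if "p \<in> P" for k p
    proof (rule laurent_rel_zero_up[OF frobenius_laurent_rel[OF F1] finP a 0 _ _ that])
      have "of_int k + \<rho> = of_int (k + n) - \<kappa>" for k by (simp add: \<rho>_def)
      then show "of_int k + \<rho> \<noteq> 0" for k by (simp only: of_int_kappa_nz not_False_eq_True)
      show "of_int k + 1 + \<rho> \<noteq> vmat d a a" if "k > -1" for k
      proof -
        have "complex_of_int (k + 1) \<noteq> 0" using that by (subst of_int_eq_0_iff) simp
        then show ?thesis unfolding V \<rho>_def by simp
      qed
    qed auto
    have "U i p = 0" if "p \<in> P" for i p using uz[OF that, of "int i - 1"] by simp
    then have "(of_nat i + \<rho>) * Y1 i = 0" "(of_nat i + \<rho>) * Y2 i = 0" for i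
      unfolding frobenius(1,2) by (simp_all add: dot_def)
    then show False using F(3) \<rho>nz by simp
  qed
  \<comment> \<open>The rescaling from the exponent n - \<kappa> to n. The denominators n + l are
    negative for l < m; the next one would be 0, which is the resonance.\<close>
  define G where "G i = (\<Prod>l<i. (of_int (n + int l) - \<kappa>) / (of_int (n + int l) :: complex))" for i :: nat
  have GS: "G (Suc i) * of_int (n + int i) = G i * (of_nat i + \<rho>)" if "i < m" for i
  proof -
    have "complex_of_int (n + int i) \<noteq> 0" using that mn by (subst of_int_eq_0_iff) simp
    then show ?thesis unfolding \<rho>i G_def by (simp del: of_int_add add: add.commute)
  qed
  define T where "T i p = G i * U i p" for i p
  have dT: "dot P x (T i) = G i * dot P x (U i)" for x i
    by (simp add: T_def dot_def sum_distrib_left mult_ac)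
  have dVt: "dot P (vmat td p) (T i) = G i * ((of_nat i + \<rho>) * (U i p + (a - p) * U (Suc i) p) + \<kappa> * U i p)" if "p \<in> P" for i p
    unfolding dot_Vt[OF that] dT R[OF that] by (simp add: T_def algebra_simps)
  \<comment> \<open>Compatibility at the resonant index: as \<open>U (Suc m)\<close> vanishes and m
    + \<rho> = - \<kappa>, the vector \<open>T m\<close> is killed by V + \<kappa>, and by
    \<open>inj\<close> already by \<open>al td\<close> and \<open>be td\<close>.\<close>
  have BU: "dot P (al td) (T m) = 0" "dot P (be td) (T m) = 0"
  proof -
    have "ga td p * dot P (al td) (T m) + ep td p * dot P (be td) (T m) = 0" if p: "p \<in> P" for p
    proof -
      have "of_nat m + \<rho> = - \<kappa>" using mn by (simp add: \<rho>_def add_diff_eq nm)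
      then show ?thesis using m[of "Suc m" p] p unfolding dot_vmat[symmetric] dVt[OF p] by simp
    qed
    from inj[OF this] show "dot P (al td) (T m) = 0" "dot P (be td) (T m) = 0" by auto
  qed
  have T0: "dot P x (T 0) = x a * U 0 a" for x
    unfolding dot_def using U0 finP a by (subst sum.remove[OF finP a]) (auto simp: T_def G_def)
  \<comment> \<open>For m = 0 the compatibility just shown would concern the lowest coefficient and
    make it vanish. So the two starting indices 0 and m are different.\<close>
  have m1: "m \<ge> 1"
  proof (rule ccontr)
    assume "\<not> m \<ge> 1"
    then have "m = 0" by simp
    then have "al td a * U 0 a = 0" using BU(1) unfolding T0[symmetric] by simp
    then show False using alt_nz[OF a] U0a by simp
  qed
  define Z where "Z x i = (if i < m then dot P x (T i) / of_int (n + int i) else 0)" for x i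
  define Z2 where "Z2 i = (if i = m then T m a / ep td a else Z (be td) i)" for i
  have Vt_aa: "vmat td a a = of_int n" using Vt[OF a a] V by simp
  have nz: "of_int (n + int i) \<noteq> (0 :: complex)" if "i < m" for i
    using that mn by (subst of_int_eq_0_iff) simp
  have ni: "of_nat i + of_int n = (of_int (n + int i) :: complex)" for i by simp
  have "\<exists>X1 X2 S R. frobenius P td a (of_int n) X1 X2 S \<and> R > 0 \<and> psconv R X1 \<and> psconv R X2 \<and>
    (\<forall>p\<in>P. psconv R (\<lambda>i. S i p)) \<and> (\<forall>i\<le>m. X1 i = Z (al td) i \<and> X2 i = Z2 i)"
  proof (rule frobenius_extend[OF finP a Vt_aa mn])
    show "(of_nat i + of_int n) * Z (al td) i = dot P (al td) (T i)" if "i \<le> m" for i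
      using that BU(1) nz[of i] nm unfolding ni by (cases "i = m") (auto simp: Z_def)
    show "(of_nat i + of_int n) * Z2 i = dot P (be td) (T i)" if "i \<le> m" for i
      using that BU(2) nz[of i] nm unfolding ni by (cases "i = m") (auto simp: Z_def Z2_def)
    show "(a - p) * T 0 p = 0" if "p \<in> P" for p using frobenius(3)[OF that] by (simp add: T_def G_def)
    show "T m a = ga td a * Z (al td) m + ep td a * Z2 m" using ept by (simp add: Z_def Z2_def)
    show "T i p + (a - p) * T (Suc i) p = ga td p * Z (al td) i + ep td p * Z2 i" if i: "i < m" and p: "p \<in> P" for i p
    proof -
      have "of_int (n + int i) * (ga td p * Z (al td) i + ep td p * Z2 i) = dot P (vmat td p) (T i)"
        unfolding dot_vmat using i nz[OF i] by (simp add: Z_def Z2_def distrib_left del: of_int_add)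
      also have "\<dots> = of_int (n + int i) * (G i * U i p) + G i * (of_nat i + \<rho>) * ((a - p) * U (Suc i) p)"
        unfolding dVt[OF p] by (simp add: \<rho>_def algebra_simps)
      also have "\<dots> = of_int (n + int i) * (T i p + (a - p) * T (Suc i) p)"
        unfolding GS[OF i, symmetric] T_def by algebra
      finally show ?thesis using nz[OF i] by (simp del: of_int_add)
    qed
  qed
  then obtain X1 X2 S R where X: "frobenius P td a (of_int n) X1 X2 S" "R > 0" "psconv R X1" "psconv R X2"
    "\<forall>p\<in>P. psconv R (\<lambda>i. S i p)" "\<forall>i\<le>m. X1 i = Z (al td) i \<and> X2 i = Z2 i" by (elim exE conjE) (rule that)
  \<comment> \<open>The second solution starts at index m, that is at the exponent 0, with the
    vector that is killed by the row at \<open>a\<close>.\<close>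
  have "\<exists>X1 X2 S R. frobenius P td a (of_int n) X1 X2 S \<and> R > 0 \<and> psconv R X1 \<and> psconv R X2 \<and>
    (\<forall>p\<in>P. psconv R (\<lambda>i. S i p)) \<and> (\<forall>i\<le>m. X1 i = (if i = m then ep td a else 0) \<and> X2 i = (if i = m then - ga td a else 0))"
    by (rule frobenius_extend[OF finP a Vt_aa mn, where U = "\<lambda>i p. 0"]) (use nm in \<open>auto simp: dot_def\<close>)
  then obtain X1' X2' S' R' where X': "frobenius P td a (of_int n) X1' X2' S'" "R' > 0" "psconv R' X1'" "psconv R' X2'"
    "\<forall>p\<in>P. psconv R' (\<lambda>i. S' i p)" "\<forall>i\<le>m. X1' i = (if i = m then ep td a else 0) \<and> X2' i = (if i = m then - ga td a else 0)"
    by (elim exE conjE) (rule that)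
  have X10: "X1 0 \<noteq> 0"
    using X(6)[rule_format, of 0] m1 T0[of "al td"] alt_nz[OF a] U0a nz[of 0] by (simp add: Z_def)
  define R0 where "R0 = min R R'"
  have R0: "R0 > 0" "R0 \<le> R" "R0 \<le> R'" using X(2) X'(2) by (auto simp: R0_def)
  obtain r where r: "r > 0" "r < R0" "cball a r \<inter> ode_sing D' \<subseteq> {a}"
    using small_radius[OF D'(1) R0(1)] by blast
  have rp: "r < dist a p" if "p \<in> P" "p \<noteq> a" for p
  proof (rule ccontr)
    assume "\<not> r < dist a p"
    then have "p \<in> cball a r \<inter> ode_sing D'" using that D'(2) by auto
    then show False using r(3) that by auto
  qed
  have sph: "sphere a r \<inter> ode_sing D' = {}" using r(1,3) by auto
  obtain \<Omega> W where W: "open \<Omega>" "sphere a r \<subseteq> \<Omega>" "a \<notin> \<Omega>" "\<Omega> \<inter> ode_sing D' = {}"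
    "W holomorphic_on \<Omega>" "\<And>z. z \<in> \<Omega> \<Longrightarrow> W z \<noteq> 0"
    "\<And>z. z \<in> \<Omega> \<Longrightarrow> deriv W z = (- \<tau>' a / (z - a) + (\<Sum>p\<in>P. \<tau>' p / (z - p))) * W z"
    using local_gauge[OF finP a r(1) rp D'(1,2) sph, of \<tau>'] by blast
  let ?\<Omega> = "\<Omega> \<inter> ball a R0"
  define f :: "2 \<Rightarrow> complex \<Rightarrow> complex" where "f j = (if j = 1 then (\<lambda>z. psum X1 (z - a)) else (\<lambda>z. psum X1' (z - a)))" for j
  define g :: "2 \<Rightarrow> complex \<Rightarrow> complex" where "g j = (if j = 1 then (\<lambda>z. psum X2 (z - a)) else (\<lambda>z. psum X2' (z - a)))" for j
  have ps: "psconv R0 X1" "psconv R0 X2" "psconv R0 X1'" "psconv R0 X2'"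
    "\<And>p. p \<in> P \<Longrightarrow> psconv R0 (\<lambda>i. S i p)" "\<And>p. p \<in> P \<Longrightarrow> psconv R0 (\<lambda>i. S' i p)"
    using X(3,4) X(5)[rule_format] X'(3,4) X'(5)[rule_format] R0 by (blast intro: psconv_mono)+
  have hol: "(\<lambda>z. psum Y (z - a)) holomorphic_on ?\<Omega>" if "psconv R0 Y" for Y
  proof -
    have "psum Y \<circ> (\<lambda>z. z - a) holomorphic_on ?\<Omega>"
      by (rule holomorphic_on_compose_gen[OF _ psum_holomorphic[OF that]])
        (auto intro!: holomorphic_intros simp: dist_norm norm_minus_commute)
    then show ?thesis by (simp add: o_def)
  qed
  have "monodromy_matrix D' (\<lambda>s. a + circ r 1 s) (mat (exp (2 * of_real pi * \<i> * of_real 1 * (of_int n - - \<tau>' a))))"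
  proof (rule scalar_monodromy[OF r(1) _ _ _ _ _ _ _ _ , where f = f and g = g and \<Omega> = ?\<Omega> and W = W])
    show "open ?\<Omega>" using W(1) by blast
    show "sphere a r \<subseteq> ?\<Omega>" using W(2) r(2) by auto
    show "W holomorphic_on ?\<Omega>" using W(5) by (rule holomorphic_on_subset) blast
    show "f j holomorphic_on ?\<Omega>" "g j holomorphic_on ?\<Omega>" for j
      unfolding f_def g_def using hol ps by auto
    show "pole_system P td (\<lambda>z. of_int n / (z - a)) (f j) (g j) z" if z: "z \<in> ?\<Omega>" for j z
    proof -
      have z': "norm (z - a) < R0" "z \<noteq> a" "z \<notin> P"
        using z W(3,4) D'(2) by (auto simp: dist_norm norm_minus_commute)
      show ?thesis
        using frobenius_pole_system[OF X(1) ps(1,2,5) z'] frobenius_pole_system[OF X'(1) ps(3,4,6) z'] by (simp add: f_def g_def)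
    qed
    show "k j = 0" if ev: "\<forall>\<^sub>F z in nhds (a + of_real r). (\<Sum>j\<in>UNIV. k j * f j z) = 0" for k j
    proof -
      let ?Y = "\<lambda>i. k 1 * X1 i + k 2 * X1' i"
      have rr: "norm (complex_of_real r) < R0" using r(1,2) by simp
      have "filterlim (\<lambda>w. a + w) (nhds (a + of_real r)) (nhds (of_real r :: complex))"
        by (intro tendsto_intros filterlim_ident)
      from eventually_compose_filterlim[OF ev this]
      have "\<forall>\<^sub>F w in nhds (of_real r). k 1 * psum X1 w + k 2 * psum X1' w = 0"
        by (simp add: sum_2 f_def)
      moreover have "\<forall>\<^sub>F w in nhds (of_real r). w \<in> ball (0::complex) R0"
        using rr by (intro eventually_nhds_in_open) auto
      ultimately have "\<forall>\<^sub>F w in nhds (of_real r). psum ?Y w = 0"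
        by eventually_elim (simp add: psum_lincomb(2)[OF ps(1,3)])
      from psum_eq_0_imp[OF psum_lincomb(1)[OF ps(1,3)] rr this]
      have z: "k 1 * X1 i + k 2 * X1' i = 0" for i by simp
      have "X1' 0 = 0" using X'(6)[rule_format, of 0] m1 by simp
      then have k1: "k 1 = 0" using z[of 0] X10 by simp
      then have "k 2 = 0" using z[of m] X'(6)[rule_format, of m] ept by simp
      then show ?thesis using k1 exhaust_2[of j] by auto
    qed
  qed (use W in auto)
  then show ?thesis unfolding apparent_at_def circlepath_eq_circ using r(1,3) by blast
qed

end

lemma psum_zero: "psum (\<lambda>_. 0) x = 0"
proof -
  have "Abs_fps (\<lambda>_. 0) = (0 :: complex fps)" by (rule fps_ext) simp
  then show ?thesis by (simp add: psum_def)
qed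

lemma frobenius_inf_lincomb:
  assumes "frobenius_inf P d \<rho> Y1 Y2 U" "frobenius_inf P d \<rho> Y1' Y2' U'"
  shows "frobenius_inf P d \<rho> (\<lambda>i. k * Y1 i + k' * Y1' i) (\<lambda>i. k * Y2 i + k' * Y2' i) (\<lambda>i p. k * U i p + k' * U' i p)"
proof -
  have F: "(\<rho> - of_nat i) * Y1 i = dot P (al d) (U i)" "(\<rho> - of_nat i) * Y2 i = dot P (be d) (U i)"
    "p \<in> P \<Longrightarrow> U 0 p = ga d p * Y1 0 + ep d p * Y2 0"
    "p \<in> P \<Longrightarrow> U (Suc i) p - p * U i p = ga d p * Y1 (Suc i) + ep d p * Y2 (Suc i)"
    "(\<rho> - of_nat i) * Y1' i = dot P (al d) (U' i)" "(\<rho> - of_nat i) * Y2' i = dot P (be d) (U' i)"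
    "p \<in> P \<Longrightarrow> U' 0 p = ga d p * Y1' 0 + ep d p * Y2' 0"
    "p \<in> P \<Longrightarrow> U' (Suc i) p - p * U' i p = ga d p * Y1' (Suc i) + ep d p * Y2' (Suc i)" for i p
    using assms unfolding frobenius_inf_def by blast+
  have d: "dot P x (\<lambda>p. k * U i p + k' * U' i p) = k * dot P x (U i) + k' * dot P x (U' i)" for x i
    by (simp add: dot_def sum.distrib sum_distrib_left algebra_simps)
  have 1: "(\<rho> - of_nat i) * (k * Y1 i + k' * Y1' i) = dot P (al d) (\<lambda>p. k * U i p + k' * U' i p)"
    "(\<rho> - of_nat i) * (k * Y2 i + k' * Y2' i) = dot P (be d) (\<lambda>p. k * U i p + k' * U' i p)" for i
    unfolding d F(1,2,5,6)[symmetric] by algebra+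
  have 2: "k * U (Suc i) p + k' * U' (Suc i) p - p * (k * U i p + k' * U' i p)
     = ga d p * (k * Y1 (Suc i) + k' * Y1' (Suc i)) + ep d p * (k * Y2 (Suc i) + k' * Y2' (Suc i))" if "p \<in> P" for i p
  proof -
    have "k * U (Suc i) p + k' * U' (Suc i) p - p * (k * U i p + k' * U' i p)
      = k * (U (Suc i) p - p * U i p) + k' * (U' (Suc i) p - p * U' i p)" by algebra
    then show ?thesis unfolding F(4,8)[OF that] by algebra
  qed
  have 3: "k * U 0 p + k' * U' 0 p = ga d p * (k * Y1 0 + k' * Y1' 0) + ep d p * (k * Y2 0 + k' * Y2' 0)" if "p \<in> P" for p
    unfolding F(3,7)[OF that] by algebra
  show ?thesis unfolding frobenius_inf_def using 1 2 3 by blast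
qed

context mc_pair
begin

text \<open>Read from the top, the polynomial solution is a series in 1/z: \<open>U k\<close> moves
  to index m - k and is rescaled by \<open>g\<close>. At index m the rescaling would divide by 0; a
  vector \<open>v\<close> with prescribed products takes that place. The choice s = 1 continues the
  given solution, and s = 0 with \<open>v\<close> in the kernel gives a second one that starts at
  the lower exponent \<kappa>.\<close>

theorem infinity_backward:
  assumes F: "frobenius P d 0 0 Y1 Y2 U" "\<forall>i>N. \<forall>p\<in>P. U i p = 0" "\<exists>i. Y1 i \<noteq> 0 \<or> Y2 i \<noteq> 0"
      "\<And>p. p \<in> P \<Longrightarrow> U 0 p = 0"
    and e: "(dot P (al d) (ga d) = of_nat m \<and> dot P (be d) (ep d) \<notin> \<int>) \<or>
      (dot P (be d) (ep d) = of_nat m \<and> dot P (al d) (ga d) \<notin> \<int>)"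
    and e': "(dot P (al td) (ga td) = of_nat m + \<kappa> \<and> dot P (be td) (ep td) = \<kappa>) \<or>
      (dot P (be td) (ep td) = of_nat m + \<kappa> \<and> dot P (al td) (ga td) = \<kappa>)"
    and surj: "\<And>A B. \<exists>v. dot P (al d) v = A \<and> dot P (be d) v = B"
    and ker: "\<exists>v. dot P (al d) v = 0 \<and> dot P (be d) v = 0 \<and> (\<exists>p\<in>P. v p \<noteq> 0)"
  shows "apparent_at_infinity D'"
proof -
  have frobenius: "of_nat i * Y1 i = dot P (al d) (U i)" "of_nat i * Y2 i = dot P (be d) (U i)"
    "p \<in> P \<Longrightarrow> U i p - p * U (Suc i) p = ga d p * Y1 i + ep d p * Y2 i" for i p
    using F(1) unfolding frobenius_def by simp_all
  obtain m' where m': "Y1 m' \<noteq> 0 \<or> Y2 m' \<noteq> 0" "\<forall>i>m'. \<forall>p\<in>P. U i p = 0"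
    "of_nat m' + 0 = dot P (al d) (ga d) \<or> of_nat m' + 0 = dot P (be d) (ep d)"
    using frobenius_top[OF F(1) F(2) ale(1) F(3)] by (elim exE conjE) (rule that)
  have "complex_of_nat m' = of_nat m" using m'(3) e by (auto simp: Ints_of_nat dest: sym)
  then have "m' = m" by (simp only: of_nat_eq_iff)
  with m' have m: "Y1 m \<noteq> 0 \<or> Y2 m \<noteq> 0" "\<And>i p. i > m \<Longrightarrow> p \<in> P \<Longrightarrow> U i p = 0" by auto
  have R: "of_nat i * (U i p - p * U (Suc i) p) = dot P (vmat d p) (U i)" if "p \<in> P" for i p
    unfolding frobenius(3)[OF that] dot_vmat frobenius(1,2)[symmetric] by algebra
  obtain v1 where v1: "dot P (al d) v1 = \<kappa> * 1 * Y1 0" "dot P (be d) v1 = \<kappa> * 1 * Y2 0" using surj by blast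
  obtain v0 p0 where v0: "dot P (al d) v0 = \<kappa> * 0 * Y1 0" "dot P (be d) v0 = \<kappa> * 0 * Y2 0" "p0 \<in> P" "v0 p0 \<noteq> 0"
    using ker by (metis mult_zero_left mult_zero_right)
  have knz: "of_nat k + \<kappa> \<noteq> 0" for k :: nat using of_int_kappa_nz(1)[of "int k"] by simp
  have k0: "\<kappa> \<noteq> 0" using knz[of 0] by simp
  define g where "g k = (\<Prod>l\<in>{1..<k}. of_nat l / (of_nat l + \<kappa>))" for k :: nat
  have gS: "g (Suc k) * (of_nat k + \<kappa>) = g k * of_nat k" if "k \<ge> 1" for k
    using that knz[of k] by (simp add: g_def prod.atLeastLessThan_Suc)
  have gnz: "g k \<noteq> 0" for k unfolding g_def using knz by (subst prod_zero_iff) auto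
  have g1: "g (Suc 0) = 1" by (simp add: g_def)
  define \<rho> where "\<rho> = of_nat m + \<kappa>"
  define T where "T s v i p = (if i < m then s * g (m - i) * U (m - i) p else v p)" for s :: complex and v :: "complex \<Rightarrow> complex" and i p
  have ext: "\<exists>Z1 Z2 S R. frobenius_inf P td \<rho> Z1 Z2 S \<and> R > 0 \<and> psconv R Z1 \<and> psconv R Z2 \<and>
      (\<forall>p\<in>P. psconv R (\<lambda>i. S i p)) \<and> (\<forall>i\<le>m. S i = T s v i)"
    if v: "dot P (al d) v = \<kappa> * s * Y1 0" "dot P (be d) v = \<kappa> * s * Y2 0" for s v
  proof -
    define X where "X x i = dot P x (T s v i) / (\<rho> - of_nat i)" for x i
    have \<rho>i: "\<rho> - of_nat i = of_nat (m - i) + \<kappa>" if "i \<le> m" for i using that by (simp add: \<rho>_def of_nat_diff)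
    have \<rho>nz: "\<rho> - of_nat i \<noteq> 0" if "i \<le> m" for i unfolding \<rho>i[OF that] by (rule knz)
    have CX: "ga td p * X (al td) i + ep td p * X (be td) i = T s v i p - p * (if i = 0 then 0 else T s v (i - 1) p)"
      if i: "i \<le> m" and p: "p \<in> P" for i p
    proof -
      have "(\<rho> - of_nat i) * (ga td p * X (al td) i + ep td p * X (be td) i) = dot P (vmat td p) (T s v i)"
        unfolding dot_vmat X_def using \<rho>nz[OF i] by (simp add: distrib_left)
      also have "\<dots> = dot P (vmat d p) (T s v i) + \<kappa> * T s v i p" by (rule dot_Vt[OF p])
      also have "\<dots> = (\<rho> - of_nat i) * (T s v i p - p * (if i = 0 then 0 else T s v (i - 1) p))"
      proof (cases "i = m")
        case True
        have Ti: "T s v i = v" by (rule ext) (simp add: T_def True)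
        \<comment> \<open>The prescribed products of \<open>v\<close> together with
          \<open>U 0 = 0\<close> replace the missing rescaling, and \<open>g1\<close> makes the
          neighbouring coefficient fit.\<close>
        have "dot P (vmat d p) v = \<kappa> * s * (U 0 p - p * U (Suc 0) p)"
          unfolding dot_vmat v frobenius(3)[OF p] by algebra
        then have "dot P (vmat d p) v = - (\<kappa> * s * p * U (Suc 0) p)" using F(4)[OF p] by simp
        moreover have "(\<rho> - of_nat i) = \<kappa>" by (simp add: \<rho>_def True)
        moreover have "(if i = 0 then 0 else T s v (i - 1) p) = s * U (Suc 0) p"
        proof (cases "m = 0")
          case True then show ?thesis using m(2)[of "Suc 0" p] p \<open>i = m\<close> by simp
        next
          case False then have "m - (m - 1) = Suc 0" "m - 1 < m" by auto
          then show ?thesis using \<open>i = m\<close> False by (simp add: T_def g1)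
        qed
        ultimately show ?thesis unfolding Ti by (simp add: algebra_simps)
      next
        case False
        define k where "k = m - i"
        have k: "k \<ge> 1" "i < m" using False i by (auto simp: k_def)
        have Ti: "T s v i = (\<lambda>p. s * g k * U k p)" by (rule ext) (simp add: T_def k k_def)
        have "dot P (vmat d p) (T s v i) = s * g k * dot P (vmat d p) (U k)"
          by (simp add: Ti dot_def sum_distrib_left mult_ac)
        then have 1: "dot P (vmat d p) (T s v i) = s * g k * (of_nat k * (U k p - p * U (Suc k) p))"
          unfolding R[OF p] .
        have 2: "(if i = 0 then 0 else T s v (i - 1) p) = s * g (Suc k) * U (Suc k) p"
        proof (cases "i = 0")
          case True then show ?thesis using m(2)[of "Suc k" p] p by (simp add: k_def)
        next
          case False
          then have "m - (i - 1) = Suc k" "i - 1 < m" using k(2) by (auto simp: k_def)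
          then show ?thesis using False by (simp add: T_def)
        qed
        have 3: "\<rho> - of_nat i = of_nat k + \<kappa>" using \<rho>i[OF i] by (simp add: k_def)
        have "(of_nat k + \<kappa>) * (s * g k * U k p - p * (s * g (Suc k) * U (Suc k) p))
          = (of_nat k + \<kappa>) * (s * g k * U k p) - p * s * U (Suc k) p * (g (Suc k) * (of_nat k + \<kappa>))" by algebra
        then show ?thesis unfolding 1 2 3 gS[OF k(1)] unfolding Ti by algebra
      qed
      finally show ?thesis using \<rho>nz[OF i] by simp
    qed
    \<comment> \<open>Past index m both exponents have been passed: the differences are negative
      integers, hence of norm at least 1.\<close>
    have big: "1 \<le> norm (\<rho> - of_nat (Suc i) - (of_nat m + \<kappa>)) \<and> 1 \<le> norm (\<rho> - of_nat (Suc i) - \<kappa>)" if "i \<ge> m" for i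
    proof -
      obtain j where j: "i = m + j" using le_Suc_ex[OF \<open>i \<ge> m\<close>] by auto
      have "\<rho> - of_nat (Suc i) - (of_nat m + \<kappa>) = - of_nat (Suc i)" "\<rho> - of_nat (Suc i) - \<kappa> = - of_nat (Suc j)"
        by (simp_all add: \<rho>_def j)
      moreover have "norm (- complex_of_nat (Suc k)) \<ge> 1" for k
        unfolding norm_minus_cancel norm_of_nat by simp
      ultimately show ?thesis by (simp only:)
    qed
    show ?thesis
    proof (rule frobenius_inf_extend[OF finP ale(2)])
      show "1 \<le> norm (\<rho> - of_nat (Suc i) - dot P (al td) (ga td))" if "i \<ge> m" for i
        using big[OF that] e' by (elim disjE conjE) (simp_all only:)
      show "1 \<le> norm (\<rho> - of_nat (Suc i) - dot P (be td) (ep td))" if "i \<ge> m" for i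
        using big[OF that] e' by (elim disjE conjE) (simp_all only:)
      show "(\<rho> - of_nat i) * X (al td) i = dot P (al td) (T s v i)" if "i \<le> m" for i
        using \<rho>nz[OF that] by (simp add: X_def)
      show "(\<rho> - of_nat i) * X (be td) i = dot P (be td) (T s v i)" if "i \<le> m" for i
        using \<rho>nz[OF that] by (simp add: X_def)
      show "T s v 0 p = ga td p * X (al td) 0 + ep td p * X (be td) 0" if "p \<in> P" for p
        using CX[OF _ that, of 0] by simp
      show "T s v (Suc i) p - p * T s v i p = ga td p * X (al td) (Suc i) + ep td p * X (be td) (Suc i)"
        if "i < m" "p \<in> P" for i p
        using CX[OF _ that(2), of "Suc i"] that(1) by simp
    qed
  qed
  obtain X1 X2 S R where X: "frobenius_inf P td \<rho> X1 X2 S" "R > 0" "psconv R X1" "psconv R X2"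
    "\<forall>p\<in>P. psconv R (\<lambda>i. S i p)" "\<forall>i\<le>m. S i = T 1 v1 i" using ext[OF v1] by (elim exE conjE) (rule that)
  obtain X1' X2' S' R' where X': "frobenius_inf P td \<rho> X1' X2' S'" "R' > 0" "psconv R' X1'" "psconv R' X2'"
    "\<forall>p\<in>P. psconv R' (\<lambda>i. S' i p)" "\<forall>i\<le>m. S' i = T 0 v0 i" using ext[OF v0(1,2)] by (elim exE conjE) (rule that)
  define R0 where "R0 = min R R'"
  have R0: "R0 > 0" "R0 \<le> R" "R0 \<le> R'" using X(2) X'(2) by (auto simp: R0_def)
  have ps: "psconv R0 X1" "psconv R0 X2" "psconv R0 X1'" "psconv R0 X2'"
    "\<And>p. p \<in> P \<Longrightarrow> psconv R0 (\<lambda>i. S i p)" "\<And>p. p \<in> P \<Longrightarrow> psconv R0 (\<lambda>i. S' i p)"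
    using X(3,4) X(5)[rule_format] X'(3,4) X'(5)[rule_format] R0 by (blast intro: psconv_mono)+
  obtain r where r: "r > 0" "ode_sing D' \<subseteq> ball 0 r" "1 / R0 < r"
  proof -
    obtain r0 where r0: "r0 > 0" "ode_sing D' \<subseteq> ball 0 r0"
      using bounded_subset_ballD[OF finite_imp_bounded[OF D'(1)]] by blast
    have "ball 0 r0 \<subseteq> ball (0::complex) (r0 + 1 / R0)" using R0(1) by (intro subset_ball) simp
    then show ?thesis using that[of "r0 + 1 / R0"] r0 R0(1) by (meson add_pos_pos less_add_same_cancel2 order_trans zero_less_divide_1_iff)
  qed
  obtain \<Omega> W where W: "open \<Omega>" "\<And>z. norm z \<ge> r \<Longrightarrow> z \<in> \<Omega>" "0 \<notin> \<Omega>" "\<Omega> \<inter> ode_sing D' = {}"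
    "W holomorphic_on \<Omega>" "\<And>z. z \<in> \<Omega> \<Longrightarrow> W z \<noteq> 0"
    "\<And>z. z \<in> \<Omega> \<Longrightarrow> deriv W z = (- (\<Sum>p\<in>P. \<tau>' p) / z + (\<Sum>p\<in>P. \<tau>' p / (z - p))) * W z"
    using infinity_gauge[OF finP r(1) D'(1,2) r(2), of \<tau>'] by blast
  let ?\<Omega> = "\<Omega> - cball 0 (1 / R0)"
  have o\<Omega>: "open ?\<Omega>" using W(1) by (intro open_Diff) auto
  have z\<Omega>: "norm (1 / z) < R0" "z \<noteq> 0" "z \<notin> P" "z \<notin> ode_sing D'" if "z \<in> ?\<Omega>" for z
  proof -
    show "z \<noteq> 0" "z \<notin> P" "z \<notin> ode_sing D'" using that W(3,4) D'(2) by auto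
    then have "1 / norm z < R0" using that R0(1) by (simp add: not_le divide_less_eq mult.commute)
    then show "norm (1 / z) < R0" by (simp add: norm_divide)
  qed
  define f :: "2 \<Rightarrow> complex \<Rightarrow> complex" where "f j = (if j = 1 then (\<lambda>z. psum X1 (1 / z)) else (\<lambda>z. psum X1' (1 / z)))" for j
  define gg :: "2 \<Rightarrow> complex \<Rightarrow> complex" where "gg j = (if j = 1 then (\<lambda>z. psum X2 (1 / z)) else (\<lambda>z. psum X2' (1 / z)))" for j
  have hol: "(\<lambda>z. psum Y (1 / z)) holomorphic_on ?\<Omega>" if "psconv R0 Y" for Y
  proof -
    have "psum Y \<circ> (\<lambda>z. 1 / z) holomorphic_on ?\<Omega>"
    proof (rule holomorphic_on_compose_gen[OF _ psum_holomorphic[OF that]])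
      show "(\<lambda>z. 1 / z) holomorphic_on ?\<Omega>" by (intro holomorphic_intros) (use z\<Omega>(2) in blast)
      show "(\<lambda>z. 1 / z) ` ?\<Omega> \<subseteq> ball 0 R0" using z\<Omega>(1) unfolding image_subset_iff mem_ball_0 by blast
    qed
    then show ?thesis by (simp add: o_def)
  qed
  have "monodromy_matrix D' (\<lambda>s. 0 + circ r (-1) s) (mat (exp (2 * of_real pi * \<i> * of_real (-1) * (\<rho> - (- (\<Sum>p\<in>P. \<tau>' p))))))"
  proof (rule scalar_monodromy[OF r(1) _ _ _ _ _ _ _ _ , where f = f and g = gg and \<Omega> = ?\<Omega> and W = W])
    show "open ?\<Omega>" by (rule o\<Omega>)
    show "sphere 0 r \<subseteq> ?\<Omega>" using W(2) r(3) by auto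
    show "W holomorphic_on ?\<Omega>" using W(5) by (rule holomorphic_on_subset) blast
    show "f j holomorphic_on ?\<Omega>" "gg j holomorphic_on ?\<Omega>" for j
      unfolding f_def gg_def using hol ps by auto
    show "pole_system P td (\<lambda>z. \<rho> / (z - 0)) (f j) (gg j) z" if z: "z \<in> ?\<Omega>" for j z
      using frobenius_inf_pole_system[OF X(1) ps(1,2,5) z\<Omega>(1-3)[OF z]] frobenius_inf_pole_system[OF X'(1) ps(3,4,6) z\<Omega>(1-3)[OF z]] by (simp add: f_def gg_def)
    \<comment> \<open>If a combination vanishes, so do the coefficients of its first component, then
      those of the second since the upper right entry is nonzero, then all those of
      \<open>S\<close>. The values at index m, and for m > 0 also at index 0, then leave only the
      zero combination.\<close>
    show "k j = 0" if ev: "\<forall>\<^sub>F z in nhds (0 + of_real r). (\<Sum>j\<in>UNIV. k j * f j z) = 0" for k j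
    proof -
      define x0 where "x0 = complex_of_real (1 / r)"
      let ?Y1 = "\<lambda>i. k 1 * X1 i + k 2 * X1' i" and ?Y2 = "\<lambda>i. k 1 * X2 i + k 2 * X2' i" and ?S = "\<lambda>i p. k 1 * S i p + k 2 * S' i p"
      have rr: "norm x0 < R0" using r(1,3) R0(1) by (simp add: x0_def norm_divide field_simps)
      have lim: "filterlim (\<lambda>w. 1 / w) (nhds (of_real r)) (nhds x0)"
        using tendsto_divide[OF tendsto_const filterlim_ident, of x0 1] r(1) by (simp add: x0_def)
      have evb: "\<forall>\<^sub>F w in nhds x0. w \<in> ball (0::complex) R0"
        using rr by (intro eventually_nhds_in_open) auto
      have "\<forall>\<^sub>F w in nhds x0. k 1 * psum X1 w + k 2 * psum X1' w = 0"
        using eventually_compose_filterlim[OF ev[unfolded add_0_left] lim] by (simp add: sum_2 f_def)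
      then have "\<forall>\<^sub>F w in nhds x0. psum ?Y1 w = 0"
        using evb by eventually_elim (simp add: psum_lincomb(2)[OF ps(1,3)])
      from psum_eq_0_imp[OF psum_lincomb(1)[OF ps(1,3)] rr this]
      have Y1: "?Y1 i = 0" for i .
      note FSi = frobenius_inf_lincomb[OF X(1) X'(1), of "k 1" "k 2"]
      have psi: "psconv R0 ?Y1" "psconv R0 ?Y2" "\<And>p. p \<in> P \<Longrightarrow> psconv R0 (\<lambda>i. ?S i p)"
        using psum_lincomb(1) ps by blast+
      have z2: "psum ?Y2 (1 / z) = 0" if z: "z \<in> ?\<Omega>" for z
      proof -
        have "pole_system P td (\<lambda>z. \<rho> / z) (\<lambda>z. psum ?Y1 (1 / z)) (\<lambda>z. psum ?Y2 (1 / z)) z"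
          by (rule frobenius_inf_pole_system[OF FSi psi z\<Omega>(1-3)[OF z]])
        then have "pole_sum P (al td) (ep td) z * psum ?Y2 (1 / z) = 0"
          unfolding pole_system_def Y1 psum_zero by simp
        moreover have "pole_sum P (al td) (ep td) z \<noteq> 0"
          using D'(3) z\<Omega>(4)[OF z] unfolding system_to_ode_def by blast
        ultimately show ?thesis by simp
      qed
      have "\<forall>\<^sub>F z in nhds (of_real r). z \<in> ?\<Omega>"
        using o\<Omega> W(2)[of "of_real r"] r(1,3) by (intro eventually_nhds_in_open) auto
      from eventually_compose_filterlim[OF this lim]
      have "\<forall>\<^sub>F w in nhds x0. psum ?Y2 w = 0"
        by (rule eventually_mono) (use z2 in force)
      from psum_eq_0_imp[OF psi(2) rr this] have Y2: "?Y2 i = 0" for i .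
      have S0: "?S i p = 0" if p: "p \<in> P" for i p
      proof (induction i)
        case 0
        have "?S 0 p = ga td p * ?Y1 0 + ep td p * ?Y2 0" using FSi p unfolding frobenius_inf_def by blast
        then show ?case unfolding Y1 Y2 by simp
      next
        case (Suc i)
        have "?S (Suc i) p - p * ?S i p = ga td p * ?Y1 (Suc i) + ep td p * ?Y2 (Suc i)" using FSi p unfolding frobenius_inf_def by blast
        then show ?case unfolding Y1 Y2 Suc by simp
      qed
      have vz: "k 1 * v1 p + k 2 * v0 p = 0" if "p \<in> P" for p
        using S0[OF that, of m] unfolding X(6)[rule_format, OF order_refl] X'(6)[rule_format, OF order_refl] by (simp add: T_def)
      have k1: "k 1 = 0"
      proof (cases "m = 0")
        case True
        have "k 1 * dot P x v1 + k 2 * dot P x v0 = dot P x (\<lambda>p. k 1 * v1 p + k 2 * v0 p)" for x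
          by (simp add: dot_def sum.distrib sum_distrib_left algebra_simps)
        also have "dot P x (\<lambda>p. k 1 * v1 p + k 2 * v0 p) = 0" for x
          unfolding dot_def using vz by (intro sum.neutral) auto
        finally have "k 1 * dot P x v1 + k 2 * dot P x v0 = 0" for x .
        from this[of "al d"] this[of "be d"] show ?thesis using m(1) k0 unfolding v1 v0 True by auto
      next
        case False
        show ?thesis
        proof (rule ccontr)
          assume k: "k 1 \<noteq> 0"
          have "U m p = 0" if "p \<in> P" for p
            using S0[OF that, of 0] gnz[of m] k False unfolding X(6)[rule_format, OF le0] X'(6)[rule_format, OF le0] by (simp add: T_def)
          then have "of_nat m * Y1 m = 0" "of_nat m * Y2 m = 0" unfolding frobenius by (simp_all add: dot_def)
          then show False using m(1) False by simp
        qed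
      qed
      then have "k 2 = 0" using vz[OF v0(3)] v0(4) by simp
      then show ?thesis using k1 exhaust_2[of j] by auto
    qed
  qed (use W in auto)
  then show ?thesis unfolding apparent_at_infinity_def reversepath_circlepath_eq_circ using r(1,2) by blast
qed

end

section \<open>Polynomial solutions and their degrees\<close>

text \<open>Dividing out the power product removes the branches: what remains is the vanishing of
  one holomorphic function on the complement of the singular points. This complement is connected,
  so it suffices to know it on the nonempty open slit plane.\<close>

lemma has_power_poly_solution_iff:
  assumes fin: "finite (ode_sing E)" "finite B" "B \<subseteq> ode_sing E"
    and hol: "ode_p E holomorphic_on - ode_sing E" "ode_q E holomorphic_on - ode_sing E"
  shows "has_power_poly_solution E B e h \<longleftrightarrow>
    h \<noteq> 0 \<and> (\<forall>z. z \<notin> ode_sing E \<longrightarrow> twisted_ode E (\<lambda>z. \<Sum>p\<in>B. e p / (z - p)) (poly h) z)"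
proof -
  let ?S = "ode_sing E"
  let ?L = "\<lambda>z. \<Sum>p\<in>B. e p / (z - p)"
  define \<Omega> where "\<Omega> = {z. z \<notin> ?S \<and> (\<forall>p\<in>B. z - p \<notin> \<real>\<^sub>\<le>\<^sub>0)}"
  define \<Phi> where "\<Phi> z = (\<Prod>p\<in>B. (z - p) powr e p)" for z
  have oS: "open (- ?S)" using fin(1) by (simp add: finite_imp_closed open_Compl)
  have o: "open \<Omega>"
  proof -
    have "\<Omega> = - ?S \<inter> (\<Inter>p\<in>B. (\<lambda>z. z - p) -` (- \<real>\<^sub>\<le>\<^sub>0))" by (auto simp: \<Omega>_def)
    moreover have "open ((\<lambda>z. z - p) -` (- \<real>\<^sub>\<le>\<^sub>0))" for p :: complex
      by (intro open_vimage continuous_intros) (simp add: open_Compl)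
    ultimately show ?thesis using oS fin(2) by (auto intro!: open_Int open_INT)
  qed
  have \<Omega>S: "\<Omega> \<subseteq> - ?S" by (auto simp: \<Omega>_def)
  have d: "(\<Phi> has_field_derivative ?L z * \<Phi> z) (at z)" and nz: "\<Phi> z \<noteq> 0" if z: "z \<in> \<Omega>" for z
  proof -
    define W where "W z = exp (\<Sum>p\<in>B. e p * Ln (z - p))" for z
    have W: "W w = \<Phi> w" if "w \<in> \<Omega>" for w
    proof -
      have "w \<noteq> p" if "p \<in> B" for p using that \<open>w \<in> \<Omega>\<close> fin(3) by (auto simp: \<Omega>_def)
      then show ?thesis unfolding W_def \<Phi>_def exp_sum[OF fin(2)]
        by (intro prod.cong) (auto simp: powr_def)
    qed
    have "((\<lambda>z. \<Sum>p\<in>B. e p * Ln (z - p)) has_field_derivative ?L z) (at z)"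
    proof (rule DERIV_sum)
      fix p assume p: "p \<in> B"
      have "z - p \<notin> \<real>\<^sub>\<le>\<^sub>0" using z p by (auto simp: \<Omega>_def)
      then show "((\<lambda>z. e p * Ln (z - p)) has_field_derivative e p / (z - p)) (at z)"
        by (auto intro!: derivative_eq_intros simp: divide_inverse mult.commute)
    qed
    from DERIV_fun_exp[OF this] have "(W has_field_derivative ?L z * W z) (at z)"
      unfolding W_def by (simp add: mult.commute)
    then have "(\<Phi> has_field_derivative ?L z * W z) (at z)"
      by (rule has_field_derivative_transform_within_open[OF _ o z]) (rule W)
    then show "(\<Phi> has_field_derivative ?L z * \<Phi> z) (at z)" by (simp add: W[OF z])
    show "\<Phi> z \<noteq> 0" unfolding W[OF z, symmetric] W_def by simp
  qed
  have h\<Phi>: "\<Phi> holomorphic_on \<Omega>" unfolding holomorphic_on_open[OF o] using d by blast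
  have hL: "?L holomorphic_on - ?S" using fin(3) by (intro holomorphic_intros) auto
  have hL\<Omega>: "?L holomorphic_on \<Omega>" by (rule holomorphic_on_subset[OF hL \<Omega>S])
  have tw: "deriv (deriv (\<lambda>z. \<Phi> z * poly h z)) z + ode_p E z * deriv (\<lambda>z. \<Phi> z * poly h z) z + ode_q E z * (\<Phi> z * poly h z) = 0
    \<longleftrightarrow> twisted_ode E ?L (poly h) z" if z: "z \<in> \<Omega>" for z
    using twist[OF o h\<Phi> poly_holomorphic[of h] hL\<Omega> DERIV_imp_deriv[OF d] z, of E] nz[OF z]
    unfolding twisted_ode_def by (simp only: mult_eq_0_iff simp_thms)
  have "has_power_poly_solution E B e h \<longleftrightarrow> h \<noteq> 0 \<and> (\<forall>z\<in>\<Omega>. twisted_ode E ?L (poly h) z)"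
    unfolding has_power_poly_solution_def solves_on_def \<Omega>_def[symmetric] \<Phi>_def[symmetric]
    using o \<Omega>S tw by (auto intro!: holomorphic_on_mult h\<Phi> poly_holomorphic)
  also have "(\<forall>z\<in>\<Omega>. twisted_ode E ?L (poly h) z) \<longleftrightarrow> (\<forall>z. z \<notin> ?S \<longrightarrow> twisted_ode E ?L (poly h) z)"
  proof
    assume \<Omega>0: "\<forall>z\<in>\<Omega>. twisted_ode E ?L (poly h) z"
    let ?G = "\<lambda>z. deriv (deriv (poly h)) z + (2 * ?L z + ode_p E z) * deriv (poly h) z
     + ((?L z)\<^sup>2 + deriv ?L z + ode_p E z * ?L z + ode_q E z) * poly h z"
    have G: "?G holomorphic_on - ?S"
      by (intro holomorphic_intros hol hL holomorphic_deriv[OF _ oS] poly_holomorphic)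
    obtain b where b: "b > 0" "\<forall>z\<in>?S. norm z \<le> b"
      using finite_imp_bounded[OF fin(1)] unfolding bounded_pos by blast
    \<comment> \<open>A point above all singular points; the slits run horizontally to the left and
      miss it.\<close>
    have "\<i> * of_real (b + 1) \<in> \<Omega>"
    proof -
      have n: "norm (\<i> * complex_of_real (b + 1)) = b + 1" using b(1) by (simp add: norm_mult del: of_real_add)
      have "\<i> * of_real (b + 1) \<notin> ?S"
      proof
        assume "\<i> * of_real (b + 1) \<in> ?S"
        then have "norm (\<i> * complex_of_real (b + 1)) \<le> b" using b(2) by blast
        then show False unfolding n by simp
      qed
      moreover have "\<i> * of_real (b + 1) - p \<notin> \<real>\<^sub>\<le>\<^sub>0" if "p \<in> B" for p
      proof
        assume "\<i> * of_real (b + 1) - p \<in> \<real>\<^sub>\<le>\<^sub>0"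
        then have "Im p = b + 1" by (simp add: complex_nonpos_Reals_iff)
        moreover have "Im p \<le> b" using b(2) that fin(3) abs_Im_le_cmod[of p] by fastforce
        ultimately show False by simp
      qed
      ultimately show ?thesis by (simp add: \<Omega>_def)
    qed
    then have ne: "\<Omega> \<noteq> {}" by blast
    have "connected (UNIV - ?S)" by (rule connected_open_delete_finite) (auto simp: fin(1))
    then have con: "connected (- ?S)" by (simp add: Compl_eq_Diff_UNIV)
    show "\<forall>z. z \<notin> ?S \<longrightarrow> twisted_ode E ?L (poly h) z"
    proof (intro allI impI)
      fix z assume z: "z \<notin> ?S"
      have "?G z = 0"
      proof (rule analytic_continuation_open[OF o oS ne con \<Omega>S G])
        show "(\<lambda>_. 0) holomorphic_on - ?S" by simp
        show "?G w = 0" if "w \<in> \<Omega>" for w using \<Omega>0 that unfolding twisted_ode_def by blast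
        show "z \<in> - ?S" using z by simp
      qed
      then show "twisted_ode E ?L (poly h) z" unfolding twisted_ode_def .
    qed
  qed (use \<Omega>S in blast)
  finally show ?thesis .
qed

section \<open>Growth of solutions at infinity\<close>

lemma poly_over_power_at_infinity:
  fixes q :: "complex poly"
  assumes "degree q \<le> n"
  shows "((\<lambda>z. poly q z / z ^ n) \<longlongrightarrow> coeff q n) at_infinity"
proof -
  have "((\<lambda>z. \<Sum>i\<le>n. coeff q i * inverse z ^ (n - i)) \<longlongrightarrow> (\<Sum>i\<le>n. coeff q i * 0 ^ (n - i))) at_infinity"
    by (intro tendsto_intros tendsto_inverse_0)
  also have "(\<Sum>i\<le>n. coeff q i * 0 ^ (n - i)) = (\<Sum>i\<le>n. if i = n then coeff q n else 0)"
    by (intro sum.cong) auto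
  also have "\<dots> = coeff q n" by simp
  finally have lim: "((\<lambda>z. \<Sum>i\<le>n. coeff q i * inverse z ^ (n - i)) \<longlongrightarrow> coeff q n) at_infinity" .
  have "\<forall>\<^sub>F z in at_infinity. z \<noteq> (0 :: complex)" by (rule eventually_not_equal_at_infinity)
  then have "\<forall>\<^sub>F z in at_infinity. (\<Sum>i\<le>n. coeff q i * inverse z ^ (n - i)) = poly q z / z ^ n"
  proof eventually_elim
    case (elim z)
    have "poly q z = (\<Sum>i\<le>n. coeff q i * z ^ i)"
    proof -
      have "poly q z = (\<Sum>i\<le>degree q. coeff q i * z ^ i)" by (rule poly_altdef)
      also have "\<dots> = (\<Sum>i\<le>n. coeff q i * z ^ i)"
        using assms by (intro sum.mono_neutral_left) (auto simp: coeff_eq_0)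
      finally show ?thesis .
    qed
    then have "poly q z / z ^ n = (\<Sum>i\<le>n. coeff q i * z ^ i / z ^ n)" by (simp add: sum_divide_distrib)
    also have "\<dots> = (\<Sum>i\<le>n. coeff q i * inverse z ^ (n - i))"
    proof (rule sum.cong)
      fix i assume "i \<in> {..n}"
      then have "z ^ n = z ^ i * z ^ (n - i)" by (simp add: power_add[symmetric])
      then show "coeff q i * z ^ i / z ^ n = coeff q i * inverse z ^ (n - i)"
        using elim by (simp add: power_inverse divide_inverse)
    qed simp
    finally show ?case by simp
  qed
  with lim show ?thesis by (rule Lim_transform_eventually)
qed

lemma over_shift_at_infinity: "((\<lambda>z. z / (z - p)) \<longlongrightarrow> (1 :: complex)) at_infinity"
proof -
  have "((\<lambda>z. 1 / (1 - p * inverse z)) \<longlongrightarrow> 1 / (1 - p * 0)) at_infinity"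
    by (intro tendsto_intros tendsto_inverse_0) simp
  moreover have "\<forall>\<^sub>F z in at_infinity. 1 / (1 - p * inverse z) = z / (z - p)"
    using eventually_not_equal_at_infinity[of 0]
  proof eventually_elim
    case (elim z)
    then have "1 - p * inverse z = (z - p) / z" by (simp add: field_simps)
    then show ?case by simp
  qed
  ultimately show ?thesis by (simp add: Lim_transform_eventually)
qed

lemma shift_inverse_at_infinity: "((\<lambda>z. 1 / (z - p)) \<longlongrightarrow> (0 :: complex)) at_infinity"
proof -
  have "((\<lambda>z. z / (z - p) * inverse z) \<longlongrightarrow> 1 * 0) at_infinity"
    by (intro tendsto_mult over_shift_at_infinity tendsto_inverse_0)
  moreover have "\<forall>\<^sub>F z in at_infinity. z / (z - p) * inverse z = 1 / (z - p)"
    using eventually_not_equal_at_infinity[of 0] by eventually_elim simp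
  ultimately show ?thesis by (simp add: Lim_transform_eventually)
qed

text \<open>The leading behaviour of the equation at \<open>\<infinity>\<close>: the exponents there are \<open>\<kappa>\<^sub>1\<close> and \<open>\<kappa>\<^sub>2 + 1\<close>.\<close>

lemma exponent_at_infinity:
  assumes t: "t \<notin> {0, 1}" and h: "h \<noteq> 0"
    and ode: "\<And>z. z \<notin> {0, 1, t, l} \<Longrightarrow> twisted_ode (D_y1 t \<theta> \<theta>i l \<mu>) (\<lambda>z. \<Sum>p\<in>{0, 1, t}. e p / (z - p)) (poly h) z"
    and X: "X = of_nat (degree h) + e 0 + e 1 + e t"
  shows "(X + kappa1 t \<theta> \<theta>i) * (X + kappa2 t \<theta> \<theta>i + 1) = 0"
proof -
  let ?D = "D_y1 t \<theta> \<theta>i l \<mu>" and ?k1 = "kappa1 t \<theta> \<theta>i" and ?k2 = "kappa2 t \<theta> \<theta>i"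
  let ?E = "\<lambda>z. \<Sum>p\<in>{0, 1, t}. e p / (z - p)"
  define N where "N = degree h"
  define s where "s = e 0 + e 1 + e t"
  define c where "c = lead_coeff h"
  have c: "c \<noteq> 0" using h by (simp add: c_def)
  have dh: "deriv (poly q) = poly (pderiv q)" for q :: "complex poly"
    by (rule ext) (rule DERIV_imp_deriv[OF poly_DERIV])
  have co: "coeff (pCons 0 (pderiv q)) i = of_nat i * coeff q i" for q :: "complex poly" and i
    by (cases i) (simp_all add: coeff_pderiv)
  have co2: "coeff (pCons 0 (pCons 0 (pderiv (pderiv q)))) i = of_nat i * (of_nat i - 1) * coeff q i" for q :: "complex poly" and i
    by (cases i rule: nat.exhaust; cases "i - 1") (auto simp: coeff_pderiv)
  have l0: "((\<lambda>z. poly h z / z ^ N) \<longlongrightarrow> c) at_infinity"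
    using poly_over_power_at_infinity[of h N] by (simp add: N_def c_def)
  have l1: "((\<lambda>z. poly (pCons 0 (pderiv h)) z / z ^ N) \<longlongrightarrow> of_nat N * c) at_infinity"
  proof -
    have "degree (pCons 0 (pderiv h)) \<le> N" by (intro degree_le) (auto simp: co N_def coeff_eq_0)
    from poly_over_power_at_infinity[OF this] show ?thesis unfolding co by (simp add: N_def c_def)
  qed
  have l2: "((\<lambda>z. poly (pCons 0 (pCons 0 (pderiv (pderiv h)))) z / z ^ N) \<longlongrightarrow> of_nat N * (of_nat N - 1) * c) at_infinity"
  proof -
    have "degree (pCons 0 (pCons 0 (pderiv (pderiv h)))) \<le> N" by (intro degree_le) (auto simp: co2 N_def coeff_eq_0)
    from poly_over_power_at_infinity[OF this] show ?thesis unfolding co2 by (simp add: N_def c_def)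
  qed
  have sum3: "(\<Sum>p\<in>{0, 1, t}. f p) = f 0 + f 1 + f t" for f :: "complex \<Rightarrow> complex" by (rule sum_01t[OF t])
  \<comment> \<open>\<open>zE\<close>, \<open>zE'\<close>, \<open>zp\<close> and \<open>zq\<close>
    stand for z E, z^2 E', z p and z^2 q. With these powers of z every coefficient of the equation
    has a limit.\<close>
  define zE where "zE z = e 0 * (z / (z - 0)) + e 1 * (z / (z - 1)) + e t * (z / (z - t))" for z
  define zE' where "zE' z = - (e 0 * (z / (z - 0))\<^sup>2 + e 1 * (z / (z - 1))\<^sup>2 + e t * (z / (z - t))\<^sup>2)" for z
  define zp where "zp z = (1 - \<theta> 0) * (z / (z - 0)) + (1 - \<theta> 1) * (z / (z - 1)) + (1 - \<theta> t) * (z / (z - t)) - z / (z - l)" for z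
  define K where "K = l * (l - 1) * (l - t) * \<mu>\<^sup>2
        - (\<theta> 0 * (l - 1) * (l - t) + \<theta> 1 * l * (l - t) + (\<theta> t - 1) * l * (l - 1)) * \<mu>
        + ?k1 * (?k2 + 1) * (l - t)"
  define zq where "zq z = (?k1 * (?k2 + 1) + l * (l - 1) * \<mu> * (1 / (z - l)) - K * (1 / (z - t))) * (z / (z - 1))" for z
  have lims: "(zE \<longlongrightarrow> s) at_infinity" "(zE' \<longlongrightarrow> - s) at_infinity"
    "(zp \<longlongrightarrow> 2 - \<theta> 0 - \<theta> 1 - \<theta> t) at_infinity" "(zq \<longlongrightarrow> ?k1 * (?k2 + 1)) at_infinity"
  proof -
    have "(zE \<longlongrightarrow> e 0 * 1 + e 1 * 1 + e t * 1) at_infinity"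
      unfolding zE_def[abs_def] by (intro tendsto_intros over_shift_at_infinity)
    then show "(zE \<longlongrightarrow> s) at_infinity" by (simp add: s_def)
    have "(zE' \<longlongrightarrow> - (e 0 * 1\<^sup>2 + e 1 * 1\<^sup>2 + e t * 1\<^sup>2)) at_infinity"
      unfolding zE'_def[abs_def] by (intro tendsto_intros over_shift_at_infinity)
    then show "(zE' \<longlongrightarrow> - s) at_infinity" by (simp add: s_def)
    have "(zp \<longlongrightarrow> (1 - \<theta> 0) * 1 + (1 - \<theta> 1) * 1 + (1 - \<theta> t) * 1 - 1) at_infinity"
      unfolding zp_def[abs_def] by (intro tendsto_intros over_shift_at_infinity)
    then show "(zp \<longlongrightarrow> 2 - \<theta> 0 - \<theta> 1 - \<theta> t) at_infinity" by (simp add: algebra_simps)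
    have "(zq \<longlongrightarrow> (?k1 * (?k2 + 1) + l * (l - 1) * \<mu> * 0 - K * 0) * 1) at_infinity"
      unfolding zq_def[abs_def] by (intro tendsto_intros over_shift_at_infinity shift_inverse_at_infinity)
    then show "(zq \<longlongrightarrow> ?k1 * (?k2 + 1)) at_infinity" by simp
  qed
  define T where "T z = poly (pCons 0 (pCons 0 (pderiv (pderiv h)))) z / z ^ N
      + (2 * zE z + zp z) * (poly (pCons 0 (pderiv h)) z / z ^ N)
      + ((zE z)\<^sup>2 + zE' z + zp z * zE z + zq z) * (poly h z / z ^ N)" for z
  have "(T \<longlongrightarrow> of_nat N * (of_nat N - 1) * c + (2 * s + (2 - \<theta> 0 - \<theta> 1 - \<theta> t)) * (of_nat N * c)
      + (s\<^sup>2 + - s + (2 - \<theta> 0 - \<theta> 1 - \<theta> t) * s + ?k1 * (?k2 + 1)) * c) at_infinity"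
    unfolding T_def[abs_def] by (intro tendsto_intros l0 l1 l2 lims)
  moreover have "(T \<longlongrightarrow> 0) at_infinity"
  proof (rule tendsto_eventually)
    have "\<forall>\<^sub>F z in at_infinity. z \<noteq> 0 \<and> z \<noteq> 1 \<and> z \<noteq> t \<and> z \<noteq> l"
      by (intro eventually_conj eventually_not_equal_at_infinity)
    then show "\<forall>\<^sub>F z in at_infinity. T z = 0"
    proof eventually_elim
      case (elim z)
      then have nz: "z \<noteq> 0" "z - 1 \<noteq> 0" "z - t \<noteq> 0" "z - l \<noteq> 0" by auto
      have dE: "deriv ?E z = - (e 0 / z\<^sup>2 + e 1 / (z - 1)\<^sup>2 + e t / (z - t)\<^sup>2)"
        unfolding sum3
        by (rule DERIV_imp_deriv) (use nz in \<open>auto intro!: derivative_eq_intros simp: power2_eq_square\<close>)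
      have zE: "zE z = z * ?E z" unfolding sum3 zE_def by (simp add: algebra_simps)
      have zE': "zE' z = z\<^sup>2 * deriv ?E z" unfolding dE zE'_def by (simp add: power_divide algebra_simps)
      have zp: "zp z = z * ode_p ?D z" unfolding D_y1_sel zp_def
        by (simp only: diff_zero distrib_left right_diff_distrib left_diff_distrib mult_1_left times_divide_eq_right mult_1_right mult.commute[of z])
      have zq: "zq z = z\<^sup>2 * ode_q ?D z"
        unfolding D_y1_q[OF t] K_def[symmetric] zq_def using nz by (simp add: divide_simps power2_eq_square)
      have "T z = z\<^sup>2 / z ^ N * (deriv (deriv (poly h)) z + (2 * ?E z + ode_p ?D z) * deriv (poly h) z
         + ((?E z)\<^sup>2 + deriv ?E z + ode_p ?D z * ?E z + ode_q ?D z) * poly h z)"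
        unfolding T_def zE zE' zp zq dh by (simp add: power2_eq_square add_divide_distrib algebra_simps)
      also have "\<dots> = 0" using ode[of z] elim unfolding twisted_ode_def by simp
      finally show ?case .
    qed
  qed
  ultimately have "of_nat N * (of_nat N - 1) * c + (2 * s + (2 - \<theta> 0 - \<theta> 1 - \<theta> t)) * (of_nat N * c)
      + (s\<^sup>2 + - s + (2 - \<theta> 0 - \<theta> 1 - \<theta> t) * s + ?k1 * (?k2 + 1)) * c = 0"
    using tendsto_unique[OF trivial_limit_at_infinity] by blast
  moreover have "?k2 = - ?k1 - \<theta> 0 - \<theta> 1 - \<theta> t" by (rule kappa2_eq)
  ultimately have "c * ((of_nat N + s + ?k1) * (of_nat N + s + ?k2 + 1)) = 0" by algebra
  then show ?thesis using c unfolding X s_def N_def by (simp add: add.assoc)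
qed

text \<open>A unit vector not killed by \<open>x\<close> and the vector \<open>w\<close>, killed by
  \<open>x\<close> but not by \<open>y\<close>, give a triangular system for the two prescribed
  values.\<close>

lemma pair_surjective:
  assumes P: "finite P" "q \<in> P" and x: "x q \<noteq> 0" and w: "dot P x w = 0" "dot P y w \<noteq> 0"
  shows "\<exists>v. dot P x v = A \<and> dot P y v = B"
proof -
  define v where "v p = (if p = q then 1 else 0 :: complex)" for p
  have dv: "dot P z v = z q" for z
    unfolding dot_def v_def using P by (simp add: if_distrib cong: if_cong)
  define a where "a = A / x q"
  define b where "b = (B - a * y q) / dot P y w"
  have lin: "dot P z (\<lambda>p. a * v p + b * w p) = a * z q + b * dot P z w" for z
    unfolding dv[symmetric] by (simp add: dot_def sum.distrib sum_distrib_left algebra_simps)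
  have "dot P x (\<lambda>p. a * v p + b * w p) = A" unfolding lin w(1) using x by (simp add: a_def)
  moreover have "dot P y (\<lambda>p. a * v p + b * w p) = B" unfolding lin using w(2) by (simp add: b_def)
  ultimately show ?thesis by blast
qed

text \<open>\<open>v\<close> is the cross product of \<open>x\<close> and \<open>y\<close>. It is
  nonzero because \<open>w\<close> separates \<open>y\<close> from the multiples of
  \<open>x\<close>.\<close>

lemma pair_kernel:
  assumes t: "t \<notin> {0, 1}" and x: "x 0 \<noteq> 0" and w: "dot {0, 1, t} x w = 0" "dot {0, 1, t} y w \<noteq> 0"
  shows "\<exists>v. dot {0, 1, t} x v = 0 \<and> dot {0, 1, t} y v = 0 \<and> (\<exists>p\<in>{0, 1, t}. v p \<noteq> 0)"
proof -
  define v where "v p = (if p = 0 then x 1 * y t - x t * y 1 else if p = 1 then x t * y 0 - x 0 * y t else x 0 * y 1 - x 1 * y 0)" for p :: complex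
  have v: "v 0 = x 1 * y t - x t * y 1" "v 1 = x t * y 0 - x 0 * y t" "v t = x 0 * y 1 - x 1 * y 0"
    using t by (auto simp: v_def)
  have d: "dot {0, 1, t} x v = 0" "dot {0, 1, t} y v = 0"
    unfolding dot_def sum_01t[OF t] v by algebra+
  have "v p \<noteq> 0" if "p = 1 \<or> p = t" "v (1 + t - p) = 0" for p
  proof
    assume "v p = 0"
    with that have "v 1 = 0" "v t = 0" by auto
    then have "x 0 * dot {0, 1, t} y w = y 0 * dot {0, 1, t} x w"
      unfolding dot_def sum_01t[OF t] v by algebra
    then show False using x w by simp
  qed
  then have "v 1 \<noteq> 0 \<or> v t \<noteq> 0" by (metis add.commute add_diff_cancel_left')
  with d show ?thesis by blast
qed

section \<open>The individual statements\<close>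

lemma int_degree_eqI:
  assumes "of_nat N = (of_int n :: complex)"
  shows "int N = n"
proof -
  have "complex_of_int (int N) = of_int n" using assms by simp
  then show ?thesis by (simp only: of_int_eq_iff)
qed

context painleve
begin

lemma D_holomorphic: "ode_p D holomorphic_on - ode_sing D" "ode_q D holomorphic_on - ode_sing D"
proof -
  show "ode_p D holomorphic_on - ode_sing D"
    unfolding D_y1_sel by (intro holomorphic_intros) auto
  have "(\<lambda>w. k1 * (k2 + 1) / (w * (w - 1)) + l * (l - 1) * \<mu> / (w * (w - 1) * (w - l))
      - t * (t - 1) * Ham t \<theta> \<theta>i l \<mu> / (w * (w - 1) * (w - t))) holomorphic_on - ode_sing D"
    unfolding D_y1_sel by (intro holomorphic_intros) auto
  then show "ode_q D holomorphic_on - ode_sing D" by (simp add: D_y1_def)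
qed

lemma D_sing: "finite (ode_sing D)" "P \<subseteq> ode_sing D"
  by (auto simp: D_y1_sel)

lemma power_poly_D_iff:
  assumes "B \<subseteq> P"
  shows "has_power_poly_solution D B e h \<longleftrightarrow>
    h \<noteq> 0 \<and> (\<forall>z. z \<notin> {0, 1, t, l} \<longrightarrow> twisted_ode D (\<lambda>z. \<Sum>p\<in>B. e p / (z - p)) (poly h) z)"
proof -
  have "finite B" "B \<subseteq> ode_sing D" using assms finite_subset D_sing by (blast intro: finite_subset[of B P])+
  from has_power_poly_solution_iff[OF D_sing(1) this D_holomorphic] show ?thesis unfolding D_y1_sel(1) .
qed

end

context painleve_pair
begin

lemma D'_sing: "ode_sing D' = {0, 1, t, lt}"
  unfolding D_y1_tilde_def D_y1_sel ..

lemmas power_poly_D'_iff = tl.power_poly_D_iff[folded D_y1_tilde_def]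

lemma vmat_td_diag: "p \<in> P \<Longrightarrow> vmat td p p = th p"
  using vmat_td[of p p] vmat_primal[of p] by (simp add: theta_tilde_def)

text \<open>The solution grows like z^X, while the exponents of the transformed equation at
  \<infinity> are k1 - k2 and 1 - k2.\<close>

lemma degree_D':
  assumes "h \<noteq> 0" "\<And>z. z \<notin> {0, 1, t, lt} \<Longrightarrow> twisted_ode D' (\<lambda>z. \<Sum>p\<in>P. e p / (z - p)) (poly h) z"
    and "X = of_nat (degree h) + e 0 + e 1 + e t"
  shows "X = k2 - k1 \<or> X = k2 - 1"
proof -
  have "(X + (k1 - k2)) * (X + - k2 + 1) = 0"
    using exponent_at_infinity[OF t assms(1) assms(2)[unfolded D_y1_tilde_def] assms(3)] unfolding kappa_tilde .
  then have "X + (k1 - k2) = 0 \<or> X + - k2 + 1 = 0" by simp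
  then show ?thesis by (auto simp: algebra_simps eq_neg_iff_add_eq_0)
qed

lemma theta_inf: "k1 - k2 = \<theta>i"
  by (simp add: kappa1_def kappa2_def field_simps)

lemma dot_dual:
  "dot P (al (dual pd)) (ep (dual pd)) = 0" "dot P (al (dual pd)) (ga (dual pd)) = k2" "dot P (be (dual pd)) (ep (dual pd)) = k1"
  "dot P (al (dual td)) (ep (dual td)) = 0" "dot P (al (dual td)) (ga (dual td)) = - k2" "dot P (be (dual td)) (ep (dual td)) = k1 - k2"
proof -
  have d: "dot P (\<lambda>p. x p) (\<lambda>p. - y p) = - dot P y x" for x y by (simp add: dot_def sum_negf mult.commute)
  show "dot P (al (dual pd)) (ep (dual pd)) = 0" "dot P (al (dual pd)) (ga (dual pd)) = k2" "dot P (be (dual pd)) (ep (dual pd)) = k1"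
  "dot P (al (dual td)) (ep (dual td)) = 0" "dot P (al (dual td)) (ga (dual td)) = - k2" "dot P (be (dual td)) (ep (dual td)) = k1 - k2"
    using dot_pd dot_td unfolding dual_def rank_one_data.simps d by simp_all
qed

lemma al_td: "al td = al pd"
  by (simp add: td_def primal_def)

lemma mc_pair_primal:
  assumes "k2 \<notin> \<int>"
  shows "mc_pair P pd td k2 D D' (\<lambda>_. 0) (\<lambda>_. 0)"
proof
  show "al td p \<noteq> 0" if "p \<in> P" for p using rr_nz[OF that] by (simp add: td_def)
  show "ep pd p \<noteq> 0" for p by (simp add: primal_def)
qed (use assms vmat_td D_sing D_holomorphic primal_ode_to_system td_system_to_ode dot_pd(1) dot_td(1) in \<open>auto simp: D'_sing\<close>)

text \<open>Dualising transposes and negates V, so the shift becomes - k2. The twists are the traces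
  of the residues on either side.\<close>

lemma mc_pair_dual:
  assumes "k2 \<notin> \<int>"
  shows "mc_pair P (dual pd) (dual td) (- k2) D D' \<theta> (\<lambda>p. vmat td p p)"
proof
  have P: "finite P" "P \<subseteq> ode_sing D'" by (auto simp: D'_sing)
  show "ode_to_system D P (dual pd) \<theta>" using dual_ode_to_system[OF primal_ode_to_system P(1) D_sing(2)] unfolding vmat_primal .
  show "system_to_ode D' P (dual td) (\<lambda>p. vmat td p p)" by (rule dual_system_to_ode[OF td_system_to_ode P])
  show "ep (dual pd) p \<noteq> 0" if "p \<in> P" for p using rr_nz[OF that] by (simp add: dual_def primal_def)
  show "al (dual td) p \<noteq> 0" if "p \<in> P" for p using sf_nz[OF that] by (simp add: dual_def td_def)
  show "vmat (dual td) p q = vmat (dual pd) p q + (if p = q then - k2 else 0)" if "p \<in> P" "q \<in> P" for p q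
    using vmat_td[OF that(2,1)] by (simp add: vmat_dual)
  show "- k2 \<notin> \<int>" using assms by (metis Ints_minus minus_minus)
qed (use D_sing D_holomorphic dot_dual in \<open>auto simp: D'_sing\<close>)

lemma tsum_single: "a \<in> P \<Longrightarrow> (\<Sum>p\<in>P. (if p = a then e p else 0) / (z - p)) = e a / (z - a)"
  using sum_e0[of "e a" a "\<lambda>_. 0" z] by (simp cong: if_cong)

text \<open>The solution found has the exponent n + k2 at \<open>a\<close>, which is
  \<open>th a\<close>. For k1 \<notin> \<int> only one of the two exponents at \<infinity> is
  compatible with an integral degree, and it gives the exact value.\<close>

lemma case_i:
  assumes a: "a \<in> P" and n: "\<theta> a = of_int n" "n \<le> -1" and k2: "k2 \<notin> \<int>" and app: "apparent_at D a"
  shows "\<exists>h. has_power_poly_solution D' {a} th h \<and> int (degree h) \<le> - n - 1 \<and> (k1 \<notin> \<int> \<longrightarrow> int (degree h) = - n - 1)"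
proof -
  interpret mc: mc_pair P pd td k2 D D' "\<lambda>_. 0" "\<lambda>_. 0" by (rule mc_pair_primal[OF k2])
  have V: "vmat pd a a = of_int n" and n0: "n \<le> 0" using n by (simp_all add: vmat_primal)
  obtain h where h: "h \<noteq> 0"
    and ode: "\<forall>z. z \<notin> ode_sing D' \<longrightarrow> twisted_ode D' (\<lambda>z. (of_int n + k2) / (z - a) + (\<Sum>p\<in>P. 0 / (z - p))) (poly h) z"
    and hd: "al td = al pd \<longrightarrow> degree h \<le> nat (- n - 1)"
    using mc.local_forward[OF a V n0 Ints_0 app] by (elim exE conjE) (rule that)
  have tha: "th a = of_int n + k2" by (simp add: theta_tilde_def n(1))
  have ode': "twisted_ode D' (\<lambda>z. th a / (z - a)) (poly h) z" if "z \<notin> {0, 1, t, lt}" for z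
    using ode[unfolded D'_sing, rule_format, OF that] by (simp add: tha)
  have deg: "int (degree h) \<le> - n - 1" using hd al_td n(2) by simp
  have "int (degree h) = - n - 1" if k1: "k1 \<notin> \<int>"
  proof -
    define e where "e p = (if p = a then th p else 0)" for p
    have "(\<lambda>z. \<Sum>p\<in>P. e p / (z - p)) = (\<lambda>z. th a / (z - a))" unfolding e_def tsum_single[OF a] ..
    then have "twisted_ode D' (\<lambda>z. \<Sum>p\<in>P. e p / (z - p)) (poly h) z" if "z \<notin> {0, 1, t, lt}" for z
      using ode'[OF that] by simp
    moreover have "e 0 + e 1 + e t = of_int n + k2" using a t unfolding e_def tha[symmetric] by auto
    then have "of_nat (degree h) + (of_int n + k2) = of_nat (degree h) + e 0 + e 1 + e t" by (simp add: add.assoc)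
    ultimately have "of_nat (degree h) + (of_int n + k2) = k2 - k1 \<or> of_nat (degree h) + (of_int n + k2) = k2 - 1"
      by (rule degree_D'[OF h])
    then have "k1 = of_int (- int (degree h) - n) \<or> of_nat (degree h) = (of_int (- n - 1) :: complex)"
    proof
      assume "of_nat (degree h) + (of_int n + k2) = k2 - k1"
      then have "k1 = - of_nat (degree h) - of_int n" by algebra
      then show ?thesis by simp
    next
      assume "of_nat (degree h) + (of_int n + k2) = k2 - 1"
      then have "of_nat (degree h) = - (of_int n :: complex) - 1" by algebra
      then show ?thesis by simp
    qed
    then show ?thesis
    proof
      assume "k1 = of_int (- int (degree h) - n)"
      then have "k1 \<in> \<int>" by (simp only: Ints_of_int)
      then show ?thesis using k1 by simp
    qed (rule int_degree_eqI)
  qed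
  moreover have "has_power_poly_solution D' {a} th h"
    using power_poly_D'_iff[of "{a}" th h] a h ode' by simp
  ultimately show ?thesis using deg by blast
qed

text \<open>In the dual system the singularity has the exponent - n. The solution found carries the
  exponent - \<open>th a\<close> at \<open>a\<close>, which removes the factor at \<open>a\<close>
  from the full power product and leaves those at \<open>b\<close> and \<open>c\<close>. The
  condition on k1 selects the exponent at \<infinity> that gives degree n.\<close>

lemma case_ii:
  assumes a: "a \<in> P" and bc: "b \<in> P" "c \<in> P" "P - {a} = {b, c}" "b \<noteq> c"
    and n: "\<theta> a = of_nat n" and k: "k1 \<notin> \<int>" "k2 \<notin> \<int>" and app: "apparent_at D a"
  shows "\<exists>h. has_power_poly_solution D' {b, c} th h \<and> degree h = n"
proof -
  interpret mc: mc_pair P "dual pd" "dual td" "- k2" D D' \<theta> "\<lambda>p. vmat td p p" by (rule mc_pair_dual[OF k(2)])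
  have V: "vmat (dual pd) a a = of_int (- int n)" using n by (simp add: vmat_dual vmat_primal)
  have n0: "- int n \<le> 0" by simp
  have \<theta>a: "\<theta> a \<in> \<int>" by (simp add: n)
  obtain h where h: "h \<noteq> 0"
    and ode: "\<forall>z. z \<notin> ode_sing D' \<longrightarrow> twisted_ode D' (\<lambda>z. (of_int (- int n) + - k2) / (z - a) + (\<Sum>p\<in>P. vmat td p p / (z - p))) (poly h) z"
    using mc.local_forward[OF a V n0 \<theta>a app] by (elim exE conjE) (rule that)
  have tha: "of_int (- int n) + - k2 = - th a" by (simp add: theta_tilde_def n)
  have S: "(\<Sum>p\<in>P. vmat td p p / (z - p)) = th a / (z - a) + (\<Sum>p\<in>{b, c}. th p / (z - p))" for z
  proof -
    have "(\<Sum>p\<in>P. vmat td p p / (z - p)) = (\<Sum>p\<in>P. th p / (z - p))" using vmat_td_diag by (intro sum.cong) auto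
    also have "\<dots> = th a / (z - a) + (\<Sum>p\<in>P - {a}. th p / (z - p))" using a by (intro sum.remove) auto
    finally show ?thesis unfolding bc(3) .
  qed
  have ode': "twisted_ode D' (\<lambda>z. \<Sum>p\<in>{b, c}. th p / (z - p)) (poly h) z" if "z \<notin> {0, 1, t, lt}" for z
    using ode[unfolded D'_sing, rule_format, OF that] unfolding tha S by simp
  have "degree h = n"
  proof -
    define e where "e p = (if p = a then 0 else th p)" for p
    have sP: "(\<Sum>p\<in>P. f p) = f a + (\<Sum>p\<in>{b, c}. f p)" for f :: "complex \<Rightarrow> complex"
      unfolding bc(3)[symmetric] using a by (intro sum.remove) auto
    have ab: "a \<noteq> b" "a \<noteq> c" using bc(3) by auto
    have "(\<Sum>p\<in>P. e p / (z - p)) = (\<Sum>p\<in>{b, c}. th p / (z - p))" for z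
      unfolding sP using ab bc(4) by (simp add: e_def)
    then have "twisted_ode D' (\<lambda>z. \<Sum>p\<in>P. e p / (z - p)) (poly h) z" if "z \<notin> {0, 1, t, lt}" for z
      using ode'[OF that] by simp
    note ode_e = this
    have "e 0 + e 1 + e t = (\<Sum>p\<in>P. e p)" by (rule sum_01t[OF t, symmetric])
    also have "\<dots> = (\<Sum>p\<in>P. \<theta> p) - \<theta> a + 2 * k2" unfolding sP using ab bc(4) by (simp add: e_def theta_tilde_def)
    also have "\<dots> = k2 - k1 - of_nat n" unfolding sum_01t[OF t] n kappa2_eq[of t \<theta> \<theta>i] by (simp add: algebra_simps)
    finally have "of_nat (degree h) + (k2 - k1 - of_nat n) = of_nat (degree h) + e 0 + e 1 + e t" by (simp add: add.assoc)
    from degree_D'[OF h ode_e this]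
    have "of_nat (degree h) = (of_int (int n) :: complex) \<or> k1 = of_int (int (degree h) - int n + 1)"
    proof
      assume "of_nat (degree h) + (k2 - k1 - of_nat n) = k2 - k1"
      then have "of_nat (degree h) = (of_nat n :: complex)" by algebra
      then show ?thesis by simp
    next
      assume "of_nat (degree h) + (k2 - k1 - of_nat n) = k2 - 1"
      then have "k1 = of_nat (degree h) - of_nat n + 1" by algebra
      then show ?thesis by simp
    qed
    then show ?thesis
    proof
      assume "k1 = of_int (int (degree h) - int n + 1)"
      then have "k1 \<in> \<int>" by (simp only: Ints_of_int)
      then show ?thesis using k(1) by simp
    qed (use int_degree_eqI in fastforce)
  qed
  moreover have "has_power_poly_solution D' {b, c} th h"
    using power_poly_D'_iff[of "{b, c}" th h] bc(1,2) h ode' by simp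
  ultimately show ?thesis by blast
qed

lemma shift_nonzero: "h \<noteq> 0 \<Longrightarrow> \<exists>i. coeff (h \<circ>\<^sub>p [:a, 1:]) i \<noteq> 0 \<or> Y2 i \<noteq> (0 :: complex)" for h :: "complex poly"
proof -
  assume "h \<noteq> 0"
  then have "h \<circ>\<^sub>p [:a, 1:] \<noteq> 0" by (simp add: pcompose_eq_0_iff)
  then show ?thesis by (auto simp: poly_eq_iff)
qed

text \<open>Since \<theta>i = k1 - k2 is not an integer, the eigenvalues - k1 and - k2 of the
  residue sum are separated modulo \<int>, and the given solution must stop at - k2.\<close>

lemma case_iii:
  assumes a: "a \<in> P" and n: "th a = of_int n" and k2: "k2 \<notin> \<int>" and \<theta>i: "\<theta>i \<notin> \<int>"
    and sol: "has_power_poly_solution D {a} \<theta> h"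
  shows "apparent_at D' a"
proof -
  interpret mc: mc_pair P pd td k2 D D' "\<lambda>_. 0" "\<lambda>_. 0" by (rule mc_pair_primal[OF k2])
  have \<theta>a: "\<theta> a = of_int n - k2" using n by (simp add: theta_tilde_def algebra_simps)
  have h: "h \<noteq> 0" "\<forall>z. z \<notin> {0, 1, t, l} \<longrightarrow> twisted_ode D (\<lambda>z. \<theta> a / (z - a)) (poly h) z"
    using sol power_poly_D_iff[of "{a}" \<theta> h] a by simp_all
  have e0: "\<theta> a = 0 \<or> a \<in> P \<and> \<theta> a = \<theta> a" using a by simp
  obtain g U N where F: "frobenius P pd a (of_int n - k2) (coeff (h \<circ>\<^sub>p [:a, 1:])) (coeff (g \<circ>\<^sub>p [:a, 1:])) U"
    and N: "\<forall>i>N. \<forall>p\<in>P. U i p = 0"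
    using primal_poly_frobenius[OF e0 h(2)] unfolding \<theta>a by (elim exE conjE) (rule that)
  show ?thesis
  proof (rule mc.local_backward[OF a _ F N shift_nonzero[OF h(1)]])
    show "vmat pd a a = of_int n - k2" by (simp add: vmat_primal \<theta>a)
    have "k2 - k1 = - \<theta>i" using theta_inf by (metis minus_diff_eq)
    then have "- k1 + k2 \<notin> \<int>" using \<theta>i by (metis Ints_minus minus_minus uminus_add_conv_diff)
    then show "dot P (al pd) (ga pd) = - k2 \<and> dot P (be pd) (ep pd) + k2 \<notin> \<int> \<or>
      dot P (be pd) (ep pd) = - k2 \<and> dot P (al pd) (ga pd) + k2 \<notin> \<int>" unfolding dot_pd by simp
    show "ep td a \<noteq> 0" using sf_nz[OF a] by (simp add: td_def)
    fix A B assume z: "\<And>p. p \<in> P \<Longrightarrow> ga td p * A + ep td p * B = 0"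
    \<comment> \<open>\<open>al td\<close> annihilates \<open>ep td\<close> and pairs with
      \<open>ga td\<close> to k2 - k1 \<noteq> 0, so pairing with it isolates A.\<close>
    have "dot P (al td) (ga td) * A + dot P (al td) (ep td) * B = dot P (al td) (\<lambda>p. ga td p * A + ep td p * B)"
      by (simp only: dot_lincomb)
    also have "\<dots> = 0" unfolding dot_def using z by (intro sum.neutral) simp
    finally have "(k2 - k1) * A = 0" unfolding dot_td by simp
    moreover have "k2 - k1 \<noteq> 0" using \<theta>i theta_inf by auto
    ultimately have "A = 0" by simp
    moreover have "B = 0" using z[OF a] sf_nz[OF a] \<open>A = 0\<close> by (simp add: td_def)
    ultimately show "A = 0 \<and> B = 0" by simp
  qed
qed

text \<open>The powers at \<open>b\<close> and \<open>c\<close> alone are the full power product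
  with the factor at \<open>a\<close> removed, so the dual system receives the exponent - \<theta> a
  there.\<close>

lemma case_iv:
  assumes a: "a \<in> P" and bc: "b \<in> P" "c \<in> P" "P - {a} = {b, c}"
    and n: "th a = of_int n" and k2: "k2 \<notin> \<int>" and \<theta>i: "\<theta>i \<notin> \<int>"
    and sol: "has_power_poly_solution D {b, c} \<theta> h"
  shows "apparent_at D' a"
proof -
  interpret mc: mc_pair P "dual pd" "dual td" "- k2" D D' \<theta> "\<lambda>p. vmat td p p" by (rule mc_pair_dual[OF k2])
  have \<theta>a: "- \<theta> a = of_int (- n) - - k2" using n by (simp add: theta_tilde_def algebra_simps)
  have S: "(\<Sum>p\<in>{b, c}. \<theta> p / (z - p)) = - \<theta> a / (z - a) + (\<Sum>p\<in>P. \<theta> p / (z - p))" for z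
  proof -
    have "(\<Sum>p\<in>P. \<theta> p / (z - p)) = \<theta> a / (z - a) + (\<Sum>p\<in>P - {a}. \<theta> p / (z - p))" using a by (intro sum.remove) auto
    then show ?thesis unfolding bc(3) by simp
  qed
  have "h \<noteq> 0 \<and> (\<forall>z. z \<notin> {0, 1, t, l} \<longrightarrow> twisted_ode D (\<lambda>z. \<Sum>p\<in>{b, c}. \<theta> p / (z - p)) (poly h) z)"
    using sol power_poly_D_iff[of "{b, c}" \<theta> h] bc(1,2) by blast
  then have h: "h \<noteq> 0" "\<forall>z. z \<notin> {0, 1, t, l} \<longrightarrow> twisted_ode D (\<lambda>z. - \<theta> a / (z - a) + (\<Sum>p\<in>P. \<theta> p / (z - p))) (poly h) z"
    unfolding S by blast+
  have e0: "- \<theta> a = 0 \<or> a \<in> P \<and> - \<theta> a = - \<theta> a" using a by simp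
  obtain g U N where F: "frobenius P (dual pd) a (of_int (- n) - - k2) (coeff (h \<circ>\<^sub>p [:a, 1:])) (coeff (g \<circ>\<^sub>p [:a, 1:])) U"
    and N: "\<forall>i>N. \<forall>p\<in>P. U i p = 0"
    using dual_poly_frobenius[OF e0 h(2)] unfolding \<theta>a by (elim exE conjE) (rule that)
  show ?thesis
  proof (rule mc.local_backward[OF a _ F N shift_nonzero[OF h(1)]])
    show "vmat (dual pd) a a = of_int (- n) - - k2" by (simp only: vmat_dual vmat_primal \<theta>a)
    show "dot P (al (dual pd)) (ga (dual pd)) = - (- k2) \<and> dot P (be (dual pd)) (ep (dual pd)) + - k2 \<notin> \<int> \<or>
      dot P (be (dual pd)) (ep (dual pd)) = - (- k2) \<and> dot P (al (dual pd)) (ga (dual pd)) + - k2 \<notin> \<int>"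
      unfolding dot_dual using \<theta>i theta_inf by simp
    show "ep (dual td) a \<noteq> 0" using rr_nz[OF a] by (simp add: dual_def td_def)
    fix A B assume z: "\<And>p. p \<in> P \<Longrightarrow> ga (dual td) p * A + ep (dual td) p * B = 0"
    have "dot P (al (dual td)) (ga (dual td)) * A + dot P (al (dual td)) (ep (dual td)) * B
      = dot P (al (dual td)) (\<lambda>p. ga (dual td) p * A + ep (dual td) p * B)"
      by (simp only: dot_lincomb)
    also have "\<dots> = 0" unfolding dot_def using z by (intro sum.neutral) simp
    finally have "- k2 * A = 0" unfolding dot_dual by simp
    then have "A = 0" using k2_nz by simp
    moreover have "B = 0" using z[OF a] rr_nz[OF a] \<open>A = 0\<close> by (simp add: dual_def td_def)
    ultimately show "A = 0 \<and> B = 0" by simp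
  qed
qed

text \<open>The first component has the eigenvalue - k1 = m - k2 with m = - \<theta>i, so its top
  coefficient yields the exact degree directly.\<close>

lemma case_v:
  assumes n: "\<theta>i = of_int n" "n \<le> 0" and k2: "k2 \<notin> \<int>" and app: "apparent_at_infinity D"
  shows "\<exists>h. has_power_poly_solution D' {} th h \<and> int (degree h) = - n"
proof -
  interpret mc: mc_pair P pd td k2 D D' "\<lambda>_. 0" "\<lambda>_. 0" by (rule mc_pair_primal[OF k2])
  define m where "m = nat (- n)"
  have "complex_of_nat m = - of_int n" using n(2) by (simp add: m_def)
  also have "\<dots> = - (k1 - k2)" by (simp only: theta_inf n(1)[symmetric])
  finally have e: "dot P (al pd) (ga pd) = of_nat m - k2" unfolding dot_pd by simp
  have "dot P (al pd) (ga pd) = of_nat m - k2 \<and> dot P (be pd) (ep pd) = - k2 \<and> al td = al pd \<or>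
    dot P (al pd) (ga pd) = - k2 \<and> dot P (be pd) (ep pd) = of_nat m - k2 \<and> 1 \<le> m"
    using e dot_pd(3) al_td by blast
  from mc.infinity_forward[OF app this]
  obtain h where h: "h \<noteq> 0"
    "\<forall>z. z \<notin> ode_sing D' \<longrightarrow> twisted_ode D' (\<lambda>z. \<Sum>p\<in>P. 0 / (z - p)) (poly h) z"
    "dot P (al pd) (ga pd) = of_nat m - k2 \<longrightarrow> degree h = m" by (elim exE conjE) (rule that)
  have "has_power_poly_solution D' {} th h"
    using power_poly_D'_iff[of "{}" th h] h(1) h(2)[unfolded D'_sing] by simp
  then show ?thesis using h(3) e n(2) by (intro exI[of _ h]) (simp add: m_def)
qed

text \<open>In the dual system the larger eigenvalue belongs to the second component. The degree is
  therefore found afterwards from the exponents at \<infinity>, one of which is excluded by k2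
  \<notin> \<int>.\<close>

lemma case_vi:
  assumes n: "\<theta>i = of_int n" "n \<ge> 1" and k2: "k2 \<notin> \<int>" and app: "apparent_at_infinity D"
  shows "\<exists>h. has_power_poly_solution D' P th h \<and> int (degree h) = n - 1"
proof -
  interpret mc: mc_pair P "dual pd" "dual td" "- k2" D D' \<theta> "\<lambda>p. vmat td p p" by (rule mc_pair_dual[OF k2])
  define m where "m = nat n"
  have kn: "k1 - k2 = of_int n" by (simp only: theta_inf n(1)[symmetric])
  then have m: "complex_of_nat m = k1 - k2" "m \<ge> 1" using n(2) by (auto simp: m_def)
  have "dot P (al (dual pd)) (ga (dual pd)) = of_nat m - - k2 \<and> dot P (be (dual pd)) (ep (dual pd)) = - (- k2) \<and> al (dual td) = al (dual pd) \<or>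
    dot P (al (dual pd)) (ga (dual pd)) = - (- k2) \<and> dot P (be (dual pd)) (ep (dual pd)) = of_nat m - - k2 \<and> 1 \<le> m"
    unfolding dot_dual m(1) using m(2) by simp
  from mc.infinity_forward[OF app this]
  obtain h where h: "h \<noteq> 0" "\<forall>z. z \<notin> ode_sing D' \<longrightarrow> twisted_ode D' (\<lambda>z. \<Sum>p\<in>P. vmat td p p / (z - p)) (poly h) z"
    by (elim exE conjE) (rule that)
  have "(\<Sum>p\<in>P. vmat td p p / (z - p)) = (\<Sum>p\<in>P. th p / (z - p))" for z using vmat_td_diag by (intro sum.cong) auto
  then have ode: "twisted_ode D' (\<lambda>z. \<Sum>p\<in>P. th p / (z - p)) (poly h) z" if "z \<notin> {0, 1, t, lt}" for z
    using h(2)[unfolded D'_sing, rule_format, OF that] by simp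
  have "th 0 + th 1 + th t = 2 * k2 - k1"
    unfolding theta_tilde_def kappa2_eq[of t \<theta> \<theta>i] by (simp add: algebra_simps)
  then have "of_nat (degree h) + (2 * k2 - k1) = of_nat (degree h) + th 0 + th 1 + th t" by (simp add: add.assoc)
  from degree_D'[OF h(1) ode this]
  have "k2 = of_int (- int (degree h)) \<or> of_nat (degree h) = k1 - k2 - 1"
  proof
    assume "of_nat (degree h) + (2 * k2 - k1) = k2 - k1"
    then have "k2 = - of_nat (degree h)" by algebra
    then show ?thesis by simp
  next
    assume "of_nat (degree h) + (2 * k2 - k1) = k2 - 1"
    then have "of_nat (degree h) = k1 - k2 - 1" by algebra
    then show ?thesis by simp
  qed
  moreover have "k2 \<noteq> of_int (- int (degree h))" using k2 by (metis Ints_of_int)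
  ultimately have "of_nat (degree h) = (of_int (n - 1) :: complex)" unfolding kn by simp
  then have "int (degree h) = n - 1" by (rule int_degree_eqI)
  moreover have "has_power_poly_solution D' P th h"
    using power_poly_D'_iff[OF order_refl, of th h] h(1) ode by blast
  ultimately show ?thesis by blast
qed

text \<open>The eigenvalue - k1 of the residue sum is the number m, while - k2 is not an integer.
  Surjectivity and kernel come from the vector \<open>ep pd\<close>, which \<open>al pd\<close>
  annihilates and \<open>be pd\<close> does not.\<close>

lemma case_vii:
  assumes n: "k1 = of_int n" "n \<le> 0" and k2: "k2 \<notin> \<int>" and sol: "has_power_poly_solution D {} \<theta> h"
  shows "apparent_at_infinity D'"
proof -
  interpret mc: mc_pair P pd td k2 D D' "\<lambda>_. 0" "\<lambda>_. 0" by (rule mc_pair_primal[OF k2])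
  define m where "m = nat (- n)"
  have m: "complex_of_nat m = - k1" using n by (simp add: m_def)
  have h: "h \<noteq> 0" "\<forall>z. z \<notin> {0, 1, t, l} \<longrightarrow> twisted_ode D (\<lambda>z. 0 / (z - 0)) (poly h) z"
    using sol power_poly_D_iff[of "{}" \<theta> h] by simp_all
  obtain g U N where F: "frobenius P pd 0 0 (coeff (h \<circ>\<^sub>p [:0, 1:])) (coeff (g \<circ>\<^sub>p [:0, 1:])) U"
    "(0 :: complex) = 0 \<longrightarrow> (\<forall>p\<in>P. U 0 p = 0)" "\<forall>i>N. \<forall>p\<in>P. U i p = 0"
    using primal_poly_frobenius[OF disjI1[OF refl] h(2)] by (elim exE conjE) (rule that)
  have al0: "0 \<in> P" "al pd 0 \<noteq> 0" using rr_nz[of 0] by (simp_all add: primal_def)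
  have w: "dot P (al pd) (ep pd) = 0" "dot P (be pd) (ep pd) \<noteq> 0" unfolding dot_pd using k2_nz by simp_all
  show ?thesis
  proof (rule mc.infinity_backward[OF F(1) F(3) shift_nonzero[OF h(1)]])
    show "U 0 p = 0" if "p \<in> P" for p using F(2) that by blast
    have "- k2 \<notin> \<int>" using k2 by (metis Ints_minus minus_minus)
    then show "dot P (al pd) (ga pd) = of_nat m \<and> dot P (be pd) (ep pd) \<notin> \<int> \<or>
      dot P (be pd) (ep pd) = of_nat m \<and> dot P (al pd) (ga pd) \<notin> \<int>" unfolding dot_pd m by simp
    show "dot P (al td) (ga td) = of_nat m + k2 \<and> dot P (be td) (ep td) = k2 \<or>
      dot P (be td) (ep td) = of_nat m + k2 \<and> dot P (al td) (ga td) = k2" unfolding dot_td m by simp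
    show "\<exists>v. dot P (al pd) v = A \<and> dot P (be pd) v = B" for A B
      by (rule pair_surjective[OF _ al0 w]) simp
    show "\<exists>v. dot P (al pd) v = 0 \<and> dot P (be pd) v = 0 \<and> (\<exists>p\<in>P. v p \<noteq> 0)"
      by (rule pair_kernel[OF t al0(2) w])
  qed
qed

text \<open>The dual counterpart with m = k1. Now \<open>al pd\<close> is the vector annihilated by
  the first of the two rows but not by the second, because k1 \<noteq> 0.\<close>

lemma case_viii:
  assumes n: "k1 = of_int n" "n \<ge> 1" and k2: "k2 \<notin> \<int>" and sol: "has_power_poly_solution D P \<theta> h"
  shows "apparent_at_infinity D'"
proof -
  interpret mc: mc_pair P "dual pd" "dual td" "- k2" D D' \<theta> "\<lambda>p. vmat td p p" by (rule mc_pair_dual[OF k2])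
  define m where "m = nat n"
  have m: "complex_of_nat m = k1" "k1 \<noteq> 0" using n by (auto simp: m_def)
  have "h \<noteq> 0 \<and> (\<forall>z. z \<notin> {0, 1, t, l} \<longrightarrow> twisted_ode D (\<lambda>z. \<Sum>p\<in>P. \<theta> p / (z - p)) (poly h) z)"
    using sol power_poly_D_iff[OF order_refl, of \<theta> h] by blast
  then have h: "h \<noteq> 0" "\<forall>z. z \<notin> {0, 1, t, l} \<longrightarrow> twisted_ode D (\<lambda>z. 0 / (z - 0) + (\<Sum>p\<in>P. \<theta> p / (z - p))) (poly h) z"
    unfolding div_0 add_0_left by blast+
  obtain g U N where F: "frobenius P (dual pd) 0 0 (coeff (h \<circ>\<^sub>p [:0, 1:])) (coeff (g \<circ>\<^sub>p [:0, 1:])) U"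
    "(0 :: complex) = 0 \<longrightarrow> (\<forall>p\<in>P. U 0 p = 0)" "\<forall>i>N. \<forall>p\<in>P. U i p = 0"
    using dual_poly_frobenius[OF disjI1[OF refl] h(2)] by (elim exE conjE) (rule that)
  have al0: "0 \<in> P" "al (dual pd) 0 \<noteq> 0" by (simp_all add: primal_def dual_def)
  have w: "dot P (al (dual pd)) (al pd) = 0" "dot P (be (dual pd)) (al pd) \<noteq> 0"
    using dot_pd(1,2) m(2) by (simp_all add: dual_def dot_def mult.commute)
  show ?thesis
  proof (rule mc.infinity_backward[OF F(1) F(3) shift_nonzero[OF h(1)]])
    show "U 0 p = 0" if "p \<in> P" for p using F(2) that by blast
    show "dot P (al (dual pd)) (ga (dual pd)) = of_nat m \<and> dot P (be (dual pd)) (ep (dual pd)) \<notin> \<int> \<or>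
      dot P (be (dual pd)) (ep (dual pd)) = of_nat m \<and> dot P (al (dual pd)) (ga (dual pd)) \<notin> \<int>"
      unfolding dot_dual m using k2 by simp
    show "dot P (al (dual td)) (ga (dual td)) = of_nat m + - k2 \<and> dot P (be (dual td)) (ep (dual td)) = - k2 \<or>
      dot P (be (dual td)) (ep (dual td)) = of_nat m + - k2 \<and> dot P (al (dual td)) (ga (dual td)) = - k2"
      unfolding dot_dual m by simp
    show "\<exists>v. dot P (al (dual pd)) v = A \<and> dot P (be (dual pd)) v = B" for A B
      by (rule pair_surjective[OF _ al0 w]) simp
    show "\<exists>v. dot P (al (dual pd)) v = 0 \<and> dot P (be (dual pd)) v = 0 \<and> (\<exists>p\<in>P. v p \<noteq> 0)"
      by (rule pair_kernel[OF t al0(2) w])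
  qed
qed

end

theorem theorem4p3:
  fixes t \<theta>i l \<mu> a b c :: complex and \<theta> :: "complex \<Rightarrow> complex"
  defines "k1 \<equiv> kappa1 t \<theta> \<theta>i" and "k2 \<equiv> kappa2 t \<theta> \<theta>i"
    and "\<theta>' \<equiv> theta_tilde t \<theta> \<theta>i"
    and "D \<equiv> D_y1 t \<theta> \<theta>i l \<mu>" and "D' \<equiv> D_y1_tilde t \<theta> \<theta>i l \<mu>"
  assumes t: "t \<notin> {0, 1}"
    and l: "l \<notin> {0, 1, t}"
    and lt_finite: "lambda_tilde_denom t \<theta> l \<mu> \<noteq> 0"
    and lt: "lambda_tilde t \<theta> \<theta>i l \<mu> \<notin> {0, 1, t}"
    and abc: "{a, b, c} = {0, 1, t}"
  shows
    \<comment> \<open>(i)\<close>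
    "(\<forall>n::int. \<theta> a = of_int n \<and> n \<le> -1 \<and> k2 \<notin> \<int> \<and> apparent_at D a \<longrightarrow>
        (\<exists>h. has_power_poly_solution D' {a} \<theta>' h \<and> int (degree h) \<le> - n - 1 \<and>
             (k1 \<notin> \<int> \<longrightarrow> int (degree h) = - n - 1)))
   \<and> \<comment> \<open>(ii)\<close>
     (\<forall>n::nat. \<theta> a = of_nat n \<and> k1 \<notin> \<int> \<and> k2 \<notin> \<int> \<and> \<theta>' b \<notin> \<int> \<and> \<theta>' c \<notin> \<int> \<and> apparent_at D a \<longrightarrow>
        (\<exists>h. has_power_poly_solution D' {b, c} \<theta>' h \<and> degree h = n))
   \<and> \<comment> \<open>(iii)\<close>
     (\<forall>n::int. \<theta>' a = of_int n \<and> n \<le> 0 \<and> k2 \<notin> \<int> \<and> \<theta>i \<notin> \<int> \<and>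
        (\<exists>h. has_power_poly_solution D {a} \<theta> h) \<longrightarrow> apparent_at D' a)
   \<and> \<comment> \<open>(iv)\<close>
     (\<forall>n::int. \<theta>' a = of_int n \<and> n \<ge> 1 \<and> k2 \<notin> \<int> \<and> \<theta>i \<notin> \<int> \<and> \<theta> b \<notin> \<int> \<and> \<theta> c \<notin> \<int> \<and>
        (\<exists>h. has_power_poly_solution D {b, c} \<theta> h) \<longrightarrow> apparent_at D' a)
   \<and> \<comment> \<open>(v)\<close>
     (\<forall>n::int. \<theta>i = of_int n \<and> n \<le> 0 \<and> k2 \<notin> \<int> \<and> apparent_at_infinity D \<longrightarrow>
        (\<exists>h. has_power_poly_solution D' {} \<theta>' h \<and> int (degree h) = - n))
   \<and> \<comment> \<open>(vi)\<close>
     (\<forall>n::int. \<theta>i = of_int n \<and> n \<ge> 1 \<and> k2 \<notin> \<int> \<and> \<theta>' 0 \<notin> \<int> \<and> \<theta>' 1 \<notin> \<int> \<and> \<theta>' t \<notin> \<int> \<and>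
        apparent_at_infinity D \<longrightarrow>
        (\<exists>h. has_power_poly_solution D' {0, 1, t} \<theta>' h \<and> int (degree h) = n - 1))
   \<and> \<comment> \<open>(vii)\<close>
     (\<forall>n::int. k1 = of_int n \<and> n \<le> 0 \<and> k2 \<notin> \<int> \<and> \<theta> 0 \<notin> \<int> \<and>
        (\<exists>h. has_power_poly_solution D {} \<theta> h) \<longrightarrow> apparent_at_infinity D')
   \<and> \<comment> \<open>(viii)\<close>
     (\<forall>n::int. k1 = of_int n \<and> n \<ge> 1 \<and> k2 \<notin> \<int> \<and> \<theta> 0 \<notin> \<int> \<and> \<theta> 1 \<notin> \<int> \<and> \<theta> t \<notin> \<int> \<and>
        (\<exists>h. has_power_poly_solution D {0, 1, t} \<theta> h) \<longrightarrow> apparent_at_infinity D')"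
proof -
  note defs = k1_def k2_def \<theta>'_def D_def D'_def
  have painleve_pair: "painleve_pair t l \<mu> \<theta>i \<theta>" if "k2 \<notin> \<int>"
    using t l lt_finite lt that unfolding k2_def by unfold_locales auto
  have card: "card {a, b, c} = 3" unfolding abc using t by simp
  have ab: "a \<noteq> b" "a \<noteq> c" and bc: "b \<noteq> c"
    using card by (auto simp: card_insert_if split: if_splits)
  have P: "a \<in> {0, 1, t}" "b \<in> {0, 1, t}" "c \<in> {0, 1, t}" "{0, 1, t} - {a} = {b, c}"
    unfolding abc[symmetric] using ab by auto
  show ?thesis
  proof (intro conjI allI impI; elim conjE exE)
    fix n :: int
    assume k2: "k2 \<notin> \<int>"
    interpret painleve_pair t l \<mu> \<theta>i \<theta> by (rule painleve_pair[OF k2])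
    show "\<exists>h. has_power_poly_solution D' {a} \<theta>' h \<and> int (degree h) \<le> - n - 1 \<and> (k1 \<notin> \<int> \<longrightarrow> int (degree h) = - n - 1)"
      if "\<theta> a = of_int n" "n \<le> -1" "apparent_at D a"
      by (rule case_i[folded defs, OF P(1) that(1,2) k2 that(3)])
    show "apparent_at D' a" if "\<theta>' a = of_int n" "\<theta>i \<notin> \<int>" "has_power_poly_solution D {a} \<theta> h" for h
      by (rule case_iii[folded defs, OF P(1) that(1) k2 that(2,3)])
    show "apparent_at D' a" if "\<theta>' a = of_int n" "\<theta>i \<notin> \<int>" "has_power_poly_solution D {b, c} \<theta> h" for h
      by (rule case_iv[folded defs, OF P that(1) k2 that(2,3)])
    show "\<exists>h. has_power_poly_solution D' {} \<theta>' h \<and> int (degree h) = - n"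
      if "\<theta>i = of_int n" "n \<le> 0" "apparent_at_infinity D"
      by (rule case_v[folded defs, OF that(1,2) k2 that(3)])
    show "\<exists>h. has_power_poly_solution D' {0, 1, t} \<theta>' h \<and> int (degree h) = n - 1"
      if "\<theta>i = of_int n" "1 \<le> n" "apparent_at_infinity D"
      by (rule case_vi[folded defs, OF that(1,2) k2 that(3)])
    show "apparent_at_infinity D'" if "k1 = of_int n" "n \<le> 0" "has_power_poly_solution D {} \<theta> h" for h
      by (rule case_vii[folded defs, OF that(1,2) k2 that(3)])
    show "apparent_at_infinity D'" if "k1 = of_int n" "1 \<le> n" "has_power_poly_solution D {0, 1, t} \<theta> h" for h
      by (rule case_viii[folded defs, OF that(1,2) k2 that(3)])
  next
    fix n :: nat
    assume k: "k1 \<notin> \<int>" "k2 \<notin> \<int>"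
    interpret painleve_pair t l \<mu> \<theta>i \<theta> by (rule painleve_pair[OF k(2)])
    show "\<exists>h. has_power_poly_solution D' {b, c} \<theta>' h \<and> degree h = n"
      if "\<theta> a = of_nat n" "apparent_at D a"
      by (rule case_ii[folded defs, OF P bc that(1) k that(2)])
  qed
qed

end
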